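(* Let $G$ be a connected $d$-dimensional Lie group, $H=\sum_{|\alpha|\leq m}c_\alpha A^\alpha$ a strongly elliptic operator of even order $m$ associated with left translations on $G$, and $K_t$ $(t>0)$ the corresponding kernel on $G$ (constructed in the context). Let $U_\rho$ denote the operator of multiplication by the function $g\mapsto e^{\rho|g|}$, where $\rho\geq0$. Then there are $a>0$ and $\omega\geq0$ such that $$\|U_\rho K_t\|_1\leq a\,e^{\omega(1+\rho^m)t}\quad\text{and}\quad\|U_\rho K_t\|_\infty\leq a\,t^{-d/m}\,e^{\omega(1+\rho^m)t}$$ for all $\rho,t>0$. Hence there are $a,b>0$ and $\omega\geq0$ such that $$|K_t(g)|\leq a\,t^{-d/m}\,e^{\omega t}\,e^{-b(|g|^m/t)^{1/(m-1)}}$$ for all $g\in G$ and $t>0$.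
   Context: $G$ has Lie algebra $\mathfrak{g}$, left-invariant Haar measure $dg$ and identity $e$; $\|\cdot\|_p$ is the norm of $L_p(G;dg)$; $(L(g)\varphi)(h)=\varphi(g^{-1}h)$ denotes left translation. Fix a vector space basis $a_1,\ldots,a_d$ of $\mathfrak{g}$ and let $A_j\varphi=\lim_{s\to0}s^{-1}(L(\exp(sa_j))\varphi-\varphi)$ be the generators of left translations (if $G=\mathbf{R}^d$ then $A_j=-\partial_j$). Multi-indices are finite sequences $\alpha=(k_1,\ldots,k_n)$, $k_j\in\{1,\ldots,d\}$, with $|\alpha|=n$, $A^\alpha=A_{k_1}\cdots A_{k_n}$, $\xi^\alpha=\xi_{k_1}\cdots\xi_{k_n}$. $H=\sum_{|\alpha|\leq m}c_\alpha A^\alpha$, $c_\alpha\in\mathbf{C}$, $m\geq 2$ even, is strongly elliptic if there is a $\mu>0$ such that $\mathrm{Re}\big((-1)^{m/2}\sum_{|\alpha|=m}c_\alpha\xi^\alpha\big)\geq\mu|\xi|^m$ for all $\xi\in\mathbf{R}^d$. The modulus $|g|$ is the shortest length of absolutely continuous paths from $g$ to $e$, i.e. the distance from $g$ to $e$ for the invariant Riemannian metric on $G$ in which $a_1,\ldots,a_d$ is orthonormal (the left- and right-invariant metrics give the same modulus). Construction of $K_t$. For $x\in\mathbf{R}^d$ put $a_x=\sum_{i=1}^dx_ia_i$. Let $\Omega\subset G$ be a sufficiently small open relatively compact neighbourhood of $e$ and $B_0\subset\mathfrak{g}$ an open ball centred at $0$ (for the norm $|a_x|=|x|$) such that $\exp|_{B_0}:B_0\to\Omega$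 is an analytic diffeomorphism; $B=\{x\in\mathbf{R}^d:a_x\in B_0\}$. For $\varphi$ on $\Omega$ put $\hat\varphi(x)=\varphi(\exp(a_x))$, $x\in B$. In these coordinates $dg=\sigma(x)\,dx$ with $\sigma$ a positive $C^\infty$-function; $dg$ is normalized so that $\sigma(0)=1$. Let $\widetilde K_t(x)=(2\pi)^{-d}\int_{\mathbf{R}^d}d\xi\,e^{ix\cdot\xi}e^{-th(\xi)}$, $h(\xi)=\sum_{|\alpha|\leq m}c_\alpha(-i\xi)^\alpha$, for $t>0$ and $\widetilde K_t=0$ for $t\leq0$. Let $\theta\in C_c^\infty(\Omega)$ with $0\leq\theta\leq1$ and $\theta=1$ near $e$. Then $K^{(0)}_t$ is the function supported in $\Omega$ with $\widehat{K^{(0)}_t}=\hat\theta\,\widetilde K_t$ on $B$; $M_t=(\partial_t+H)K^{(0)}_t$ for $t>0$ and $M_t=0$ for $t\leq0$; $(\varphi\,\hat*\,\psi)_t(g)=\int_0^tds\int_Gdh\,\varphi_{t-s}(h)\psi_s(h^{-1}g)$; $K^{(n)}_t=-(K^{(n-1)}\,\hat*\,M)_t$ for $n\geq1$; and $K_t=\sum_{n\geq0}K^{(n)}_t$, the series converging in $L_p(G;dg)$ for all $p\in[1,\infty]$ and $t>0$. *)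

theory Defs
  imports "HOL-Probability.Essential_Supremum" "HOL-Algebra.Group"
begin

text \<open>Multi-exponents are functions \<open>k\<close> from the standard basis to the natural numbers; the
  power series in \<open>y - x\<close> is an unordered (hence absolutely convergent) sum.  The set \<open>S\<close> is
  meant to be open.\<close>

definition real_analytic_on :: "('a::euclidean_space \<Rightarrow> 'b::euclidean_space) \<Rightarrow> 'a set \<Rightarrow> bool"
  where "real_analytic_on f S \<longleftrightarrow>
    (\<forall>x\<in>S. \<exists>c r. r > 0 \<and>
       (\<forall>y\<in>ball x r.
          ((\<lambda>k. (\<Prod>b\<in>Basis. ((y - x) \<bullet> b) ^ k b) *\<^sub>R c k) has_sum f y) (Basis \<rightarrow>\<^sub>E (UNIV :: nat set))))"

primrec times_differentiable_on ::
    "nat \<Rightarrow> ('a::euclidean_space \<Rightarrow> real) \<Rightarrow> 'a set \<Rightarrow> bool" where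
  "times_differentiable_on 0 f S \<longleftrightarrow> continuous_on S f"
| "times_differentiable_on (Suc n) f S \<longleftrightarrow>
     (\<forall>x\<in>S. f differentiable (at x)) \<and>
     (\<forall>v. times_differentiable_on n (\<lambda>x. frechet_derivative f (at x) v) S)"

definition smooth_on :: "('a::euclidean_space \<Rightarrow> real) \<Rightarrow> 'a set \<Rightarrow> bool"
  where "smooth_on f S \<longleftrightarrow> (\<forall>n. times_differentiable_on n f S)"

text \<open>Absolute continuity on a compact interval; \<open>D\<close> ranges over finite families of
  non-overlapping compact subintervals \<open>[Inf k, Sup k]\<close>.\<close>

definition absolutely_continuous_on :: "real \<Rightarrow> real \<Rightarrow> (real \<Rightarrow> real) \<Rightarrow> bool"
  where "absolutely_continuous_on u v f \<longleftrightarrow>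
    (\<forall>\<epsilon>>0. \<exists>\<delta>>0. \<forall>D S. D division_of S \<and> S \<subseteq> {u..v} \<and> (\<Sum>k\<in>D. Sup k - Inf k) < \<delta> \<longrightarrow>
        (\<Sum>k\<in>D. \<bar>f (Sup k) - f (Inf k)\<bar>) < \<epsilon>)"

type_synonym ('m, 'e) chart = "'m set \<times> ('m \<Rightarrow> 'e)"

definition is_chart :: "('m::topological_space, 'e::euclidean_space) chart \<Rightarrow> bool"
  where "is_chart = (\<lambda>(U, \<phi>).
    open U \<and> open (\<phi> ` U) \<and> homeomorphism U (\<phi> ` U) \<phi> (inv_into U \<phi>))"

definition analytic_atlas :: "('m::topological_space, 'e::euclidean_space) chart set \<Rightarrow> bool"
  where "analytic_atlas \<A> \<longleftrightarrow>
    (\<forall>c\<in>\<A>. is_chart c) \<and> (\<Union>(U, \<phi>)\<in>\<A>. U) = UNIV \<and>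
    (\<forall>(U, \<phi>)\<in>\<A>. \<forall>(V, \<psi>)\<in>\<A>. real_analytic_on (\<psi> \<circ> inv_into U \<phi>) (\<phi> ` (U \<inter> V)))"

definition prod_atlas ::
    "('m, 'e) chart set \<Rightarrow> ('n, 'f) chart set \<Rightarrow> ('m \<times> 'n, 'e \<times> 'f) chart set"
  where "prod_atlas \<A> \<B> = {(U \<times> V, map_prod \<phi> \<psi>) | U \<phi> V \<psi>. (U, \<phi>) \<in> \<A> \<and> (V, \<psi>) \<in> \<B>}"

definition vec_atlas :: "('e, 'e) chart set"
  where "vec_atlas = {(UNIV, id)}"

definition analytic_map ::
    "('m::topological_space, 'e::euclidean_space) chart set \<Rightarrow>
     ('n::topological_space, 'f::euclidean_space) chart set \<Rightarrow> 'm set \<Rightarrow> ('m \<Rightarrow> 'n) \<Rightarrow> bool"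
  where "analytic_map \<A> \<B> S f \<longleftrightarrow> open S \<and> continuous_on S f \<and>
    (\<forall>(U, \<phi>)\<in>\<A>. \<forall>(V, \<psi>)\<in>\<B>.
       real_analytic_on (\<psi> \<circ> f \<circ> inv_into U \<phi>) (\<phi> ` (U \<inter> S \<inter> f -` V)))"

definition analytic_diffeomorphism ::
    "('m::topological_space, 'e::euclidean_space) chart set \<Rightarrow>
     ('n::topological_space, 'f::euclidean_space) chart set \<Rightarrow>
     'm set \<Rightarrow> 'n set \<Rightarrow> ('m \<Rightarrow> 'n) \<Rightarrow> bool"
  where "analytic_diffeomorphism \<A> \<B> S T f \<longleftrightarrow> bij_betw f S T \<and>
    analytic_map \<A> \<B> S f \<and> analytic_map \<B> \<A> T (inv_into S f)"

definition smooth_functions ::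
    "('m::topological_space, 'e::euclidean_space) chart set \<Rightarrow> ('m \<Rightarrow> real) set"
  where "smooth_functions \<A> = {f. \<forall>(U, \<phi>)\<in>\<A>. smooth_on (f \<circ> inv_into U \<phi>) (\<phi> ` U)}"

text \<open>The tangent space at \<open>p\<close> consists of the derivations at \<open>p\<close> of the algebra of smooth
  functions.  Derivations are set to zero on non-smooth functions, so that distinct
  HOL functions are distinct tangent vectors.\<close>

type_synonym 'm tangent_vector = "('m \<Rightarrow> real) \<Rightarrow> real"

definition tangent_space ::
    "('m::topological_space, 'e::euclidean_space) chart set \<Rightarrow> 'm \<Rightarrow> 'm tangent_vector set"
  where "tangent_space \<A> p = {X.
    (\<forall>f\<in>smooth_functions \<A>. \<forall>g\<in>smooth_functions \<A>.
        X (\<lambda>q. f q + g q) = X f + X g \<and>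
        X (\<lambda>q. f q * g q) = f p * X g + g p * X f) \<and>
    (\<forall>f\<in>smooth_functions \<A>. \<forall>c. X (\<lambda>q. c * f q) = c * X f) \<and>
    (\<forall>f. f \<notin> smooth_functions \<A> \<longrightarrow> X f = 0)}"

text \<open>Both are infinite for non-measurable functions.\<close>

definition L1_norm :: "'a measure \<Rightarrow> ('a \<Rightarrow> complex) \<Rightarrow> ennreal"
  where "L1_norm \<mu> f =
    (if f \<in> borel_measurable \<mu> then (\<integral>\<^sup>+ x. ennreal (cmod (f x)) \<partial>\<mu>) else \<infinity>)"

definition Linf_norm :: "'a measure \<Rightarrow> ('a \<Rightarrow> complex) \<Rightarrow> ennreal"
  where "Linf_norm \<mu> f =
    (if f \<in> borel_measurable \<mu> then esssup \<mu> (\<lambda>x. ennreal (cmod (f x))) else \<infinity>)"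

text \<open>A Lie group is a group with a compatible structure of a Hausdorff, second countable
  real-analytic manifold.  The carrier is the whole type \<open>'g\<close> and the charts take
  values in \<open>real ^ 'd\<close>, so that the dimension \<open>d\<close> is \<open>CARD('d)\<close>.\<close>

locale lie_group = group G
  for G :: "'g::{t2_space, second_countable_topology} monoid" (structure) +
  fixes atlas :: "('g, real ^ 'd::finite) chart set"
  assumes carrier_UNIV: "carrier G = UNIV"
    and atlas: "analytic_atlas atlas"
    and mult_analytic:
      "analytic_map (prod_atlas atlas atlas) atlas UNIV (\<lambda>(g, h). g \<otimes>\<^bsub>G\<^esub> h)"
    and inv_analytic: "analytic_map atlas atlas UNIV (\<lambda>g. inv\<^bsub>G\<^esub> g)"
begin

text \<open>Only the vector space structure of the Lie algebra is needed; the bracket is omitted.\<close>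

definition lie_algebra :: "'g tangent_vector set"
  where "lie_algebra = tangent_space atlas \<one>\<^bsub>G\<^esub>"

definition one_parameter_subgroup :: "'g tangent_vector \<Rightarrow> (real \<Rightarrow> 'g) \<Rightarrow> bool"
  where "one_parameter_subgroup X \<gamma> \<longleftrightarrow> continuous_on UNIV \<gamma> \<and>
    (\<forall>s t. \<gamma> (s + t) = \<gamma> s \<otimes>\<^bsub>G\<^esub> \<gamma> t) \<and>
    (\<forall>f\<in>smooth_functions atlas. ((f \<circ> \<gamma>) has_real_derivative X f) (at 0))"

definition lie_exp :: "'g tangent_vector \<Rightarrow> 'g"
  where "lie_exp X = (THE \<gamma>. one_parameter_subgroup X \<gamma>) 1"

definition left_translation :: "'g \<Rightarrow> ('g \<Rightarrow> complex) \<Rightarrow> 'g \<Rightarrow> complex"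
  where "left_translation g \<phi> h = \<phi> (inv\<^bsub>G\<^esub> g \<otimes>\<^bsub>G\<^esub> h)"

text \<open>Regularity is automatic, because \<open>G\<close> is locally compact and second countable.\<close>

definition left_haar_measure :: "'g measure \<Rightarrow> bool"
  where "left_haar_measure \<mu> \<longleftrightarrow> sets \<mu> = sets borel \<and>
    (\<forall>C. compact C \<longrightarrow> emeasure \<mu> C < \<infinity>) \<and> emeasure \<mu> UNIV \<noteq> 0 \<and>
    (\<forall>g. distr \<mu> \<mu> (\<lambda>h. g \<otimes>\<^bsub>G\<^esub> h) = \<mu>)"

end

locale lie_group_with_basis = lie_group G atlas
  for G :: "'g::{t2_space, second_countable_topology} monoid" (structure)
    and atlas :: "('g, real ^ 'd::finite) chart set" +
  fixes a :: "'d \<Rightarrow> 'g tangent_vector"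
  assumes basis_in: "\<And>i. a i \<in> lie_algebra"
    and basis: "\<And>X. X \<in> lie_algebra \<Longrightarrow> \<exists>!x :: real ^ 'd. X = (\<lambda>f. \<Sum>i\<in>UNIV. x $ i * a i f)"
begin

definition lie_vec :: "real ^ 'd \<Rightarrow> 'g tangent_vector"
  where "lie_vec x = (\<lambda>f. \<Sum>i\<in>UNIV. x $ i * a i f)"

definition exp_coord :: "real ^ 'd \<Rightarrow> 'g"
  where "exp_coord x = lie_exp (lie_vec x)"

definition generator :: "'d \<Rightarrow> ('g \<Rightarrow> complex) \<Rightarrow> 'g \<Rightarrow> complex"
  where "generator j \<phi> h =
    Lim (at 0) (\<lambda>s. (left_translation (exp_coord (s *\<^sub>R axis j 1)) \<phi> h - \<phi> h) /\<^sub>R s)"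

definition generator_power :: "'d list \<Rightarrow> ('g \<Rightarrow> complex) \<Rightarrow> 'g \<Rightarrow> complex"
  where "generator_power \<alpha> \<phi> = foldr generator \<alpha> \<phi>"

text \<open>\<open>path_velocity \<gamma> u\<close>: for almost every \<open>s \<in> [0, 1]\<close> the path \<open>\<gamma>\<close> has at \<open>s\<close> the tangent
  vector with coordinates \<open>u s\<close> in the frame of left-invariant vector fields
  determined by \<open>a\<close>; the field determined by \<open>a i\<close> maps \<open>f\<close> to
  \<open>g \<mapsto> a i (\<lambda>h. f (g h))\<close>.  This frame is orthonormal for the invariant
  Riemannian metric in question, so the speed of \<open>\<gamma>\<close> is \<open>norm (u s)\<close>.\<close>

definition path_velocity :: "(real \<Rightarrow> 'g) \<Rightarrow> (real \<Rightarrow> real ^ 'd) \<Rightarrow> bool"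
  where "path_velocity \<gamma> u \<longleftrightarrow>
    (AE s in lborel. s \<in> {0..1} \<longrightarrow>
       (\<forall>f\<in>smooth_functions atlas.
          ((f \<circ> \<gamma>) has_real_derivative (\<Sum>i\<in>UNIV. u s $ i * a i (\<lambda>h. f (\<gamma> s \<otimes>\<^bsub>G\<^esub> h)))) (at s)))"

definition absolutely_continuous_path :: "(real \<Rightarrow> 'g) \<Rightarrow> bool"
  where "absolutely_continuous_path \<gamma> \<longleftrightarrow>
    (\<forall>f\<in>smooth_functions atlas. absolutely_continuous_on 0 1 (f \<circ> \<gamma>))"

definition modulus :: "'g \<Rightarrow> real"
  where "modulus g = Inf {integral {0..1} (\<lambda>s. norm (u s)) | \<gamma> u.
    absolutely_continuous_path \<gamma> \<and> \<gamma> 0 = g \<and> \<gamma> 1 = \<one>\<^bsub>G\<^esub> \<and>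
    path_velocity \<gamma> u \<and> (\<lambda>s. norm (u s)) integrable_on {0..1}}"

definition U :: "real \<Rightarrow> ('g \<Rightarrow> complex) \<Rightarrow> 'g \<Rightarrow> complex"
  where "U \<rho> \<phi> g = of_real (exp (\<rho> * modulus g)) * \<phi> g"

end

text \<open>Multi-indices are finite sequences of indices, not exponent vectors, since the generators
  need not commute.\<close>

definition multi_indices :: "nat \<Rightarrow> 'd list set"
  where "multi_indices m = {\<alpha>. length \<alpha> \<le> m}"

definition strongly_elliptic :: "nat \<Rightarrow> ('d::finite list \<Rightarrow> complex) \<Rightarrow> bool"
  where "strongly_elliptic m c \<longleftrightarrow>
    (\<exists>\<mu>>0. \<forall>\<xi> :: real ^ 'd.
       Re ((-1) ^ (m div 2) *
           (\<Sum>\<alpha> | length \<alpha> = m. c \<alpha> * of_real (prod_list (map (\<lambda>k. \<xi> $ k) \<alpha>))))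
         \<ge> \<mu> * norm \<xi> ^ m)"

text \<open>The measure \<open>dg\<close> is the left Haar measure whose density in exponential coordinates,
  on the ball \<open>B\<close> of radius \<open>r\<close>, is a positive smooth function \<open>\<sigma>\<close> with \<open>\<sigma> 0 = 1\<close>.\<close>

locale kernel_construction = lie_group_with_basis G atlas a
  for G :: "'g::{t2_space, second_countable_topology} monoid" (structure)
    and atlas :: "('g, real ^ 'd::finite) chart set"
    and a :: "'d \<Rightarrow> 'g tangent_vector" +
  fixes m :: nat and c :: "'d list \<Rightarrow> complex"
    and r :: real and \<Omega> :: "'g set" and dg :: "'g measure" and \<theta> :: "'g \<Rightarrow> real"
  assumes m_even: "even m" and m_ge_2: "m \<ge> 2"
    and elliptic: "strongly_elliptic m c"
    and r_pos: "r > 0"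
    and Omega: "open \<Omega>" "compact (closure \<Omega>)" "\<one>\<^bsub>G\<^esub> \<in> \<Omega>"
    and exp_diffeo: "analytic_diffeomorphism vec_atlas atlas (ball 0 r) \<Omega> exp_coord"
    and haar: "left_haar_measure dg"
    and haar_normalized:
      "\<exists>\<sigma>. smooth_on \<sigma> (ball 0 r) \<and> (\<forall>x\<in>ball 0 r. \<sigma> x > 0) \<and> \<sigma> 0 = 1 \<and>
         (\<forall>S\<in>sets borel. S \<subseteq> \<Omega> \<longrightarrow>
            emeasure dg S =
              (\<integral>\<^sup>+ x\<in>ball 0 r. ennreal (\<sigma> x) * indicator S (exp_coord x) \<partial>lborel))"
    and theta_smooth: "\<theta> \<in> smooth_functions atlas"
    and theta_support: "compact (closure {g. \<theta> g \<noteq> 0})" "closure {g. \<theta> g \<noteq> 0} \<subseteq> \<Omega>"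
    and theta_range: "\<And>g. 0 \<le> \<theta> g \<and> \<theta> g \<le> 1"
    and theta_one: "\<forall>\<^sub>F g in nhds \<one>\<^bsub>G\<^esub>. \<theta> g = 1"
begin

definition H :: "('g \<Rightarrow> complex) \<Rightarrow> 'g \<Rightarrow> complex"
  where "H \<phi> g = (\<Sum>\<alpha>\<in>multi_indices m. c \<alpha> * generator_power \<alpha> \<phi> g)"

definition symbol :: "real ^ 'd \<Rightarrow> complex"
  where "symbol \<xi> =
    (\<Sum>\<alpha>\<in>multi_indices m. c \<alpha> * prod_list (map (\<lambda>k. - \<i> * of_real (\<xi> $ k)) \<alpha>))"

definition K_tilde :: "real \<Rightarrow> real ^ 'd \<Rightarrow> complex"
  where "K_tilde t x =
    (if t > 0
     then (LINT \<xi>|lborel. exp (\<i> * of_real (x \<bullet> \<xi>)) * exp (- of_real t * symbol \<xi>))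
            / of_real ((2 * pi) ^ CARD('d))
     else 0)"

definition K0 :: "real \<Rightarrow> 'g \<Rightarrow> complex"
  where "K0 t g =
    (if g \<in> \<Omega> then of_real (\<theta> g) * K_tilde t (inv_into (ball 0 r) exp_coord g) else 0)"

definition M :: "real \<Rightarrow> 'g \<Rightarrow> complex"
  where "M t g = (if t > 0 then vector_derivative (\<lambda>s. K0 s g) (at t) + H (K0 t) g else 0)"

definition conv ::
    "(real \<Rightarrow> 'g \<Rightarrow> complex) \<Rightarrow> (real \<Rightarrow> 'g \<Rightarrow> complex) \<Rightarrow> real \<Rightarrow> 'g \<Rightarrow> complex"
  where "conv \<phi> \<psi> t g =
    (LINT s:{0..t}|lborel. (LINT h|dg. \<phi> (t - s) h * \<psi> s (inv\<^bsub>G\<^esub> h \<otimes>\<^bsub>G\<^esub> g)))"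

primrec K_iter :: "nat \<Rightarrow> real \<Rightarrow> 'g \<Rightarrow> complex" where
  "K_iter 0 = K0"
| "K_iter (Suc n) = (\<lambda>t g. - conv (K_iter n) M t g)"

text \<open>The terms are continuous in \<open>g\<close>, so convergence of the series in \<open>L\<^sub>\<infinity>\<close> is uniform
  convergence, and the pointwise sum is the continuous representative of the sum in every \<open>L\<^sub>p\<close>.\<close>

definition K :: "real \<Rightarrow> 'g \<Rightarrow> complex"
  where "K t g = (\<Sum>n. K_iter n t g)"

end

end

theory Submission
  imports Defs "HOL-Complex_Analysis.Complex_Analysis" "HOL-Probability.Sinc_Integral"
begin

text \<open>In exponential coordinates the generators are \<open>A\<^sub>j = - \<partial>\<^sub>j\<close> plus a vector field vanishing at
  the origin, so \<open>M\<^sub>t = (\<partial>\<^sub>t + H) K\<^sup>(\<^sup>0\<^sup>)\<^sub>t\<close> is a combination of derivatives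
  \<open>\<partial>\<^sup>\<beta> K'\<^sub>t\<close>, \<open>|\<beta>| \<le> m\<close>, of the Euclidean kernel \<open>K'\<close> in which the coefficients with
  \<open>|\<beta>| = m\<close> vanish at the origin.  Shifting the contour in the Fourier integral to
  \<open>\<xi> + i \<tau> x / |x|\<close> gives, for every \<open>\<tau> \<ge> 0\<close>,
  \<open>|\<partial>\<^sup>\<beta> K'\<^sub>t(x)| \<le> a t\<^bsup>-(d + |\<beta>|) / m\<^esup> exp (\<omega> (1 + \<tau>\<^sup>m) t - \<tau> |x|)\<close>.  As
  \<open>|exp x| \<le> C |x|\<close>, the choice \<open>\<tau> = C \<rho> + 2 t\<^bsup>-1 / m\<^esup>\<close> yields weighted \<open>L\<^sub>1\<close> and
  \<open>L\<^sub>\<infinity>\<close> bounds for \<open>K\<^sup>(\<^sup>0\<^sup>)\<close> and, with an additional integrable factor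
  \<open>t\<^bsup>1 / m - 1\<^esup>\<close>, for \<open>M\<close>.  Since \<open>e\<^bsup>\<rho> |gh|\<^esup> \<le> e\<^bsup>\<rho> |g|\<^esup> e\<^bsup>\<rho> |h|\<^esup>\<close>, they propagate through the
  convolutions; measured against \<open>e\<^bsup>(\<omega> (1 + \<rho>\<^sup>m) + \<nu>) t\<^esup>\<close> with \<open>\<nu>\<close> large, each convolution with
  \<open>M\<close> gains a factor \<open>1/2\<close> and the series is geometric.  Optimizing over \<open>\<rho>\<close> gives the
  Gaussian bound.  Only upper bounds of the modulus enter, hence no property of the exponential
  map except that it is a chart with \<open>exp 0 = e\<close>.\<close>

text \<open>The order in which constants are chosen carries the proof. The bounds for
  \<open>K0\<close> and \<open>M\<close> grow like e^(\<omega>(1+\<rho>^m)t) with \<omega> free of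
  \<rho>: shifting the frequency by \<tau> costs \<tau>^m in the symbol, and \<tau> is affine in
  \<rho>. The exponent \<nu> is fixed afterwards from the integrable singularity s^(1/m - 1) alone,
  so it is free of \<rho> too; this permits the final choice of \<rho> for each g and t. The gain
  t^(1/m) comes from the vanishing leading coefficients: with T = t^(1/m), |x| e^(-2|x|/T) \<le> T
  e^(-|x|/T), so one of the two units of decay pays for one derivative and the other is left to be
  integrated. Supremum bounds cannot be iterated by themselves, as t^(-d/m) need not be integrable
  at 0; they are carried along with the L1 bounds and the time integral is cut at t/2. For small s
  this calls for the integral of |M(h^-1 g)| in h, which left invariance turns into that of
  |M(h^-1)|. As G may fail to be unimodular, it is compared with the L1 norm through the compact
  closure of \<Omega>.\<close>

section \<open>Smooth and analytic functions on Euclidean space\<close>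

text \<open>Dominated convergence along sequences: on a ball the mean value inequality bounds the
  difference quotients by \<open>w\<close>, and subtracting the derivative at most doubles this. The
  measure is arbitrary so that power series (counting measure), the contour parameter and the
  Fourier integrals can all be differentiated by this one lemma.\<close>

lemma has_derivative_integral:
  fixes f :: "'a::{real_normed_vector, perfect_space} \<Rightarrow> 'b \<Rightarrow> 'c::{banach, second_countable_topology}"
  assumes "0 < e"
    and int: "\<And>x. x \<in> ball x0 e \<Longrightarrow> integrable M (f x)"
    and der: "\<And>x \<omega>. x \<in> ball x0 e \<Longrightarrow> \<omega> \<in> space M \<Longrightarrow> ((\<lambda>x. f x \<omega>) has_derivative f' x \<omega>) (at x)"
    and bound: "\<And>x \<omega> v. x \<in> ball x0 e \<Longrightarrow> \<omega> \<in> space M \<Longrightarrow> norm (f' x \<omega> v) \<le> w \<omega> * norm v"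
    and w: "integrable M w"
    and meas: "\<And>v. (\<lambda>\<omega>. f' x0 \<omega> v) \<in> borel_measurable M"
  shows "((\<lambda>x. \<integral>\<omega>. f x \<omega> \<partial>M) has_derivative (\<lambda>v. \<integral>\<omega>. f' x0 \<omega> v \<partial>M)) (at x0)"
proof -
  let ?B = "ball x0 e"
  have x0: "x0 \<in> ?B" using \<open>0 < e\<close> by simp
  have int': "integrable M (\<lambda>\<omega>. f' x0 \<omega> v)" for v
    by (rule Bochner_Integration.integrable_bound[OF _ meas, of "\<lambda>\<omega>. w \<omega> * norm v"])
      (use w bound[OF x0, of _ v] in \<open>auto intro!: AE_I2 intro: order_trans[OF _ abs_ge_self]\<close>)
  have lin: "bounded_linear (f' x0 \<omega>)" if "\<omega> \<in> space M" for \<omega>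
    using der[OF x0 that] by (rule has_derivative_bounded_linear)
  have bl: "bounded_linear (\<lambda>v. \<integral>\<omega>. f' x0 \<omega> v \<partial>M)"
  proof (rule bounded_linear_intro)
    fix v u
    show "(\<integral>\<omega>. f' x0 \<omega> (v + u) \<partial>M) = (\<integral>\<omega>. f' x0 \<omega> v \<partial>M) + (\<integral>\<omega>. f' x0 \<omega> u \<partial>M)"
      unfolding Bochner_Integration.integral_add[OF int' int', symmetric]
      by (rule Bochner_Integration.integral_cong) (auto dest!: lin simp: linear_simps)
  next
    fix s v
    show "(\<integral>\<omega>. f' x0 \<omega> (s *\<^sub>R v) \<partial>M) = s *\<^sub>R (\<integral>\<omega>. f' x0 \<omega> v \<partial>M)"
      unfolding integral_scaleR_right[symmetric]
      by (rule Bochner_Integration.integral_cong) (auto dest!: lin simp: linear_simps)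
  next
    fix v
    have "norm (\<integral>\<omega>. f' x0 \<omega> v \<partial>M) \<le> (\<integral>\<omega>. w \<omega> * norm v \<partial>M)"
      by (intro order_trans[OF integral_norm_bound] Bochner_Integration.integral_mono) (use int' w bound[OF x0] in auto)
    then show "norm (\<integral>\<omega>. f' x0 \<omega> v \<partial>M) \<le> norm v * (\<integral>\<omega>. w \<omega> \<partial>M)"
      by (simp add: mult.commute)
  qed
  have lip: "norm (f y \<omega> - f x0 \<omega>) \<le> w \<omega> * norm (y - x0)" if "y \<in> ?B" "\<omega> \<in> space M" for y \<omega>
  proof (rule differentiable_bound[OF convex_ball _ _ that(1) x0])
    show "((\<lambda>x. f x \<omega>) has_derivative f' x \<omega>) (at x within ?B)" if "x \<in> ?B" for x
      using der[OF that \<open>\<omega> \<in> space M\<close>] by (rule has_derivative_at_withinI)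
    show "onorm (f' x \<omega>) \<le> w \<omega>" if "x \<in> ?B" for x
      by (rule onorm_le) (rule bound[OF that \<open>\<omega> \<in> space M\<close>])
  qed
  let ?q = "\<lambda>y \<omega>. (1 / norm (y - x0)) *\<^sub>R (f y \<omega> - (f x0 \<omega> + f' x0 \<omega> (y - x0)))"
  have "((\<lambda>x. \<integral>\<omega>. f x \<omega> \<partial>M) has_derivative (\<lambda>v. \<integral>\<omega>. f' x0 \<omega> v \<partial>M)) (at x0 within ?B)"
    unfolding has_derivative_within
  proof (intro conjI bl)
    show "((\<lambda>y. (1 / norm (y - x0)) *\<^sub>R ((\<integral>\<omega>. f y \<omega> \<partial>M) - ((\<integral>\<omega>. f x0 \<omega> \<partial>M) + (\<integral>\<omega>. f' x0 \<omega> (y - x0) \<partial>M)))) \<longlongrightarrow> 0)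
       (at x0 within ?B)"
      unfolding tendsto_at_iff_sequentially comp_def
    proof (intro allI impI)
      fix X assume X: "\<forall>i. X i \<in> ?B - {x0}" "X \<longlonglongrightarrow> x0"
      have eq: "(1 / norm (X i - x0)) *\<^sub>R ((\<integral>\<omega>. f (X i) \<omega> \<partial>M) - ((\<integral>\<omega>. f x0 \<omega> \<partial>M) + (\<integral>\<omega>. f' x0 \<omega> (X i - x0) \<partial>M)))
         = (\<integral>\<omega>. ?q (X i) \<omega> \<partial>M)" for i
        using X int int' x0 by simp
      have "(\<lambda>i. \<integral>\<omega>. ?q (X i) \<omega> \<partial>M) \<longlonglongrightarrow> (\<integral>\<omega>. 0 \<partial>M)"
      proof (rule integral_dominated_convergence[where w = "\<lambda>\<omega>. 2 * w \<omega>"])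
        show "(\<lambda>\<omega>. ?q (X i) \<omega>) \<in> borel_measurable M" for i
          using X int int' x0 by (intro borel_measurable_integrable) simp
        show "integrable M (\<lambda>\<omega>. 2 * w \<omega>)" using w by simp
        show "AE \<omega> in M. (\<lambda>i. ?q (X i) \<omega>) \<longlonglongrightarrow> 0"
        proof (rule AE_I2)
          fix \<omega> assume "\<omega> \<in> space M"
          then have "((\<lambda>y. ?q y \<omega>) \<longlongrightarrow> 0) (at x0 within ?B)"
            using has_derivative_at_withinI[OF der[OF x0], of \<omega> ?B] unfolding has_derivative_within by blast
          then show "(\<lambda>i. ?q (X i) \<omega>) \<longlonglongrightarrow> 0"
            using X unfolding tendsto_at_iff_sequentially comp_def by blast
        qed
        show "AE \<omega> in M. norm (?q (X i) \<omega>) \<le> 2 * w \<omega>" for i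
        proof (rule AE_I2)
          fix \<omega> assume \<omega>: "\<omega> \<in> space M"
          have Xi: "X i \<in> ?B" "X i \<noteq> x0" using X by auto
          have "norm (f (X i) \<omega> - (f x0 \<omega> + f' x0 \<omega> (X i - x0)))
             \<le> norm (f (X i) \<omega> - f x0 \<omega>) + norm (f' x0 \<omega> (X i - x0))"
            by (metis diff_diff_eq norm_triangle_ineq4)
          also have "\<dots> \<le> 2 * w \<omega> * norm (X i - x0)"
            using lip[OF Xi(1) \<omega>] bound[OF x0 \<omega>, of "X i - x0"] by simp
          finally show "norm (?q (X i) \<omega>) \<le> 2 * w \<omega>"
            unfolding norm_scaleR using Xi by (simp add: pos_divide_le_eq)
        qed
      qed simp
      then show "(\<lambda>i. (1 / norm (X i - x0)) *\<^sub>R ((\<integral>\<omega>. f (X i) \<omega> \<partial>M) - ((\<integral>\<omega>. f x0 \<omega> \<partial>M) + (\<integral>\<omega>. f' x0 \<omega> (X i - x0) \<partial>M)))) \<longlonglongrightarrow> 0"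
        unfolding eq by simp
    qed
  qed
  then show ?thesis by (simp only: at_within_open[OF x0 open_ball])
qed

section \<open>Calculus of n-fold differentiable and smooth functions\<close>

lemma frechet_derivative_at':
  "(f has_derivative f') (at x) \<Longrightarrow> frechet_derivative f (at x) = f'"
  using frechet_derivative_at by fastforce

lemma times_differentiable_on_subset:
  "times_differentiable_on n f S \<Longrightarrow> T \<subseteq> S \<Longrightarrow> times_differentiable_on n f T"
  by (induction n arbitrary: f) (auto intro: continuous_on_subset)

lemma times_differentiable_on_cong:
  assumes "open S" "times_differentiable_on n f S" "\<And>x. x \<in> S \<Longrightarrow> f x = g x"
  shows "times_differentiable_on n g S"
  using assms(2,3)
proof (induction n arbitrary: f g)
  case 0
  then show ?case by (simp cong: continuous_on_cong)
next
  case (Suc n)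
  have "g differentiable (at x)" if "x \<in> S" for x
    using Suc.prems that assms(1) unfolding differentiable_def times_differentiable_on.simps
    by (meson has_derivative_transform_within_open)
  moreover have "times_differentiable_on n (\<lambda>x. frechet_derivative g (at x) v) S" for v
  proof (rule Suc.IH)
    show "times_differentiable_on n (\<lambda>x. frechet_derivative f (at x) v) S" using Suc.prems by simp
    show "frechet_derivative f (at x) v = frechet_derivative g (at x) v" if "x \<in> S" for x
      using Suc.prems that assms(1) by (subst frechet_derivative_transform_within_open[of f x S g]) auto
  qed
  ultimately show ?case by simp
qed

lemma times_differentiable_on_local:
  assumes "\<And>x. x \<in> S \<Longrightarrow> \<exists>T. open T \<and> x \<in> T \<and> times_differentiable_on n f T"
  shows "times_differentiable_on n f S"
  using assms
proof (induction n arbitrary: f)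
  case 0
  then show ?case
    by (auto intro!: continuous_at_imp_continuous_on) (meson continuous_on_eq_continuous_at)
next
  case (Suc n)
  have "times_differentiable_on n (\<lambda>x. frechet_derivative f (at x) v) S" for v
    by (rule Suc.IH) (use Suc.prems in \<open>force\<close>)
  moreover have "f differentiable at x" if "x \<in> S" for x using Suc.prems[OF that] by auto
  ultimately show ?case by simp
qed

lemma times_differentiable_on_lower:
  "times_differentiable_on (Suc n) f S \<Longrightarrow> times_differentiable_on n f S"
  by (induction n arbitrary: f)
    (auto intro!: continuous_at_imp_continuous_on differentiable_imp_continuous_within)

lemma times_differentiable_on_const: "times_differentiable_on n (\<lambda>x. c) S"
  by (induction n arbitrary: c) auto

lemma times_differentiable_on_linear:
  assumes "bounded_linear f"
  shows "times_differentiable_on n f S"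
proof (cases n)
  case 0
  then show ?thesis using assms by (simp add: linear_continuous_on)
next
  case (Suc k)
  have *: "frechet_derivative f (at x) = f" for x
    using bounded_linear_imp_has_derivative[OF assms] by (rule frechet_derivative_at')
  show ?thesis using Suc bounded_linear_imp_differentiable[OF assms]
    by (simp add: * times_differentiable_on_const)
qed

lemma times_differentiable_on_add:
  assumes "open S" "times_differentiable_on n f S" "times_differentiable_on n g S"
  shows "times_differentiable_on n (\<lambda>x. f x + g x) S"
  using assms(2,3)
proof (induction n arbitrary: f g)
  case 0
  then show ?case by (simp add: continuous_on_add)
next
  case (Suc n)
  have d: "frechet_derivative (\<lambda>x. f x + g x) (at x) v = frechet_derivative f (at x) v + frechet_derivative g (at x) v"
    if "x \<in> S" for x v
    using Suc.prems that
    by (subst frechet_derivative_at'[OF has_derivative_add]) (auto simp: frechet_derivative_works)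
  have "times_differentiable_on n (\<lambda>x. frechet_derivative (\<lambda>x. f x + g x) (at x) v) S" for v
    by (rule times_differentiable_on_cong[OF assms(1) Suc.IH[of "\<lambda>x. frechet_derivative f (at x) v" "\<lambda>x. frechet_derivative g (at x) v"]])
      (use Suc.prems d in auto)
  then show ?case using Suc.prems by simp
qed

lemma times_differentiable_on_mult:
  assumes "open S" "times_differentiable_on n f S" "times_differentiable_on n g S"
  shows "times_differentiable_on n (\<lambda>x. f x * g x) S"
  using assms(2,3)
proof (induction n arbitrary: f g)
  case 0
  then show ?case by (simp add: continuous_on_mult)
next
  case (Suc n)
  have d: "frechet_derivative (\<lambda>x. f x * g x) (at x) v
      = f x * frechet_derivative g (at x) v + frechet_derivative f (at x) v * g x"
    if "x \<in> S" for x v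
    using Suc.prems that
    by (subst frechet_derivative_at'[OF has_derivative_mult]) (auto simp: frechet_derivative_works)
  have "times_differentiable_on n (\<lambda>x. f x * frechet_derivative g (at x) v + frechet_derivative f (at x) v * g x) S" for v
    by (intro times_differentiable_on_add Suc.IH assms(1)) (use Suc.prems times_differentiable_on_lower in auto)
  then have "times_differentiable_on n (\<lambda>x. frechet_derivative (\<lambda>x. f x * g x) (at x) v) S" for v
    by (rule times_differentiable_on_cong[OF assms(1)]) (use d in auto)
  then show ?case using Suc.prems by simp
qed

lemma times_differentiable_on_sum:
  assumes "open S" "\<And>i. i \<in> I \<Longrightarrow> times_differentiable_on n (f i) S"
  shows "times_differentiable_on n (\<lambda>x. \<Sum>i\<in>I. f i x) S"
  using assms(2)
  by (induction I rule: infinite_finite_induct)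
    (auto simp: times_differentiable_on_const intro!: times_differentiable_on_add assms(1))

text \<open>By the chain rule every directional derivative of the composite is a sum of products of
  a derivative of a coordinate of \<open>g\<close> and a partial derivative of \<open>f\<close>
  evaluated at \<open>g\<close>. Hence the induction runs over all \<open>f\<close> at once, and
  \<open>g\<close> reenters with one order of differentiability less.\<close>

lemma times_differentiable_on_compose:
  fixes g :: "'a::euclidean_space \<Rightarrow> 'b::euclidean_space"
  assumes "open S" "open T" "g ` S \<subseteq> T"
    and "times_differentiable_on n f T"
    and "\<And>b. b \<in> Basis \<Longrightarrow> times_differentiable_on n (\<lambda>x. g x \<bullet> b) S"
  shows "times_differentiable_on n (\<lambda>x. f (g x)) S"
  using assms(4,5)
proof (induction n arbitrary: f)
  case 0
  have "continuous_on S g"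
    using 0 by (subst continuous_on_componentwise) simp
  then show ?case using 0 assms(3) by (auto intro: continuous_on_compose2)
next
  case (Suc n)
  have dg: "(g has_derivative (\<lambda>v. \<Sum>b\<in>Basis. frechet_derivative (\<lambda>x. g x \<bullet> b) (at x) v *\<^sub>R b)) (at x)"
    if "x \<in> S" for x
    by (subst has_derivative_componentwise_within)
      (use Suc.prems that in \<open>auto simp: inner_sum_left inner_Basis if_distrib frechet_derivative_works cong: if_cong\<close>)
  have df: "(f has_derivative frechet_derivative f (at (g x))) (at (g x))" if "x \<in> S" for x
    using Suc.prems that assms(3) by (auto simp: frechet_derivative_works)
  have dc: "((\<lambda>x. f (g x)) has_derivative (\<lambda>v. \<Sum>b\<in>Basis. frechet_derivative (\<lambda>x. g x \<bullet> b) (at x) v * frechet_derivative f (at (g x)) b)) (at x)"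
    if "x \<in> S" for x
  proof -
    have lin: "linear (frechet_derivative f (at (g x)))"
      using has_derivative_bounded_linear[OF df[OF that]] by (rule bounded_linear.linear)
    show ?thesis
      using diff_chain_at[OF dg df, OF that that]
      by (simp add: o_def linear_sum[OF lin] linear_cmul[OF lin])
  qed
  have "times_differentiable_on n (\<lambda>x. \<Sum>b\<in>Basis. frechet_derivative (\<lambda>x. g x \<bullet> b) (at x) v * frechet_derivative f (at (g x)) b) S" for v
  proof (rule times_differentiable_on_sum[OF assms(1)], rule times_differentiable_on_mult[OF assms(1)])
    fix b :: 'b assume b: "b \<in> Basis"
    then show "times_differentiable_on n (\<lambda>x. frechet_derivative (\<lambda>x. g x \<bullet> b) (at x) v) S"
      using Suc.prems(2) by simp
    show "times_differentiable_on n (\<lambda>x. frechet_derivative f (at (g x)) b) S"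
      by (rule Suc.IH[where f = "\<lambda>y. frechet_derivative f (at y) b"])
        (use Suc.prems(1) Suc.prems(2)[THEN times_differentiable_on_lower] in auto)
  qed
  then have "times_differentiable_on n (\<lambda>x. frechet_derivative (\<lambda>x. f (g x)) (at x) v) S" for v
    by (rule times_differentiable_on_cong[OF assms(1)]) (use frechet_derivative_at'[OF dc] in auto)
  then show ?case using dc by (auto simp: differentiable_def)
qed

lemma smooth_on_subset: "smooth_on f S \<Longrightarrow> T \<subseteq> S \<Longrightarrow> smooth_on f T"
  unfolding smooth_on_def using times_differentiable_on_subset by blast

lemma smooth_on_cong: "open S \<Longrightarrow> smooth_on f S \<Longrightarrow> (\<And>x. x \<in> S \<Longrightarrow> f x = g x) \<Longrightarrow> smooth_on g S"
  unfolding smooth_on_def using times_differentiable_on_cong by blast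

lemma smooth_on_local:
  "(\<And>x. x \<in> S \<Longrightarrow> \<exists>T. open T \<and> x \<in> T \<and> smooth_on f T) \<Longrightarrow> smooth_on f S"
  unfolding smooth_on_def by (intro allI times_differentiable_on_local) metis

lemma smooth_on_const: "smooth_on (\<lambda>x. c) S"
  by (simp add: smooth_on_def times_differentiable_on_const)

lemma smooth_on_linear: "bounded_linear f \<Longrightarrow> smooth_on f S"
  by (simp add: smooth_on_def times_differentiable_on_linear)

lemma smooth_on_add: "open S \<Longrightarrow> smooth_on f S \<Longrightarrow> smooth_on g S \<Longrightarrow> smooth_on (\<lambda>x. f x + g x) S"
  by (simp add: smooth_on_def times_differentiable_on_add)

lemma smooth_on_mult: "open S \<Longrightarrow> smooth_on f S \<Longrightarrow> smooth_on g S \<Longrightarrow> smooth_on (\<lambda>x. f x * g x) S"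
  by (simp add: smooth_on_def times_differentiable_on_mult)

lemma smooth_on_sum: "open S \<Longrightarrow> (\<And>i. i \<in> I \<Longrightarrow> smooth_on (f i) S) \<Longrightarrow> smooth_on (\<lambda>x. \<Sum>i\<in>I. f i x) S"
  by (simp add: smooth_on_def times_differentiable_on_sum)

lemma smooth_on_compose:
  fixes g :: "'a::euclidean_space \<Rightarrow> 'b::euclidean_space"
  assumes "open S" "open T" "g ` S \<subseteq> T" "smooth_on f T" "\<And>b. b \<in> Basis \<Longrightarrow> smooth_on (\<lambda>x. g x \<bullet> b) S"
  shows "smooth_on (\<lambda>x. f (g x)) S"
  unfolding smooth_on_def
proof
  fix n
  show "times_differentiable_on n (\<lambda>x. f (g x)) S"
    by (rule times_differentiable_on_compose[OF assms(1-3), where f = f])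
      (use assms(4,5) in \<open>auto simp: smooth_on_def\<close>)
qed

lemma smooth_on_frechet: "smooth_on f S \<Longrightarrow> smooth_on (\<lambda>x. frechet_derivative f (at x) v) S"
  unfolding smooth_on_def by (metis times_differentiable_on.simps(2))

lemma smooth_on_has_derivative:
  "smooth_on f S \<Longrightarrow> x \<in> S \<Longrightarrow> (f has_derivative frechet_derivative f (at x)) (at x)"
  unfolding smooth_on_def by (metis times_differentiable_on.simps(2) frechet_derivative_works)

lemma smooth_on_continuous: "smooth_on f S \<Longrightarrow> continuous_on S f"
  unfolding smooth_on_def by (metis times_differentiable_on.simps(1))


section \<open>Power series in several variables; analytic functions are smooth\<close>

lemma abs_prod_power_le:
  fixes z :: "'a::euclidean_space"
  assumes "norm z \<le> \<rho>"
  shows "\<bar>\<Prod>b\<in>Basis. (z \<bullet> b) ^ k b\<bar> \<le> \<rho> ^ (\<Sum>b\<in>Basis. k b)"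
proof -
  have "\<bar>\<Prod>b\<in>Basis. (z \<bullet> b) ^ k b\<bar> = (\<Prod>b\<in>Basis. \<bar>z \<bullet> b\<bar> ^ k b)"
    by (simp add: abs_prod power_abs)
  also have "\<dots> \<le> (\<Prod>b\<in>Basis. \<rho> ^ k b)"
    by (intro prod_mono conjI power_mono) (auto intro: order_trans[OF Basis_le_norm assms])
  finally show ?thesis by (simp add: power_sum)
qed

text \<open>Truncated subtraction in \<open>k b - 1\<close> does no harm: it only matters for
  \<open>k b = 0\<close>, where the coefficient \<open>k b\<close> vanishes.\<close>

lemma has_derivative_prod_power:
  fixes x :: "'a::euclidean_space"
  shows "((\<lambda>y. \<Prod>b\<in>Basis. ((y - x) \<bullet> b) ^ k b) has_derivative
     (\<lambda>v. \<Sum>b\<in>Basis. (v \<bullet> b) * (real (k b) * (\<Prod>b'\<in>Basis. ((y - x) \<bullet> b') ^ (k(b := k b - 1)) b')))) (at y)"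
proof -
  have "((\<lambda>y. \<Prod>b\<in>Basis. ((y - x) \<bullet> b) ^ k b) has_derivative
     (\<lambda>v. \<Sum>b\<in>Basis. (real (k b) * (v \<bullet> b) * ((y - x) \<bullet> b) ^ (k b - 1)) * (\<Prod>b'\<in>Basis - {b}. ((y - x) \<bullet> b') ^ k b'))) (at y)"
    by (rule has_derivative_prod) (auto intro!: derivative_eq_intros simp: field_simps)
  moreover have "(real (k b) * (v \<bullet> b) * ((y - x) \<bullet> b) ^ (k b - 1)) * (\<Prod>b'\<in>Basis - {b}. ((y - x) \<bullet> b') ^ k b')
     = (v \<bullet> b) * (real (k b) * (\<Prod>b'\<in>Basis. ((y - x) \<bullet> b') ^ (k(b := k b - 1)) b'))" if "b \<in> Basis" for b v
  proof -
    have "(\<Prod>b'\<in>Basis. ((y - x) \<bullet> b') ^ (k(b := k b - 1)) b')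
       = ((y - x) \<bullet> b) ^ (k b - 1) * (\<Prod>b'\<in>Basis - {b}. ((y - x) \<bullet> b') ^ k b')"
      using that by (subst prod.remove[of _ b]) (auto intro!: prod.cong)
    then show ?thesis by simp
  qed
  ultimately show ?thesis
    by (elim has_derivative_eq_rhs) (intro ext sum.cong refl)
qed

text \<open>Termwise differentiation on a smaller ball: the factor \<open>k i b\<close> that it
  produces is absorbed by the boundedness of n (\<rho>'/\<rho>)^n. Terms are indexed by an abstract
  \<open>i\<close> with exponents \<open>k i\<close>, and not by the exponents, because after
  differentiation different terms may have the same exponents; in this form the derivative is again
  a series of the same kind and the lemma can be iterated.\<close>

lemma power_series_has_derivative:
  fixes c :: "'i \<Rightarrow> real" and k :: "'i \<Rightarrow> 'a::euclidean_space \<Rightarrow> nat"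
  assumes \<rho>: "0 < \<rho>'" "\<rho>' < \<rho>"
    and c: "integrable (count_space I) (\<lambda>i. \<bar>c i\<bar> * \<rho> ^ (\<Sum>b\<in>Basis. k i b))"
    and f: "\<And>y. y \<in> ball x \<rho> \<Longrightarrow> f y = (\<integral>i. c i * (\<Prod>b\<in>Basis. ((y - x) \<bullet> b) ^ k i b) \<partial>count_space I)"
    and y: "y \<in> ball x \<rho>'"
  shows "\<And>b. b \<in> Basis \<Longrightarrow>
      integrable (count_space I) (\<lambda>i. \<bar>c i * real (k i b)\<bar> * \<rho>' ^ (\<Sum>b'\<in>Basis. ((k i)(b := k i b - 1)) b'))"
    and "(f has_derivative (\<lambda>v. \<Sum>b\<in>Basis. (v \<bullet> b) *
      (\<integral>i. (c i * real (k i b)) * (\<Prod>b'\<in>Basis. ((y - x) \<bullet> b') ^ ((k i)(b := k i b - 1)) b') \<partial>count_space I))) (at y)"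
proof -
  let ?K = "\<lambda>i. \<Sum>b\<in>Basis. k i b"
  let ?k = "\<lambda>i b. (k i)(b := k i b - 1)"
  let ?m = "\<lambda>k y. \<Prod>b\<in>Basis. ((y - x) \<bullet> b) ^ (k b :: nat)"
  have "(\<lambda>n. real n * (\<rho>' / \<rho>) ^ n) \<longlonglongrightarrow> 0"
    by (rule powser_times_n_limit_0) (use \<rho> in auto)
  then obtain C where C: "\<And>n. \<bar>real n * (\<rho>' / \<rho>) ^ n\<bar> \<le> C"
    using BseqE[OF convergent_imp_Bseq[OF convergentI]] by (metis real_norm_def)
  have le: "\<bar>c i * real (k i b)\<bar> * \<rho>' ^ (\<Sum>b'\<in>Basis. (?k i b) b') \<le> C / \<rho>' * (\<bar>c i\<bar> * \<rho> ^ ?K i)" if b: "b \<in> Basis" for i b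
  proof (cases "k i b = 0")
    case True
    then show ?thesis using C[of 0] \<rho> by simp
  next
    case False
    have "(\<Sum>b'\<in>Basis. k i b') = k i b + (\<Sum>b'\<in>Basis - {b}. k i b')"
      using b by (simp add: sum.remove)
    moreover have "(\<Sum>b'\<in>Basis. (?k i b) b') = (k i b - 1) + (\<Sum>b'\<in>Basis - {b}. k i b')"
      using b by (subst sum.remove[of _ b]) (auto intro!: sum.cong)
    ultimately have K: "?K i = Suc (\<Sum>b'\<in>Basis. (?k i b) b')" and kK: "k i b \<le> ?K i"
      using False by auto
    have "real (k i b) * \<rho>' ^ (\<Sum>b'\<in>Basis. (?k i b) b') \<le> real (?K i) * \<rho>' ^ (\<Sum>b'\<in>Basis. (?k i b) b')"
      using \<rho> by (intro mult_right_mono of_nat_mono kK) auto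
    also have "\<dots> = real (?K i) * (\<rho>' / \<rho>) ^ ?K i * \<rho> ^ ?K i / \<rho>'"
      unfolding K using \<rho> by (simp add: field_simps)
    also have "\<dots> \<le> C * \<rho> ^ ?K i / \<rho>'"
      using C[of "?K i"] \<rho> by (intro divide_right_mono mult_right_mono) auto
    finally have "\<bar>c i\<bar> * (real (k i b) * \<rho>' ^ (\<Sum>b'\<in>Basis. (?k i b) b')) \<le> \<bar>c i\<bar> * (C * \<rho> ^ ?K i / \<rho>')"
      by (rule mult_left_mono) simp
    then show ?thesis by (simp add: abs_mult mult_ac)
  qed
  show int: "integrable (count_space I) (\<lambda>i. \<bar>c i * real (k i b)\<bar> * \<rho>' ^ (\<Sum>b'\<in>Basis. (?k i b) b'))"
    if b: "b \<in> Basis" for b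
  proof (rule Bochner_Integration.integrable_bound[OF integrable_mult_right[OF c, of "C / \<rho>'"]])
    have "norm (\<bar>c i * real (k i b)\<bar> * \<rho>' ^ (\<Sum>b'\<in>Basis. (?k i b) b')) \<le> norm (C / \<rho>' * (\<bar>c i\<bar> * \<rho> ^ ?K i))" for i
      using order_trans[OF le[OF b] abs_ge_self, of i] \<rho> by (simp add: abs_mult del: fun_upd_apply)
    then show "AE i in count_space I. norm (\<bar>c i * real (k i b)\<bar> * \<rho>' ^ (\<Sum>b'\<in>Basis. (?k i b) b')) \<le> norm (C / \<rho>' * (\<bar>c i\<bar> * \<rho> ^ ?K i))"
      by (intro AE_I2)
  qed simp
  define e where "e = \<rho>' - dist x y"
  have e: "0 < e" using y by (simp add: e_def)
  have sub: "norm (z - x) < \<rho>'" if "z \<in> ball y e" for z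
  proof -
    have "norm (z - x) = dist x z" by (simp add: dist_norm norm_minus_commute)
    also have "\<dots> \<le> dist x y + dist y z" by (rule dist_triangle)
    finally show ?thesis using that unfolding e_def by simp
  qed
  have D: "((\<lambda>z. \<integral>i. c i * ?m (k i) z \<partial>count_space I) has_derivative
     (\<lambda>v. \<integral>i. (\<Sum>b\<in>Basis. (v \<bullet> b) * ((c i * real (k i b)) * ?m (?k i b) y)) \<partial>count_space I)) (at y)"
  proof (rule has_derivative_integral[where f' = "\<lambda>z i v. \<Sum>b\<in>Basis. (v \<bullet> b) * ((c i * real (k i b)) * ?m (?k i b) z)"
        and w = "\<lambda>i. \<Sum>b\<in>Basis. \<bar>c i * real (k i b)\<bar> * \<rho>' ^ (\<Sum>b'\<in>Basis. (?k i b) b')", OF e])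
    show "integrable (count_space I) (\<lambda>i. c i * ?m (k i) z)" if "z \<in> ball y e" for z
    proof (rule Bochner_Integration.integrable_bound[OF c])
      have "\<bar>?m (k i) z\<bar> \<le> \<rho> ^ ?K i" for i
        by (rule abs_prod_power_le) (use sub[OF that] \<rho> in auto)
      then show "AE i in count_space I. norm (c i * ?m (k i) z) \<le> norm (\<bar>c i\<bar> * \<rho> ^ ?K i)"
        using \<rho> by (auto intro!: AE_I2 mult_left_mono simp: abs_mult)
    qed simp
    show "((\<lambda>z. c i * ?m (k i) z) has_derivative (\<lambda>v. \<Sum>b\<in>Basis. (v \<bullet> b) * ((c i * real (k i b)) * ?m (?k i b) z))) (at z)" for z i
      using has_derivative_mult_right[OF has_derivative_prod_power[of x "k i" z], of "c i"]
      by (simp add: sum_distrib_left mult_ac)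
    show "norm (\<Sum>b\<in>Basis. (v \<bullet> b) * ((c i * real (k i b)) * ?m (?k i b) z))
        \<le> (\<Sum>b\<in>Basis. \<bar>c i * real (k i b)\<bar> * \<rho>' ^ (\<Sum>b'\<in>Basis. (?k i b) b')) * norm v"
      if "z \<in> ball y e" for z i v
      unfolding sum_distrib_right
    proof (rule order_trans[OF norm_sum], rule sum_mono)
      fix b :: 'a assume b: "b \<in> Basis"
      have "\<bar>?m (?k i b) z\<bar> \<le> \<rho>' ^ (\<Sum>b'\<in>Basis. (?k i b) b')"
        by (rule abs_prod_power_le) (use sub[OF that] in auto)
      then have "\<bar>v \<bullet> b\<bar> * (\<bar>c i * real (k i b)\<bar> * \<bar>?m (?k i b) z\<bar>)
         \<le> norm v * (\<bar>c i * real (k i b)\<bar> * \<rho>' ^ (\<Sum>b'\<in>Basis. (?k i b) b'))"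
        by (intro mult_mono mult_left_mono Basis_le_norm b) auto
      then show "norm ((v \<bullet> b) * ((c i * real (k i b)) * ?m (?k i b) z))
         \<le> \<bar>c i * real (k i b)\<bar> * \<rho>' ^ (\<Sum>b'\<in>Basis. (?k i b) b') * norm v"
        by (simp only: real_norm_def abs_mult mult_ac)
    qed
    show "integrable (count_space I) (\<lambda>i. \<Sum>b\<in>Basis. \<bar>c i * real (k i b)\<bar> * \<rho>' ^ (\<Sum>b'\<in>Basis. (?k i b) b'))"
      by (rule Bochner_Integration.integrable_sum) (rule int)
  qed simp
  have int': "integrable (count_space I) (\<lambda>i. (c i * real (k i b)) * ?m (?k i b) y)" if b: "b \<in> Basis" for b
  proof (rule Bochner_Integration.integrable_bound[OF int[OF b]])
    have "\<bar>?m (?k i b) y\<bar> \<le> \<rho>' ^ (\<Sum>b'\<in>Basis. (?k i b) b')" for i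
      by (rule abs_prod_power_le) (use sub[of y] e in auto)
    then have "\<bar>c i * real (k i b)\<bar> * \<bar>?m (?k i b) y\<bar> \<le> \<bar>c i * real (k i b)\<bar> * \<rho>' ^ (\<Sum>b'\<in>Basis. (?k i b) b')" for i
      by (intro mult_left_mono) auto
    then show "AE i in count_space I. norm ((c i * real (k i b)) * ?m (?k i b) y)
       \<le> norm (\<bar>c i * real (k i b)\<bar> * \<rho>' ^ (\<Sum>b'\<in>Basis. (?k i b) b'))"
      using \<rho> by (intro AE_I2) (simp add: abs_mult mult_ac)
  qed simp
  have "(\<integral>i. (\<Sum>b\<in>Basis. (v \<bullet> b) * ((c i * real (k i b)) * ?m (?k i b) y)) \<partial>count_space I)
     = (\<Sum>b\<in>Basis. (v \<bullet> b) * (\<integral>i. (c i * real (k i b)) * ?m (?k i b) y \<partial>count_space I))" for v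
    using int' by (subst Bochner_Integration.integral_sum) auto
  then have "((\<lambda>z. \<integral>i. c i * ?m (k i) z \<partial>count_space I) has_derivative
     (\<lambda>v. \<Sum>b\<in>Basis. (v \<bullet> b) * (\<integral>i. (c i * real (k i b)) * ?m (?k i b) y \<partial>count_space I))) (at y)"
    using D by simp
  then show "(f has_derivative (\<lambda>v. \<Sum>b\<in>Basis. (v \<bullet> b) *
      (\<integral>i. (c i * real (k i b)) * ?m (?k i b) y \<partial>count_space I))) (at y)"
    by (rule has_derivative_transform_within_open[OF _ open_ball[of x \<rho>]]) (use f y \<rho> in auto)
qed

lemma power_series_times_differentiable:
  fixes c :: "'i \<Rightarrow> real" and k :: "'i \<Rightarrow> 'a::euclidean_space \<Rightarrow> nat"
  assumes "0 < \<rho>'" "\<rho>' < \<rho>"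
    and "integrable (count_space I) (\<lambda>i. \<bar>c i\<bar> * \<rho> ^ (\<Sum>b\<in>Basis. k i b))"
    and "\<And>y. y \<in> ball x \<rho> \<Longrightarrow> f y = (\<integral>i. c i * (\<Prod>b\<in>Basis. ((y - x) \<bullet> b) ^ k i b) \<partial>count_space I)"
  shows "times_differentiable_on n f (ball x \<rho>')"
  using assms
proof (induction n arbitrary: c k f \<rho>)
  case 0
  then show ?case
    by (auto intro!: continuous_at_imp_continuous_on has_derivative_continuous[OF power_series_has_derivative(2)])
next
  case (Suc n)
  \<comment> \<open>One differentiation shrinks the radius from \<rho> to \<rho>1; the induction
    hypothesis then leads from \<rho>1 to the fixed \<rho>'.\<close>
  define \<rho>1 where "\<rho>1 = (\<rho>' + \<rho>) / 2"
  have \<rho>1: "\<rho>' < \<rho>1" "\<rho>1 < \<rho>" "0 < \<rho>1" using Suc.prems by (auto simp: \<rho>1_def)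
  let ?g = "\<lambda>b y. \<integral>i. (c i * real (k i b)) * (\<Prod>b'\<in>Basis. ((y - x) \<bullet> b') ^ ((k i)(b := k i b - 1)) b') \<partial>count_space I"
  have d: "(f has_derivative (\<lambda>v. \<Sum>b\<in>Basis. (v \<bullet> b) * ?g b y)) (at y)" if "y \<in> ball x \<rho>1" for y
    by (rule power_series_has_derivative(2)[OF \<rho>1(3,2) Suc.prems(3,4) that]) auto
  have g: "times_differentiable_on n (?g b) (ball x \<rho>')" if "b \<in> Basis" for b
    by (rule Suc.IH[OF Suc.prems(1) \<rho>1(1), where c = "\<lambda>i. c i * real (k i b)" and k = "\<lambda>i. (k i)(b := k i b - 1)"])
      (use power_series_has_derivative(1)[OF \<rho>1(3,2) Suc.prems(3,4), where y = x and b = b] \<rho>1 that in auto)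
  have "times_differentiable_on n (\<lambda>y. \<Sum>b\<in>Basis. (v \<bullet> b) * ?g b y) (ball x \<rho>')" for v
    by (intro times_differentiable_on_sum times_differentiable_on_mult times_differentiable_on_const g open_ball)
  then have "times_differentiable_on n (\<lambda>y. frechet_derivative f (at y) v) (ball x \<rho>')" for v
    by (rule times_differentiable_on_cong[OF open_ball])
      (use frechet_derivative_at'[OF d] \<rho>1 in auto)
  moreover have "f differentiable at y" if "y \<in> ball x \<rho>'" for y
    using d[of y] that \<rho>1 by (auto simp: differentiable_def)
  ultimately show ?case by simp
qed

lemma real_analytic_imp_smooth_on:
  assumes "real_analytic_on f S"
  shows "smooth_on (\<lambda>x. f x \<bullet> j) S"
  unfolding smooth_on_def
proof (intro allI times_differentiable_on_local)
  fix n x assume "x \<in> S"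
  then obtain c r where r: "r > 0" and hs: "\<And>y. y \<in> ball x r \<Longrightarrow>
      ((\<lambda>k. (\<Prod>b\<in>Basis. ((y - x) \<bullet> b) ^ k b) *\<^sub>R c k) has_sum f y) (Basis \<rightarrow>\<^sub>E (UNIV :: nat set))"
    using assms unfolding real_analytic_on_def by blast
  let ?I = "(Basis :: 'a set) \<rightarrow>\<^sub>E (UNIV :: nat set)"
  let ?c = "\<lambda>k. c k \<bullet> j"
  have hs': "((\<lambda>k. ?c k * (\<Prod>b\<in>Basis. ((y - x) \<bullet> b) ^ k b)) has_sum (f y \<bullet> j)) ?I" if "y \<in> ball x r" for y
    using has_sum_bounded_linear[OF bounded_linear_inner_left hs[OF that], of j] by (simp add: o_def mult.commute)
  \<comment> \<open>With this radius the corner x + \<rho>(1,...,1) still lies in the ball of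
    convergence. There every monomial equals \<rho>^|k|, so convergence at this single point, which
    is absolute for an unordered real sum, gives the majorant for the whole ball of radius
    \<rho>.\<close>
  define \<rho> where "\<rho> = r / (2 * DIM('a))"
  have "(1::nat) \<le> DIM('a)"
    by (simp add: Suc_leI)
  then have "r * 1 \<le> r * (2 * real DIM('a))"
    using r by (intro mult_left_mono) linarith+
  then have \<rho>: "0 < \<rho>" "\<rho> \<le> r" using r by (auto simp: \<rho>_def field_simps)
  define y0 where "y0 = x + (\<Sum>b\<in>Basis. \<rho> *\<^sub>R b)"
  have "norm (\<Sum>b\<in>(Basis :: 'a set). \<rho> *\<^sub>R b) \<le> (\<Sum>b\<in>(Basis :: 'a set). \<rho>)"
    by (rule order_trans[OF norm_sum]) (use \<rho> in auto)
  also have "\<dots> < r" using r by (simp add: \<rho>_def)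
  finally have y0: "y0 \<in> ball x r" by (simp add: y0_def dist_norm)
  have y0b: "(y0 - x) \<bullet> b = \<rho>" if "b \<in> Basis" for b
    using that by (simp add: y0_def inner_sum_left inner_Basis if_distrib cong: if_cong)
  have m0: "(\<Prod>b\<in>Basis. ((y0 - x) \<bullet> b) ^ k b) = \<rho> ^ (\<Sum>b\<in>Basis. k b)" for k :: "'a \<Rightarrow> nat"
    using y0b by (simp add: power_sum)
  have "(\<lambda>k. ?c k * \<rho> ^ (\<Sum>b\<in>Basis. k b)) summable_on ?I"
    using hs'[OF y0] unfolding m0 by (rule has_sum_imp_summable)
  then have "Infinite_Sum.abs_summable_on (\<lambda>k. ?c k * \<rho> ^ (\<Sum>b\<in>Basis. k b)) ?I"
    by (rule iffD1[OF summable_on_iff_abs_summable_on_real])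
  then have int0: "integrable (count_space ?I) (\<lambda>k. ?c k * \<rho> ^ (\<Sum>b\<in>Basis. k b))"
    by (simp only: abs_summable_equivalent Infinite_Set_Sum.abs_summable_on_def)
  have int: "integrable (count_space ?I) (\<lambda>k. \<bar>?c k\<bar> * \<rho> ^ (\<Sum>b\<in>Basis. k b))"
    using integrable_norm[OF int0] \<rho> by (simp add: abs_mult)
  have eq: "f y \<bullet> j = (\<integral>k. ?c k * (\<Prod>b\<in>Basis. ((y - x) \<bullet> b) ^ k b) \<partial>count_space ?I)" if y: "y \<in> ball x \<rho>" for y
  proof -
    have "integrable (count_space ?I) (\<lambda>k. ?c k * (\<Prod>b\<in>Basis. ((y - x) \<bullet> b) ^ k b))"
    proof (rule Bochner_Integration.integrable_bound[OF int])
      have "norm (y - x) \<le> \<rho>" using y by (simp add: dist_norm norm_minus_commute)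
      from abs_prod_power_le[OF this]
      show "AE k in count_space ?I. norm (?c k * (\<Prod>b\<in>Basis. ((y - x) \<bullet> b) ^ k b)) \<le> norm (\<bar>?c k\<bar> * \<rho> ^ (\<Sum>b\<in>Basis. k b))"
        using \<rho> by (intro AE_I2) (simp add: abs_mult mult_left_mono)
    qed simp
    then have "Infinite_Set_Sum.abs_summable_on (\<lambda>k. ?c k * (\<Prod>b\<in>Basis. ((y - x) \<bullet> b) ^ k b)) ?I"
      unfolding Infinite_Set_Sum.abs_summable_on_def .
    then have "infsetsum (\<lambda>k. ?c k * (\<Prod>b\<in>Basis. ((y - x) \<bullet> b) ^ k b)) ?I = infsum (\<lambda>k. ?c k * (\<Prod>b\<in>Basis. ((y - x) \<bullet> b) ^ k b)) ?I"
      by (rule infsetsum_infsum)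
    then show ?thesis
      using infsumI[OF hs'[of y]] y \<rho> by (simp add: infsetsum_def)
  qed
  have "times_differentiable_on n (\<lambda>x. f x \<bullet> j) (ball x (\<rho> / 2))"
    by (rule power_series_times_differentiable[where \<rho> = \<rho> and c = ?c and k = "\<lambda>k. k" and I = ?I]) (use \<rho> int eq in auto)
  then show "\<exists>T. open T \<and> x \<in> T \<and> times_differentiable_on n (\<lambda>x. f x \<bullet> j) T"
    using \<rho> by (intro exI[of _ "ball x (\<rho> / 2)"]) auto
qed

section \<open>The heat kernel of the symbol on Euclidean space\<close>

text \<open>Only \<open>f\<close> itself has to be dominated, locally uniformly in z: the Cauchy
  inequality on unit circles turns the majorant into one for the derivative in z, whose
  measurability follows from its being a limit of difference quotients.\<close>

lemma holomorphic_integral: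
  fixes f :: "complex \<Rightarrow> 'b \<Rightarrow> complex"
  assumes hol: "\<And>\<omega>. (\<lambda>z. f z \<omega>) holomorphic_on UNIV"
    and meas: "\<And>z. f z \<in> borel_measurable M"
    and bound: "\<And>R. \<exists>w. integrable M w \<and> (\<forall>z \<omega>. norm z \<le> R \<longrightarrow> norm (f z \<omega>) \<le> w \<omega>)"
  shows "(\<lambda>z. \<integral>\<omega>. f z \<omega> \<partial>M) holomorphic_on UNIV"
proof (rule holomorphic_onI)
  fix z0 :: complex
  obtain w where w: "integrable M w" "\<And>z \<omega>. norm z \<le> norm z0 + 2 \<Longrightarrow> norm (f z \<omega>) \<le> w \<omega>"
    using bound[of "norm z0 + 2"] by blast
  let ?d = "\<lambda>z \<omega>. deriv (\<lambda>z. f z \<omega>) z"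
  have d: "((\<lambda>z. f z \<omega>) has_field_derivative ?d z \<omega>) (at z)" for z \<omega>
    by (rule holomorphic_derivI[OF hol]) auto
  have near: "norm z \<le> norm z0 + 1" if "z \<in> ball z0 1" for z
    using that norm_triangle_ineq2[of z z0] by (simp add: dist_norm norm_minus_commute)
  have dle: "norm (?d z \<omega>) \<le> w \<omega>" if "z \<in> ball z0 1" for z \<omega>
  proof -
    have "norm (f x \<omega>) \<le> w \<omega>" if "norm (z - x) = 1" for x
      using that near[OF \<open>z \<in> _\<close>] norm_triangle_ineq2[of x z]
      by (intro w(2)) (simp add: norm_minus_commute)
    then have "norm ((deriv ^^ 1) (\<lambda>z. f z \<omega>) z) \<le> fact 1 * w \<omega> / 1 ^ 1"
      by (intro Cauchy_inequality)
        (auto intro: holomorphic_on_subset[OF hol] holomorphic_on_imp_continuous_on)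
    then show ?thesis by simp
  qed
  have md: "(\<lambda>\<omega>. ?d z0 \<omega>) \<in> borel_measurable M"
  proof (rule borel_measurable_LIMSEQ_metric)
    let ?s = "\<lambda>n. complex_of_real (inverse (real (Suc n)))"
    show "(\<lambda>\<omega>. (f (z0 + ?s n) \<omega> - f z0 \<omega>) / ?s n) \<in> borel_measurable M" for n
      using meas by simp
    fix \<omega>
    have "(\<lambda>h. (f (z0 + h) \<omega> - f z0 \<omega>) / h) \<midarrow>0\<rightarrow> ?d z0 \<omega>"
      using d[of \<omega> z0] by (simp add: DERIV_def)
    moreover have "?s \<longlonglongrightarrow> 0"
      using tendsto_of_real[OF LIMSEQ_inverse_real_of_nat, where 'a = complex] by simp
    moreover have "\<forall>n. ?s n \<in> UNIV - {0}"
      by (simp add: of_nat_neq_0 del: of_nat_Suc)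
    ultimately show "(\<lambda>n. (f (z0 + ?s n) \<omega> - f z0 \<omega>) / ?s n) \<longlonglongrightarrow> ?d z0 \<omega>"
      unfolding tendsto_at_iff_sequentially comp_def by metis
  qed
  have "((\<lambda>z. \<integral>\<omega>. f z \<omega> \<partial>M) has_derivative (\<lambda>v. \<integral>\<omega>. ?d z0 \<omega> * v \<partial>M)) (at z0)"
  proof (rule has_derivative_integral[where e = 1 and w = w and f' = "\<lambda>z \<omega> v. ?d z \<omega> * v"])
    show "integrable M (f z)" if "z \<in> ball z0 1" for z
      by (rule Bochner_Integration.integrable_bound[OF w(1) meas])
        (use w(2)[of z] near[OF that] in \<open>auto intro!: AE_I2 order_trans[OF _ abs_ge_self]\<close>)
    show "((\<lambda>z. f z \<omega>) has_derivative (\<lambda>v. ?d z \<omega> * v)) (at z)" for z \<omega>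
      using d[of \<omega> z] by (simp add: has_field_derivative_def)
    show "norm (?d z \<omega> * v) \<le> w \<omega> * norm v" if "z \<in> ball z0 1" for z \<omega> v
      unfolding norm_mult by (intro mult_right_mono dle that) simp
  qed (use w md in auto)
  then have "((\<lambda>z. \<integral>\<omega>. f z \<omega> \<partial>M) has_field_derivative (\<integral>\<omega>. ?d z0 \<omega> \<partial>M)) (at z0)"
    by (simp add: has_field_derivative_def)
  then show "(\<lambda>z. \<integral>\<omega>. f z \<omega> \<partial>M) field_differentiable at z0 within UNIV"
    by (auto simp: field_differentiable_def)
qed

section \<open>Lebesgue integrals: translation, scaling and integrability tests\<close>

lemma integral_lborel_translate:
  fixes f :: "'a::euclidean_space \<Rightarrow> 'b::{banach, second_countable_topology}"
  assumes "f \<in> borel_measurable borel"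
  shows "(\<integral>x. f (c + x) \<partial>lborel) = (\<integral>x. f x \<partial>lborel)"
proof -
  have "(\<integral>x. f x \<partial>distr lborel borel ((+) c)) = (\<integral>x. f (c + x) \<partial>lborel)"
    using assms by (intro integral_distr) auto
  then show ?thesis by (simp add: lborel_distr_plus)
qed

lemma nn_integral_lborel_scale:
  fixes f :: "'a::euclidean_space \<Rightarrow> ennreal"
  assumes [measurable]: "f \<in> borel_measurable borel" and "T > 0"
  shows "(\<integral>\<^sup>+x. f (T *\<^sub>R x) \<partial>lborel) = ennreal (1 / T ^ DIM('a)) * (\<integral>\<^sup>+x. f x \<partial>lborel)"
proof -
  have "(\<integral>\<^sup>+x. f x \<partial>lborel) = ennreal (T ^ DIM('a)) * (\<integral>\<^sup>+x. f (T *\<^sub>R x) \<partial>lborel)"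
    using \<open>T > 0\<close> by (subst lborel_affine[of T 0])
      (auto simp: nn_integral_density nn_integral_distr nn_integral_cmult)
  then show ?thesis using \<open>T > 0\<close>
    by (simp add: mult.assoc[symmetric] ennreal_mult[symmetric])
qed

lemma integral_lborel_scale:
  fixes f :: "'a::euclidean_space \<Rightarrow> real"
  assumes [measurable]: "f \<in> borel_measurable borel" and "T > 0" and nonneg: "\<And>x. 0 \<le> f x"
  shows "(\<integral>x. f (T *\<^sub>R x) \<partial>lborel) = (\<integral>x. f x \<partial>lborel) / T ^ DIM('a)"
  using nn_integral_lborel_scale[of "\<lambda>x. ennreal (f x)" T] \<open>T > 0\<close> nonneg
  by (simp add: integral_eq_nn_integral enn2real_mult)

text \<open>Each factor (1 + |x|)^2 dominates one factor 1 + x_b^2, so the integral is below a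
  product of one-dimensional integrals of 1/(1 + x^2).\<close>

lemma integrable_inverse_norm_power:
  "integrable lborel (\<lambda>x::'a::euclidean_space. inverse ((1 + norm x) ^ (2 * DIM('a))))"
proof -
  let ?g = "\<lambda>x::real. inverse (1 + x\<^sup>2)"
  have "integrable lborel ?g"
    using integrable_inverse_1_plus_square by (simp add: set_integrable_def)
  then have fin: "(\<integral>\<^sup>+x. ennreal (?g x) \<partial>lborel) < \<infinity>"
    by (subst nn_integral_eq_integral) auto
  have "(\<integral>\<^sup>+x. ennreal (inverse ((1 + norm x) ^ (2 * DIM('a)))) \<partial>(lborel :: 'a measure))
      \<le> (\<integral>\<^sup>+x. (\<Prod>b\<in>Basis. ennreal (?g (x \<bullet> b))) \<partial>(lborel :: 'a measure))"
  proof (rule nn_integral_mono)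
    fix x :: 'a
    have "(\<Prod>b\<in>Basis. 1 + (x \<bullet> b)\<^sup>2) \<le> (\<Prod>b\<in>(Basis :: 'a set). (1 + norm x) ^ 2)"
    proof (intro prod_mono conjI)
      fix b :: 'a assume "b \<in> Basis"
      then have "(x \<bullet> b)\<^sup>2 \<le> (norm x)\<^sup>2"
        by (metis Basis_le_norm abs_le_square_iff abs_norm_cancel)
      then have "(x \<bullet> b)\<^sup>2 \<le> (norm x)\<^sup>2 + 2 * norm x"
        using norm_ge_zero[of x] by linarith
      then show "1 + (x \<bullet> b)\<^sup>2 \<le> (1 + norm x)\<^sup>2" by (simp add: power2_sum)
    qed (simp add: add_nonneg_nonneg)
    then have "inverse ((1 + norm x) ^ (2 * DIM('a))) \<le> inverse (\<Prod>b\<in>Basis. 1 + (x \<bullet> b)\<^sup>2)"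
      by (intro le_imp_inverse_le prod_pos) (auto simp: add_pos_nonneg power_mult)
    then show "ennreal (inverse ((1 + norm x) ^ (2 * DIM('a)))) \<le> (\<Prod>b\<in>Basis. ennreal (?g (x \<bullet> b)))"
      by (simp add: prod_ennreal ennreal_leI flip: prod_inversef)
  qed
  also have "\<dots> = (\<Prod>b\<in>(Basis :: 'a set). (\<integral>\<^sup>+x. ennreal (?g x) \<partial>lborel))"
    by (rule nn_integral_lborel_prod) auto
  also have "\<dots> < \<infinity>"
    using fin by (simp add: power_less_top_ennreal)
  finally show ?thesis by (intro integrableI_nonneg) auto
qed

text \<open>The k-th power of z \<le> e^z at z = s v/(k+1); dividing by k+1 and not by k includes
  the case k = 0.\<close>

lemma power_le_exp:
  fixes s v :: real
  assumes "s > 0" "v \<ge> 0"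
  shows "v ^ k \<le> (real (Suc k) / s) ^ k * exp (s * v)"
proof -
  have "s * v / real (Suc k) \<le> exp (s * v / real (Suc k))"
    using exp_ge_add_one_self[of "s * v / real (Suc k)"] by linarith
  then have "(s * v / real (Suc k)) ^ k \<le> exp (s * v / real (Suc k)) ^ k"
    using assms by (intro power_mono) auto
  also have "\<dots> = exp (real k * (s * v / real (Suc k)))"
    by (rule exp_of_nat_mult[symmetric])
  also have "\<dots> \<le> exp (s * v)"
  proof -
    have "real k * (s * v) \<le> real (Suc k) * (s * v)" using assms by (intro mult_right_mono) auto
    then show ?thesis by (simp add: field_simps)
  qed
  finally have "(s * v / real (Suc k)) ^ k \<le> exp (s * v)" .
  then have "(real (Suc k) / s) ^ k * (s * v / real (Suc k)) ^ k \<le> (real (Suc k) / s) ^ k * exp (s * v)"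
    using assms by (intro mult_left_mono) auto
  moreover have "(real (Suc k) / s) ^ k * (s * v / real (Suc k)) ^ k = v ^ k"
    using assms by (simp flip: power_mult_distrib)
  ultimately show ?thesis by simp
qed

text \<open>The integrability test for all Fourier integrands. As |x|^m \<ge> |x| - 1, the decay is
  at least e^(2s) e^(-s(1+|x|)) up to direction of the estimate, and \<open>power_le_exp\<close>
  exchanges this exponential for the power of 1 + |x| that cancels the polynomial growth and leaves
  an integrable function.\<close>

lemma integrable_power_exp_bound:
  fixes f :: "'a::euclidean_space \<Rightarrow> 'b::{banach, second_countable_topology}"
  assumes [measurable]: "f \<in> borel_measurable borel" and "s > 0" "m \<ge> 1"
    and f: "\<And>x. norm (f x) \<le> C * (1 + norm x) ^ N * exp (- s * norm x ^ m)"
  shows "integrable lborel f"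
proof -
  define k where "k = N + 2 * DIM('a)"
  define B where "B = \<bar>C\<bar> * ((real (Suc k) / s) ^ k * exp (2 * s))"
  have "norm (f x) \<le> B * inverse ((1 + norm x) ^ (2 * DIM('a)))" for x
  proof -
    have "norm x - 1 \<le> norm x ^ m"
    proof (cases "norm x \<ge> 1")
      case True
      then have "norm x ^ 1 \<le> norm x ^ m" using \<open>m \<ge> 1\<close> by (intro power_increasing)
      then show ?thesis by simp
    next
      case False
      then show ?thesis using zero_le_power[OF norm_ge_zero, of x m] by linarith
    qed
    then have "s * (norm x - 1) \<le> s * norm x ^ m"
      using \<open>s > 0\<close> by (intro mult_left_mono) auto
    then have e: "exp (- s * norm x ^ m) \<le> exp (2 * s) * exp (- (s * (1 + norm x)))"
      by (simp add: algebra_simps flip: exp_add)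
    have p: "(1 + norm x) ^ k * exp (- (s * (1 + norm x))) \<le> (real (Suc k) / s) ^ k"
    proof -
      have "(1 + norm x) ^ k * exp (- (s * (1 + norm x)))
          \<le> (real (Suc k) / s) ^ k * exp (s * (1 + norm x)) * exp (- (s * (1 + norm x)))"
        by (intro mult_right_mono power_le_exp \<open>s > 0\<close>) auto
      then show ?thesis by (simp only: mult.assoc exp_minus_inverse mult_1_right)
    qed
    have "norm (f x) \<le> \<bar>C\<bar> * ((1 + norm x) ^ N * exp (- s * norm x ^ m))"
    proof (rule order_trans[OF f[of x]])
      show "C * (1 + norm x) ^ N * exp (- s * norm x ^ m) \<le> \<bar>C\<bar> * ((1 + norm x) ^ N * exp (- s * norm x ^ m))"
        unfolding mult.assoc by (intro mult_right_mono abs_ge_self) simp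
    qed
    also have "\<dots> \<le> \<bar>C\<bar> * ((1 + norm x) ^ N * (exp (2 * s) * exp (- (s * (1 + norm x)))))"
      by (intro mult_left_mono e) auto
    also have "\<dots> = \<bar>C\<bar> * (((1 + norm x) ^ k * exp (- (s * (1 + norm x)))) * exp (2 * s)) * inverse ((1 + norm x) ^ (2 * DIM('a)))"
    proof -
      have "(1 + norm x) ^ (2 * DIM('a)) \<noteq> 0"
        by (metis add_pos_nonneg less_irrefl norm_ge_zero power_eq_0_iff zero_less_one)
      then show ?thesis by (simp add: k_def power_add field_simps)
    qed
    also have "\<dots> \<le> B * inverse ((1 + norm x) ^ (2 * DIM('a)))"
      unfolding B_def by (intro mult_right_mono mult_left_mono p) auto
    finally show ?thesis .
  qed
  then show ?thesis
    by (intro Bochner_Integration.integrable_bound[OF integrable_mult_right[OF integrable_inverse_norm_power, of B]])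
      (auto intro!: AE_I2 order_trans[OF _ abs_ge_self])
qed

lemma has_derivative_exp_complex:
  fixes f :: "'a::real_normed_vector \<Rightarrow> complex"
  assumes "(f has_derivative f') (at x)"
  shows "((\<lambda>x. exp (f x)) has_derivative (\<lambda>v. exp (f x) * f' v)) (at x)"
  using has_derivative_compose[OF assms DERIV_exp[unfolded has_field_derivative_def]] .

section \<open>Elementary inequalities for products, powers and exponentials\<close>

lemma norm_prod_list_map_le:
  fixes f :: "'a \<Rightarrow> complex"
  assumes "\<And>k. norm (f k) \<le> R"
  shows "norm (prod_list (map f \<alpha>)) \<le> R ^ length \<alpha>"
proof (induction \<alpha>)
  case (Cons k \<alpha>)
  have "0 \<le> R" using assms[of k] norm_ge_zero order_trans by blast
  then show ?case using Cons assms[of k] by (auto simp: norm_mult intro!: mult_mono)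
qed simp

text \<open>Replace one factor at a time: (f + g)P - fQ = gP + f(P - Q). It controls the change of
  the principal part of the symbol when a real frequency is perturbed; the bound keeps the
  subtracted power of \<open>u\<close>, so that for a small perturbation only a small multiple of
  that power survives.\<close>

lemma norm_prod_list_add_diff:
  fixes f g :: "'a \<Rightarrow> complex"
  assumes f: "\<And>k. norm (f k) \<le> u" and g: "\<And>k. norm (g k) \<le> R"
  shows "norm (prod_list (map (\<lambda>k. f k + g k) \<alpha>) - prod_list (map f \<alpha>)) \<le> (u + R) ^ length \<alpha> - u ^ length \<alpha>"
proof (induction \<alpha>)
  case (Cons k \<alpha>)
  let ?P = "prod_list (map (\<lambda>k. f k + g k) \<alpha>)" and ?Q = "prod_list (map f \<alpha>)" and ?n = "length \<alpha>"
  have 0: "0 \<le> u" "0 \<le> R"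
    by (rule order_trans[OF norm_ge_zero f], rule order_trans[OF norm_ge_zero g])
  have P: "norm ?P \<le> (u + R) ^ ?n"
    by (rule norm_prod_list_map_le) (rule order_trans[OF norm_triangle_ineq add_mono[OF f g]])
  have "norm ((f k + g k) * ?P - f k * ?Q) = norm (g k * ?P + f k * (?P - ?Q))"
    by (simp add: algebra_simps)
  also have "\<dots> \<le> norm (g k) * norm ?P + norm (f k) * norm (?P - ?Q)"
    unfolding norm_mult[symmetric] by (rule norm_triangle_ineq)
  also have "\<dots> \<le> R * (u + R) ^ ?n + u * ((u + R) ^ ?n - u ^ ?n)"
    by (rule add_mono[OF mult_mono[OF g P 0(2) norm_ge_zero] mult_mono[OF f Cons 0(1) norm_ge_zero]])
  also have "\<dots> = (u + R) ^ length (k # \<alpha>) - u ^ length (k # \<alpha>)"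
    by (simp add: algebra_simps)
  finally show ?case by simp
qed simp

text \<open>Choose \<delta> with (1 + \<delta>)^m < 1 + \<epsilon>. If R \<le> \<delta> u, the sum
  is at most (1 + \<delta>)u; otherwise u \<le> R/\<delta> and everything is a multiple of R^m. A
  coefficient of u^m close to 1 is essential, because u^m is subtracted in
  \<open>norm_prod_list_add_diff\<close>.\<close>

lemma power_add_le:
  fixes \<epsilon> :: real
  assumes "\<epsilon> > 0"
  shows "\<exists>C\<ge>0. \<forall>u\<ge>0. \<forall>R\<ge>0. (u + R) ^ m \<le> (1 + \<epsilon>) * u ^ m + C * R ^ m"
proof -
  have "((\<lambda>\<delta>::real. (1 + \<delta>) ^ m) \<longlongrightarrow> (1 + 0) ^ m) (at_right 0)"
    by (intro tendsto_intros)
  then have "\<forall>\<^sub>F \<delta> in at_right 0. (1 + \<delta>) ^ m < 1 + \<epsilon>"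
    by (rule order_tendstoD) (use assms in auto)
  moreover have "\<forall>\<^sub>F \<delta> in at_right 0. (0::real) < \<delta>"
    by (simp add: eventually_at_right_less)
  ultimately have "\<forall>\<^sub>F \<delta> in at_right 0. 0 < \<delta> \<and> (1 + \<delta>) ^ m < 1 + \<epsilon>"
    by eventually_elim auto
  then obtain \<delta> :: real where \<delta>: "0 < \<delta>" "(1 + \<delta>) ^ m < 1 + \<epsilon>"
    using eventually_happens trivial_limit_at_right_real by blast
  define C where "C = (1 / \<delta> + 1) ^ m"
  have "(u + R) ^ m \<le> (1 + \<epsilon>) * u ^ m + C * R ^ m" if "u \<ge> 0" "R \<ge> 0" for u R :: real
  proof (cases "R \<le> \<delta> * u")
    case True
    then have "(u + R) ^ m \<le> ((1 + \<delta>) * u) ^ m"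
      using that by (intro power_mono) (auto simp: algebra_simps)
    also have "\<dots> \<le> (1 + \<epsilon>) * u ^ m"
      unfolding power_mult_distrib using \<delta> that by (intro mult_right_mono) auto
    also have "\<dots> \<le> (1 + \<epsilon>) * u ^ m + C * R ^ m"
      using that \<delta> by (simp add: C_def)
    finally show ?thesis .
  next
    case False
    then have "u \<le> R / \<delta>" using \<delta> by (simp add: field_simps)
    then have "(u + R) ^ m \<le> ((1 / \<delta> + 1) * R) ^ m"
      using that by (intro power_mono) (auto simp: algebra_simps)
    also have "\<dots> \<le> (1 + \<epsilon>) * u ^ m + C * R ^ m"
      using that assms by (simp add: C_def power_mult_distrib)
    finally show ?thesis .
  qed
  moreover have "C \<ge> 0" using \<delta> by (simp add: C_def)
  ultimately show ?thesis by blast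
qed

text \<open>Absorbs terms of lower order into a small multiple of the top order, by distinguishing
  whether v exceeds 1/\<delta>.\<close>

lemma power_less_le:
  fixes \<delta> v :: real
  assumes "\<delta> > 0" "v \<ge> 0"
  shows "v ^ n \<le> \<delta> * v ^ Suc n + (1 / \<delta>) ^ n"
proof (cases "1 \<le> \<delta> * v")
  case True
  then have "1 * v ^ n \<le> (\<delta> * v) * v ^ n" using assms by (intro mult_right_mono) auto
  moreover have "0 \<le> (1 / \<delta>) ^ n" using assms by simp
  ultimately show ?thesis by (simp add: mult_ac)
next
  case False
  then have "v \<le> 1 / \<delta>" using assms by (simp add: field_simps)
  then have "v ^ n \<le> (1 / \<delta>) ^ n" using assms by (intro power_mono) auto
  moreover have "0 \<le> \<delta> * v ^ Suc n" using assms by simp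
  ultimately show ?thesis by linarith
qed

lemma power_sum3_le:
  fixes a b c :: real
  assumes "a \<ge> 0" "b \<ge> 0" "c \<ge> 0"
  shows "(a + b + c) ^ m \<le> 3 ^ m * (a ^ m + b ^ m + c ^ m)"
proof -
  define M where "M = max a (max b c)"
  have "(a + b + c) ^ m \<le> (3 * M) ^ m"
    using assms by (intro power_mono) (auto simp: M_def max_def)
  also have "\<dots> = 3 ^ m * M ^ m" by (simp add: power_mult_distrib)
  also have "M ^ m \<le> a ^ m + b ^ m + c ^ m"
    using assms by (auto simp: M_def max_def add_nonneg_nonneg add_increasing add_increasing2)
  finally show ?thesis by simp
qed


text \<open>Applied with u = T|\<xi>| and v = T\<tau>, T = t^(1/m): the polynomial factor of a
  derivative is paid for by a small part of the decay in \<xi> and by a factor e^(t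
  \<tau>^m).\<close>

lemma one_add_power_exp_bound:
  fixes u v \<kappa> :: real
  assumes "u \<ge> 0" "v \<ge> 0" "\<kappa> > 0" "n \<le> m"
  shows "(u + v) ^ n \<le> 3 ^ m * (1 + 1 / \<kappa>) * exp (\<kappa> * u ^ m) * exp (v ^ m)"
proof -
  have "(u + v) ^ n \<le> (1 + u + v) ^ n" using assms by (intro power_mono) auto
  also have "\<dots> \<le> (1 + u + v) ^ m" using assms by (intro power_increasing) auto
  also have "\<dots> \<le> 3 ^ m * (1 ^ m + u ^ m + v ^ m)" using assms by (intro power_sum3_le) auto
  also have "1 ^ m + u ^ m + v ^ m \<le> (1 + u ^ m) * (1 + v ^ m)"
    using assms by (simp add: algebra_simps)
  also have "1 + u ^ m \<le> (1 + 1 / \<kappa>) * exp (\<kappa> * u ^ m)"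
  proof -
    have "0 \<le> \<kappa> * u ^ m" using assms by simp
    then have "1 \<le> exp (\<kappa> * u ^ m)" by simp
    moreover have "\<kappa> * u ^ m \<le> exp (\<kappa> * u ^ m)"
      using exp_ge_add_one_self[of "\<kappa> * u ^ m"] by linarith
    then have "u ^ m \<le> exp (\<kappa> * u ^ m) / \<kappa>" using assms by (simp add: field_simps)
    moreover have "(1 + 1 / \<kappa>) * exp (\<kappa> * u ^ m) = exp (\<kappa> * u ^ m) + exp (\<kappa> * u ^ m) / \<kappa>"
      by (simp add: algebra_simps)
    ultimately show ?thesis by linarith
  qed
  also have "1 + v ^ m \<le> exp (v ^ m)" by (rule exp_ge_add_one_self)
  finally show ?thesis using assms by (simp add: mult_left_mono mult_right_mono mult.assoc)
qed

lemma finite_multi_indices [simp]: "finite (multi_indices n :: 'd::finite list set)"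
  using finite_lists_length_le[of "UNIV :: 'd set" n] by (simp add: multi_indices_def)

section \<open>Strongly elliptic symbols at complex frequencies\<close>

locale elliptic_symbol =
  fixes m :: nat and c :: "'d::finite list \<Rightarrow> complex"
  assumes even_order: "even m" and order_ge_2: "m \<ge> 2"
    and strongly_elliptic: "strongly_elliptic m c"
begin

definition complex_symbol :: "('d \<Rightarrow> complex) \<Rightarrow> complex"
  where "complex_symbol \<zeta> = (\<Sum>\<alpha>\<in>multi_indices m. c \<alpha> * prod_list (map (\<lambda>k. - \<i> * \<zeta> k) \<alpha>))"

lemma norm_complex_symbol_le:
  "\<exists>C\<ge>0. \<forall>\<zeta> R. (\<forall>k. norm (\<zeta> k) \<le> R) \<longrightarrow> 0 \<le> R \<longrightarrow> norm (complex_symbol \<zeta>) \<le> C * (1 + R) ^ m"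
proof (intro exI conjI allI impI)
  let ?C = "\<Sum>\<alpha>\<in>multi_indices m. norm (c \<alpha>)"
  show "0 \<le> ?C" by (simp add: sum_nonneg)
  fix \<zeta> :: "'d \<Rightarrow> complex" and R :: real
  assume R: "\<forall>k. norm (\<zeta> k) \<le> R" "0 \<le> R"
  have "norm (c \<alpha> * prod_list (map (\<lambda>k. - \<i> * \<zeta> k) \<alpha>)) \<le> norm (c \<alpha>) * (1 + R) ^ m" if "\<alpha> \<in> multi_indices m" for \<alpha>
  proof -
    have "norm (prod_list (map (\<lambda>k. - \<i> * \<zeta> k) \<alpha>)) \<le> R ^ length \<alpha>"
      by (rule norm_prod_list_map_le) (use R in \<open>simp add: norm_mult\<close>)
    also have "\<dots> \<le> (1 + R) ^ length \<alpha>" using R by (intro power_mono) auto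
    also have "\<dots> \<le> (1 + R) ^ m" using R that by (intro power_increasing) (auto simp: multi_indices_def)
    finally show ?thesis by (simp add: norm_mult mult_left_mono)
  qed
  then show "norm (complex_symbol \<zeta>) \<le> ?C * (1 + R) ^ m"
    unfolding complex_symbol_def sum_distrib_right by (rule sum_norm_le)
qed

text \<open>Ellipticity gives \<mu>|\<xi>|^m for the principal part at the real frequency. The
  remainder, that is the perturbation of the principal part and all terms of lower order, is at most
  \<open>C0 * e\<close>, which costs half of this and a multiple of 1 + R^m. The growth R^m is the
  origin of the factor 1 + \<rho>^m in the final estimates.\<close>

lemma Re_complex_symbol_ge:
  "\<exists>\<kappa>>0. \<exists>\<omega>\<ge>0. \<forall>(\<xi> :: real ^ 'd) w R. (\<forall>k. norm (w k) \<le> R) \<longrightarrow> 0 \<le> R \<longrightarrow>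
     Re (complex_symbol (\<lambda>k. of_real (\<xi> $ k) + w k)) \<ge> \<kappa> * norm \<xi> ^ m - \<omega> * (1 + R ^ m)"
proof -
  obtain \<mu> where \<mu>: "\<mu> > 0" "\<And>\<xi> :: real ^ 'd. Re ((-1) ^ (m div 2) *
           (\<Sum>\<alpha> | length \<alpha> = m. c \<alpha> * of_real (prod_list (map (\<lambda>k. \<xi> $ k) \<alpha>)))) \<ge> \<mu> * norm \<xi> ^ m"
    using strongly_elliptic unfolding strongly_elliptic_def by blast
  define C0 where "C0 = (\<Sum>\<alpha>\<in>(multi_indices m :: 'd list set). norm (c \<alpha>))"
  have C0: "C0 \<ge> 0" by (simp add: C0_def sum_nonneg)
  \<comment> \<open>Makes \<open>C0 * \<epsilon>\<close> at most \<mu>/4. There are two kinds of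
    error, each with coefficient \<epsilon> at |\<xi>|^m, so together they use up at most
    \<mu>/2.\<close>
  define \<epsilon> where "\<epsilon> = \<mu> / (4 * (C0 + 1))"
  have \<epsilon>: "\<epsilon> > 0" using \<mu> C0 by (simp add: \<epsilon>_def)
  have C0\<epsilon>: "C0 * \<epsilon> \<le> \<mu> / 4" using \<mu> C0 by (simp add: \<epsilon>_def field_simps)
  obtain C1 where C1: "C1 \<ge> 0" "\<And>u R :: real. u \<ge> 0 \<Longrightarrow> R \<ge> 0 \<Longrightarrow> (u + R) ^ m \<le> (1 + \<epsilon>) * u ^ m + C1 * R ^ m"
    using power_add_le[OF \<epsilon>, of m] by blast
  \<comment> \<open>Compensates the factor 3^m of \<open>power_sum3_le\<close>, applied to (1 +
    |\<xi>| + R)^m.\<close>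
  define \<delta> where "\<delta> = \<epsilon> / 3 ^ m"
  define C2 where "C2 = (1 / \<delta>) ^ (m - 1)"
  have \<delta>: "\<delta> > 0" "\<delta> * 3 ^ m = \<epsilon>" using \<epsilon> by (auto simp: \<delta>_def)
  have C2: "C2 \<ge> 0" using \<delta> by (simp add: C2_def)
  have m: "Suc (m - 1) = m" using order_ge_2 by simp
  define \<omega> where "\<omega> = C0 * (C1 + \<epsilon> + C2)"
  have \<omega>: "\<omega> \<ge> 0" using C0 C1 C2 \<epsilon> by (simp add: \<omega>_def)
  have "Re (complex_symbol (\<lambda>k. of_real (\<xi> $ k) + w k)) \<ge> \<mu> / 2 * norm \<xi> ^ m - \<omega> * (1 + R ^ m)"
    if w: "\<And>k. norm (w k) \<le> R" and R: "0 \<le> R" for \<xi> :: "real ^ 'd" and w R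
  proof -
    let ?u = "norm \<xi>"
    let ?z = "\<lambda>k. of_real (\<xi> $ k) :: complex"
    let ?T = "\<lambda>\<alpha>. c \<alpha> * prod_list (map (\<lambda>k. - \<i> * (?z k + w k)) \<alpha>)"
    let ?S = "\<lambda>\<alpha>. c \<alpha> * prod_list (map (\<lambda>k. - \<i> * ?z k) \<alpha>)"
    let ?E = "\<lambda>\<alpha>. if length \<alpha> = m then ?T \<alpha> - ?S \<alpha> else ?T \<alpha>"
    define e where "e = (\<epsilon> * ?u ^ m + C1 * R ^ m) + (\<epsilon> * (1 + ?u ^ m + R ^ m) + C2)"
    have z: "norm (?z k) \<le> ?u" for k
      by (simp add: component_le_norm_cart)
    have nn: "0 \<le> \<epsilon> * ?u ^ m + C1 * R ^ m" "0 \<le> \<epsilon> * (1 + ?u ^ m + R ^ m) + C2"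
      using \<epsilon> C1 C2 R by (auto intro!: add_nonneg_nonneg mult_nonneg_nonneg)
    have E: "norm (?E \<alpha>) \<le> norm (c \<alpha>) * e" if \<alpha>: "\<alpha> \<in> multi_indices m" for \<alpha>
    proof (cases "length \<alpha> = m")
      case True
      have "norm (prod_list (map (\<lambda>k. - \<i> * ?z k + - \<i> * w k) \<alpha>) - prod_list (map (\<lambda>k. - \<i> * ?z k) \<alpha>))
          \<le> (?u + R) ^ length \<alpha> - ?u ^ length \<alpha>"
        by (rule norm_prod_list_add_diff) (use z w in \<open>simp_all add: norm_mult\<close>)
      also have "\<dots> \<le> \<epsilon> * ?u ^ m + C1 * R ^ m"
        using C1(2)[of ?u R] R True by (simp add: algebra_simps)
      also have "\<dots> \<le> e" using nn by (simp add: e_def)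
      finally have "norm (c \<alpha>) * norm (prod_list (map (\<lambda>k. - \<i> * (?z k + w k)) \<alpha>) - prod_list (map (\<lambda>k. - \<i> * ?z k) \<alpha>)) \<le> norm (c \<alpha>) * e"
        by (intro mult_left_mono) (simp_all add: distrib_left)
      then show ?thesis
        using True by (simp add: norm_mult[symmetric] right_diff_distrib)
    next
      case False
      then have l: "length \<alpha> \<le> m - 1" using \<alpha> by (simp add: multi_indices_def)
      have "norm (prod_list (map (\<lambda>k. - \<i> * (?z k + w k)) \<alpha>)) \<le> (?u + R) ^ length \<alpha>"
      proof (rule norm_prod_list_map_le)
        fix k show "norm (- \<i> * (?z k + w k)) \<le> ?u + R"
          using order_trans[OF norm_triangle_ineq add_mono[OF z w], of k k] by (simp add: norm_mult)
      qed
      also have "\<dots> \<le> (1 + ?u + R) ^ length \<alpha>" using R by (intro power_mono) auto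
      also have "\<dots> \<le> (1 + ?u + R) ^ (m - 1)" using R l by (intro power_increasing) auto
      also have "\<dots> \<le> \<delta> * (1 + ?u + R) ^ m + C2"
        using power_less_le[OF \<delta>(1), of "1 + ?u + R" "m - 1"] add_nonneg_nonneg[OF add_nonneg_nonneg[OF zero_le_one norm_ge_zero] R, of \<xi>]
        by (simp only: m C2_def simp_thms)
      also have "\<dots> \<le> \<delta> * (3 ^ m * (1 ^ m + ?u ^ m + R ^ m)) + C2"
        using R \<delta> by (intro add_right_mono mult_left_mono power_sum3_le) auto
      also have "\<dots> = \<epsilon> * (1 + ?u ^ m + R ^ m) + C2"
        by (simp add: mult.assoc[symmetric] \<delta>(2))
      also have "\<dots> \<le> e" using nn by (simp add: e_def)
      finally show ?thesis using False by (simp add: norm_mult mult_left_mono)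
    qed
    have "(\<Sum>\<alpha>\<in>multi_indices m. ?T \<alpha>) = (\<Sum>\<alpha>\<in>multi_indices m. (if length \<alpha> = m then ?S \<alpha> else 0) + ?E \<alpha>)"
      by (intro sum.cong) auto
    also have "\<dots> = (\<Sum>\<alpha>\<in>multi_indices m. if length \<alpha> = m then ?S \<alpha> else 0) + (\<Sum>\<alpha>\<in>multi_indices m. ?E \<alpha>)"
      by (rule sum.distrib)
    also have "(\<Sum>\<alpha>\<in>multi_indices m. if length \<alpha> = m then ?S \<alpha> else 0) = (\<Sum>\<alpha> | length \<alpha> = m. ?S \<alpha>)"
      by (intro sum.mono_neutral_cong_right) (auto simp: multi_indices_def intro: finite_multi_indices[unfolded multi_indices_def])
    also have "\<dots> = (-1) ^ (m div 2) * (\<Sum>\<alpha> | length \<alpha> = m. c \<alpha> * of_real (prod_list (map (\<lambda>k. \<xi> $ k) \<alpha>)))"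
      unfolding sum_distrib_left
    proof (rule sum.cong, simp)
      fix \<alpha> :: "'d list" assume "\<alpha> \<in> {\<alpha>. length \<alpha> = m}"
      moreover have "prod_list (map (\<lambda>k. - \<i> * ?z k) \<alpha>) = (- \<i>) ^ length \<alpha> * of_real (prod_list (map (\<lambda>k. \<xi> $ k) \<alpha>))"
        by (induction \<alpha>) auto
      moreover have "(- \<i>) ^ m = (-1) ^ (m div 2)"
      proof -
        have "(- \<i>) ^ (2 * (m div 2)) = (-1) ^ (m div 2)" by (subst power_mult) simp
        then show ?thesis using even_order by simp
      qed
      ultimately show "?S \<alpha> = (-1) ^ (m div 2) * (c \<alpha> * of_real (prod_list (map (\<lambda>k. \<xi> $ k) \<alpha>)))"
        by (simp only: mem_Collect_eq) (simp only: mult_ac)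
    qed
    finally have eq: "complex_symbol (\<lambda>k. ?z k + w k)
      = (-1) ^ (m div 2) * (\<Sum>\<alpha> | length \<alpha> = m. c \<alpha> * of_real (prod_list (map (\<lambda>k. \<xi> $ k) \<alpha>)))
        + (\<Sum>\<alpha>\<in>multi_indices m. ?E \<alpha>)"
      by (simp only: complex_symbol_def)
    have "norm (\<Sum>\<alpha>\<in>multi_indices m. ?E \<alpha>) \<le> C0 * e"
      unfolding C0_def sum_distrib_right by (rule sum_norm_le) (rule E)
    then have "- Re (\<Sum>\<alpha>\<in>multi_indices m. ?E \<alpha>) \<le> C0 * e"
      by (rule order_trans[OF order_trans[OF abs_ge_minus_self abs_Re_le_cmod]])
    then have "Re (complex_symbol (\<lambda>k. ?z k + w k)) \<ge> \<mu> * ?u ^ m - C0 * e"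
      unfolding eq using \<mu>(2)[of \<xi>] by simp
    moreover have "C0 * e \<le> \<mu> / 2 * ?u ^ m + \<omega> * (1 + R ^ m)"
    proof -
      have "C0 * e = 2 * (C0 * \<epsilon>) * ?u ^ m + C0 * (C1 + \<epsilon>) * R ^ m + C0 * (\<epsilon> + C2)"
        by (simp add: e_def algebra_simps)
      also have "\<dots> \<le> \<mu> / 2 * ?u ^ m + C0 * (C1 + \<epsilon> + C2) * R ^ m + C0 * (C1 + \<epsilon> + C2)"
      proof -
        have "C0 * (C1 + \<epsilon>) \<le> C0 * (C1 + \<epsilon> + C2)" "C0 * (\<epsilon> + C2) \<le> C0 * (C1 + \<epsilon> + C2)"
          using C0 C1 C2 \<epsilon> by (auto intro!: mult_left_mono)
        then show ?thesis
          using C0\<epsilon> R by (intro add_mono mult_right_mono) auto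
      qed
      finally show ?thesis by (simp add: \<omega>_def algebra_simps)
    qed
    ultimately show ?thesis by simp
  qed
  then show ?thesis using \<mu> \<omega> by (intro exI[of _ "\<mu> / 2"] exI[of _ \<omega>] conjI) auto
qed

section \<open>Fourier integrals for the Euclidean kernel and the shift of the contour\<close>

text \<open>Defined for complex frequencies, so that the contour of integration can be shifted.\<close>

definition integrand :: "'d list \<Rightarrow> real \<Rightarrow> real ^ 'd \<Rightarrow> ('d \<Rightarrow> complex) \<Rightarrow> complex"
  where "integrand \<beta> t x \<zeta> = prod_list (map (\<lambda>k. \<i> * \<zeta> k) \<beta>) *
    exp (\<i> * (\<Sum>k\<in>UNIV. of_real (x $ k) * \<zeta> k)) * exp (- of_real t * complex_symbol \<zeta>)"

text \<open>The derivative \<partial>^\<beta> of \<open>K_tilde t\<close> for t > 0. Taking the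
  Fourier integral as definition lets the contour shift treat all orders of derivatives
  alike.\<close>

definition heat_deriv :: "'d list \<Rightarrow> real \<Rightarrow> real ^ 'd \<Rightarrow> complex"
  where "heat_deriv \<beta> t x = (\<integral>\<xi>. integrand \<beta> t x (\<lambda>k. of_real (\<xi> $ k)) \<partial>lborel) / of_real ((2 * pi) ^ CARD('d))"

lemma continuous_prod_list_map:
  fixes f :: "'a \<Rightarrow> 'b::topological_space \<Rightarrow> complex"
  assumes "\<And>k. continuous_on S (f k)"
  shows "continuous_on S (\<lambda>x. prod_list (map (\<lambda>k. f k x) \<beta>))"
  by (induction \<beta>) (auto intro!: continuous_intros assms)

lemma continuous_integrand:
  fixes t :: "'b::topological_space \<Rightarrow> real"
  assumes "continuous_on S t" "continuous_on S x" "\<And>k. continuous_on S (\<lambda>p. \<zeta> p k)"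
  shows "continuous_on S (\<lambda>p. integrand \<beta> (t p) (x p) (\<zeta> p))"
  unfolding integrand_def complex_symbol_def
  by (intro continuous_intros continuous_prod_list_map assms)

lemma holomorphic_integrand:
  assumes "\<And>k. (\<lambda>z. \<zeta> z k) holomorphic_on S"
  shows "(\<lambda>z. integrand \<beta> t x (\<zeta> z)) holomorphic_on S"
proof -
  have p: "(\<lambda>z. prod_list (map (\<lambda>k. a * \<zeta> z k) \<beta>)) holomorphic_on S" for a and \<beta> :: "'d list"
    by (induction \<beta>) (auto intro!: holomorphic_intros assms)
  show ?thesis
    unfolding integrand_def complex_symbol_def by (intro holomorphic_intros assms p)
qed


text \<open>Displays gain and price of leaving the real frequencies by \<open>w\<close>: the
  exponential of -x \<bullet> Im w against the exponential of t\<omega>(1 + R^m).\<close>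

lemma norm_integrand_le:
  fixes w :: "'d \<Rightarrow> complex"
  assumes "\<And>(\<xi> :: real ^ 'd) w R. \<forall>k. norm (w k) \<le> R \<Longrightarrow> 0 \<le> R \<Longrightarrow>
      \<kappa> * norm \<xi> ^ m - \<omega> * (1 + R ^ m) \<le> Re (complex_symbol (\<lambda>k. of_real (\<xi> $ k) + w k))"
    and "t \<ge> 0" and w: "\<forall>k. norm (w k) \<le> R" and "0 \<le> R"
  shows "norm (integrand \<beta> t x (\<lambda>k. of_real (\<xi> $ k) + w k)) \<le> (norm \<xi> + R) ^ length \<beta> *
    exp (- (\<Sum>k\<in>UNIV. x $ k * Im (w k))) * (exp (- t * \<kappa> * norm \<xi> ^ m) * exp (t * (\<omega> * (1 + R ^ m))))"
proof -
  let ?\<zeta> = "\<lambda>k. of_real (\<xi> $ k) + w k"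
  have "norm (prod_list (map (\<lambda>k. \<i> * ?\<zeta> k) \<beta>)) \<le> (norm \<xi> + R) ^ length \<beta>"
  proof (rule norm_prod_list_map_le)
    fix k
    have "norm (of_real (\<xi> $ k) :: complex) \<le> norm \<xi>" by (simp add: component_le_norm_cart)
    then have "norm (?\<zeta> k) \<le> norm \<xi> + R"
      using w by (intro order_trans[OF norm_triangle_ineq add_mono]) auto
    then show "norm (\<i> * ?\<zeta> k) \<le> norm \<xi> + R" by (simp add: norm_mult)
  qed
  moreover have "norm (exp (\<i> * (\<Sum>k\<in>UNIV. of_real (x $ k) * ?\<zeta> k))) = exp (- (\<Sum>k\<in>UNIV. x $ k * Im (w k)))"
    by (simp add: norm_exp_eq_Re)
  moreover have "norm (exp (- of_real t * complex_symbol ?\<zeta>)) \<le> exp (- t * \<kappa> * norm \<xi> ^ m) * exp (t * (\<omega> * (1 + R ^ m)))"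
  proof -
    have "t * (\<kappa> * norm \<xi> ^ m - \<omega> * (1 + R ^ m)) \<le> t * Re (complex_symbol ?\<zeta>)"
      using assms by (intro mult_left_mono) auto
    then show ?thesis by (simp add: norm_exp_eq_Re algebra_simps flip: exp_add)
  qed
  ultimately show ?thesis
    unfolding integrand_def norm_mult
    using \<open>0 \<le> R\<close> by (intro mult_mono) auto
qed

lemma measurable_integrand_real [measurable]:
  "(\<lambda>\<xi> :: real ^ 'd. integrand \<beta> t x (\<lambda>k. of_real (\<xi> $ k) + w k)) \<in> borel_measurable borel"
  by (intro borel_measurable_continuous_onI continuous_integrand continuous_intros)

text \<open>This replaces a contour argument in several variables. The integral is an entire
  function of the single variable z; at real z it is constant by translation invariance of Lebesgue
  measure, and the identity theorem extends this to every z. It is applied with z = \<i>.\<close>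

lemma heat_deriv_shift:
  assumes "t > 0"
  shows "(\<integral>\<xi>. integrand \<beta> t x (\<lambda>k. of_real (\<xi> $ k) + z * of_real (\<eta> $ k)) \<partial>lborel)
    = (\<integral>\<xi>. integrand \<beta> t x (\<lambda>k. of_real (\<xi> $ k)) \<partial>lborel)"
proof -
  obtain \<kappa> \<omega> where \<kappa>: "\<kappa> > 0" "\<omega> \<ge> 0" and ell: "\<And>(\<xi> :: real ^ 'd) w R. \<forall>k. norm (w k) \<le> R \<Longrightarrow> 0 \<le> R \<Longrightarrow>
      \<kappa> * norm \<xi> ^ m - \<omega> * (1 + R ^ m) \<le> Re (complex_symbol (\<lambda>k. of_real (\<xi> $ k) + w k))"
    using Re_complex_symbol_ge by blast
  let ?f = "\<lambda>z \<xi>. integrand \<beta> t x (\<lambda>k. of_real (\<xi> $ k) + z * of_real (\<eta> $ k))"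
  define \<Phi> where "\<Phi> z = (\<integral>\<xi>. ?f z \<xi> \<partial>lborel)" for z
  have hol: "\<Phi> holomorphic_on UNIV"
    unfolding \<Phi>_def
  proof (rule holomorphic_integral)
    show "(\<lambda>z. ?f z \<xi>) holomorphic_on UNIV" for \<xi>
      by (intro holomorphic_integrand holomorphic_intros)
    show "?f z \<in> borel_measurable lborel" for z by measurable
    fix R0 :: real
    define R where "R = \<bar>R0\<bar> * norm \<eta>"
    have R: "R \<ge> 0" by (simp add: R_def)
    let ?E = "exp (norm x * R * real CARD('d)) * exp (t * (\<omega> * (1 + R ^ m)))"
    let ?w = "\<lambda>\<xi> :: real ^ 'd. (norm \<xi> + R) ^ length \<beta> * (?E * exp (- t * \<kappa> * norm \<xi> ^ m))"
    have "integrable lborel ?w"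
    proof (rule integrable_power_exp_bound[where s = "t * \<kappa>" and m = m and N = "length \<beta>" and C = "(1 + R) ^ length \<beta> * ?E"])
      fix \<xi> :: "real ^ 'd"
      have "(norm \<xi> + R) ^ length \<beta> \<le> ((1 + R) * (1 + norm \<xi>)) ^ length \<beta>"
        using R by (intro power_mono) (auto simp: algebra_simps)
      then have "(norm \<xi> + R) ^ length \<beta> * (?E * exp (- t * \<kappa> * norm \<xi> ^ m))
         \<le> ((1 + R) * (1 + norm \<xi>)) ^ length \<beta> * (?E * exp (- t * \<kappa> * norm \<xi> ^ m))"
        by (intro mult_right_mono) auto
      then show "norm (?w \<xi>) \<le> (1 + R) ^ length \<beta> * ?E * (1 + norm \<xi>) ^ length \<beta> * exp (- (t * \<kappa>) * norm \<xi> ^ m)"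
        using R by (simp add: power_mult_distrib mult_ac)
    qed (use assms \<kappa> order_ge_2 in auto)
    moreover have "norm (?f z \<xi>) \<le> ?w \<xi>" if "norm z \<le> R0" for z \<xi>
    proof -
      let ?w' = "\<lambda>k. z * of_real (\<eta> $ k)"
      have w': "\<forall>k. norm (?w' k) \<le> R"
        unfolding norm_mult R_def using that by (auto intro!: mult_mono simp: component_le_norm_cart)
      have "- (\<Sum>k\<in>UNIV. x $ k * Im (?w' k)) \<le> (\<Sum>k\<in>(UNIV :: 'd set). norm x * R)"
        unfolding sum_negf[symmetric]
      proof (rule sum_mono)
        fix k
        have "- (x $ k * Im (?w' k)) \<le> \<bar>x $ k\<bar> * \<bar>Im (?w' k)\<bar>"
          by (metis abs_ge_minus_self abs_mult)
        also have "\<dots> \<le> norm x * R"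
          using w' by (intro mult_mono component_le_norm_cart order_trans[OF abs_Im_le_cmod]) auto
        finally show "- (x $ k * Im (?w' k)) \<le> norm x * R" .
      qed
      then have e: "exp (- (\<Sum>k\<in>UNIV. x $ k * Im (?w' k))) \<le> exp (norm x * R * real CARD('d))"
        by (simp add: mult_ac)
      have "norm (?f z \<xi>) \<le> (norm \<xi> + R) ^ length \<beta> * exp (- (\<Sum>k\<in>UNIV. x $ k * Im (?w' k))) *
          (exp (- t * \<kappa> * norm \<xi> ^ m) * exp (t * (\<omega> * (1 + R ^ m))))"
        using norm_integrand_le[OF ell _ w' R, of t] assms by simp
      also have "\<dots> \<le> (norm \<xi> + R) ^ length \<beta> * exp (norm x * R * real CARD('d)) *
          (exp (- t * \<kappa> * norm \<xi> ^ m) * exp (t * (\<omega> * (1 + R ^ m))))"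
        using R by (intro mult_right_mono mult_left_mono e) auto
      finally show ?thesis by (simp add: mult_ac)
    qed
    ultimately show "\<exists>w. integrable lborel w \<and> (\<forall>z \<xi>. norm z \<le> R0 \<longrightarrow> norm (?f z \<xi>) \<le> w \<xi>)"
      by blast
  qed
  have real: "\<Phi> (of_real s) = \<Phi> 0" for s
  proof -
    have "\<Phi> (of_real s) = (\<integral>\<xi>. ?f 0 (s *\<^sub>R \<eta> + \<xi>) \<partial>lborel)"
      unfolding \<Phi>_def by (intro Bochner_Integration.integral_cong) (auto simp: add.commute)
    also have "\<dots> = \<Phi> 0"
      unfolding \<Phi>_def by (rule integral_lborel_translate) measurable
    finally show ?thesis .
  qed
  have "\<Phi> z - \<Phi> 0 = 0"
  proof (rule analytic_continuation[where f = "\<lambda>z. \<Phi> z - \<Phi> 0" and S = UNIV and U = "range of_real" and \<xi> = 0])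
    show "(\<lambda>z. \<Phi> z - \<Phi> 0) holomorphic_on UNIV" by (intro holomorphic_intros hol)
    show "0 islimpt range complex_of_real"
      unfolding islimpt_approachable
    proof (intro allI impI)
      fix e :: real assume "e > 0"
      then show "\<exists>x'\<in>range complex_of_real. x' \<noteq> 0 \<and> dist x' 0 < e"
        by (intro bexI[of _ "of_real (e / 2)"] rangeI) (auto simp: dist_norm)
    qed
    show "\<Phi> z - \<Phi> 0 = 0" if "z \<in> range complex_of_real" for z using real that by auto
  qed auto
  then show ?thesis by (simp add: \<Phi>_def)
qed

text \<open>Shift the frequency by i\<tau>x/|x|. One half of the decay e^(-\<kappa>t|\<xi>|^m)
  absorbs the polynomial factor, leaving t^(-|\<beta>|/m) and e^(t\<tau>^m), which raises \<omega>
  by 1; the other half, integrated after the scaling of \<xi> by t^(1/m), gives t^(-d/m). The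
  parameter \<tau> remains free.\<close>

lemma heat_deriv_bound:
  "\<exists>A>0. \<exists>\<omega>\<ge>0. \<forall>\<beta>\<in>multi_indices m. \<forall>t>0. \<forall>x. \<forall>\<tau>\<ge>0.
     norm (heat_deriv \<beta> t x) \<le> A / (t powr (1 / m)) ^ (CARD('d) + length \<beta>) * exp (\<omega> * (1 + \<tau> ^ m) * t) * exp (- \<tau> * norm x)"
proof -
  obtain \<kappa> \<omega> where \<kappa>: "\<kappa> > 0" "\<omega> \<ge> 0" and ell: "\<And>(\<xi> :: real ^ 'd) w R. \<forall>k. norm (w k) \<le> R \<Longrightarrow> 0 \<le> R \<Longrightarrow>
      \<kappa> * norm \<xi> ^ m - \<omega> * (1 + R ^ m) \<le> Re (complex_symbol (\<lambda>k. of_real (\<xi> $ k) + w k))"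
    using Re_complex_symbol_ge by blast
  define g where "g \<xi> = exp (- (\<kappa> / 2) * norm \<xi> ^ m)" for \<xi> :: "real ^ 'd"
  define I where "I = (\<integral>\<xi>. g \<xi> \<partial>lborel)"
  define A where "A = 3 ^ m * (1 + 1 / (\<kappa> / 2))"
  have A: "A > 0" using \<kappa> by (simp add: A_def add_pos_nonneg)
  have g_meas [measurable]: "g \<in> borel_measurable borel"
    unfolding g_def by measurable
  have g_int: "integrable lborel g"
    by (rule integrable_power_exp_bound[where s = "\<kappa> / 2" and m = m and N = 0 and C = 1])
      (use \<kappa> order_ge_2 in \<open>auto simp: g_def\<close>)
  have I: "I \<ge> 0" by (simp add: I_def g_def)
  have main: "norm (heat_deriv \<beta> t x) \<le> (A * (I + 1)) / (t powr (1 / m)) ^ (CARD('d) + length \<beta>) * exp ((\<omega> + 1) * (1 + \<tau> ^ m) * t) * exp (- \<tau> * norm x)"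
    if \<beta>: "\<beta> \<in> multi_indices m" and t: "t > 0" and \<tau>: "\<tau> \<ge> 0" for \<beta> t x \<tau>
  proof -
    define T where "T = t powr (1 / m)"
    have T: "T > 0" using t by (simp add: T_def)
    have Tm: "T ^ m = t" using t order_ge_2 by (simp add: T_def powr_power)
    define n where "n = length \<beta>"
    have n: "n \<le> m" using \<beta> by (simp add: n_def multi_indices_def)
    \<comment> \<open>At x = 0 division by zero makes this 0, which satisfies both properties used:
      norm at most \<tau> and inner product \<tau>|x| with x.\<close>
    define \<eta> where "\<eta> = (\<tau> / norm x) *\<^sub>R x"
    have \<eta>: "norm \<eta> \<le> \<tau>" using \<tau> by (simp add: \<eta>_def)
    have x\<eta>: "(\<Sum>k\<in>UNIV. x $ k * \<eta> $ k) = \<tau> * norm x"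
    proof -
      have "(\<Sum>k\<in>UNIV. x $ k * \<eta> $ k) = x \<bullet> \<eta>" by (simp add: inner_vec_def)
      also have "\<dots> = \<tau> * norm x" by (simp add: \<eta>_def power2_norm_eq_inner[symmetric] power2_eq_square)
      finally show ?thesis .
    qed
    let ?w = "\<lambda>k. \<i> * of_real (\<eta> $ k)"
    let ?B = "A / T ^ n * exp ((\<omega> + 1) * (1 + \<tau> ^ m) * t) * exp (- \<tau> * norm x)"
    have w: "\<forall>k. norm (?w k) \<le> \<tau>"
      using \<eta> by (auto simp: norm_mult intro: order_trans[OF component_le_norm_cart])
    have le: "norm (integrand \<beta> t x (\<lambda>k. of_real (\<xi> $ k) + ?w k)) \<le> ?B * g (T *\<^sub>R \<xi>)" for \<xi>
    proof -
      let ?u = "norm \<xi>"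
      have "(T * ?u + T * \<tau>) ^ n \<le> A * exp (\<kappa> / 2 * (T * ?u) ^ m) * exp ((T * \<tau>) ^ m)"
        unfolding A_def by (rule one_add_power_exp_bound) (use T \<tau> \<kappa> n in auto)
      moreover have "(T * ?u + T * \<tau>) ^ n = T ^ n * (?u + \<tau>) ^ n"
        by (simp flip: distrib_left power_mult_distrib)
      ultimately have 1: "(?u + \<tau>) ^ n \<le> A / T ^ n * exp (\<kappa> / 2 * (t * ?u ^ m)) * exp (t * \<tau> ^ m)"
        using T by (simp add: power_mult_distrib Tm field_simps)
      have "norm (integrand \<beta> t x (\<lambda>k. of_real (\<xi> $ k) + ?w k)) \<le> (?u + \<tau>) ^ n * exp (- \<tau> * norm x) *
          (exp (- t * \<kappa> * ?u ^ m) * exp (t * (\<omega> * (1 + \<tau> ^ m))))"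
        using norm_integrand_le[OF ell _ w \<tau>, of t \<beta> x \<xi>] t by (simp add: x\<eta> n_def)
      also have "\<dots> \<le> (A / T ^ n * exp (\<kappa> / 2 * (t * ?u ^ m)) * exp (t * \<tau> ^ m)) * exp (- \<tau> * norm x) *
          (exp (- t * \<kappa> * ?u ^ m) * exp (t * (\<omega> * (1 + \<tau> ^ m))))"
        by (intro mult_right_mono 1) auto
      also have "\<dots> = A / T ^ n * exp (- \<tau> * norm x) * ((exp (\<kappa> / 2 * (t * ?u ^ m)) * exp (- t * \<kappa> * ?u ^ m)) * (exp (t * \<tau> ^ m) * exp (t * (\<omega> * (1 + \<tau> ^ m)))))"
        by (simp only: mult_ac)
      also have "exp (\<kappa> / 2 * (t * ?u ^ m)) * exp (- t * \<kappa> * ?u ^ m) = g (T *\<^sub>R \<xi>)"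
        using T by (simp add: g_def power_mult_distrib Tm algebra_simps flip: exp_add)
      also have "A / T ^ n * exp (- \<tau> * norm x) * (g (T *\<^sub>R \<xi>) * (exp (t * \<tau> ^ m) * exp (t * (\<omega> * (1 + \<tau> ^ m)))))
         \<le> A / T ^ n * exp (- \<tau> * norm x) * (g (T *\<^sub>R \<xi>) * exp ((\<omega> + 1) * (1 + \<tau> ^ m) * t))"
        using A T t by (intro mult_left_mono) (auto simp: g_def algebra_simps simp flip: exp_add)
      finally show ?thesis by (simp only: mult_ac)
    qed
    have gT: "integrable lborel (\<lambda>\<xi>. g (T *\<^sub>R \<xi>))"
      by (rule integrable_power_exp_bound[where s = "\<kappa> / 2 * t" and m = m and N = 0 and C = 1])
        (use \<kappa> order_ge_2 t T in \<open>auto simp: g_def power_mult_distrib Tm mult_ac\<close>)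
    have "norm (\<integral>\<xi>. integrand \<beta> t x (\<lambda>k. of_real (\<xi> $ k) + ?w k) \<partial>lborel) \<le> (\<integral>\<xi>. ?B * g (T *\<^sub>R \<xi>) \<partial>lborel)"
    proof (rule order_trans[OF integral_norm_bound Bochner_Integration.integral_mono])
      show "integrable lborel (\<lambda>\<xi>. norm (integrand \<beta> t x (\<lambda>k. of_real (\<xi> $ k) + ?w k)))"
        by (rule Bochner_Integration.integrable_bound[OF integrable_mult_right[OF gT, of ?B]])
          (simp, rule AE_I2, simp only: real_norm_def abs_norm_cancel, rule order_trans[OF le abs_ge_self])
    qed (use gT le in auto)
    also have "\<dots> = ?B * (I / T ^ CARD('d))"
      using integral_lborel_scale[OF g_meas T] by (simp add: g_def I_def)
    finally have "norm (\<integral>\<xi>. integrand \<beta> t x (\<lambda>k. of_real (\<xi> $ k)) \<partial>lborel) \<le> ?B * (I / T ^ CARD('d))"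
      by (simp only: heat_deriv_shift[OF t])
    moreover have "norm (heat_deriv \<beta> t x) \<le> norm (\<integral>\<xi>. integrand \<beta> t x (\<lambda>k. of_real (\<xi> $ k)) \<partial>lborel)"
    proof -
      have "(1::real) \<le> (2 * pi) ^ CARD('d)" using pi_ge_two by (intro one_le_power) auto
      then have "norm (\<integral>\<xi>. integrand \<beta> t x (\<lambda>k. of_real (\<xi> $ k)) \<partial>lborel) / (2 * pi) ^ CARD('d)
         \<le> norm (\<integral>\<xi>. integrand \<beta> t x (\<lambda>k. of_real (\<xi> $ k)) \<partial>lborel) / 1"
        by (intro divide_left_mono) auto
      then show ?thesis
        unfolding heat_deriv_def norm_divide norm_of_real by simp
    qed
    moreover have "?B * (I / T ^ CARD('d)) \<le> ?B * ((I + 1) / T ^ CARD('d))"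
      using A T by (intro mult_left_mono divide_right_mono) auto
    ultimately show ?thesis
      by (simp add: T_def[symmetric] n_def[symmetric] power_add mult_ac)
  qed
  show ?thesis
    using A I \<kappa> main by (intro exI[of _ "A * (I + 1)"] exI[of _ "\<omega> + 1"] conjI ballI allI impI) auto
qed


text \<open>Uniformity for t in a whole interval provides the majorant for differentiation under the
  integral in t.\<close>

lemma integrand_real_bound:
  assumes "s > 0"
  shows "\<exists>C\<ge>0. \<exists>b>0. \<forall>t\<in>{s..2 * s}. \<forall>x \<xi>.
    norm (integrand \<beta> t x (\<lambda>k. of_real (\<xi> $ k))) \<le> C * (1 + norm \<xi>) ^ length \<beta> * exp (- b * norm \<xi> ^ m)"
proof -
  obtain \<kappa> \<omega> where \<kappa>: "\<kappa> > 0" "\<omega> \<ge> 0" and ell: "\<And>(\<xi> :: real ^ 'd) w R. \<forall>k. norm (w k) \<le> R \<Longrightarrow> 0 \<le> R \<Longrightarrow>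
      \<kappa> * norm \<xi> ^ m - \<omega> * (1 + R ^ m) \<le> Re (complex_symbol (\<lambda>k. of_real (\<xi> $ k) + w k))"
    using Re_complex_symbol_ge by blast
  have m0: "m \<noteq> 0" using order_ge_2 by simp
  have "norm (integrand \<beta> t x (\<lambda>k. of_real (\<xi> $ k))) \<le> exp (2 * s * \<omega>) * (1 + norm \<xi>) ^ length \<beta> * exp (- (s * \<kappa>) * norm \<xi> ^ m)"
    if t: "t \<in> {s..2 * s}" for t x \<xi>
  proof -
    have t': "0 \<le> t" using t assms by auto
    have "norm (integrand \<beta> t x (\<lambda>k. of_real (\<xi> $ k))) \<le> norm \<xi> ^ length \<beta> *
          (exp (- t * \<kappa> * norm \<xi> ^ m) * exp (t * \<omega>))"
      using norm_integrand_le[OF ell t', of "\<lambda>k. 0" 0 \<beta> x \<xi>] m0 by (simp add: power_0_left)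
    also have "\<dots> \<le> (1 + norm \<xi>) ^ length \<beta> * (exp (- (s * \<kappa>) * norm \<xi> ^ m) * exp (2 * s * \<omega>))"
    proof (intro mult_mono power_mono)
      have "s * \<kappa> * norm \<xi> ^ m \<le> t * \<kappa> * norm \<xi> ^ m"
        using t \<kappa> by (intro mult_right_mono) auto
      then show "exp (- t * \<kappa> * norm \<xi> ^ m) \<le> exp (- (s * \<kappa>) * norm \<xi> ^ m)" by simp
      show "exp (t * \<omega>) \<le> exp (2 * s * \<omega>)"
        using t \<kappa> by (auto intro!: mult_right_mono)
    qed auto
    finally show ?thesis by (simp add: mult_ac)
  qed
  moreover have "0 \<le> exp (2 * s * \<omega>)" "0 < s * \<kappa>" using assms \<kappa> by auto
  ultimately show ?thesis by blast
qed

lemma measurable_integrand_real' [measurable]: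
  "(\<lambda>\<xi> :: real ^ 'd. integrand \<beta> t x (\<lambda>k. of_real (\<xi> $ k))) \<in> borel_measurable borel"
  using measurable_integrand_real[of \<beta> t x "\<lambda>k. 0"] by simp

lemma integrable_integrand:
  assumes "t > 0"
  shows "integrable lborel (\<lambda>\<xi>. integrand \<beta> t x (\<lambda>k. of_real (\<xi> $ k)))"
proof -
  obtain C b where b: "b > 0" and le: "\<forall>t\<in>{t..2 * t}. \<forall>x \<xi>.
    norm (integrand \<beta> t x (\<lambda>k. of_real (\<xi> $ k))) \<le> C * (1 + norm \<xi>) ^ length \<beta> * exp (- b * norm \<xi> ^ m)"
    using integrand_real_bound[OF assms, of \<beta>] by blast
  show ?thesis
    by (rule integrable_power_exp_bound[where s = b and m = m and C = C and N = "length \<beta>"]) (use b le assms order_ge_2 in auto)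
qed

lemma heat_deriv_has_derivative:
  assumes "t > 0"
  shows "(heat_deriv \<beta> t has_derivative (\<lambda>v. \<Sum>k\<in>UNIV. of_real (v $ k) * heat_deriv (k # \<beta>) t x)) (at x)"
proof -
  let ?F = "\<lambda>\<beta> x \<xi>. integrand \<beta> t x (\<lambda>k. of_real (\<xi> $ k))"
  obtain C b where C: "C \<ge> 0" and b: "b > 0" and le: "\<forall>t\<in>{t..2 * t}. \<forall>x \<xi>.
    norm (integrand \<beta> t x (\<lambda>k. of_real (\<xi> $ k))) \<le> C * (1 + norm \<xi>) ^ length \<beta> * exp (- b * norm \<xi> ^ m)"
    using integrand_real_bound[OF assms, of \<beta>] by blast
  let ?w = "\<lambda>\<xi> :: real ^ 'd. norm \<xi> * (C * (1 + norm \<xi>) ^ length \<beta> * exp (- b * norm \<xi> ^ m))"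
  have "((\<lambda>x. \<integral>\<xi>. ?F \<beta> x \<xi> \<partial>lborel) has_derivative (\<lambda>v. \<integral>\<xi>. \<i> * of_real (v \<bullet> \<xi>) * ?F \<beta> x \<xi> \<partial>lborel)) (at x)"
  proof (rule has_derivative_integral[where e = 1 and w = ?w and f' = "\<lambda>x \<xi> v. \<i> * of_real (v \<bullet> \<xi>) * ?F \<beta> x \<xi>"])
    show "integrable lborel ?w"
      by (rule integrable_power_exp_bound[where s = b and m = m and C = C and N = "Suc (length \<beta>)"])
        (use b C order_ge_2 in \<open>auto simp: mult_ac intro!: mult_left_mono mult_right_mono\<close>)
    show "((\<lambda>x. ?F \<beta> x \<xi>) has_derivative (\<lambda>v. \<i> * of_real (v \<bullet> \<xi>) * ?F \<beta> x \<xi>)) (at x)" for x \<xi>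
    proof -
      have e: "(\<Sum>k\<in>UNIV. complex_of_real (y $ k) * of_real (\<xi> $ k)) = of_real (y \<bullet> \<xi>)" for y
        by (simp add: inner_vec_def)
      have "((\<lambda>x. exp (\<i> * of_real (x \<bullet> \<xi>))) has_derivative (\<lambda>v. exp (\<i> * of_real (x \<bullet> \<xi>)) * (\<i> * of_real (v \<bullet> \<xi>)))) (at x)"
        by (rule has_derivative_exp_complex) (auto intro!: derivative_eq_intros)
      then show ?thesis
        unfolding integrand_def e
        by (auto intro!: derivative_eq_intros simp: fun_eq_iff mult_ac)
    qed
    show "norm (\<i> * of_real (v \<bullet> \<xi>) * ?F \<beta> x \<xi>) \<le> ?w \<xi> * norm v" for x \<xi> v
    proof -
      have "\<bar>v \<bullet> \<xi>\<bar> * norm (?F \<beta> x \<xi>) \<le> (norm v * norm \<xi>) * (C * (1 + norm \<xi>) ^ length \<beta> * exp (- b * norm \<xi> ^ m))"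
        using le assms by (intro mult_mono Cauchy_Schwarz_ineq2) auto
      then show ?thesis by (simp add: norm_mult mult_ac)
    qed
  qed (use assms integrable_integrand in auto)
  moreover have "(\<integral>\<xi>. \<i> * of_real (v \<bullet> \<xi>) * ?F \<beta> x \<xi> \<partial>lborel) = (\<Sum>k\<in>UNIV. of_real (v $ k) * (\<integral>\<xi>. ?F (k # \<beta>) x \<xi> \<partial>lborel))" for v
  proof -
    have "(\<integral>\<xi>. \<i> * of_real (v \<bullet> \<xi>) * ?F \<beta> x \<xi> \<partial>lborel) = (\<integral>\<xi>. (\<Sum>k\<in>UNIV. of_real (v $ k) * ?F (k # \<beta>) x \<xi>) \<partial>lborel)"
      by (intro Bochner_Integration.integral_cong)
        (auto simp: integrand_def inner_vec_def sum_distrib_left sum_distrib_right mult_ac)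
    also have "\<dots> = (\<Sum>k\<in>UNIV. of_real (v $ k) * (\<integral>\<xi>. ?F (k # \<beta>) x \<xi> \<partial>lborel))"
      using integrable_integrand[OF assms] by simp
    finally show ?thesis .
  qed
  ultimately have "((\<lambda>x. \<integral>\<xi>. ?F \<beta> x \<xi> \<partial>lborel) has_derivative
      (\<lambda>v. \<Sum>k\<in>UNIV. of_real (v $ k) * (\<integral>\<xi>. ?F (k # \<beta>) x \<xi> \<partial>lborel))) (at x)"
    by simp
  then have "((\<lambda>x. (\<integral>\<xi>. ?F \<beta> x \<xi> \<partial>lborel) / of_real ((2 * pi) ^ CARD('d))) has_derivative
      (\<lambda>v. (\<Sum>k\<in>UNIV. of_real (v $ k) * (\<integral>\<xi>. ?F (k # \<beta>) x \<xi> \<partial>lborel)) / of_real ((2 * pi) ^ CARD('d)))) (at x)"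
    by (rule bounded_linear.has_derivative[OF bounded_linear_divide])
  then show ?thesis
    unfolding heat_deriv_def[abs_def] by (simp add: sum_divide_distrib)
qed

text \<open>The symbol is written in powers of -i\<zeta>, whereas derivatives of the kernel bring
  down i\<zeta>; the sign (-1)^|\<alpha>| mediates.\<close>

lemma complex_symbol_real:
  "complex_symbol \<zeta> = (\<Sum>\<alpha>\<in>multi_indices m. c \<alpha> * (-1) ^ length \<alpha> * prod_list (map (\<lambda>k. \<i> * \<zeta> k) \<alpha>))"
proof -
  have "prod_list (map (\<lambda>k. - \<i> * \<zeta> k) \<alpha>) = (-1) ^ length \<alpha> * prod_list (map (\<lambda>k. \<i> * \<zeta> k) \<alpha>)" for \<alpha>
    by (induction \<alpha>) auto
  then show ?thesis by (simp add: complex_symbol_def mult.assoc)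
qed

text \<open>The heat equation with the constant coefficients frozen at e, where A_j is
  -\<partial>_j. It supplies the terms that cancel the leading part of H applied to
  \<open>K0\<close>.\<close>

lemma heat_deriv_time_derivative:
  assumes "t > 0"
  shows "((\<lambda>t. heat_deriv [] t x) has_vector_derivative
     (- (\<Sum>\<alpha>\<in>multi_indices m. c \<alpha> * (-1) ^ length \<alpha> * heat_deriv \<alpha> t x))) (at t)"
proof -
  let ?z = "\<lambda>\<xi> :: real ^ 'd. \<lambda>k. complex_of_real (\<xi> $ k)"
  let ?F = "\<lambda>\<beta> t \<xi>. integrand \<beta> t x (?z \<xi>)"
  \<comment> \<open>Puts t in the middle of the interval from s to 2s, so that the ball of radius
    t/3 around t lies in it.\<close>
  define s where "s = 2 * t / 3"
  have s: "s > 0" using assms by (simp add: s_def)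
  obtain C b where C: "C \<ge> 0" and b: "b > 0" and le: "\<forall>t\<in>{s..2 * s}. \<forall>x \<xi>.
    norm (integrand [] t x (?z \<xi>)) \<le> C * (1 + norm \<xi>) ^ length ([] :: 'd list) * exp (- b * norm \<xi> ^ m)"
    using integrand_real_bound[OF s, of "[]"] by blast
  obtain C' where C': "C' \<ge> 0" "\<And>\<zeta> R. \<forall>k. norm (\<zeta> k) \<le> R \<Longrightarrow> 0 \<le> R \<Longrightarrow> norm (complex_symbol \<zeta>) \<le> C' * (1 + R) ^ m"
    using norm_complex_symbol_le by blast
  let ?w = "\<lambda>\<xi> :: real ^ 'd. (C' * (1 + norm \<xi>) ^ m) * (C * exp (- b * norm \<xi> ^ m))"
  have near: "t' \<in> {s..2 * s}" "t' > 0" if "t' \<in> ball t (t / 3)" for t'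
    using that assms by (auto simp: s_def dist_real_def abs_if split: if_splits)
  have meas: "(\<lambda>\<xi> :: real ^ 'd. complex_symbol (?z \<xi>)) \<in> borel_measurable borel"
    unfolding complex_symbol_def
    by (intro borel_measurable_continuous_onI continuous_intros continuous_prod_list_map)
  have "((\<lambda>t. \<integral>\<xi>. ?F [] t \<xi> \<partial>lborel) has_derivative (\<lambda>v. \<integral>\<xi>. of_real v * (- complex_symbol (?z \<xi>) * ?F [] t \<xi>) \<partial>lborel)) (at t)"
  proof (rule has_derivative_integral[where e = "t / 3" and w = ?w and f' = "\<lambda>t \<xi> v. of_real v * (- complex_symbol (?z \<xi>) * ?F [] t \<xi>)"])
    show "integrable lborel ?w"
      by (rule integrable_power_exp_bound[where s = b and m = m and C = "C' * C" and N = m])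
        (use b C C' order_ge_2 in \<open>auto simp: mult_ac\<close>)
    show "((\<lambda>t. ?F [] t \<xi>) has_derivative (\<lambda>v. of_real v * (- complex_symbol (?z \<xi>) * ?F [] t' \<xi>))) (at t')" for t' \<xi>
    proof -
      have "((\<lambda>t. exp (- of_real t * complex_symbol (?z \<xi>))) has_derivative
          (\<lambda>v. exp (- of_real t' * complex_symbol (?z \<xi>)) * (- of_real v * complex_symbol (?z \<xi>)))) (at t')"
        by (rule has_derivative_exp_complex) (auto intro!: derivative_eq_intros)
      then show ?thesis
        unfolding integrand_def by (auto intro!: derivative_eq_intros simp: fun_eq_iff mult_ac)
    qed
    show "norm (of_real v * (- complex_symbol (?z \<xi>) * ?F [] t' \<xi>)) \<le> ?w \<xi> * norm v"
      if "t' \<in> ball t (t / 3)" for t' \<xi> v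
    proof -
      have "norm (complex_symbol (?z \<xi>)) \<le> C' * (1 + norm \<xi>) ^ m"
        by (rule C'(2)) (simp_all add: component_le_norm_cart)
      moreover have "norm (?F [] t' \<xi>) \<le> C * exp (- b * norm \<xi> ^ m)"
        using le near[OF that] by simp
      ultimately have "norm (complex_symbol (?z \<xi>)) * norm (?F [] t' \<xi>) \<le> ?w \<xi>"
        using C' by (intro mult_mono) auto
      then have "\<bar>v\<bar> * (norm (complex_symbol (?z \<xi>)) * norm (?F [] t' \<xi>)) \<le> \<bar>v\<bar> * ?w \<xi>"
        by (rule mult_left_mono) simp
      then show ?thesis by (simp add: norm_mult mult_ac)
    qed
    show "(\<lambda>\<xi>. of_real v * (- complex_symbol (?z \<xi>) * ?F [] t \<xi>)) \<in> borel_measurable lborel" for v :: real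
      using meas by measurable
  qed (use assms integrable_integrand near in auto)
  moreover have "(\<integral>\<xi>. of_real v * (- complex_symbol (?z \<xi>) * ?F [] t \<xi>) \<partial>lborel)
      = of_real v * - (\<Sum>\<alpha>\<in>multi_indices m. c \<alpha> * (-1) ^ length \<alpha> * (\<integral>\<xi>. ?F \<alpha> t \<xi> \<partial>lborel))" for v
  proof -
    have "(\<integral>\<xi>. of_real v * (- complex_symbol (?z \<xi>) * ?F [] t \<xi>) \<partial>lborel)
       = of_real v * - (\<integral>\<xi>. complex_symbol (?z \<xi>) * ?F [] t \<xi> \<partial>lborel)"
      by simp
    also have "(\<integral>\<xi>. complex_symbol (?z \<xi>) * ?F [] t \<xi> \<partial>lborel)
       = (\<integral>\<xi>. (\<Sum>\<alpha>\<in>multi_indices m. c \<alpha> * (-1) ^ length \<alpha> * ?F \<alpha> t \<xi>) \<partial>lborel)"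
    proof (intro Bochner_Integration.integral_cong refl)
      fix \<xi> :: "real ^ 'd"
      have F: "prod_list (map (\<lambda>k. \<i> * ?z \<xi> k) \<alpha>) * ?F [] t \<xi> = ?F \<alpha> t \<xi>" for \<alpha>
        by (simp add: integrand_def)
      show "complex_symbol (?z \<xi>) * ?F [] t \<xi> = (\<Sum>\<alpha>\<in>multi_indices m. c \<alpha> * (-1) ^ length \<alpha> * ?F \<alpha> t \<xi>)"
        by (subst complex_symbol_real) (simp only: F sum_distrib_right mult.assoc)
    qed
    also have "\<dots> = (\<Sum>\<alpha>\<in>multi_indices m. c \<alpha> * (-1) ^ length \<alpha> * (\<integral>\<xi>. ?F \<alpha> t \<xi> \<partial>lborel))"
      using integrable_integrand[OF assms] by simp
    finally show ?thesis .
  qed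
  ultimately have "((\<lambda>t. \<integral>\<xi>. ?F [] t \<xi> \<partial>lborel) has_derivative
      (\<lambda>v. of_real v * - (\<Sum>\<alpha>\<in>multi_indices m. c \<alpha> * (-1) ^ length \<alpha> * (\<integral>\<xi>. ?F \<alpha> t \<xi> \<partial>lborel)))) (at t)"
    by (simp only:)
  then have "((\<lambda>t. (\<integral>\<xi>. ?F [] t \<xi> \<partial>lborel) / of_real ((2 * pi) ^ CARD('d))) has_derivative
      (\<lambda>v. (of_real v * - (\<Sum>\<alpha>\<in>multi_indices m. c \<alpha> * (-1) ^ length \<alpha> * (\<integral>\<xi>. ?F \<alpha> t \<xi> \<partial>lborel))) / of_real ((2 * pi) ^ CARD('d)))) (at t)"
    by (rule bounded_linear.has_derivative[OF bounded_linear_divide])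
  then show ?thesis
    unfolding heat_deriv_def[abs_def] has_vector_derivative_def
    by (elim has_derivative_eq_rhs) (simp add: fun_eq_iff scaleR_conv_of_real flip: sum_divide_distrib)
qed

lemma measurable_heat_deriv:
  "(\<lambda>(t, x). heat_deriv \<beta> t x) \<in> borel_measurable (borel \<Otimes>\<^sub>M borel)"
proof -
  have "(\<lambda>p :: (real \<times> (real ^ 'd)) \<times> (real ^ 'd). integrand \<beta> (fst (fst p)) (snd (fst p)) (\<lambda>k. of_real (snd p $ k))) \<in> borel_measurable borel"
    by (intro borel_measurable_continuous_onI continuous_integrand continuous_intros)
  then have "(\<lambda>(q, \<xi>). integrand \<beta> (fst q) (snd q) (\<lambda>k. of_real (\<xi> $ k))) \<in> borel_measurable (borel \<Otimes>\<^sub>M (lborel :: (real ^ 'd) measure))"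
  proof (subst measurable_cong_sets[OF _ refl, of _ borel])
    show "sets (borel \<Otimes>\<^sub>M (lborel :: (real ^ 'd) measure)) = sets (borel :: ((real \<times> (real ^ 'd)) \<times> (real ^ 'd)) measure)"
      by (metis borel_prod sets_lborel sets_pair_measure_cong)
  qed (simp add: case_prod_beta')
  then have "(\<lambda>q :: real \<times> (real ^ 'd). \<integral>\<xi>. integrand \<beta> (fst q) (snd q) (\<lambda>k. of_real (\<xi> $ k)) \<partial>lborel) \<in> borel_measurable borel"
    by (rule lborel.borel_measurable_lebesgue_integral)
  then show ?thesis
    unfolding heat_deriv_def by (simp add: borel_prod case_prod_beta')
qed

end

section \<open>Smooth maps into a Lie group\<close>

context lie_group
begin

lemma chart_homeomorphism:
  assumes "(U, \<phi>) \<in> atlas"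
  shows "open U" "open (\<phi> ` U)" "homeomorphism U (\<phi> ` U) \<phi> (inv_into U \<phi>)"
  using atlas assms unfolding analytic_atlas_def is_chart_def by force+

lemma chart_inverse:
  assumes "(U, \<phi>) \<in> atlas" "x \<in> U"
  shows "inv_into U \<phi> (\<phi> x) = x"
  using homeomorphism_apply1[OF chart_homeomorphism(3)[OF assms(1)] assms(2)] .

lemma chart_inverse_right:
  assumes "(U, \<phi>) \<in> atlas" "y \<in> \<phi> ` U"
  shows "\<phi> (inv_into U \<phi> y) = y" "inv_into U \<phi> y \<in> U"
  using assms(2) by (auto simp: f_inv_into_f inv_into_into)

lemma chart_continuous:
  assumes "(U, \<phi>) \<in> atlas"
  shows "continuous_on U \<phi>" "continuous_on (\<phi> ` U) (inv_into U \<phi>)"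
  using chart_homeomorphism(3)[OF assms] by (auto simp: homeomorphism_def)

lemma chart_at: obtains U \<phi> where "(U, \<phi>) \<in> atlas" "x \<in> U"
  using atlas unfolding analytic_atlas_def by blast

lemma chart_image_open:
  assumes "(U, \<phi>) \<in> atlas" "open V"
  shows "open (\<phi> ` (U \<inter> V))"
proof -
  have "\<phi> ` (U \<inter> V) = \<phi> ` U \<inter> inv_into U \<phi> -` V"
    using chart_inverse[OF assms(1)] by (auto simp: image_iff)
  then show ?thesis
    using continuous_open_preimage[OF chart_continuous(2) chart_homeomorphism(2) assms(2), OF assms(1) assms(1)] by simp
qed

lemma continuous_mult: "continuous_on UNIV (\<lambda>(g, h). g \<otimes> h)"
  using mult_analytic by (simp add: analytic_map_def)

lemma continuous_inv: "continuous_on UNIV (\<lambda>g. inv g)"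
  using inv_analytic by (simp add: analytic_map_def)

lemma continuous_on_mult_compose [continuous_intros]:
  "continuous_on S f \<Longrightarrow> continuous_on S g \<Longrightarrow> continuous_on S (\<lambda>x. f x \<otimes> g x)"
  using continuous_on_compose2[OF continuous_mult, of S "\<lambda>x. (f x, g x)"]
  by (simp add: continuous_on_Pair)

lemma continuous_on_inv_compose [continuous_intros]:
  "continuous_on S f \<Longrightarrow> continuous_on S (\<lambda>x. inv (f x))"
  using continuous_on_compose2[OF continuous_inv, of S f] by simp

text \<open>Maps from open subsets of Euclidean spaces into the group take the place of general maps
  between manifolds: they are closed under the group operations and under Euclidean
  reparametrization, and this is the form in which coordinate expressions arise.\<close>

definition smooth_into :: "'n::euclidean_space set \<Rightarrow> ('n \<Rightarrow> 'g) \<Rightarrow> bool"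
  where "smooth_into S u \<longleftrightarrow> open S \<and> continuous_on S u \<and>
    (\<forall>(V, \<psi>)\<in>atlas. \<forall>b\<in>Basis. smooth_on (\<lambda>x. \<psi> (u x) \<bullet> b) (S \<inter> u -` V))"

lemma smooth_into_open: "smooth_into S u \<Longrightarrow> open S"
  and smooth_into_continuous: "smooth_into S u \<Longrightarrow> continuous_on S u"
  by (auto simp: smooth_into_def)

lemma smooth_into_chart_coord:
  "smooth_into S u \<Longrightarrow> (V, \<psi>) \<in> atlas \<Longrightarrow> b \<in> Basis \<Longrightarrow> smooth_on (\<lambda>x. \<psi> (u x) \<bullet> b) (S \<inter> u -` V)"
  unfolding smooth_into_def by fast

lemma smooth_into_preimage: "smooth_into S u \<Longrightarrow> open W \<Longrightarrow> open (S \<inter> u -` W)"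
  by (auto simp: smooth_into_def intro: continuous_open_preimage)

text \<open>One chart near each point is enough, because the transition to any other chart is
  analytic and hence smooth.\<close>

lemma smooth_intoI:
  assumes S: "open S" "continuous_on S u"
    and loc: "\<And>x. x \<in> S \<Longrightarrow> \<exists>V \<psi> T. (V, \<psi>) \<in> atlas \<and> open T \<and> x \<in> T \<and> T \<subseteq> S \<inter> u -` V \<and>
      (\<forall>b\<in>Basis. smooth_on (\<lambda>x. \<psi> (u x) \<bullet> b) T)"
  shows "smooth_into S u"
proof -
  have "smooth_on (\<lambda>x. \<psi>' (u x) \<bullet> b) (S \<inter> u -` V')" if V': "(V', \<psi>') \<in> atlas" for V' \<psi>' b
  proof (rule smooth_on_local)
    fix x assume x: "x \<in> S \<inter> u -` V'"
    then obtain V \<psi> T where V: "(V, \<psi>) \<in> atlas" and T: "open T" "x \<in> T" "T \<subseteq> S \<inter> u -` V"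
        "\<And>b. b \<in> Basis \<Longrightarrow> smooth_on (\<lambda>x. \<psi> (u x) \<bullet> b) T"
      using loc[of x] by blast
    let ?T = "T \<inter> (S \<inter> u -` V')"
    have o: "open ?T"
      using T(1) S chart_homeomorphism(1)[OF V'] by (auto intro: continuous_open_preimage)
    have an: "real_analytic_on (\<psi>' \<circ> inv_into V \<psi>) (\<psi> ` (V \<inter> V'))"
      using atlas V V' unfolding analytic_atlas_def by fast
    have "smooth_on (\<lambda>x. (\<psi>' \<circ> inv_into V \<psi>) (\<psi> (u x)) \<bullet> b) ?T"
      by (rule smooth_on_compose[OF o chart_image_open[OF V chart_homeomorphism(1)[OF V']] _ real_analytic_imp_smooth_on[OF an]])
        (use T in \<open>auto intro: smooth_on_subset\<close>)
    moreover have "(\<psi>' \<circ> inv_into V \<psi>) (\<psi> (u x)) = \<psi>' (u x)" if "x \<in> ?T" for x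
      using that T(3) chart_inverse[OF V, of "u x"] by auto
    ultimately have "smooth_on (\<lambda>x. \<psi>' (u x) \<bullet> b) ?T"
      by (elim smooth_on_cong[OF o]) simp
    then show "\<exists>T. open T \<and> x \<in> T \<and> smooth_on (\<lambda>x. \<psi>' (u x) \<bullet> b) T"
      using o T x by blast
  qed
  then show ?thesis using S by (auto simp: smooth_into_def)
qed

lemma smooth_into_compose:
  fixes g :: "'a::euclidean_space \<Rightarrow> 'b::euclidean_space"
  assumes u: "smooth_into S u" and T: "open T" "g ` T \<subseteq> S"
    and g: "\<And>b. b \<in> Basis \<Longrightarrow> smooth_on (\<lambda>x. g x \<bullet> b) T"
  shows "smooth_into T (\<lambda>x. u (g x))"
proof -
  have cg: "continuous_on T g"
    by (subst continuous_on_componentwise) (auto intro: smooth_on_continuous g)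
  have cu: "continuous_on T (\<lambda>x. u (g x))"
    using continuous_on_compose2[OF smooth_into_continuous[OF u] cg T(2)] .
  have "smooth_on (\<lambda>x. \<psi> (u (g x)) \<bullet> b) (T \<inter> (\<lambda>x. u (g x)) -` V)"
    if V: "(V, \<psi>) \<in> atlas" and b: "b \<in> Basis" for V \<psi> b
  proof (rule smooth_on_compose[where f = "\<lambda>y. \<psi> (u y) \<bullet> b" and T = "S \<inter> u -` V"])
    show "open (T \<inter> (\<lambda>x. u (g x)) -` V)"
      using cu T(1) chart_homeomorphism(1)[OF V] by (rule continuous_open_preimage)
    show "open (S \<inter> u -` V)" using u chart_homeomorphism(1)[OF V] by (rule smooth_into_preimage)
    show "smooth_on (\<lambda>y. \<psi> (u y) \<bullet> b) (S \<inter> u -` V)" using u V b by (rule smooth_into_chart_coord)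
  qed (use T g in \<open>auto intro: smooth_on_subset\<close>)
  then show ?thesis using T cu by (auto simp: smooth_into_def)
qed

lemma smooth_into_subset: "smooth_into S u \<Longrightarrow> open T \<Longrightarrow> T \<subseteq> S \<Longrightarrow> smooth_into T u"
  by (rule smooth_into_compose[where g = "\<lambda>x. x"])
    (auto intro: smooth_on_linear bounded_linear_inner_left)

lemma smooth_into_const: "open S \<Longrightarrow> smooth_into S (\<lambda>x. g)"
  by (auto simp: smooth_into_def smooth_on_const)

lemma smooth_into_chart_inverse:
  assumes "(U, \<phi>) \<in> atlas"
  shows "smooth_into (\<phi> ` U) (inv_into U \<phi>)"
proof (rule smooth_intoI)
  fix x assume x: "x \<in> \<phi> ` U"
  have "smooth_on (\<lambda>x. \<phi> (inv_into U \<phi> x) \<bullet> b) (\<phi> ` U)" for b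
    by (rule smooth_on_cong[OF chart_homeomorphism(2)[OF assms] smooth_on_linear[OF bounded_linear_inner_left]])
      (simp add: chart_inverse_right[OF assms])
  then show "\<exists>V \<psi> T. (V, \<psi>) \<in> atlas \<and> open T \<and> x \<in> T \<and> T \<subseteq> \<phi> ` U \<inter> inv_into U \<phi> -` V \<and>
      (\<forall>b\<in>Basis. smooth_on (\<lambda>x. \<psi> (inv_into U \<phi> x) \<bullet> b) T)"
    using assms x chart_homeomorphism(2)[OF assms] chart_inverse_right[OF assms]
    by (intro exI[of _ U] exI[of _ \<phi>] exI[of _ "\<phi> ` U"]) auto
qed (use chart_homeomorphism(2) chart_continuous(2) assms in auto)

lemma smooth_into_inv:
  assumes u: "smooth_into S u"
  shows "smooth_into S (\<lambda>x. inv (u x))"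
proof (rule smooth_intoI)
  show c: "continuous_on S (\<lambda>x. inv (u x))"
    by (intro continuous_intros smooth_into_continuous u)
  fix x assume x: "x \<in> S"
  obtain U \<phi> where U: "(U, \<phi>) \<in> atlas" "u x \<in> U" by (rule chart_at)
  obtain W \<zeta> where W: "(W, \<zeta>) \<in> atlas" "inv (u x) \<in> W" by (rule chart_at)
  note oW = chart_homeomorphism(1)[OF W(1)]
  let ?T = "(S \<inter> u -` U) \<inter> (S \<inter> (\<lambda>x. inv (u x)) -` W)"
  have o: "open ?T"
    by (intro open_Int smooth_into_preimage[OF u] chart_homeomorphism(1)[OF U(1)]
        continuous_open_preimage[OF c smooth_into_open[OF u]] oW)
  have an: "real_analytic_on (\<zeta> \<circ> (\<lambda>g. inv g) \<circ> inv_into U \<phi>) (\<phi> ` (U \<inter> UNIV \<inter> (\<lambda>g. inv g) -` W))"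
    using inv_analytic U W unfolding analytic_map_def by fast
  have oD: "open (\<phi> ` (U \<inter> UNIV \<inter> (\<lambda>g. inv g) -` W))"
    using chart_image_open[OF U(1) open_vimage[OF oW continuous_inv]] by simp
  have "smooth_on (\<lambda>x. \<zeta> (inv (u x)) \<bullet> b) ?T" if b: "b \<in> Basis" for b
  proof (rule smooth_on_cong[OF o])
    show "smooth_on (\<lambda>x. (\<zeta> \<circ> (\<lambda>g. inv g) \<circ> inv_into U \<phi>) (\<phi> (u x)) \<bullet> b) ?T"
      by (rule smooth_on_compose[OF o oD _ real_analytic_imp_smooth_on[OF an]])
        (auto intro: smooth_on_subset[OF smooth_into_chart_coord[OF u U(1)]])
  qed (use chart_inverse[OF U(1)] in auto)
  then show "\<exists>V \<psi> T. (V, \<psi>) \<in> atlas \<and> open T \<and> x \<in> T \<and> T \<subseteq> S \<inter> (\<lambda>x. inv (u x)) -` V \<and>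
      (\<forall>b\<in>Basis. smooth_on (\<lambda>x. \<psi> (inv (u x)) \<bullet> b) T)"
    using o U W x by (intro exI[of _ W] exI[of _ \<zeta>] exI[of _ ?T]) auto
qed (rule smooth_into_open[OF u])

lemma inv_into_map_prod:
  assumes "inj_on f A" "inj_on g B" "x \<in> A" "y \<in> B"
  shows "inv_into (A \<times> B) (map_prod f g) (f x, g y) = (x, y)"
proof -
  have "inj_on (map_prod f g) (A \<times> B)" using assms by (auto simp: inj_on_def)
  then show ?thesis using inv_into_f_f[of "map_prod f g" "A \<times> B" "(x, y)"] assms by simp
qed

lemma smooth_into_mult:
  assumes u: "smooth_into S u" and v: "smooth_into S v"
  shows "smooth_into S (\<lambda>x. u x \<otimes> v x)"
proof (rule smooth_intoI)
  show c: "continuous_on S (\<lambda>x. u x \<otimes> v x)"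
    by (intro continuous_intros smooth_into_continuous u v)
  fix x assume x: "x \<in> S"
  obtain U \<phi> where U: "(U, \<phi>) \<in> atlas" "u x \<in> U" by (rule chart_at)
  obtain V \<psi> where V: "(V, \<psi>) \<in> atlas" "v x \<in> V" by (rule chart_at)
  obtain W \<zeta> where W: "(W, \<zeta>) \<in> atlas" "u x \<otimes> v x \<in> W" by (rule chart_at)
  note oW = chart_homeomorphism(1)[OF W(1)]
  let ?T = "(S \<inter> u -` U) \<inter> (S \<inter> v -` V) \<inter> (S \<inter> (\<lambda>x. u x \<otimes> v x) -` W)"
  let ?m = "\<lambda>(g, h). g \<otimes> h"
  let ?Q = "\<zeta> \<circ> ?m \<circ> inv_into (U \<times> V) (map_prod \<phi> \<psi>)"
  let ?D = "map_prod \<phi> \<psi> ` ((U \<times> V) \<inter> UNIV \<inter> ?m -` W)"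
  have inj: "inj_on \<phi> U" "inj_on \<psi> V"
    by (auto intro: inj_on_inverseI chart_inverse[OF U(1)] chart_inverse[OF V(1)])
  have inv: "inv_into (U \<times> V) (map_prod \<phi> \<psi>) (\<phi> g, \<psi> h) = (g, h)" if "g \<in> U" "h \<in> V" for g h
    using inv_into_map_prod[OF inj that] .
  have o: "open ?T"
    by (intro open_Int smooth_into_preimage[OF u] smooth_into_preimage[OF v] chart_homeomorphism(1)[OF U(1)] chart_homeomorphism(1)[OF V(1)]
        continuous_open_preimage[OF c smooth_into_open[OF u]] oW)
  have "(U \<times> V, map_prod \<phi> \<psi>) \<in> prod_atlas atlas atlas"
    using U V by (auto simp: prod_atlas_def)
  then have an: "real_analytic_on ?Q ?D"
    using mult_analytic W unfolding analytic_map_def by fast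
  \<comment> \<open>Rewriting the domain of the coordinate expression as a preimage under a
    continuous map shows that it is open, as the chain rule requires.\<close>
  have "?D = (\<phi> ` U \<times> \<psi> ` V) \<inter> (\<lambda>p. inv_into U \<phi> (fst p) \<otimes> inv_into V \<psi> (snd p)) -` W"
    by (auto simp: chart_inverse[OF U(1)] chart_inverse[OF V(1)] image_iff)
  moreover have "open ((\<phi> ` U \<times> \<psi> ` V) \<inter> (\<lambda>p. inv_into U \<phi> (fst p) \<otimes> inv_into V \<psi> (snd p)) -` W)"
  proof (rule continuous_open_preimage[OF _ _ oW])
    show "open (\<phi> ` U \<times> \<psi> ` V)"
      by (intro open_Times chart_homeomorphism(2)[OF U(1)] chart_homeomorphism(2)[OF V(1)])
    show "continuous_on (\<phi> ` U \<times> \<psi> ` V) (\<lambda>p. inv_into U \<phi> (fst p) \<otimes> inv_into V \<psi> (snd p))"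
      by (intro continuous_on_mult_compose continuous_on_compose2[OF chart_continuous(2)[OF U(1)]]
          continuous_on_compose2[OF chart_continuous(2)[OF V(1)]] continuous_intros) auto
  qed
  ultimately have oD: "open ?D" by simp
  have "smooth_on (\<lambda>x. \<zeta> (u x \<otimes> v x) \<bullet> b) ?T" if b: "b \<in> Basis" for b
  proof (rule smooth_on_cong[OF o])
    show "smooth_on (\<lambda>x. ?Q (\<phi> (u x), \<psi> (v x)) \<bullet> b) ?T"
    proof (rule smooth_on_compose[OF o oD _ real_analytic_imp_smooth_on[OF an]])
      show "(\<lambda>x. (\<phi> (u x), \<psi> (v x))) ` ?T \<subseteq> ?D" by auto
      fix b' :: "(real ^ 'd) \<times> (real ^ 'd)" assume "b' \<in> Basis"
      then show "smooth_on (\<lambda>x. (\<phi> (u x), \<psi> (v x)) \<bullet> b') ?T"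
        by (auto simp: Basis_prod_def intro: smooth_on_subset[OF smooth_into_chart_coord[OF u U(1)]]
            smooth_on_subset[OF smooth_into_chart_coord[OF v V(1)]])
    qed
  qed (auto simp: inv)
  then show "\<exists>V \<psi> T. (V, \<psi>) \<in> atlas \<and> open T \<and> x \<in> T \<and> T \<subseteq> S \<inter> (\<lambda>x. u x \<otimes> v x) -` V \<and>
      (\<forall>b\<in>Basis. smooth_on (\<lambda>x. \<psi> (u x \<otimes> v x) \<bullet> b) T)"
    using o U V W x by (intro exI[of _ W] exI[of _ \<zeta>] exI[of _ ?T]) auto
qed (rule smooth_into_open[OF u])

lemma smooth_function_compose:
  assumes f: "f \<in> smooth_functions atlas" and u: "smooth_into S u"
  shows "smooth_on (\<lambda>x. f (u x)) S"
proof (rule smooth_on_local)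
  fix x assume x: "x \<in> S"
  obtain U \<phi> where U: "(U, \<phi>) \<in> atlas" "u x \<in> U" by (rule chart_at)
  have o: "open (S \<inter> u -` U)" using u chart_homeomorphism(1)[OF U(1)] by (rule smooth_into_preimage)
  have "smooth_on (\<lambda>x. (f \<circ> inv_into U \<phi>) (\<phi> (u x))) (S \<inter> u -` U)"
  proof (rule smooth_on_compose[OF o chart_homeomorphism(2)[OF U(1)]])
    show "smooth_on (f \<circ> inv_into U \<phi>) (\<phi> ` U)"
      using f U unfolding smooth_functions_def by fast
  qed (use smooth_into_chart_coord[OF u U(1)] in auto)
  then have "smooth_on (\<lambda>x. f (u x)) (S \<inter> u -` U)"
    by (rule smooth_on_cong[OF o]) (use chart_inverse[OF U(1)] in auto)
  then show "\<exists>T. open T \<and> x \<in> T \<and> smooth_on (\<lambda>x. f (u x)) T"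
    using o x U by blast
qed

text \<open>The definition tests inverse charts only, which are among these \<open>u\<close>. The
  premise is given for all \<open>u\<close> because in that form it follows from the closure
  properties of \<open>smooth_into\<close>.\<close>

lemma smooth_functionsI:
  assumes "\<And>(S :: (real ^ 'd) set) u. smooth_into S u \<Longrightarrow> smooth_on (\<lambda>x. f (u x)) S"
  shows "f \<in> smooth_functions atlas"
  using assms[OF smooth_into_chart_inverse] by (auto simp: smooth_functions_def o_def)

lemma smooth_function_translate:
  "f \<in> smooth_functions atlas \<Longrightarrow> (\<lambda>h. f (g \<otimes> h)) \<in> smooth_functions atlas"
  by (rule smooth_functionsI)
    (rule smooth_function_compose[OF _ smooth_into_mult[OF smooth_into_const]], auto simp: smooth_into_open)

lemma smooth_function_add:
  "f \<in> smooth_functions atlas \<Longrightarrow> g \<in> smooth_functions atlas \<Longrightarrow> (\<lambda>h. f h + g h) \<in> smooth_functions atlas"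
  by (rule smooth_functionsI) (simp add: smooth_on_add smooth_into_open smooth_function_compose)

lemma smooth_function_mult:
  "f \<in> smooth_functions atlas \<Longrightarrow> g \<in> smooth_functions atlas \<Longrightarrow> (\<lambda>h. f h * g h) \<in> smooth_functions atlas"
  by (rule smooth_functionsI) (simp add: smooth_on_mult smooth_into_open smooth_function_compose)

lemma smooth_function_const: "(\<lambda>h. a) \<in> smooth_functions atlas"
  by (rule smooth_functionsI) (rule smooth_on_const)

end

section \<open>Exponential coordinates\<close>

lemma has_derivative_componentwise_frechet:
  fixes g :: "'a::euclidean_space \<Rightarrow> 'b::euclidean_space"
  assumes "\<And>b. b \<in> Basis \<Longrightarrow> (\<lambda>x. g x \<bullet> b) differentiable (at x)"
  shows "(g has_derivative frechet_derivative g (at x)) (at x)"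
    and "b \<in> Basis \<Longrightarrow> frechet_derivative g (at x) v \<bullet> b = frechet_derivative (\<lambda>x. g x \<bullet> b) (at x) v"
proof -
  have "g differentiable (at x)"
    using assms by (subst differentiable_componentwise_within) simp
  then show d: "(g has_derivative frechet_derivative g (at x)) (at x)"
    by (simp add: frechet_derivative_works)
  show "frechet_derivative g (at x) v \<bullet> b = frechet_derivative (\<lambda>x. g x \<bullet> b) (at x) v" if "b \<in> Basis"
    using frechet_derivative_at'[OF has_derivative_inner_left[OF d, of b]] by simp
qed

context kernel_construction
begin

sublocale elliptic_symbol m c
  using m_even m_ge_2 elliptic by unfold_locales

definition log_coord :: "'g \<Rightarrow> real ^ 'd"
  where "log_coord = inv_into (ball 0 r) exp_coord"

lemma exp_bij: "bij_betw exp_coord (ball 0 r) \<Omega>"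
  using exp_diffeo by (simp add: analytic_diffeomorphism_def)

lemma log_exp [simp]: "x \<in> ball 0 r \<Longrightarrow> log_coord (exp_coord x) = x"
  unfolding log_coord_def using exp_bij by (auto simp: bij_betw_def)

lemma exp_in: "x \<in> ball 0 r \<Longrightarrow> exp_coord x \<in> \<Omega>"
  using exp_bij by (auto simp: bij_betw_def)

lemma exp_log: "g \<in> \<Omega> \<Longrightarrow> exp_coord (log_coord g) = g" "g \<in> \<Omega> \<Longrightarrow> log_coord g \<in> ball 0 r"
  unfolding log_coord_def using exp_bij
  by (auto simp: bij_betw_def f_inv_into_f inv_into_into simp del: mem_ball_0)

lemma smooth_into_exp: "smooth_into (ball 0 r) exp_coord"
proof -
  have a: "analytic_map vec_atlas atlas (ball 0 r) exp_coord"
    using exp_diffeo by (simp add: analytic_diffeomorphism_def)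
  have "smooth_on (\<lambda>x. \<psi> (exp_coord x) \<bullet> b) (ball 0 r \<inter> exp_coord -` V)" if "(V, \<psi>) \<in> atlas" for V \<psi> b
  proof -
    have "real_analytic_on (\<psi> \<circ> exp_coord \<circ> inv_into UNIV id) (id ` (UNIV \<inter> ball 0 r \<inter> exp_coord -` V))"
      using a that unfolding analytic_map_def vec_atlas_def by fast
    then have "real_analytic_on (\<psi> \<circ> exp_coord) (ball 0 r \<inter> exp_coord -` V)"
      by simp
    then show ?thesis using real_analytic_imp_smooth_on by force
  qed
  then show ?thesis using a by (auto simp: smooth_into_def analytic_map_def)
qed

lemma continuous_log: "continuous_on \<Omega> log_coord"
  using exp_diffeo by (simp add: analytic_diffeomorphism_def analytic_map_def log_coord_def)

lemma smooth_on_log: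
  assumes u: "smooth_into S u" "u ` S \<subseteq> \<Omega>"
  shows "smooth_on (\<lambda>x. log_coord (u x) \<bullet> b) S"
proof (rule smooth_on_local)
  fix x assume x: "x \<in> S"
  obtain U \<phi> where U: "(U, \<phi>) \<in> atlas" "u x \<in> U" by (rule chart_at)
  have a: "analytic_map atlas vec_atlas \<Omega> log_coord"
    using exp_diffeo by (simp add: analytic_diffeomorphism_def log_coord_def)
  have "real_analytic_on (id \<circ> log_coord \<circ> inv_into U \<phi>) (\<phi> ` (U \<inter> \<Omega> \<inter> log_coord -` UNIV))"
    using a U unfolding analytic_map_def vec_atlas_def by fast
  then have an: "real_analytic_on (log_coord \<circ> inv_into U \<phi>) (\<phi> ` (U \<inter> \<Omega>))"
    by simp
  have o: "open (S \<inter> u -` U)" using u(1) chart_homeomorphism(1)[OF U(1)] by (rule smooth_into_preimage)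
  have "smooth_on (\<lambda>x. (log_coord \<circ> inv_into U \<phi>) (\<phi> (u x)) \<bullet> b) (S \<inter> u -` U)"
    by (rule smooth_on_compose[OF o chart_image_open[OF U(1) Omega(1)] _ real_analytic_imp_smooth_on[OF an]])
      (use u(2) smooth_into_chart_coord[OF u(1) U(1)] in auto)
  then have "smooth_on (\<lambda>x. log_coord (u x) \<bullet> b) (S \<inter> u -` U)"
    by (rule smooth_on_cong[OF o]) (use chart_inverse[OF U(1)] in auto)
  then show "\<exists>T. open T \<and> x \<in> T \<and> smooth_on (\<lambda>x. log_coord (u x) \<bullet> b) T"
    using o x U by blast
qed

section \<open>The cut-off function and the exponential of zero\<close>

definition supp :: "'g set"
  where "supp = closure {g. \<theta> g \<noteq> 0}"

lemma supp: "compact supp" "closed supp" "supp \<subseteq> \<Omega>" "g \<notin> supp \<Longrightarrow> \<theta> g = 0"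
  using theta_support closure_subset[of "{g. \<theta> g \<noteq> 0}"] by (auto simp: supp_def)

lemma theta_one_at: "\<theta> \<one> = 1"
  using eventually_nhds_x_imp_x[OF theta_one] .

text \<open>The factor \<theta> turns a local coordinate into a smooth function on all of G: the
  product vanishes on the open complement of \<open>supp\<close>, and \<open>supp\<close> lies
  inside \<Omega>.\<close>

lemma localized_coord_smooth:
  "(\<lambda>g. if g \<in> \<Omega> then \<theta> g * (log_coord g \<bullet> b) else 0) \<in> smooth_functions atlas"
proof (rule smooth_functionsI, rule smooth_on_local)
  fix S :: "(real ^ 'd) set" and u x
  assume u: "smooth_into S u" and x: "x \<in> S"
  show "\<exists>T. open T \<and> x \<in> T \<and> smooth_on (\<lambda>x. if u x \<in> \<Omega> then \<theta> (u x) * (log_coord (u x) \<bullet> b) else 0) T"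
  proof (cases "u x \<in> \<Omega>")
    case True
    let ?T = "S \<inter> u -` \<Omega>"
    have o: "open ?T" using u Omega(1) by (rule smooth_into_preimage)
    have u': "smooth_into ?T u" using u o by (rule smooth_into_subset) auto
    have "smooth_on (\<lambda>x. \<theta> (u x) * (log_coord (u x) \<bullet> b)) ?T"
      by (intro smooth_on_mult o smooth_function_compose[OF theta_smooth u'] smooth_on_log[OF u']) auto
    then have "smooth_on (\<lambda>x. if u x \<in> \<Omega> then \<theta> (u x) * (log_coord (u x) \<bullet> b) else 0) ?T"
      by (rule smooth_on_cong[OF o]) auto
    then show ?thesis using o x True by blast
  next
    case False
    let ?T = "S \<inter> u -` (- supp)"
    have o: "open ?T" using u supp(2) by (intro smooth_into_preimage) auto
    have "smooth_on (\<lambda>x. if u x \<in> \<Omega> then \<theta> (u x) * (log_coord (u x) \<bullet> b) else 0) ?T"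
      by (rule smooth_on_cong[OF o smooth_on_const[of 0]]) (use supp(4) in auto)
    then show ?thesis using o x False supp(3) by blast
  qed
qed

text \<open>Testing with \<theta> puts g into \<Omega>; testing with the localized coordinates then
  identifies its logarithm.\<close>

lemma smooth_functions_separate_one:
  assumes "\<And>f. f \<in> smooth_functions atlas \<Longrightarrow> f g = f \<one>"
  shows "g = \<one>"
proof -
  have 1: "\<theta> g = 1" using assms[OF theta_smooth] theta_one_at by simp
  then have g: "g \<in> \<Omega>" using supp(3,4) by force
  have eq: "log_coord g \<bullet> b = log_coord \<one> \<bullet> b" for b
    using assms[OF localized_coord_smooth[of b]] by (simp only: g 1 theta_one_at Omega(3) if_True mult_1)
  have "log_coord g = log_coord \<one>"
    by (rule euclidean_eqI[OF eq])
  then have "exp_coord (log_coord g) = exp_coord (log_coord \<one>)" by (rule arg_cong)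
  then show ?thesis by (simp only: exp_log(1)[OF g] exp_log(1)[OF Omega(3)])
qed

text \<open>Evaluates the definite description in \<open>lie_exp\<close> at the zero vector.
  Translating f by \<gamma> t moves the derivative condition from time 0 to time t, so f is constant
  along \<gamma> for every smooth f, and smooth functions recognize the identity.\<close>

lemma one_parameter_subgroup_zero:
  "one_parameter_subgroup (\<lambda>f. 0) \<gamma> \<longleftrightarrow> \<gamma> = (\<lambda>t. \<one>)"
proof
  assume \<gamma>: "one_parameter_subgroup (\<lambda>f. 0) \<gamma>"
  have hom: "\<gamma> (s + t) = \<gamma> s \<otimes> \<gamma> t" for s t
    using \<gamma> by (simp add: one_parameter_subgroup_def)
  have \<gamma>0: "\<gamma> 0 = \<one>"
    using hom[of 0 0, symmetric] l_cancel_one[of "\<gamma> 0" "\<gamma> 0"] by (simp add: carrier_UNIV)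
  have "f (\<gamma> t) = f \<one>" if f: "f \<in> smooth_functions atlas" for f t
  proof -
    have "((f \<circ> \<gamma>) has_real_derivative 0) (at t)" for t
    proof -
      have "(((\<lambda>h. f (\<gamma> t \<otimes> h)) \<circ> \<gamma>) has_real_derivative 0) (at 0)"
        using \<gamma> smooth_function_translate[OF f] by (auto simp: one_parameter_subgroup_def)
      then have "((\<lambda>s. f (\<gamma> (t + s))) has_real_derivative 0) (at 0)"
        by (simp add: o_def hom)
      then show ?thesis
        using DERIV_shift[of "f \<circ> \<gamma>" 0 0 t] by (simp add: o_def add.commute)
    qed
    then have "(f \<circ> \<gamma>) t = (f \<circ> \<gamma>) 0"
      by (intro DERIV_isconst_all) blast
    then show ?thesis by (simp add: \<gamma>0)
  qed
  then show "\<gamma> = (\<lambda>t. \<one>)" using smooth_functions_separate_one by blast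
next
  assume "\<gamma> = (\<lambda>t. \<one>)"
  then show "one_parameter_subgroup (\<lambda>f. 0) \<gamma>"
    by (simp add: one_parameter_subgroup_def o_def)
qed

lemma exp_coord_0: "exp_coord 0 = \<one>"
proof -
  have "lie_vec 0 = (\<lambda>f. 0)" by (simp add: lie_vec_def)
  then show ?thesis
    by (simp add: exp_coord_def lie_exp_def one_parameter_subgroup_zero)
qed

lemma log_coord_one: "log_coord \<one> = 0"
  using log_exp[of 0] r_pos by (simp add: exp_coord_0)

section \<open>The generators as vector fields in exponential coordinates\<close>

text \<open>The map (x, y) \<mapsto> log(exp(x)^-1 exp(y)). Its derivative in x at x = 0 yields the
  generators of left translations; its derivative in y on the diagonal yields velocities in the
  left-invariant frame.\<close>

definition transl :: "(real ^ 'd) \<times> (real ^ 'd) \<Rightarrow> real ^ 'd"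
  where "transl p = log_coord (inv (exp_coord (fst p)) \<otimes> exp_coord (snd p))"

definition transl_dom :: "((real ^ 'd) \<times> (real ^ 'd)) set"
  where "transl_dom = (ball 0 r \<times> ball 0 r) \<inter> (\<lambda>p. inv (exp_coord (fst p)) \<otimes> exp_coord (snd p)) -` \<Omega>"

lemma smooth_into_transl:
  "smooth_into (ball 0 r \<times> ball 0 r) (\<lambda>p. inv (exp_coord (fst p)) \<otimes> exp_coord (snd p))"
proof (intro smooth_into_mult smooth_into_inv)
  have bl: "bounded_linear (\<lambda>p :: (real ^ 'd) \<times> (real ^ 'd). fst p \<bullet> b)"
    "bounded_linear (\<lambda>p :: (real ^ 'd) \<times> (real ^ 'd). snd p \<bullet> b)" for b
    by (auto intro: bounded_linear_compose[OF bounded_linear_inner_left] bounded_linear_fst bounded_linear_snd)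
  show "smooth_into (ball 0 r \<times> ball 0 r) (\<lambda>p :: (real ^ 'd) \<times> (real ^ 'd). exp_coord (fst p))"
    by (rule smooth_into_compose[OF smooth_into_exp], simp add: open_Times, force) (rule smooth_on_linear[OF bl(1)])
  show "smooth_into (ball 0 r \<times> ball 0 r) (\<lambda>p :: (real ^ 'd) \<times> (real ^ 'd). exp_coord (snd p))"
    by (rule smooth_into_compose[OF smooth_into_exp], simp add: open_Times, force) (rule smooth_on_linear[OF bl(2)])
qed

lemma open_transl_dom: "open transl_dom"
  unfolding transl_dom_def using smooth_into_transl Omega(1) by (rule smooth_into_preimage)

lemma smooth_transl: "smooth_on (\<lambda>p. transl p \<bullet> b) transl_dom"
  unfolding transl_def
  by (rule smooth_on_log[OF smooth_into_subset[OF smooth_into_transl open_transl_dom]])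
    (auto simp: transl_dom_def)

lemma exp_transl: "p \<in> transl_dom \<Longrightarrow> exp_coord (transl p) = inv (exp_coord (fst p)) \<otimes> exp_coord (snd p)"
  and transl_in: "p \<in> transl_dom \<Longrightarrow> transl p \<in> ball 0 r"
  unfolding transl_def transl_dom_def using exp_log by blast+

lemma transl_0: "x \<in> ball 0 r \<Longrightarrow> (0, x) \<in> transl_dom" "x \<in> ball 0 r \<Longrightarrow> transl (0, x) = x"
  using r_pos exp_in[of x] by (auto simp: transl_dom_def transl_def exp_coord_0 carrier_UNIV simp del: mem_ball_0)

lemma transl_diag: "y \<in> ball 0 r \<Longrightarrow> (y, y) \<in> transl_dom" "transl (y, y) = 0"
  using Omega(3) by (auto simp: transl_dom_def transl_def carrier_UNIV log_coord_one)

lemma transl_has_derivative: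
  assumes "p \<in> transl_dom"
  shows "(transl has_derivative frechet_derivative transl (at p)) (at p)"
    and "b \<in> Basis \<Longrightarrow> frechet_derivative transl (at p) v \<bullet> b = frechet_derivative (\<lambda>p. transl p \<bullet> b) (at p) v"
proof -
  have "(\<lambda>p. transl p \<bullet> b) differentiable (at p)" for b
    using smooth_on_has_derivative[OF smooth_transl assms] by (auto simp: differentiable_def)
  note * = has_derivative_componentwise_frechet[of transl p, OF this]
  show "(transl has_derivative frechet_derivative transl (at p)) (at p)" by (rule *(1))
  show "b \<in> Basis \<Longrightarrow> frechet_derivative transl (at p) v \<bullet> b = frechet_derivative (\<lambda>p. transl p \<bullet> b) (at p) v"
    by (rule *(2))
qed

text \<open>The vector field A_j read in the chart: the derivative at s = 0 of log(exp(s a_j)^-1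
  exp(x)).\<close>

definition generator_field :: "'d \<Rightarrow> real ^ 'd \<Rightarrow> real ^ 'd"
  where "generator_field j x = frechet_derivative transl (at (0, x)) (axis j 1, 0)"

lemma smooth_generator_field: "smooth_on (\<lambda>x. generator_field j x $ k) (ball 0 r)"
proof (rule smooth_on_cong[OF open_ball])
  let ?f = "\<lambda>p. frechet_derivative (\<lambda>p. transl p \<bullet> axis k 1) (at p) (axis j 1, 0)"
  show "smooth_on (\<lambda>x. ?f (0, x)) (ball 0 r)"
  proof (rule smooth_on_compose[where f = ?f, OF open_ball open_transl_dom])
    show "smooth_on ?f transl_dom" by (rule smooth_on_frechet[OF smooth_transl])
    fix b :: "(real ^ 'd) \<times> (real ^ 'd)"
    have "bounded_linear (\<lambda>x :: real ^ 'd. (0, x) \<bullet> b)"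
      by (cases b) (simp add: bounded_linear_inner_left)
    then show "smooth_on (\<lambda>x :: real ^ 'd. (0, x) \<bullet> b) (ball 0 r)" by (rule smooth_on_linear)
  qed (use transl_0(1) in auto)
  show "?f (0, x) = generator_field j x $ k" if "x \<in> ball 0 r" for x
    using transl_has_derivative(2)[OF transl_0(1)[OF that], of "axis k 1"]
    by (simp add: generator_field_def cart_eq_inner_axis axis_in_Basis_iff)
qed

text \<open>Differentiate \<open>transl (y, y) = 0\<close> and \<open>transl (0, x) = x\<close>.\<close>

lemma generator_field_0: "generator_field j 0 = - axis j 1"
proof -
  let ?D = "frechet_derivative transl (at (0, 0))"
  let ?v = "axis j 1 :: real ^ 'd"
  have D: "(transl has_derivative ?D) (at (0, 0))"
    using transl_has_derivative(1)[OF transl_0(1)[of 0]] r_pos by simp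
  have lin: "linear ?D" using has_derivative_bounded_linear[OF D] by (rule bounded_linear.linear)
  have pair: "((\<lambda>y :: real ^ 'd. (y, y)) has_derivative (\<lambda>v. (v, v))) (at 0)"
    "((\<lambda>y :: real ^ 'd. (0 :: real ^ 'd, y)) has_derivative (\<lambda>v. (0, v))) (at 0)"
    by (auto intro!: derivative_eq_intros)
  have d1: "((\<lambda>y. transl (y, y)) has_derivative (\<lambda>v. ?D (v, v))) (at 0)"
    by (rule has_derivative_compose[OF pair(1)]) (rule D)
  have d2: "((\<lambda>y. transl (y, y)) has_derivative (\<lambda>v. 0)) (at 0)"
    by (simp add: transl_diag)
  have d3: "((\<lambda>x. transl (0, x)) has_derivative (\<lambda>v. ?D (0, v))) (at 0)"
    by (rule has_derivative_compose[OF pair(2)]) (rule D)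
  have d4: "((\<lambda>x. transl (0, x)) has_derivative (\<lambda>v. v)) (at 0)"
    by (rule has_derivative_transform_within_open[OF has_derivative_ident open_ball[of 0 r]])
      (use r_pos transl_0(2) in auto)
  have 1: "?D (?v, ?v) = 0" by (rule fun_cong[OF has_derivative_unique[OF d1 d2]])
  have 2: "?D (0, ?v) = ?v" by (rule fun_cong[OF has_derivative_unique[OF d3 d4]])
  have "?D (?v, ?v) = ?D (?v, 0) + ?D (0, ?v)"
    using linear_add[OF lin, of "(?v, 0)" "(0, ?v)"] by simp
  then show ?thesis using 1 2 by (simp add: generator_field_def eq_neg_iff_add_eq_0)
qed

text \<open>Chain rule for s \<mapsto> \<Phi>(transl(s e_j, x)) at s = 0. For small s the pair stays
  in the open set \<open>transl_dom\<close>, and there this difference quotient is the one in the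
  definition of \<open>generator\<close>.\<close>

lemma generator_exp:
  assumes x: "x \<in> ball 0 r" and f: "\<And>y. y \<in> ball 0 r \<Longrightarrow> f (exp_coord y) = \<Phi> y"
    and \<Phi>: "(\<Phi> has_derivative \<Phi>') (at x)"
  shows "generator j f (exp_coord x) = \<Phi>' (generator_field j x)"
proof -
  let ?e = "\<lambda>s. (s *\<^sub>R axis j 1 :: real ^ 'd, x)"
  let ?D = "frechet_derivative transl (at (0, x))"
  have D: "(transl has_derivative ?D) (at (0, x))"
    by (rule transl_has_derivative(1)[OF transl_0(1)[OF x]])
  have lin: "linear ?D" using has_derivative_bounded_linear[OF D] by (rule bounded_linear.linear)
  have lin': "linear \<Phi>'" using has_derivative_bounded_linear[OF \<Phi>] by (rule bounded_linear.linear)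
  have e: "(?e has_derivative (\<lambda>s. (s *\<^sub>R axis j 1, 0))) (at 0)"
    by (auto intro!: derivative_eq_intros)
  have "((\<lambda>s. transl (?e s)) has_derivative (\<lambda>s. ?D (s *\<^sub>R axis j 1, 0))) (at 0)"
    by (rule has_derivative_compose[OF e]) (use D in simp)
  then have q: "((\<lambda>s. transl (?e s)) has_derivative (\<lambda>s. s *\<^sub>R generator_field j x)) (at 0)"
    by (elim has_derivative_eq_rhs) (simp add: fun_eq_iff generator_field_def flip: linear_cmul[OF lin])
  have "((\<lambda>s. \<Phi> (transl (?e s))) has_derivative (\<lambda>s. \<Phi>' (s *\<^sub>R generator_field j x))) (at 0)"
    by (rule has_derivative_compose[OF q]) (use \<Phi> transl_0(2)[OF x] in simp)
  then have "(\<lambda>s. norm (\<Phi> (transl (?e s)) - \<Phi> x - s *\<^sub>R \<Phi>' (generator_field j x)) / norm s) \<midarrow>0\<rightarrow> 0"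
    using transl_0(2)[OF x] by (simp add: has_derivative_at linear_cmul[OF lin'])
  moreover have "\<forall>\<^sub>F s in at 0. norm (\<Phi> (transl (?e s)) - \<Phi> x - s *\<^sub>R \<Phi>' (generator_field j x)) / norm s
      = norm ((\<Phi> (transl (?e s)) - \<Phi> x) /\<^sub>R s - \<Phi>' (generator_field j x))"
    unfolding eventually_at_filter
  proof (intro always_eventually allI impI)
    fix s :: real assume s: "s \<noteq> 0"
    have "(\<Phi> (transl (?e s)) - \<Phi> x) /\<^sub>R s - \<Phi>' (generator_field j x) = (\<Phi> (transl (?e s)) - \<Phi> x - s *\<^sub>R \<Phi>' (generator_field j x)) /\<^sub>R s"
      using s by (simp add: scaleR_diff_right)
    then show "norm (\<Phi> (transl (?e s)) - \<Phi> x - s *\<^sub>R \<Phi>' (generator_field j x)) / norm s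
      = norm ((\<Phi> (transl (?e s)) - \<Phi> x) /\<^sub>R s - \<Phi>' (generator_field j x))"
      by (simp only: norm_scaleR) (simp add: divide_inverse mult.commute)
  qed
  ultimately have "(\<lambda>s. norm ((\<Phi> (transl (?e s)) - \<Phi> x) /\<^sub>R s - \<Phi>' (generator_field j x))) \<midarrow>0\<rightarrow> 0"
    by (rule Lim_transform_eventually)
  then have lim: "((\<lambda>s. (\<Phi> (transl (?e s)) - \<Phi> x) /\<^sub>R s) \<longlongrightarrow> \<Phi>' (generator_field j x)) (at 0)"
    by (rule LIM_zero_cancel[OF tendsto_norm_zero_cancel])
  have "continuous_on UNIV ?e" by (intro continuous_intros)
  then have "open (?e -` transl_dom)" using open_transl_dom by (rule open_vimage[rotated])
  moreover have "0 \<in> ?e -` transl_dom" using transl_0(1)[OF x] by simp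
  ultimately have "\<forall>\<^sub>F s in at 0. ?e s \<in> transl_dom"
    unfolding eventually_at_topological by blast
  then have "\<forall>\<^sub>F s in at 0. (\<Phi> (transl (?e s)) - \<Phi> x) /\<^sub>R s
       = (left_translation (exp_coord (s *\<^sub>R axis j 1)) f (exp_coord x) - f (exp_coord x)) /\<^sub>R s"
  proof eventually_elim
    case (elim s)
    have "f (exp_coord (transl (?e s))) = \<Phi> (transl (?e s))" using f transl_in[OF elim] by simp
    then show ?case using exp_transl[OF elim] f[OF x] by (simp add: left_translation_def)
  qed
  then have "((\<lambda>s. (left_translation (exp_coord (s *\<^sub>R axis j 1)) f (exp_coord x) - f (exp_coord x)) /\<^sub>R s)
      \<longlongrightarrow> \<Phi>' (generator_field j x)) (at 0)"
    by (rule Lim_transform_eventually[OF lim])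
  then show ?thesis unfolding generator_def by (intro tendsto_Lim) auto
qed

text \<open>Serves the points outside \<Omega>, which the chart does not reach.\<close>

lemma generator_zero:
  assumes W: "open W" "h \<in> W" and f: "\<And>g. g \<in> W \<Longrightarrow> f g = 0"
  shows "generator j f h = 0"
proof -
  let ?u = "\<lambda>s. inv (exp_coord (s *\<^sub>R axis j 1)) \<otimes> h"
  have ball: "s *\<^sub>R (axis j 1 :: real ^ 'd) \<in> ball 0 r" if "s \<in> ball 0 r" for s
    using that by simp
  have c: "continuous_on (ball 0 r) ?u"
    by (intro continuous_intros continuous_on_compose2[OF smooth_into_continuous[OF smooth_into_exp]])
      (use ball in auto)
  have "open (ball 0 r \<inter> ?u -` W)" by (rule continuous_open_preimage[OF c open_ball W(1)])
  moreover have "0 \<in> ball 0 r \<inter> ?u -` W" using r_pos W(2) by (simp add: exp_coord_0 carrier_UNIV)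
  ultimately have "\<forall>\<^sub>F s in at 0. s \<in> ball 0 r \<inter> ?u -` W"
    unfolding eventually_at_topological by blast
  then have "\<forall>\<^sub>F s in at 0. 0 = (left_translation (exp_coord (s *\<^sub>R axis j 1)) f h - f h) /\<^sub>R s"
    by eventually_elim (use f W(2) in \<open>auto simp: left_translation_def\<close>)
  then have "((\<lambda>s. (left_translation (exp_coord (s *\<^sub>R axis j 1)) f h - f h) /\<^sub>R s) \<longlongrightarrow> 0) (at 0)"
    by (rule Lim_transform_eventually[OF tendsto_const])
  then show ?thesis unfolding generator_def by (intro tendsto_Lim) auto
qed

definition lift :: "(real ^ 'd \<Rightarrow> complex) \<Rightarrow> 'g \<Rightarrow> complex"
  where "lift \<Phi> g = (if g \<in> \<Omega> then \<Phi> (log_coord g) else 0)"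

text \<open>Extension by zero commutes with the generators because the function vanishes off the
  closed set \<open>supp\<close>: a point outside \<Omega> then has a whole neighbourhood where the
  extension is zero.\<close>

lemma generator_lift:
  assumes \<Phi>: "\<And>x. x \<in> ball 0 r \<Longrightarrow> (\<Phi> has_derivative \<Phi>' x) (at x)"
    and z: "\<And>x. x \<in> ball 0 r \<Longrightarrow> exp_coord x \<notin> supp \<Longrightarrow> \<Phi> x = 0"
  shows "generator j (lift \<Phi>) = lift (\<lambda>x. \<Phi>' x (generator_field j x))"
proof
  fix g
  show "generator j (lift \<Phi>) g = lift (\<lambda>x. \<Phi>' x (generator_field j x)) g"
  proof (cases "g \<in> \<Omega>")
    case True
    have "generator j (lift \<Phi>) (exp_coord (log_coord g)) = \<Phi>' (log_coord g) (generator_field j (log_coord g))"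
      by (rule generator_exp[where \<Phi> = \<Phi>]) (use exp_log(2)[OF True] exp_in \<Phi> in \<open>auto simp: lift_def simp del: mem_ball_0\<close>)
    then show ?thesis using True exp_log(1)[OF True] by (simp add: lift_def)
  next
    case False
    have "generator j (lift \<Phi>) g = 0"
    proof (rule generator_zero[of "- supp"])
      show "lift \<Phi> g = 0" if "g \<in> - supp" for g
        using that z[of "log_coord g"] exp_log[of g] by (auto simp: lift_def)
    qed (use supp False in auto)
    then show ?thesis using False by (simp add: lift_def)
  qed
qed

end

section \<open>The parametrix\<close>

lemma sum_multi_indices_Suc:
  fixes f :: "'d::finite list \<Rightarrow> 'a::comm_monoid_add"
  shows "(\<Sum>\<gamma>\<in>multi_indices (Suc n). case \<gamma> of [] \<Rightarrow> 0 | k # \<beta> \<Rightarrow> f (k # \<beta>))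
     = (\<Sum>k\<in>UNIV. \<Sum>\<beta>\<in>multi_indices n. f (k # \<beta>))"
proof -
  let ?c = "\<lambda>(k, \<beta>). k # \<beta> :: 'd list"
  have "(\<Sum>\<gamma>\<in>multi_indices (Suc n). case \<gamma> of [] \<Rightarrow> 0 | k # \<beta> \<Rightarrow> f (k # \<beta>))
      = (\<Sum>\<gamma>\<in>?c ` (UNIV \<times> multi_indices n). f \<gamma>)"
    by (rule sum.mono_neutral_cong_right)
      (auto simp: multi_indices_def image_iff split: list.splits intro: finite_multi_indices[unfolded multi_indices_def])
  also have "\<dots> = (\<Sum>p\<in>UNIV \<times> multi_indices n. f (?c p))"
    by (subst sum.reindex) (auto simp: inj_on_def o_def)
  also have "\<dots> = (\<Sum>k\<in>UNIV. \<Sum>\<beta>\<in>multi_indices n. f (k # \<beta>))"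
    by (subst sum.cartesian_product) (simp add: case_prod_beta')
  finally show ?thesis .
qed

context kernel_construction
begin

lemma frechet_derivative_generator_field:
  fixes f :: "real ^ 'd \<Rightarrow> real"
  assumes "(f has_derivative frechet_derivative f (at x)) (at x)"
  shows "frechet_derivative f (at x) (generator_field j x) = (\<Sum>k\<in>UNIV. generator_field j x $ k * frechet_derivative f (at x) (axis k 1))"
proof -
  have lin: "linear (frechet_derivative f (at x))"
    using has_derivative_bounded_linear[OF assms] by (rule bounded_linear.linear)
  have "generator_field j x = (\<Sum>k\<in>UNIV. generator_field j x $ k *\<^sub>R axis k 1)"
    using basis_expansion[of "generator_field j x"] by (simp add: scalar_mult_eq_scaleR)
  then have "frechet_derivative f (at x) (generator_field j x) = frechet_derivative f (at x) (\<Sum>k\<in>UNIV. generator_field j x $ k *\<^sub>R axis k 1)"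
    by simp
  also have "\<dots> = (\<Sum>k\<in>UNIV. generator_field j x $ k * frechet_derivative f (at x) (axis k 1))"
    by (simp add: linear_sum[OF lin] linear_cmul[OF lin])
  finally show ?thesis .
qed

lemma open_off_supp: "open (ball 0 r \<inter> exp_coord -` (- supp))"
  using supp(2) by (intro smooth_into_preimage[OF smooth_into_exp]) auto

text \<open>A normal form with coefficients independent of t. At the origin the field of A_j is
  -e_j, so at top order each generator just prepends its index and contributes a sign; this is the
  exact value of the leading coefficients that \<open>M_expansion\<close> cancels.\<close>

lemma generator_power_K0:
  "\<exists>p :: 'd list \<Rightarrow> real ^ 'd \<Rightarrow> real.
    (\<forall>\<beta>. smooth_on (p \<beta>) (ball 0 r)) \<and>
    (\<forall>\<beta>. \<forall>x\<in>ball 0 r. exp_coord x \<notin> supp \<longrightarrow> p \<beta> x = 0) \<and>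
    (\<forall>\<beta>. length \<beta> > length \<alpha> \<longrightarrow> p \<beta> = (\<lambda>x. 0)) \<and>
    (\<forall>\<beta>. length \<beta> = length \<alpha> \<longrightarrow> p \<beta> 0 = (if \<beta> = \<alpha> then (-1) ^ length \<alpha> else 0)) \<and>
    (\<forall>t>0. generator_power \<alpha> (K0 t) = lift (\<lambda>x. \<Sum>\<beta>\<in>multi_indices (length \<alpha>). of_real (p \<beta> x) * heat_deriv \<beta> t x))"
proof (induction \<alpha>)
  case Nil
  define p where "p \<beta> = (if \<beta> = [] then (\<lambda>x. \<theta> (exp_coord x)) else (\<lambda>x. 0))" for \<beta> :: "'d list"
  have "multi_indices 0 = {[] :: 'd list}" by (auto simp: multi_indices_def)
  moreover have "K_tilde t x = heat_deriv [] t x" if "t > 0" for t x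
    using that by (simp add: K_tilde_def heat_deriv_def integrand_def symbol_def complex_symbol_def inner_vec_def)
  ultimately have "generator_power [] (K0 t) = lift (\<lambda>x. \<Sum>\<beta>\<in>multi_indices (length ([] :: 'd list)). of_real (p \<beta> x) * heat_deriv \<beta> t x)"
    if "t > 0" for t
    using that exp_log(1) by (auto simp: generator_power_def lift_def K0_def p_def fun_eq_iff log_coord_def)
  moreover have "smooth_on (p \<beta>) (ball 0 r)" for \<beta>
    by (simp add: p_def smooth_on_const smooth_function_compose[OF theta_smooth smooth_into_exp])
  ultimately show ?case
    using supp(4) by (intro exI[of _ p]) (auto simp: p_def exp_coord_0 theta_one_at)
next
  case (Cons j \<alpha>)
  let ?n = "length \<alpha>"
  obtain p where sm: "\<And>\<beta>. smooth_on (p \<beta>) (ball 0 r)"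
    and sp: "\<And>\<beta> x. x \<in> ball 0 r \<Longrightarrow> exp_coord x \<notin> supp \<Longrightarrow> p \<beta> x = 0"
    and hi: "\<And>\<beta>. length \<beta> > ?n \<Longrightarrow> p \<beta> = (\<lambda>x. 0)"
    and top: "\<And>\<beta>. length \<beta> = ?n \<Longrightarrow> p \<beta> 0 = (if \<beta> = \<alpha> then (-1) ^ ?n else 0)"
    and eq: "\<And>t. t > 0 \<Longrightarrow> generator_power \<alpha> (K0 t) = lift (\<lambda>x. \<Sum>\<beta>\<in>multi_indices ?n. of_real (p \<beta> x) * heat_deriv \<beta> t x)"
    using Cons by blast
  let ?Dp = "\<lambda>\<beta> x. frechet_derivative (p \<beta>) (at x)"
  \<comment> \<open>Product rule: \<open>a\<close> collects the terms in which the generator hits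
    the coefficient, \<open>b\<close> those in which it hits the kernel and lengthens the
    multi-index by one.\<close>
  define a where "a \<gamma> x = (\<Sum>k\<in>UNIV. generator_field j x $ k * ?Dp \<gamma> x (axis k 1))" for \<gamma> x
  define b where "b \<gamma> x = (case \<gamma> of [] \<Rightarrow> 0 | k # \<beta> \<Rightarrow> generator_field j x $ k * p \<beta> x)" for \<gamma> x
  define p' where "p' \<gamma> x = a \<gamma> x + b \<gamma> x" for \<gamma> x
  have Dp: "(p \<beta> has_derivative ?Dp \<beta> x) (at x)" if "x \<in> ball 0 r" for \<beta> x
    using smooth_on_has_derivative[OF sm that] .
  have a: "a \<gamma> x = ?Dp \<gamma> x (generator_field j x)" if "x \<in> ball 0 r" for \<gamma> x
    using frechet_derivative_generator_field[OF Dp[OF that]] by (simp add: a_def)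
  have a_hi: "a \<gamma> x = 0" if "length \<gamma> > ?n" for \<gamma> x
    using hi[OF that] by (simp add: a_def)
  have "smooth_on (p' \<gamma>) (ball 0 r)" for \<gamma>
  proof -
    have "smooth_on (a \<gamma>) (ball 0 r)"
      unfolding a_def[abs_def] by (intro smooth_on_sum smooth_on_mult smooth_on_frechet sm smooth_generator_field open_ball)
    moreover have "smooth_on (b \<gamma>) (ball 0 r)"
      unfolding b_def[abs_def] by (cases \<gamma>) (auto intro!: smooth_on_mult sm smooth_generator_field smooth_on_const)
    ultimately show ?thesis unfolding p'_def[abs_def] by (intro smooth_on_add open_ball)
  qed
  moreover have "p' \<gamma> x = 0" if x: "x \<in> ball 0 r" "exp_coord x \<notin> supp" for \<gamma> x
  proof -
    have "(p \<gamma> has_derivative (\<lambda>v. 0)) (at x)"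
      by (rule has_derivative_transform_within_open[OF has_derivative_const open_off_supp]) (use sp x in auto)
    then have "?Dp \<gamma> x = (\<lambda>v. 0)" by (rule frechet_derivative_at')
    then show ?thesis using sp[OF x] by (simp add: p'_def a_def b_def split: list.splits)
  qed
  moreover have "p' \<gamma> = (\<lambda>x. 0)" if "length \<gamma> > length (j # \<alpha>)" for \<gamma>
    using that hi a_hi[of \<gamma>] by (auto simp: fun_eq_iff p'_def b_def split: list.splits)
  moreover have "p' \<gamma> 0 = (if \<gamma> = j # \<alpha> then (-1) ^ length (j # \<alpha>) else 0)" if l: "length \<gamma> = length (j # \<alpha>)" for \<gamma>
  proof -
    obtain k \<beta> where \<gamma>: "\<gamma> = k # \<beta>" "length \<beta> = ?n" using l by (cases \<gamma>) auto
    have "p' \<gamma> 0 = generator_field j 0 $ k * p \<beta> 0" using l by (simp add: p'_def a_hi b_def \<gamma>(1))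
    then show ?thesis using top[OF \<gamma>(2)] by (auto simp: generator_field_0 \<gamma>(1) axis_def)
  qed
  moreover have "generator_power (j # \<alpha>) (K0 t) = lift (\<lambda>x. \<Sum>\<beta>\<in>multi_indices (length (j # \<alpha>)). of_real (p' \<beta> x) * heat_deriv \<beta> t x)"
    if t: "t > 0" for t
  proof -
    let ?\<Phi> = "\<lambda>x. \<Sum>\<beta>\<in>multi_indices ?n. of_real (p \<beta> x) * heat_deriv \<beta> t x"
    let ?\<Phi>' = "\<lambda>x v. \<Sum>\<beta>\<in>multi_indices ?n. of_real (p \<beta> x) * (\<Sum>k\<in>UNIV. of_real (v $ k) * heat_deriv (k # \<beta>) t x)
        + of_real (?Dp \<beta> x v) * heat_deriv \<beta> t x"
    have "generator_power (j # \<alpha>) (K0 t) = generator j (lift ?\<Phi>)"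
      using eq[OF t] by (simp add: generator_power_def)
    also have "\<dots> = lift (\<lambda>x. ?\<Phi>' x (generator_field j x))"
    proof (rule generator_lift)
      show "(?\<Phi> has_derivative ?\<Phi>' x) (at x)" if "x \<in> ball 0 r" for x
        by (intro has_derivative_sum has_derivative_mult has_derivative_of_real Dp[OF that] heat_deriv_has_derivative[OF t])
      show "?\<Phi> x = 0" if "x \<in> ball 0 r" "exp_coord x \<notin> supp" for x
        using sp[OF that] by simp
    qed
    also have "\<dots> = lift (\<lambda>x. \<Sum>\<gamma>\<in>multi_indices (length (j # \<alpha>)). of_real (p' \<gamma> x) * heat_deriv \<gamma> t x)"
    proof
      fix g
      show "lift (\<lambda>x. ?\<Phi>' x (generator_field j x)) g = lift (\<lambda>x. \<Sum>\<gamma>\<in>multi_indices (length (j # \<alpha>)). of_real (p' \<gamma> x) * heat_deriv \<gamma> t x) g"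
      proof (cases "g \<in> \<Omega>")
        case True
        define x where "x = log_coord g"
        have x: "x \<in> ball 0 r" using exp_log(2)[OF True] by (simp add: x_def)
        let ?F = "\<lambda>\<gamma>. of_real (generator_field j x $ hd \<gamma> * p (tl \<gamma>) x) * heat_deriv \<gamma> t x"
        have "(\<Sum>\<gamma>\<in>multi_indices (Suc ?n). of_real (p' \<gamma> x) * heat_deriv \<gamma> t x)
          = (\<Sum>\<gamma>\<in>multi_indices (Suc ?n). of_real (a \<gamma> x) * heat_deriv \<gamma> t x)
            + (\<Sum>\<gamma>\<in>multi_indices (Suc ?n). of_real (b \<gamma> x) * heat_deriv \<gamma> t x)"
          by (simp add: p'_def distrib_right sum.distrib)
        also have "(\<Sum>\<gamma>\<in>multi_indices (Suc ?n). of_real (a \<gamma> x) * heat_deriv \<gamma> t x)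
           = (\<Sum>\<gamma>\<in>multi_indices ?n. of_real (?Dp \<gamma> x (generator_field j x)) * heat_deriv \<gamma> t x)"
          by (rule sum.mono_neutral_cong_right)
            (auto simp: multi_indices_def a_hi a[OF x, symmetric] intro: finite_multi_indices[unfolded multi_indices_def])
        also have "(\<Sum>\<gamma>\<in>multi_indices (Suc ?n). of_real (b \<gamma> x) * heat_deriv \<gamma> t x)
           = (\<Sum>\<gamma>\<in>multi_indices (Suc ?n). case \<gamma> of [] \<Rightarrow> 0 | k # \<beta> \<Rightarrow> ?F (k # \<beta>))"
          by (intro sum.cong refl) (auto simp: b_def split: list.splits)
        also have "\<dots> = (\<Sum>k\<in>UNIV. \<Sum>\<beta>\<in>multi_indices ?n. ?F (k # \<beta>))"
          by (rule sum_multi_indices_Suc)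
        also have "\<dots> = (\<Sum>\<beta>\<in>multi_indices ?n. of_real (p \<beta> x) * (\<Sum>k\<in>UNIV. of_real (generator_field j x $ k) * heat_deriv (k # \<beta>) t x))"
          by (subst sum.swap) (simp add: sum_distrib_left mult_ac)
        finally show ?thesis using True by (simp add: lift_def sum.distrib add.commute flip: x_def)
      qed (simp add: lift_def)
    qed
    finally show ?thesis .
  qed
  ultimately show ?case by (intro exI[of _ p']) blast
qed

section \<open>Bounds for the coefficients and the expansion of M\<close>

lemma supp_radius: "\<exists>r'. 0 < r' \<and> r' < r \<and> (\<forall>x\<in>ball 0 r. exp_coord x \<in> supp \<longrightarrow> norm x \<le> r')"
proof -
  have cl: "compact (log_coord ` supp)"
    using supp(1,3) continuous_log by (intro compact_continuous_image) (auto intro: continuous_on_subset)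
  have sub: "log_coord ` supp \<subseteq> ball 0 r" using supp(3) exp_log(2) by blast
  have c: "compact (norm ` log_coord ` supp)"
    by (rule compact_continuous_image[OF continuous_on_norm[OF continuous_on_id] cl])
  \<comment> \<open>The maximum with r/2 keeps the radius positive, whatever the cut-off is.\<close>
  define r' where "r' = max (r / 2) (Sup (norm ` log_coord ` supp))"
  have ne: "norm ` log_coord ` supp \<noteq> {}"
    using supp(4)[of \<one>] theta_one_at by force
  have "Sup (norm ` log_coord ` supp) \<in> norm ` log_coord ` supp"
    using compact_imp_closed[OF c] compact_imp_bounded[OF c] ne
    by (intro closed_contains_Sup) (auto simp: bounded_imp_bdd_above)
  then have "r' < r" using sub r_pos by (auto simp: r'_def)
  moreover have "norm x \<le> r'" if "x \<in> ball 0 r" "exp_coord x \<in> supp" for x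
  proof -
    have "norm x \<in> norm ` log_coord ` supp" using log_exp[OF that(1)] that(2) by (metis image_eqI)
    then have "norm x \<le> Sup (norm ` log_coord ` supp)"
      using compact_imp_bounded[OF c] by (intro cSup_upper bounded_imp_bdd_above)
    then show ?thesis by (simp add: r'_def)
  qed
  ultimately show ?thesis using r_pos by (intro exI[of _ r']) (auto simp: r'_def)
qed

text \<open>The ball is open and the function may be defined arbitrarily outside, so compactness is
  applied to a smaller closed ball that contains the support; the Lipschitz bound comes from the
  partial derivatives on that convex set.\<close>

lemma smooth_supported_bound:
  assumes f: "smooth_on f (ball 0 r)" and z: "\<And>x. x \<in> ball 0 r \<Longrightarrow> exp_coord x \<notin> supp \<Longrightarrow> f x = 0"
  shows "\<exists>B\<ge>0. \<forall>x\<in>ball 0 r. \<bar>f x\<bar> \<le> B \<and> \<bar>f x - f 0\<bar> \<le> B * norm x"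
proof -
  obtain r' where r': "0 < r'" "r' < r" "\<And>x. x \<in> ball 0 r \<Longrightarrow> exp_coord x \<in> supp \<Longrightarrow> norm x \<le> r'"
    using supp_radius by blast
  let ?C = "cball (0 :: real ^ 'd) r'"
  have sub: "?C \<subseteq> ball 0 r" using r' by auto
  have bd: "\<exists>B\<ge>0. \<forall>x\<in>?C. \<bar>g x\<bar> \<le> B" if "smooth_on g (ball 0 r)" for g :: "real ^ 'd \<Rightarrow> real"
  proof -
    have "compact (g ` ?C)"
      by (intro compact_continuous_image continuous_on_subset[OF smooth_on_continuous[OF that] sub]) auto
    then obtain B where "\<forall>y\<in>g ` ?C. norm y \<le> B"
      using compact_imp_bounded bounded_iff by blast
    then show ?thesis by (intro exI[of _ "\<bar>B\<bar>"]) auto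
  qed
  obtain B0 where B0: "B0 \<ge> 0" "\<And>x. x \<in> ?C \<Longrightarrow> \<bar>f x\<bar> \<le> B0" using bd[OF f] by blast
  have "\<forall>k. \<exists>B\<ge>0. \<forall>x\<in>?C. \<bar>frechet_derivative f (at x) (axis k 1)\<bar> \<le> B"
    using bd[OF smooth_on_frechet[OF f]] by blast
  then obtain B where B: "\<And>k. B k \<ge> 0" "\<And>k x. x \<in> ?C \<Longrightarrow> \<bar>frechet_derivative f (at x) (axis k 1)\<bar> \<le> B k"
    by metis
  define B1 where "B1 = (\<Sum>k\<in>UNIV. B k)"
  have D: "(f has_derivative frechet_derivative f (at x)) (at x)" if "x \<in> ?C" for x
    using smooth_on_has_derivative[OF f] sub that by blast
  have lip: "\<bar>f x - f 0\<bar> \<le> B1 * norm x" if x: "x \<in> ?C" for x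
  proof -
    have "norm (f x - f 0) \<le> B1 * norm (x - 0)"
    proof (rule differentiable_bound[OF convex_cball _ _ x])
      fix y assume y: "y \<in> ?C"
      show "(f has_derivative frechet_derivative f (at y)) (at y within ?C)"
        by (rule has_derivative_at_withinI[OF D[OF y]])
      have lin: "linear (frechet_derivative f (at y))"
        using has_derivative_bounded_linear[OF D[OF y]] by (rule bounded_linear.linear)
      show "onorm (frechet_derivative f (at y)) \<le> B1"
      proof (rule onorm_le)
        fix v :: "real ^ 'd"
        have "v = (\<Sum>k\<in>UNIV. v $ k *\<^sub>R axis k 1)"
          using basis_expansion[of v] by (simp add: scalar_mult_eq_scaleR)
        then have "frechet_derivative f (at y) v = frechet_derivative f (at y) (\<Sum>k\<in>UNIV. v $ k *\<^sub>R axis k 1)"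
          by simp
        also have "\<dots> = (\<Sum>k\<in>UNIV. v $ k * frechet_derivative f (at y) (axis k 1))"
          by (simp add: linear_sum[OF lin] linear_cmul[OF lin])
        also have "norm \<dots> \<le> (\<Sum>k\<in>UNIV. norm v * B k)"
          by (intro order_trans[OF norm_sum] sum_mono) (auto simp: abs_mult intro!: mult_mono component_le_norm_cart B y)
        finally show "norm (frechet_derivative f (at y) v) \<le> B1 * norm v"
          by (simp add: B1_def sum_distrib_left mult.commute)
      qed
    qed (use r' in auto)
    then show ?thesis by simp
  qed
  have B1: "B1 \<ge> 0" by (simp add: B1_def B sum_nonneg)
  \<comment> \<open>The last summand handles x beyond r', where f vanishes and |f 0| has to be
    compared with |x| \<ge> r'.\<close>
  define Q where "Q = B0 + B1 + \<bar>f 0\<bar> / r'"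
  have "\<bar>f x\<bar> \<le> Q \<and> \<bar>f x - f 0\<bar> \<le> Q * norm x" if x: "x \<in> ball 0 r" for x
  proof (cases "norm x \<le> r'")
    case True
    have q: "0 \<le> \<bar>f 0\<bar> / r'" using r' by simp
    have "B1 * norm x \<le> Q * norm x" using B0 B1 q by (intro mult_right_mono) (auto simp: Q_def)
    then show ?thesis using B0(2)[of x] lip[of x] True B1 q by (auto simp: Q_def)
  next
    case False
    then have "f x = 0" using z[OF x] r'(3)[OF x] by blast
    moreover have "\<bar>f 0\<bar> \<le> Q * norm x"
    proof -
      have "\<bar>f 0\<bar> = (\<bar>f 0\<bar> / r') * r'" using r' by simp
      also have "\<dots> \<le> Q * norm x"
        using False B0 B1 r' by (intro mult_mono) (auto simp: Q_def)
      finally show ?thesis .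
    qed
    moreover have "0 \<le> Q" using B0 B1 r' by (simp add: Q_def)
    ultimately show ?thesis by simp
  qed
  moreover have "Q \<ge> 0" using B0 B1 r' by (simp add: Q_def)
  ultimately show ?thesis by blast
qed

text \<open>The sum in \<open>q\<close> comes from H, the subtracted term from the time derivative
  through the heat equation. For |\<beta>| = m only \<alpha> = \<beta> contributes at the origin,
  and as \<theta>(e) = 1 the two terms cancel there; smoothness then makes these coefficients
  O(|x|).\<close>

lemma M_expansion:
  "\<exists>q Q. Q \<ge> 0 \<and> (\<forall>\<beta>. continuous_on (ball 0 r) (q \<beta>)) \<and>
    (\<forall>\<beta>. \<forall>x\<in>ball 0 r. exp_coord x \<notin> supp \<longrightarrow> q \<beta> x = 0) \<and>
    (\<forall>\<beta>\<in>multi_indices m. \<forall>x\<in>ball 0 r. norm (q \<beta> x) \<le> Q \<and> (length \<beta> = m \<longrightarrow> norm (q \<beta> x) \<le> Q * norm x)) \<and>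
    (\<forall>t>0. M t = lift (\<lambda>x. \<Sum>\<beta>\<in>multi_indices m. q \<beta> x * heat_deriv \<beta> t x))"
proof -
  have "\<exists>P :: 'd list \<Rightarrow> 'd list \<Rightarrow> real ^ 'd \<Rightarrow> real. \<forall>\<alpha>. (\<forall>\<beta>. smooth_on (P \<alpha> \<beta>) (ball 0 r)) \<and>
    (\<forall>\<beta>. \<forall>x\<in>ball 0 r. exp_coord x \<notin> supp \<longrightarrow> P \<alpha> \<beta> x = 0) \<and>
    (\<forall>\<beta>. length \<beta> > length \<alpha> \<longrightarrow> P \<alpha> \<beta> = (\<lambda>x. 0)) \<and>
    (\<forall>\<beta>. length \<beta> = length \<alpha> \<longrightarrow> P \<alpha> \<beta> 0 = (if \<beta> = \<alpha> then (-1) ^ length \<alpha> else 0)) \<and>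
    (\<forall>t>0. generator_power \<alpha> (K0 t) = lift (\<lambda>x. \<Sum>\<beta>\<in>multi_indices (length \<alpha>). of_real (P \<alpha> \<beta> x) * heat_deriv \<beta> t x))"
    by (intro choice allI generator_power_K0)
  then obtain P :: "'d list \<Rightarrow> 'd list \<Rightarrow> real ^ 'd \<Rightarrow> real" where
    sm: "\<And>\<alpha> \<beta>. smooth_on (P \<alpha> \<beta>) (ball 0 r)"
    and sp: "\<And>\<alpha> \<beta> x. x \<in> ball 0 r \<Longrightarrow> exp_coord x \<notin> supp \<Longrightarrow> P \<alpha> \<beta> x = 0"
    and hi: "\<And>\<alpha> \<beta>. length \<beta> > length \<alpha> \<Longrightarrow> P \<alpha> \<beta> = (\<lambda>x. 0)"
    and top: "\<And>\<alpha> \<beta>. length \<beta> = length \<alpha> \<Longrightarrow> P \<alpha> \<beta> 0 = (if \<beta> = \<alpha> then (-1) ^ length \<alpha> else 0)"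
    and eq: "\<And>\<alpha> t. t > 0 \<Longrightarrow> generator_power \<alpha> (K0 t) = lift (\<lambda>x. \<Sum>\<beta>\<in>multi_indices (length \<alpha>). of_real (P \<alpha> \<beta> x) * heat_deriv \<beta> t x)"
    by blast
  let ?th = "\<lambda>x. \<theta> (exp_coord x)"
  have th: "smooth_on ?th (ball 0 r)" by (rule smooth_function_compose[OF theta_smooth smooth_into_exp])
  define q where "q \<beta> x = (\<Sum>\<alpha>\<in>multi_indices m. c \<alpha> * of_real (P \<alpha> \<beta> x)) - c \<beta> * (-1) ^ length \<beta> * of_real (?th x)" for \<beta> x
  have "\<exists>B. \<forall>\<alpha> \<beta>. B \<alpha> \<beta> \<ge> 0 \<and> (\<forall>x\<in>ball 0 r. \<bar>P \<alpha> \<beta> x\<bar> \<le> B \<alpha> \<beta> \<and> \<bar>P \<alpha> \<beta> x - P \<alpha> \<beta> 0\<bar> \<le> B \<alpha> \<beta> * norm x)"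
    by (intro choice allI smooth_supported_bound[OF sm sp])
  then obtain B where B: "\<And>\<alpha> \<beta>. B \<alpha> \<beta> \<ge> 0" "\<And>\<alpha> \<beta> x. x \<in> ball 0 r \<Longrightarrow> \<bar>P \<alpha> \<beta> x\<bar> \<le> B \<alpha> \<beta> \<and> \<bar>P \<alpha> \<beta> x - P \<alpha> \<beta> 0\<bar> \<le> B \<alpha> \<beta> * norm x"
    by blast
  obtain B' where B': "B' \<ge> 0" "\<And>x. x \<in> ball 0 r \<Longrightarrow> \<bar>?th x\<bar> \<le> B' \<and> \<bar>?th x - ?th 0\<bar> \<le> B' * norm x"
    using smooth_supported_bound[OF th] supp(4) by blast
  define Q\<beta> where "Q\<beta> \<beta> = (\<Sum>\<alpha>\<in>multi_indices m. norm (c \<alpha>) * B \<alpha> \<beta>) + norm (c \<beta>) * B'" for \<beta>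
  have Q\<beta>: "Q\<beta> \<beta> \<ge> 0" for \<beta> using B B' by (auto simp: Q\<beta>_def intro!: add_nonneg_nonneg sum_nonneg)
  define Q where "Q = (\<Sum>\<beta>\<in>multi_indices m. Q\<beta> \<beta>)"
  have Q: "Q \<ge> 0" "\<And>\<beta>. \<beta> \<in> multi_indices m \<Longrightarrow> Q\<beta> \<beta> \<le> Q"
    using Q\<beta> by (auto simp: Q_def intro!: sum_nonneg member_le_sum)
  have qb: "norm (q \<beta> x) \<le> Q\<beta> \<beta>" if "x \<in> ball 0 r" for \<beta> x
    unfolding q_def Q\<beta>_def
    by (intro order_trans[OF norm_triangle_ineq4] add_mono sum_norm_le)
      (use B B' that in \<open>auto simp: norm_mult norm_power intro!: mult_left_mono\<close>)
  have q0: "q \<beta> 0 = 0" if l: "length \<beta> = m" for \<beta>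
  proof -
    have "(\<Sum>\<alpha>\<in>multi_indices m. c \<alpha> * of_real (P \<alpha> \<beta> 0)) = (\<Sum>\<alpha>\<in>multi_indices m. if \<alpha> = \<beta> then c \<beta> * (-1) ^ length \<beta> else 0)"
    proof (rule sum.cong[OF refl])
      fix \<alpha> :: "'d list" assume "\<alpha> \<in> multi_indices m"
      then consider "length \<alpha> < length \<beta>" | "length \<alpha> = length \<beta>" using l by (force simp: multi_indices_def)
      then show "c \<alpha> * of_real (P \<alpha> \<beta> 0) = (if \<alpha> = \<beta> then c \<beta> * (-1) ^ length \<beta> else 0)"
        by cases (auto simp: hi top)
    qed
    also have "\<dots> = c \<beta> * (-1) ^ length \<beta>" using l by (simp add: multi_indices_def finite_multi_indices[unfolded multi_indices_def])
    finally show ?thesis by (simp add: q_def exp_coord_0 theta_one_at)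
  qed
  have ql: "norm (q \<beta> x) \<le> Q\<beta> \<beta> * norm x" if x: "x \<in> ball 0 r" and l: "length \<beta> = m" for \<beta> x
  proof -
    have "q \<beta> x = q \<beta> x - q \<beta> 0" using q0[OF l] by simp
    also have "\<dots> = (\<Sum>\<alpha>\<in>multi_indices m. c \<alpha> * of_real (P \<alpha> \<beta> x - P \<alpha> \<beta> 0)) - c \<beta> * (-1) ^ length \<beta> * of_real (?th x - ?th 0)"
      by (simp add: q_def right_diff_distrib sum_subtractf)
    also have "norm \<dots> \<le> (\<Sum>\<alpha>\<in>multi_indices m. norm (c \<alpha>) * (B \<alpha> \<beta> * norm x)) + norm (c \<beta>) * (B' * norm x)"
      by (intro order_trans[OF norm_triangle_ineq4] add_mono sum_norm_le)
        (use B B' x in \<open>auto simp: norm_mult norm_power simp flip: of_real_diff intro!: mult_left_mono\<close>)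
    also have "\<dots> = Q\<beta> \<beta> * norm x" by (simp add: Q\<beta>_def distrib_right sum_distrib_right mult.assoc)
    finally show ?thesis .
  qed
  have Meq: "M t = lift (\<lambda>x. \<Sum>\<beta>\<in>multi_indices m. q \<beta> x * heat_deriv \<beta> t x)" if t: "t > 0" for t
  proof
    fix g
    have H: "H (K0 t) g = (\<Sum>\<alpha>\<in>multi_indices m. c \<alpha> * lift (\<lambda>x. \<Sum>\<beta>\<in>multi_indices m. of_real (P \<alpha> \<beta> x) * heat_deriv \<beta> t x) g)"
      unfolding H_def
    proof (rule sum.cong[OF refl])
      fix \<alpha> :: "'d list" assume \<alpha>: "\<alpha> \<in> multi_indices m"
      have "(\<Sum>\<beta>\<in>multi_indices (length \<alpha>). of_real (P \<alpha> \<beta> x) * heat_deriv \<beta> t x) = (\<Sum>\<beta>\<in>multi_indices m. of_real (P \<alpha> \<beta> x) * heat_deriv \<beta> t x)" for x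
        by (rule sum.mono_neutral_left) (use \<alpha> hi in \<open>auto simp: multi_indices_def intro: finite_multi_indices[unfolded multi_indices_def]\<close>)
      then show "c \<alpha> * generator_power \<alpha> (K0 t) g = c \<alpha> * lift (\<lambda>x. \<Sum>\<beta>\<in>multi_indices m. of_real (P \<alpha> \<beta> x) * heat_deriv \<beta> t x) g"
        by (simp add: eq[OF t])
    qed
    show "M t g = lift (\<lambda>x. \<Sum>\<beta>\<in>multi_indices m. q \<beta> x * heat_deriv \<beta> t x) g"
    proof (cases "g \<in> \<Omega>")
      case True
      define x where "x = log_coord g"
      have gx: "g = exp_coord x" using exp_log(1)[OF True] by (simp add: x_def)
      have K0: "K0 s g = of_real (\<theta> g) * heat_deriv [] s x" if "s > 0" for s
        using that True by (simp add: K0_def x_def log_coord_def K_tilde_def heat_deriv_def integrand_def symbol_def complex_symbol_def inner_vec_def)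
      let ?d = "of_real (\<theta> g) * (- (\<Sum>\<beta>\<in>multi_indices m. c \<beta> * (-1) ^ length \<beta> * heat_deriv \<beta> t x))"
      have "((\<lambda>s. of_real (\<theta> g) * heat_deriv [] s x) has_vector_derivative ?d) (at t)"
        by (intro has_vector_derivative_mult_right heat_deriv_time_derivative t)
      then have "((\<lambda>s. K0 s g) has_vector_derivative ?d) (at t)"
        by (rule has_vector_derivative_transform_within_open[OF _ open_greaterThan[of 0]]) (use t K0 in auto)
      then have "M t g = ?d + (\<Sum>\<alpha>\<in>multi_indices m. c \<alpha> * (\<Sum>\<beta>\<in>multi_indices m. of_real (P \<alpha> \<beta> x) * heat_deriv \<beta> t x))"
        using t True by (simp add: M_def H vector_derivative_at lift_def x_def)
      also have "\<dots> = (\<Sum>\<beta>\<in>multi_indices m. q \<beta> x * heat_deriv \<beta> t x)"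
      proof -
        have "(\<Sum>\<alpha>\<in>multi_indices m. c \<alpha> * (\<Sum>\<beta>\<in>multi_indices m. of_real (P \<alpha> \<beta> x) * heat_deriv \<beta> t x))
          = (\<Sum>\<beta>\<in>multi_indices m. (\<Sum>\<alpha>\<in>multi_indices m. c \<alpha> * of_real (P \<alpha> \<beta> x)) * heat_deriv \<beta> t x)"
          unfolding sum_distrib_left sum_distrib_right mult.assoc by (rule sum.swap)
        moreover have "?d = - (\<Sum>\<beta>\<in>multi_indices m. c \<beta> * (-1) ^ length \<beta> * of_real (?th x) * heat_deriv \<beta> t x)"
          unfolding gx by (simp add: sum_distrib_left mult_ac)
        ultimately show ?thesis by (simp add: q_def left_diff_distrib sum_subtractf)
      qed
      finally show ?thesis using True by (simp add: lift_def x_def)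
    next
      case False
      then have "(\<lambda>s. K0 s g) = (\<lambda>s. 0)" by (simp add: K0_def)
      then show ?thesis using False t by (simp add: M_def H lift_def vector_derivative_const_at)
    qed
  qed
  have "continuous_on (ball 0 r) (q \<beta>)" for \<beta>
    unfolding q_def[abs_def] by (intro continuous_intros smooth_on_continuous sm th)
  moreover have "q \<beta> x = 0" if "x \<in> ball 0 r" "exp_coord x \<notin> supp" for \<beta> x
    using sp[OF that] supp(4)[OF that(2)] by (simp add: q_def)
  moreover have "norm (q \<beta> x) \<le> Q \<and> (length \<beta> = m \<longrightarrow> norm (q \<beta> x) \<le> Q * norm x)"
    if "\<beta> \<in> multi_indices m" "x \<in> ball 0 r" for \<beta> x
    using order_trans[OF qb[OF that(2)] Q(2)[OF that(1)]] order_trans[OF ql[OF that(2)] mult_right_mono[OF Q(2)[OF that(1)] norm_ge_zero]]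
    by blast
  ultimately show ?thesis using Q(1) Meq by (intro exI[of _ q] exI[of _ Q]) blast
qed

end

section \<open>The modulus\<close>

lemma division_real_interval:
  fixes k :: "real set"
  assumes "D division_of S" "k \<in> D"
  shows "k = {Inf k..Sup k}" "Inf k \<le> Sup k" "Inf k \<in> S" "Sup k \<in> S"
proof -
  obtain a b where k: "k = cbox a b" using division_ofD(4)[OF assms] by blast
  then have ab: "a \<le> b" using division_ofD(3)[OF assms] by (auto simp: not_less)
  show 1: "k = {Inf k..Sup k}" "Inf k \<le> Sup k" using k ab by simp_all
  show "Inf k \<in> S" "Sup k \<in> S" using 1 division_ofD(2)[OF assms] by (metis atLeastAtMost_iff order_refl subsetD)+
qed

lemma absolutely_continuous_on_cong:
  assumes "absolutely_continuous_on u v f" "\<And>x. x \<in> {u..v} \<Longrightarrow> f x = g x"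
  shows "absolutely_continuous_on u v g"
  unfolding absolutely_continuous_on_def
proof (intro allI impI)
  fix \<epsilon> :: real assume "\<epsilon> > 0"
  then obtain \<delta> where \<delta>: "\<delta> > 0" "\<And>D S. D division_of S \<and> S \<subseteq> {u..v} \<and> (\<Sum>k\<in>D. Sup k - Inf k) < \<delta> \<Longrightarrow>
        (\<Sum>k\<in>D. \<bar>f (Sup k) - f (Inf k)\<bar>) < \<epsilon>"
    using assms(1) unfolding absolutely_continuous_on_def by blast
  have "(\<Sum>k\<in>D. \<bar>g (Sup k) - g (Inf k)\<bar>) < \<epsilon>"
    if D: "D division_of S \<and> S \<subseteq> {u..v} \<and> (\<Sum>k\<in>D. Sup k - Inf k) < \<delta>" for D S
  proof -
    have "(\<Sum>k\<in>D. \<bar>g (Sup k) - g (Inf k)\<bar>) = (\<Sum>k\<in>D. \<bar>f (Sup k) - f (Inf k)\<bar>)"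
    proof (rule sum.cong[OF refl])
      fix k assume k: "k \<in> D"
      have "Inf k \<in> {u..v}" "Sup k \<in> {u..v}"
        using D division_real_interval(3,4)[of D S k] k by blast+
      then show "\<bar>g (Sup k) - g (Inf k)\<bar> = \<bar>f (Sup k) - f (Inf k)\<bar>" using assms(2) by simp
    qed
    then show ?thesis using \<delta>(2)[OF D] by simp
  qed
  then show "\<exists>\<delta>>0. \<forall>D S. D division_of S \<and> S \<subseteq> {u..v} \<and> (\<Sum>k\<in>D. Sup k - Inf k) < \<delta> \<longrightarrow>
        (\<Sum>k\<in>D. \<bar>g (Sup k) - g (Inf k)\<bar>) < \<epsilon>"
    using \<delta>(1) by blast
qed

lemma absolutely_continuous_on_add:
  assumes f: "absolutely_continuous_on u v f" and g: "absolutely_continuous_on u v g"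
  shows "absolutely_continuous_on u v (\<lambda>x. f x + g x)"
  unfolding absolutely_continuous_on_def
proof (intro allI impI)
  fix \<epsilon> :: real assume "\<epsilon> > 0"
  then have e: "\<epsilon> / 2 > 0" by simp
  obtain \<delta>1 where \<delta>1: "\<delta>1 > 0" "\<And>D S. D division_of S \<and> S \<subseteq> {u..v} \<and> (\<Sum>k\<in>D. Sup k - Inf k) < \<delta>1 \<Longrightarrow>
        (\<Sum>k\<in>D. \<bar>f (Sup k) - f (Inf k)\<bar>) < \<epsilon> / 2"
    using f e unfolding absolutely_continuous_on_def by blast
  obtain \<delta>2 where \<delta>2: "\<delta>2 > 0" "\<And>D S. D division_of S \<and> S \<subseteq> {u..v} \<and> (\<Sum>k\<in>D. Sup k - Inf k) < \<delta>2 \<Longrightarrow>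
        (\<Sum>k\<in>D. \<bar>g (Sup k) - g (Inf k)\<bar>) < \<epsilon> / 2"
    using g e unfolding absolutely_continuous_on_def by blast
  have "(\<Sum>k\<in>D. \<bar>(f (Sup k) + g (Sup k)) - (f (Inf k) + g (Inf k))\<bar>) < \<epsilon>"
    if D: "D division_of S \<and> S \<subseteq> {u..v} \<and> (\<Sum>k\<in>D. Sup k - Inf k) < min \<delta>1 \<delta>2" for D S
  proof -
    have "(\<Sum>k\<in>D. \<bar>(f (Sup k) + g (Sup k)) - (f (Inf k) + g (Inf k))\<bar>)
      \<le> (\<Sum>k\<in>D. \<bar>f (Sup k) - f (Inf k)\<bar> + \<bar>g (Sup k) - g (Inf k)\<bar>)"
      by (intro sum_mono) linarith
    also have "\<dots> < \<epsilon>"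
      using \<delta>1(2)[of D S] \<delta>2(2)[of D S] D by (simp add: sum.distrib)
    finally show ?thesis .
  qed
  then show "\<exists>\<delta>>0. \<forall>D S. D division_of S \<and> S \<subseteq> {u..v} \<and> (\<Sum>k\<in>D. Sup k - Inf k) < \<delta> \<longrightarrow>
        (\<Sum>k\<in>D. \<bar>(f (Sup k) + g (Sup k)) - (f (Inf k) + g (Inf k))\<bar>) < \<epsilon>"
    using \<delta>1(1) \<delta>2(1) by (intro exI[of _ "min \<delta>1 \<delta>2"]) auto
qed

lemma absolutely_continuous_on_lipschitz:
  assumes "\<And>x y. x \<in> {u..v} \<Longrightarrow> y \<in> {u..v} \<Longrightarrow> \<bar>f x - f y\<bar> \<le> L * \<bar>x - y\<bar>"
  shows "absolutely_continuous_on u v f"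
  unfolding absolutely_continuous_on_def
proof (intro allI impI)
  fix \<epsilon> :: real assume "\<epsilon> > 0"
  define \<delta> where "\<delta> = \<epsilon> / (\<bar>L\<bar> + 1)"
  have \<delta>: "\<delta> > 0" using \<open>\<epsilon> > 0\<close> by (simp add: \<delta>_def add_nonneg_pos)
  have "(\<Sum>k\<in>D. \<bar>f (Sup k) - f (Inf k)\<bar>) < \<epsilon>"
    if D: "D division_of S \<and> S \<subseteq> {u..v} \<and> (\<Sum>k\<in>D. Sup k - Inf k) < \<delta>" for D S
  proof -
    have "(\<Sum>k\<in>D. \<bar>f (Sup k) - f (Inf k)\<bar>) \<le> (\<Sum>k\<in>D. (\<bar>L\<bar> + 1) * (Sup k - Inf k))"
    proof (rule sum_mono)
      fix k assume k: "k \<in> D"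
      note * = division_real_interval[of D S k]
      have "\<bar>f (Sup k) - f (Inf k)\<bar> \<le> L * \<bar>Sup k - Inf k\<bar>"
        using D * k by (intro assms) blast+
      also have "\<dots> \<le> (\<bar>L\<bar> + 1) * \<bar>Sup k - Inf k\<bar>" by (intro mult_right_mono) auto
      finally show "\<bar>f (Sup k) - f (Inf k)\<bar> \<le> (\<bar>L\<bar> + 1) * (Sup k - Inf k)"
        using * D k by simp
    qed
    also have "\<dots> = (\<bar>L\<bar> + 1) * (\<Sum>k\<in>D. Sup k - Inf k)" by (simp add: sum_distrib_left)
    also have "\<dots> < (\<bar>L\<bar> + 1) * \<delta>" using D by (intro mult_strict_left_mono) auto
    also have "\<dots> = \<epsilon>" by (simp add: \<delta>_def)
    finally show ?thesis .
  qed
  then show "\<exists>\<delta>>0. \<forall>D S. D division_of S \<and> S \<subseteq> {u..v} \<and> (\<Sum>k\<in>D. Sup k - Inf k) < \<delta> \<longrightarrow>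
        (\<Sum>k\<in>D. \<bar>f (Sup k) - f (Inf k)\<bar>) < \<epsilon>"
    using \<delta> by blast
qed

text \<open>The images of the intervals of a division under \<open>\<tau>\<close> may collapse to points and then
  coincide, but these contribute nothing to the sums.\<close>

lemma absolutely_continuous_on_compose:
  assumes f: "absolutely_continuous_on u' v' f"
    and \<tau>: "\<And>x. x \<in> {u..v} \<Longrightarrow> \<tau> x \<in> {u'..v'}"
    and mono: "\<And>x y. x \<in> {u..v} \<Longrightarrow> y \<in> {u..v} \<Longrightarrow> x \<le> y \<Longrightarrow> \<tau> x \<le> \<tau> y"
    and lip: "\<And>x y. x \<in> {u..v} \<Longrightarrow> y \<in> {u..v} \<Longrightarrow> x \<le> y \<Longrightarrow> \<tau> y - \<tau> x \<le> L * (y - x)" and L: "L > 0"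
  shows "absolutely_continuous_on u v (\<lambda>x. f (\<tau> x))"
  unfolding absolutely_continuous_on_def
proof (intro allI impI)
  fix \<epsilon> :: real assume "\<epsilon> > 0"
  then obtain \<delta> where \<delta>: "\<delta> > 0" "\<And>D S. D division_of S \<and> S \<subseteq> {u'..v'} \<and> (\<Sum>k\<in>D. Sup k - Inf k) < \<delta> \<Longrightarrow>
        (\<Sum>k\<in>D. \<bar>f (Sup k) - f (Inf k)\<bar>) < \<epsilon>"
    using f unfolding absolutely_continuous_on_def by blast
  have "(\<Sum>k\<in>D. \<bar>f (\<tau> (Sup k)) - f (\<tau> (Inf k))\<bar>) < \<epsilon>"
    if D: "D division_of S \<and> S \<subseteq> {u..v} \<and> (\<Sum>k\<in>D. Sup k - Inf k) < \<delta> / L" for D S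
  proof -
    define J where "J k = {\<tau> (Inf k)..\<tau> (Sup k)}" for k
    have k: "k = {Inf k..Sup k}" "Inf k \<le> Sup k" "Inf k \<in> {u..v}" "Sup k \<in> {u..v}" if "k \<in> D" for k
      using division_real_interval[of D S k] D that by blast+
    have le: "\<tau> (Inf k) \<le> \<tau> (Sup k)" if "k \<in> D" for k
      using mono k that by blast
    have SI: "Sup (J k) = \<tau> (Sup k)" "Inf (J k) = \<tau> (Inf k)" if "k \<in> D" for k
      using le[OF that] by (auto simp: J_def)
    have disj: "interior (J k) \<inter> interior (J l) = {}" if kl: "k \<in> D" "l \<in> D" "k \<noteq> l" for k l
    proof -
      have "interior k \<inter> interior l = {}" using D division_ofD(5) kl by blast
      then have i: "{Inf k<..<Sup k} \<inter> {Inf l<..<Sup l} = {}"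
        using k(1)[OF kl(1)] k(1)[OF kl(2)] interior_atLeastAtMost_real by metis
      consider "Inf k = Sup k" | "Inf l = Sup l" | "Inf k < Sup k" "Inf l < Sup l"
        using k(2)[OF kl(1)] k(2)[OF kl(2)] by linarith
      then show ?thesis
      proof cases
        case 3
        have "Sup k \<le> Inf l \<or> Sup l \<le> Inf k"
        proof (rule ccontr)
          assume "\<not> (Sup k \<le> Inf l \<or> Sup l \<le> Inf k)"
          then have "max (Inf k) (Inf l) < min (Sup k) (Sup l)" using 3 by auto
          then obtain z where "max (Inf k) (Inf l) < z" "z < min (Sup k) (Sup l)" using dense by blast
          then have "z \<in> {Inf k<..<Sup k} \<inter> {Inf l<..<Sup l}" by auto
          then show False using i by blast
        qed
        then have "\<tau> (Sup k) \<le> \<tau> (Inf l) \<or> \<tau> (Sup l) \<le> \<tau> (Inf k)"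
          using mono k[OF kl(1)] k[OF kl(2)] by blast
        then show ?thesis by (auto simp: J_def interior_atLeastAtMost_real)
      qed (auto simp: J_def interior_atLeastAtMost_real)
    qed
    have "J ` D division_of \<Union> (J ` D)"
    proof (rule division_ofI)
      show "finite (J ` D)" using D division_ofD(1) by blast
      fix K assume "K \<in> J ` D"
      then obtain k where K: "K = J k" "k \<in> D" by blast
      show "K \<subseteq> \<Union> (J ` D)" using K by blast
      show "K \<noteq> {}" using K le by (auto simp: J_def)
      show "\<exists>a b. K = cbox a b" using K by (auto simp: J_def)
    next
      fix K1 K2 assume "K1 \<in> J ` D" "K2 \<in> J ` D" "K1 \<noteq> K2"
      then show "interior K1 \<inter> interior K2 = {}" using disj by blast
    qed auto
    moreover have "\<Union> (J ` D) \<subseteq> {u'..v'}"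
    proof
      fix z assume "z \<in> \<Union> (J ` D)"
      then obtain k0 where k0: "k0 \<in> D" "z \<in> J k0" by blast
      then show "z \<in> {u'..v'}" using \<tau>[OF k(3)[OF k0(1)]] \<tau>[OF k(4)[OF k0(1)]] by (auto simp: J_def)
    qed
    moreover have reindex: "(\<Sum>K\<in>J ` D. h (Sup K) (Inf K)) = (\<Sum>k\<in>D. h (\<tau> (Sup k)) (\<tau> (Inf k)))"
      if h: "\<And>x. h x x = 0" for h :: "real \<Rightarrow> real \<Rightarrow> real"
    proof -
      have "(\<Sum>K\<in>J ` D. h (Sup K) (Inf K)) = (\<Sum>k\<in>D. h (Sup (J k)) (Inf (J k)))"
      proof (subst sum.reindex_nontrivial)
        show "finite D" using D division_ofD(1) by blast
        fix k l assume kl: "k \<in> D" "l \<in> D" "k \<noteq> l" "J k = J l"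
        then have "interior (J k) = {}" using disj[OF kl(1,2,3)] by simp
        then have "\<tau> (Sup k) = \<tau> (Inf k)"
          using le[OF kl(1)] by (auto simp: J_def interior_atLeastAtMost_real)
        then show "h (Sup (J k)) (Inf (J k)) = 0" using h SI[OF kl(1)] by simp
      qed simp
      then show ?thesis using SI by simp
    qed
    moreover have "(\<Sum>k\<in>D. \<tau> (Sup k) - \<tau> (Inf k)) < \<delta>"
    proof -
      have "(\<Sum>k\<in>D. \<tau> (Sup k) - \<tau> (Inf k)) \<le> (\<Sum>k\<in>D. L * (Sup k - Inf k))"
        using k lip by (intro sum_mono) (metis)
      also have "\<dots> = L * (\<Sum>k\<in>D. Sup k - Inf k)" by (simp add: sum_distrib_left)
      also have "\<dots> < L * (\<delta> / L)" using D L by (intro mult_strict_left_mono) auto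
      finally show ?thesis using L by simp
    qed
    ultimately have "(\<Sum>K\<in>J ` D. \<bar>f (Sup K) - f (Inf K)\<bar>) < \<epsilon>"
      by (intro \<delta>(2)[of _ "\<Union> (J ` D)"]) (simp add: reindex[of "\<lambda>x y. x - y"])
    then show ?thesis by (simp add: reindex[of "\<lambda>x y. \<bar>f x - f y\<bar>"])
  qed
  then show "\<exists>\<delta>>0. \<forall>D S. D division_of S \<and> S \<subseteq> {u..v} \<and> (\<Sum>k\<in>D. Sup k - Inf k) < \<delta> \<longrightarrow>
        (\<Sum>k\<in>D. \<bar>f (\<tau> (Sup k)) - f (\<tau> (Inf k))\<bar>) < \<epsilon>"
    using \<delta>(1) L by (intro exI[of _ "\<delta> / L"]) auto
qed

text \<open>For concatenated paths: each half is an affine reparametrization of a path whose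
  velocity is known almost everywhere.\<close>

lemma AE_lborel_affine:
  fixes c :: real
  assumes "AE s in lborel. Q s" "c \<noteq> 0"
  shows "AE s in lborel. Q (t + c * s)"
proof -
  obtain N where N: "N \<in> null_sets lborel" "{s. \<not> Q s} \<subseteq> N"
    using assms(1) by (auto elim!: AE_E simp: null_sets_def)
  have Nb: "N \<in> sets borel" using N by (auto simp: null_sets_def)
  let ?V = "(\<lambda>x. t + c * x) -` N"
  have V: "?V \<in> sets borel"
    using measurable_sets[of "\<lambda>x. t + c * x" borel borel N] Nb by simp
  have "emeasure lborel N = ennreal \<bar>c\<bar> * emeasure lborel ?V"
    using Nb by (subst lborel_affine[OF assms(2), of t]) (simp add: emeasure_density_const emeasure_distr)
  then have "emeasure lborel ?V = 0" using N assms(2) by (auto simp: null_sets_def)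
  then have "?V \<in> null_sets lborel" using V by (auto simp: null_sets_def)
  then show ?thesis by (rule AE_I') (use N in auto)
qed

lemma has_integral_join:
  fixes f g :: "real \<Rightarrow> real"
  assumes f: "(f has_integral i) {0..1}" and g: "(g has_integral j) {0..1}"
  shows "((\<lambda>s. if s \<le> 1/2 then 2 * f (2 * s) else 2 * g (2 * s - 1)) has_integral (i + j)) {0..1}"
proof (rule has_integral_combine[of 0 "1/2" 1])
  have f2: "((\<lambda>s. f (2 * s)) has_integral i / 2) {0..1/2}"
    using has_integral_affinity'[OF f[folded box_real(2)], of 2 0] by simp
  have f3: "((\<lambda>s. 2 * f (2 * s)) has_integral i) {0..1/2}"
    using has_integral_mult_right[OF f2, of 2] by simp
  show "((\<lambda>s. if s \<le> 1/2 then 2 * f (2 * s) else 2 * g (2 * s - 1)) has_integral i) {0..1/2}"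
    by (rule has_integral_eq[OF _ f3]) simp
  have g2: "((\<lambda>s. g (2 * s - 1)) has_integral j / 2) {1/2..1}"
    using has_integral_affinity'[OF g[folded box_real(2)], of 2 "-1"] by simp
  have g3: "((\<lambda>s. 2 * g (2 * s - 1)) has_integral j) {1/2..1}"
    using has_integral_mult_right[OF g2, of 2] by simp
  \<comment> \<open>At s = 1/2 the integrand still has the value of the first half; a single point
    does not change the integral.\<close>
  show "((\<lambda>s. if s \<le> 1/2 then 2 * f (2 * s) else 2 * g (2 * s - 1)) has_integral j) {1/2..1}"
    by (rule has_integral_spike_finite[OF _ _ g3, of "{1/2}"]) simp_all
qed auto

section \<open>Concatenation of paths and the triangle inequality\<close>

context lie_group_with_basis
begin

text \<open>Separates the length of a path from its existence: facts about the infimum in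
  \<open>modulus\<close> need to know that the set of lengths is nonempty.\<close>

definition path_to :: "'g \<Rightarrow> real \<Rightarrow> bool"
  where "path_to g l \<longleftrightarrow> (\<exists>\<gamma> u. absolutely_continuous_path \<gamma> \<and> \<gamma> 0 = g \<and> \<gamma> 1 = \<one> \<and>
    path_velocity \<gamma> u \<and> ((\<lambda>s. norm (u s)) has_integral l) {0..1})"

lemma modulus_path_to: "modulus g = Inf {l. path_to g l}"
  unfolding modulus_def path_to_def
  by (rule arg_cong[where f = Inf]) (auto simp: has_integral_iff)

lemma path_to_nonneg: "path_to g l \<Longrightarrow> 0 \<le> l"
  unfolding path_to_def by (auto elim: has_integral_nonneg)

lemma modulus_le: "path_to g l \<Longrightarrow> modulus g \<le> l"
  unfolding modulus_path_to by (rule cInf_lower) (auto intro: bdd_belowI path_to_nonneg)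

text \<open>Run through g \<gamma>1 from gh to g, then through \<gamma>2 from g to e. Left
  translation by g does not change coordinates in a left-invariant frame, so the first piece has the
  length of \<gamma>1; double speed on half the time preserves both lengths.\<close>

lemma path_to_mult:
  assumes "path_to g l" "path_to h l'"
  shows "path_to (g \<otimes> h) (l' + l)"
proof -
  obtain \<gamma>1 u1 where 1: "absolutely_continuous_path \<gamma>1" "\<gamma>1 0 = h" "\<gamma>1 1 = \<one>"
    "path_velocity \<gamma>1 u1" "((\<lambda>s. norm (u1 s)) has_integral l') {0..1}"
    using assms(2) unfolding path_to_def by blast
  obtain \<gamma>2 u2 where 2: "absolutely_continuous_path \<gamma>2" "\<gamma>2 0 = g" "\<gamma>2 1 = \<one>"
    "path_velocity \<gamma>2 u2" "((\<lambda>s. norm (u2 s)) has_integral l) {0..1}"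
    using assms(1) unfolding path_to_def by blast
  define \<gamma> where "\<gamma> s = (if s \<le> 1/2 then g \<otimes> \<gamma>1 (2 * s) else \<gamma>2 (2 * s - 1))" for s :: real
  define u where "u s = (if s \<le> 1/2 then 2 *\<^sub>R u1 (2 * s) else 2 *\<^sub>R u2 (2 * s - 1))" for s :: real
  have "absolutely_continuous_path \<gamma>"
    unfolding absolutely_continuous_path_def
  proof
    fix f assume f: "f \<in> smooth_functions atlas"
    have a1: "absolutely_continuous_on 0 1 (\<lambda>s. f (g \<otimes> \<gamma>1 s))"
      using 1(1) smooth_function_translate[OF f, of g] by (auto simp: absolutely_continuous_path_def o_def)
    have a2: "absolutely_continuous_on 0 1 (\<lambda>s. f (\<gamma>2 s))"
      using 2(1) f by (auto simp: absolutely_continuous_path_def o_def)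
    \<comment> \<open>Avoids pasting two absolutely continuous functions at 1/2: stopping the clock
      makes one of the two summands equal to f(g) on each half, so that their sum minus f(g) is f
      along the joined path.\<close>
    have "absolutely_continuous_on 0 1 (\<lambda>s. f (g \<otimes> \<gamma>1 (min (2 * s) 1)))"
      by (rule absolutely_continuous_on_compose[OF a1, where L = 2]) auto
    moreover have "absolutely_continuous_on 0 1 (\<lambda>s. f (\<gamma>2 (max (2 * s - 1) 0)))"
      by (rule absolutely_continuous_on_compose[OF a2, where L = 2]) auto
    moreover have "absolutely_continuous_on 0 1 (\<lambda>s. - f g)"
      by (rule absolutely_continuous_on_lipschitz[where L = 0]) simp
    ultimately have "absolutely_continuous_on 0 1
        (\<lambda>s. (f (g \<otimes> \<gamma>1 (min (2 * s) 1)) + f (\<gamma>2 (max (2 * s - 1) 0))) + (- f g))"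
      by (intro absolutely_continuous_on_add)
    then show "absolutely_continuous_on 0 1 (f \<circ> \<gamma>)"
      by (rule absolutely_continuous_on_cong)
        (use 1(3) 2(2) in \<open>auto simp: \<gamma>_def carrier_UNIV min_def max_def\<close>)
  qed
  moreover have "\<gamma> 0 = g \<otimes> h" "\<gamma> 1 = \<one>" using 1(2) 2(3) by (auto simp: \<gamma>_def)
  moreover have "path_velocity \<gamma> u"
  proof -
    let ?P = "\<lambda>\<gamma> u s. s \<in> {0..1::real} \<longrightarrow> (\<forall>f\<in>smooth_functions atlas.
          ((f \<circ> \<gamma>) has_real_derivative (\<Sum>i\<in>UNIV. u s $ i * a i (\<lambda>h. f (\<gamma> s \<otimes> h)))) (at s))"
    have "AE s in lborel. ?P \<gamma>1 u1 (0 + 2 * s)"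
      using 1(4) unfolding path_velocity_def by (rule AE_lborel_affine) simp
    moreover have "AE s in lborel. ?P \<gamma>2 u2 (-1 + 2 * s)"
      using 2(4) unfolding path_velocity_def by (rule AE_lborel_affine) simp
    moreover have "AE s in lborel. s \<noteq> (1/2 :: real)" by (rule AE_lborel_singleton)
    ultimately have "AE s in lborel. ?P \<gamma> u s"
    proof eventually_elim
      case (elim s)
      show ?case
      proof (intro impI ballI)
        fix f assume s: "s \<in> {0..1}" and f: "f \<in> smooth_functions atlas"
        show "((f \<circ> \<gamma>) has_real_derivative (\<Sum>i\<in>UNIV. u s $ i * a i (\<lambda>h. f (\<gamma> s \<otimes> h)))) (at s)"
        proof (cases "s < 1/2")
          case True
          have "(((\<lambda>h. f (g \<otimes> h)) \<circ> \<gamma>1) has_real_derivative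
              (\<Sum>i\<in>UNIV. u1 (2 * s) $ i * a i (\<lambda>h. f (g \<otimes> (\<gamma>1 (2 * s) \<otimes> h))))) (at (2 * s))"
            using elim(1) s True smooth_function_translate[OF f, of g] by auto
          moreover have "((\<lambda>s. 2 * s) has_real_derivative 2) (at s)"
            by (auto intro!: derivative_eq_intros)
          ultimately have "((\<lambda>s. ((\<lambda>h. f (g \<otimes> h)) \<circ> \<gamma>1) (2 * s)) has_real_derivative
              (\<Sum>i\<in>UNIV. u1 (2 * s) $ i * a i (\<lambda>h. f (g \<otimes> (\<gamma>1 (2 * s) \<otimes> h)))) * 2) (at s)"
            by (rule DERIV_chain2)
          then have "((f \<circ> \<gamma>) has_real_derivative
              (\<Sum>i\<in>UNIV. u1 (2 * s) $ i * a i (\<lambda>h. f (g \<otimes> (\<gamma>1 (2 * s) \<otimes> h)))) * 2) (at s)"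
            by (rule has_field_derivative_transform_within_open[OF _ open_lessThan[of "1/2"]]) (use True in \<open>auto simp: \<gamma>_def\<close>)
          then show ?thesis
            using True by (simp add: \<gamma>_def u_def m_assoc carrier_UNIV sum_distrib_left mult_ac)
        next
          case False
          then have s2: "1/2 < s" using elim(3) by simp
          have "((f \<circ> \<gamma>2) has_real_derivative
              (\<Sum>i\<in>UNIV. u2 (2 * s - 1) $ i * a i (\<lambda>h. f (\<gamma>2 (2 * s - 1) \<otimes> h)))) (at (2 * s - 1))"
            using elim(2) s s2 f by auto
          moreover have "((\<lambda>s. 2 * s - 1) has_real_derivative 2) (at s)"
            by (auto intro!: derivative_eq_intros)
          ultimately have "((\<lambda>s. (f \<circ> \<gamma>2) (2 * s - 1)) has_real_derivative
              (\<Sum>i\<in>UNIV. u2 (2 * s - 1) $ i * a i (\<lambda>h. f (\<gamma>2 (2 * s - 1) \<otimes> h))) * 2) (at s)"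
            by (rule DERIV_chain2)
          then have "((f \<circ> \<gamma>) has_real_derivative
              (\<Sum>i\<in>UNIV. u2 (2 * s - 1) $ i * a i (\<lambda>h. f (\<gamma>2 (2 * s - 1) \<otimes> h))) * 2) (at s)"
            by (rule has_field_derivative_transform_within_open[OF _ open_greaterThan[of "1/2"]]) (use s2 in \<open>auto simp: \<gamma>_def\<close>)
          then show ?thesis
            using s2 by (simp add: \<gamma>_def u_def sum_distrib_left mult_ac)
        qed
      qed
    qed
    then show ?thesis by (simp only: path_velocity_def)
  qed
  moreover have "((\<lambda>s. norm (u s)) has_integral l' + l) {0..1}"
    by (rule has_integral_eq[OF _ has_integral_join[OF 1(5) 2(5)]]) (auto simp: u_def)
  ultimately show ?thesis unfolding path_to_def by blast
qed

text \<open>The hypotheses make both sets of lengths nonempty, so that the infimum can be taken in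
  the two variables in turn.\<close>

lemma modulus_mult_le:
  assumes "path_to g l" "path_to h l'"
  shows "modulus (g \<otimes> h) \<le> modulus g + modulus h"
proof -
  have "modulus (g \<otimes> h) - y \<le> modulus g" if y: "path_to h y" for y
    unfolding modulus_path_to[of g]
  proof (rule cInf_greatest)
    fix x assume "x \<in> {l. path_to g l}"
    then show "modulus (g \<otimes> h) - y \<le> x" using modulus_le[OF path_to_mult[OF _ y]] by force
  qed (use assms in auto)
  then have "modulus (g \<otimes> h) - modulus g \<le> modulus h"
    unfolding modulus_path_to[of h] by (intro cInf_greatest) (use assms in \<open>force+\<close>)
  then show ?thesis by simp
qed

lemma modulus_nonneg: "path_to g l \<Longrightarrow> 0 \<le> modulus g"
  unfolding modulus_path_to by (rule cInf_greatest) (auto intro: path_to_nonneg)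

end

section \<open>Lengths of paths in exponential coordinates and continuity of the modulus\<close>

context kernel_construction
begin

text \<open>A coordinate vector of the exponential chart at e, presented as a derivation so that
  \<open>basis\<close> can expand it in the \<open>a i\<close>.\<close>

definition exp_partial :: "'d \<Rightarrow> 'g tangent_vector"
  where "exp_partial k f = (if f \<in> smooth_functions atlas
     then frechet_derivative (\<lambda>x. f (exp_coord x)) (at 0) (axis k 1) else 0)"

lemma smooth_exp_derivative:
  assumes "f \<in> smooth_functions atlas" "x \<in> ball 0 r"
  shows "((\<lambda>x. f (exp_coord x)) has_derivative frechet_derivative (\<lambda>x. f (exp_coord x)) (at x)) (at x)"
  using smooth_on_has_derivative[OF smooth_function_compose[OF assms(1) smooth_into_exp] assms(2)] .

lemma exp_partial_in: "exp_partial k \<in> lie_algebra"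
proof -
  have 0: "0 \<in> ball (0 :: real ^ 'd) r" using r_pos by simp
  have D: "((\<lambda>x. f (exp_coord x)) has_derivative frechet_derivative (\<lambda>x. f (exp_coord x)) (at 0)) (at 0)"
    if "f \<in> smooth_functions atlas" for f
    using smooth_exp_derivative[OF that 0] .
  have "exp_partial k (\<lambda>q. f q + g q) = exp_partial k f + exp_partial k g"
    "exp_partial k (\<lambda>q. f q * g q) = f \<one> * exp_partial k g + g \<one> * exp_partial k f"
    if fg: "f \<in> smooth_functions atlas" "g \<in> smooth_functions atlas" for f g
    using frechet_derivative_at'[OF has_derivative_add[OF D[OF fg(1)] D[OF fg(2)]]]
      frechet_derivative_at'[OF has_derivative_mult[OF D[OF fg(1)] D[OF fg(2)]]]
    by (simp_all add: exp_partial_def fg smooth_function_add smooth_function_mult exp_coord_0)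
  moreover have "exp_partial k (\<lambda>q. b * f q) = b * exp_partial k f" if f: "f \<in> smooth_functions atlas" for f b
    using frechet_derivative_at'[OF has_derivative_mult_right[OF D[OF f], of b]]
    by (simp add: exp_partial_def f smooth_function_mult[OF smooth_function_const])
  ultimately show ?thesis
    by (simp add: lie_algebra_def tangent_space_def exp_partial_def[of _ f for f] del: exp_partial_def)
qed

text \<open>The vectors \<open>S k\<close> are the columns of the differential of the exponential
  chart at 0 with respect to the basis \<open>a\<close>, obtained by expanding each
  \<open>exp_partial k\<close> and extending linearly.\<close>

lemma frechet_exp_basis:
  "\<exists>S :: 'd \<Rightarrow> real ^ 'd. \<forall>f\<in>smooth_functions atlas. \<forall>v.
     frechet_derivative (\<lambda>x. f (exp_coord x)) (at 0) v = (\<Sum>i\<in>UNIV. (\<Sum>k\<in>UNIV. v $ k *\<^sub>R S k) $ i * a i f)"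
proof -
  have "\<forall>k. \<exists>x :: real ^ 'd. exp_partial k = (\<lambda>f. \<Sum>i\<in>UNIV. x $ i * a i f)"
    using basis[OF exp_partial_in] by blast
  then obtain S :: "'d \<Rightarrow> real ^ 'd" where S: "\<And>k. exp_partial k = (\<lambda>f. \<Sum>i\<in>UNIV. S k $ i * a i f)"
    by metis
  have "frechet_derivative (\<lambda>x. f (exp_coord x)) (at 0) v = (\<Sum>i\<in>UNIV. (\<Sum>k\<in>UNIV. v $ k *\<^sub>R S k) $ i * a i f)"
    if f: "f \<in> smooth_functions atlas" for f v
  proof -
    let ?D = "frechet_derivative (\<lambda>x. f (exp_coord x)) (at 0)"
    have lin: "linear ?D"
      using has_derivative_bounded_linear[OF smooth_exp_derivative[OF f, of 0]] r_pos
      by (simp add: bounded_linear.linear)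
    have e: "?D (axis k 1) = (\<Sum>i\<in>UNIV. S k $ i * a i f)" for k
      using fun_cong[OF S[of k], of f] f by (simp add: exp_partial_def)
    have v: "v = (\<Sum>k\<in>UNIV. v $ k *\<^sub>R axis k 1)"
      using basis_expansion[of v] by (simp add: scalar_mult_eq_scaleR)
    have "?D v = ?D (\<Sum>k\<in>UNIV. v $ k *\<^sub>R axis k 1)"
      using v by simp
    also have "\<dots> = (\<Sum>k\<in>UNIV. v $ k * (\<Sum>i\<in>UNIV. S k $ i * a i f))"
      by (simp add: linear_sum[OF lin] linear_cmul[OF lin] e)
    also have "\<dots> = (\<Sum>i\<in>UNIV. (\<Sum>k\<in>UNIV. v $ k *\<^sub>R S k) $ i * a i f)"
      by (simp add: sum_distrib_left sum_distrib_right mult.assoc) (rule sum.swap)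
    finally show ?thesis .
  qed
  then show ?thesis by blast
qed

text \<open>Applied to \<open>v = - x\<close> at \<open>y = (1 - s) x\<close>, this gives the velocity of the path
  \<open>s \<mapsto> exp ((1 - s) x)\<close> in the left-invariant frame.\<close>

definition frame_coord :: "real ^ 'd \<Rightarrow> real ^ 'd \<Rightarrow> real ^ 'd"
  where "frame_coord y v = frechet_derivative transl (at (y, y)) (0, v)"

lemma frame_coord_expand:
  assumes "y \<in> ball 0 r"
  shows "frame_coord y v = (\<Sum>k\<in>UNIV. v $ k *\<^sub>R frame_coord y (axis k 1))"
proof -
  let ?D = "frechet_derivative transl (at (y, y))"
  have lin: "linear (\<lambda>v. ?D (0, v))"
    using has_derivative_bounded_linear[OF transl_has_derivative(1)[OF transl_diag(1)[OF assms]]]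
    by (intro bounded_linear.linear bounded_linear_compose[of ?D "\<lambda>v. (0, v)"] bounded_linear_Pair bounded_linear_zero bounded_linear_ident)
  have "v = (\<Sum>k\<in>UNIV. v $ k *\<^sub>R axis k 1)"
    using basis_expansion[of v] by (simp add: scalar_mult_eq_scaleR)
  then have "?D (0, v) = ?D (0, \<Sum>k\<in>UNIV. v $ k *\<^sub>R axis k 1)" by simp
  also have "\<dots> = (\<Sum>k\<in>UNIV. v $ k *\<^sub>R ?D (0, axis k 1))"
    by (simp add: linear_sum[OF lin] linear_cmul[OF lin])
  finally show ?thesis by (simp add: frame_coord_def)
qed

lemma continuous_frame_coord: "continuous_on (ball 0 r) (\<lambda>y. frame_coord y v)"
proof (subst continuous_on_componentwise, intro ballI)
  fix b :: "real ^ 'd" assume b: "b \<in> Basis"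
  have "continuous_on transl_dom (\<lambda>p. frechet_derivative (\<lambda>p. transl p \<bullet> b) (at p) (0, v))"
    by (intro smooth_on_continuous smooth_on_frechet smooth_transl)
  then have "continuous_on (ball 0 r) (\<lambda>y. frechet_derivative (\<lambda>p. transl p \<bullet> b) (at (y, y)) (0, v))"
    by (rule continuous_on_compose2[where f = "\<lambda>y. (y, y)"]) (use transl_diag(1) in \<open>auto intro!: continuous_intros\<close>)
  then show "continuous_on (ball 0 r) (\<lambda>y. frame_coord y v \<bullet> b)"
    by (rule continuous_on_eq) (use transl_has_derivative(2)[OF transl_diag(1) b] in \<open>auto simp: frame_coord_def\<close>)
qed

text \<open>Near w = y one has exp(w) = exp(y) exp(transl(y, w)); since transl(y, y) = 0, the chain
  rule reduces a derivative at y to one at 0 of the translated function.\<close>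

lemma frechet_translate:
  assumes f: "f \<in> smooth_functions atlas" and y: "y \<in> ball 0 r"
  shows "frechet_derivative (\<lambda>x. f (exp_coord x)) (at y) v
     = frechet_derivative (\<lambda>x. f (exp_coord y \<otimes> exp_coord x)) (at 0) (frame_coord y v)"
proof -
  let ?G = "\<lambda>x. f (exp_coord y \<otimes> exp_coord x)"
  have G: "(?G has_derivative frechet_derivative ?G (at 0)) (at 0)"
    using smooth_exp_derivative[OF smooth_function_translate[OF f], of 0] r_pos by simp
  have p: "((\<lambda>w. (y, w)) has_derivative (\<lambda>v. (0, v))) (at y)" by (auto intro!: derivative_eq_intros)
  have t: "((\<lambda>w. transl (y, w)) has_derivative frame_coord y) (at y)"
    unfolding frame_coord_def[abs_def]
    by (rule has_derivative_compose[OF p]) (rule transl_has_derivative(1)[OF transl_diag(1)[OF y]])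
  have d1: "((\<lambda>w. ?G (transl (y, w))) has_derivative (\<lambda>v. frechet_derivative ?G (at 0) (frame_coord y v))) (at y)"
    by (rule has_derivative_compose[OF t]) (use G transl_diag(2) in simp)
  have "open ((\<lambda>w. (y, w)) -` transl_dom)"
    by (rule open_vimage[OF open_transl_dom]) (intro continuous_intros)
  then have "((\<lambda>x. f (exp_coord x)) has_derivative (\<lambda>v. frechet_derivative ?G (at 0) (frame_coord y v))) (at y)"
    by (rule has_derivative_transform_within_open[OF d1])
      (use transl_diag(1)[OF y] in \<open>auto simp: exp_transl carrier_UNIV m_assoc[symmetric]\<close>)
  then show ?thesis using frechet_derivative_at' by metis
qed

text \<open>The path follows the ray from x to 0, which stays in a closed ball inside the chart,
  where the frame coordinates are bounded by compactness. For a fixed base point they depend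
  linearly on the direction -x, whence a length of order |x|.\<close>

lemma path_to_exp:
  assumes r': "r' < r"
  shows "\<exists>C\<ge>0. \<forall>x. norm x \<le> r' \<longrightarrow> (\<exists>l. l \<le> C * norm x \<and> path_to (exp_coord x) l)"
proof -
  obtain S :: "'d \<Rightarrow> real ^ 'd" where S: "\<And>f v. f \<in> smooth_functions atlas \<Longrightarrow>
     frechet_derivative (\<lambda>x. f (exp_coord x)) (at 0) v = (\<Sum>i\<in>UNIV. (\<Sum>k\<in>UNIV. v $ k *\<^sub>R S k) $ i * a i f)"
    using frechet_exp_basis by blast
  define T where "T v = (\<Sum>k\<in>UNIV. v $ k *\<^sub>R S k)" for v
  have T: "norm (T v) \<le> (\<Sum>k\<in>UNIV. norm (S k)) * norm v" for v
    unfolding T_def sum_distrib_right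
  proof (rule sum_norm_le)
    fix k
    have "\<bar>v $ k\<bar> * norm (S k) \<le> norm v * norm (S k)"
      by (intro mult_right_mono component_le_norm_cart) simp
    then show "norm (v $ k *\<^sub>R S k) \<le> norm (S k) * norm v" by (simp add: mult.commute)
  qed
  have "\<forall>k. \<exists>B. \<forall>y\<in>cball 0 r'. norm (frame_coord y (axis k 1)) \<le> B"
  proof
    fix k
    have "compact ((\<lambda>y. frame_coord y (axis k 1)) ` cball 0 r')"
      by (intro compact_continuous_image continuous_on_subset[OF continuous_frame_coord]) (use r' in auto)
    then show "\<exists>B. \<forall>y\<in>cball 0 r'. norm (frame_coord y (axis k 1)) \<le> B"
      using compact_imp_bounded bounded_iff by (metis image_eqI)
  qed
  then obtain B where B: "\<And>k y. y \<in> cball 0 r' \<Longrightarrow> norm (frame_coord y (axis k 1)) \<le> B k" by metis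
  have inb: "y \<in> ball 0 r" if "y \<in> cball 0 r'" for y :: "real ^ 'd" using that r' by auto
  have V: "norm (frame_coord y v) \<le> (\<Sum>k\<in>UNIV. B k) * norm v" if y: "y \<in> cball 0 r'" for y v
    unfolding frame_coord_expand[OF inb[OF y], of v] sum_distrib_right
  proof (rule sum_norm_le)
    fix k
    have "\<bar>v $ k\<bar> * norm (frame_coord y (axis k 1)) \<le> norm v * B k"
      by (intro mult_mono component_le_norm_cart B y) auto
    then show "norm (v $ k *\<^sub>R frame_coord y (axis k 1)) \<le> B k * norm v" by (simp add: mult.commute)
  qed
  \<comment> \<open>The absolute value keeps C nonnegative even for r' < 0, when the ball is empty
    and the \<open>B k\<close> are unconstrained.\<close>
  define C where "C = (\<Sum>k\<in>UNIV. norm (S k)) * \<bar>\<Sum>k\<in>UNIV. B k\<bar>"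
  have C: "C \<ge> 0" by (simp add: C_def sum_nonneg)
  have "\<exists>l. l \<le> C * norm x \<and> path_to (exp_coord x) l" if x: "norm x \<le> r'" for x
  proof -
    let ?y = "\<lambda>s. (1 - s) *\<^sub>R x"
    have y: "?y s \<in> cball 0 r'" if "s \<in> {0..1}" for s
    proof -
      have "\<bar>1 - s\<bar> * norm x \<le> 1 * norm x" using that by (intro mult_right_mono) auto
      then show ?thesis using x by simp
    qed
    have yb: "?y ` {0..1} \<subseteq> ball 0 r" using y inb by blast
    define u where "u s = T (frame_coord (?y s) (- x))" for s
    have "continuous_on {0..1} (\<lambda>s. frame_coord (?y s) (- x))"
      by (rule continuous_on_compose2[OF continuous_frame_coord _ yb]) (intro continuous_intros)
    then have "continuous_on {0..1} (\<lambda>s. norm (u s))"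
      unfolding u_def T_def by (intro continuous_intros)
    then have int: "(\<lambda>s. norm (u s)) integrable_on {0..1}" by (rule integrable_continuous_real)
    have le: "norm (u s) \<le> C * norm x" if s: "s \<in> {0..1}" for s
    proof -
      have "norm (u s) \<le> (\<Sum>k\<in>UNIV. norm (S k)) * norm (frame_coord (?y s) (- x))"
        unfolding u_def by (rule T)
      also have "\<dots> \<le> (\<Sum>k\<in>UNIV. norm (S k)) * (\<bar>\<Sum>k\<in>UNIV. B k\<bar> * norm (- x))"
        by (intro mult_left_mono order_trans[OF V[OF y[OF s]]] mult_right_mono) (auto simp: sum_nonneg)
      finally show ?thesis by (simp add: C_def mult.assoc)
    qed
    have "integral {0..1} (\<lambda>s. norm (u s)) \<le> integral {0..1} (\<lambda>s :: real. C * norm x)"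
      by (rule integral_le[OF int]) (use le in auto)
    then have l: "integral {0..1} (\<lambda>s. norm (u s)) \<le> C * norm x" by simp
    define \<gamma> where "\<gamma> s = exp_coord (?y s)" for s
    have D: "((\<lambda>s. f (\<gamma> s)) has_real_derivative frechet_derivative (\<lambda>x. f (exp_coord x)) (at (?y s)) (- x)) (at s)"
      if f: "f \<in> smooth_functions atlas" and s: "s \<in> {0..1}" for f s
    proof -
      let ?D = "frechet_derivative (\<lambda>x. f (exp_coord x)) (at (?y s))"
      have d: "((\<lambda>x. f (exp_coord x)) has_derivative ?D) (at (?y s))"
        by (rule smooth_exp_derivative[OF f inb[OF y[OF s]]])
      have lin: "linear ?D" using has_derivative_bounded_linear[OF d] by (rule bounded_linear.linear)
      have yd: "(?y has_derivative (\<lambda>h. h *\<^sub>R (- x))) (at s)"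
        by (auto intro!: derivative_eq_intros)
      have "((\<lambda>s. f (exp_coord (?y s))) has_derivative (\<lambda>h. ?D (h *\<^sub>R (- x)))) (at s)"
        by (rule has_derivative_compose[OF yd]) (rule d)
      then show ?thesis
        unfolding \<gamma>_def has_field_derivative_def
        by (elim has_derivative_eq_rhs) (rule ext, simp only: linear_cmul[OF lin] real_scaleR_def, rule mult.commute)
    qed
    have ac: "absolutely_continuous_path \<gamma>"
      unfolding absolutely_continuous_path_def
    proof
      fix f assume f: "f \<in> smooth_functions atlas"
      let ?d = "\<lambda>s. frechet_derivative (\<lambda>x. f (exp_coord x)) (at (?y s)) (- x)"
      have cd: "continuous_on (ball 0 r) (\<lambda>y. frechet_derivative (\<lambda>x. f (exp_coord x)) (at y) (- x))"
        by (intro smooth_on_continuous smooth_on_frechet smooth_function_compose[OF f smooth_into_exp])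
      have "continuous_on {0..1} ?d"
        by (rule continuous_on_compose2[OF cd _ yb]) (intro continuous_intros)
      then have "bounded (?d ` {0..1})" by (intro compact_imp_bounded compact_continuous_image) auto
      then obtain L where "\<forall>z\<in>?d ` {0..1}. norm z \<le> L" unfolding bounded_iff by blast
      then have L: "norm (?d s) \<le> L" if "s \<in> {0..1}" for s using that by blast
      have "norm (f (\<gamma> s) - f (\<gamma> s')) \<le> L * norm (s - s')" if "s \<in> {0..1}" "s' \<in> {0..1}" for s s'
        by (rule field_differentiable_bound[of "{0..1}" "\<lambda>s. f (\<gamma> s)" ?d])
          (use D[OF f] L that in \<open>auto intro: has_field_derivative_at_within\<close>)
      then show "absolutely_continuous_on 0 1 (f \<circ> \<gamma>)"
        by (intro absolutely_continuous_on_lipschitz[where L = L]) auto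
    qed
    have vel: "path_velocity \<gamma> u"
      unfolding path_velocity_def
    proof (rule AE_I2, intro impI ballI)
      fix s f assume s: "s \<in> {0..1::real}" and f: "f \<in> smooth_functions atlas"
      have "frechet_derivative (\<lambda>x. f (exp_coord x)) (at (?y s)) (- x)
         = frechet_derivative (\<lambda>x. f (exp_coord (?y s) \<otimes> exp_coord x)) (at 0) (frame_coord (?y s) (- x))"
        by (rule frechet_translate[OF f inb[OF y[OF s]]])
      also have "\<dots> = (\<Sum>i\<in>UNIV. u s $ i * a i (\<lambda>h. f (\<gamma> s \<otimes> h)))"
        unfolding S[OF smooth_function_translate[OF f]] by (simp add: u_def T_def \<gamma>_def)
      finally show "((f \<circ> \<gamma>) has_real_derivative (\<Sum>i\<in>UNIV. u s $ i * a i (\<lambda>h. f (\<gamma> s \<otimes> h)))) (at s)"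
        using D[OF f s] by (simp add: o_def)
    qed
    have "path_to (exp_coord x) (integral {0..1} (\<lambda>s. norm (u s)))"
      unfolding path_to_def
      by (rule exI[of _ \<gamma>], rule exI[of _ u]) (use ac vel int in \<open>auto simp: \<gamma>_def exp_coord_0 integrable_integral\<close>)
    then show ?thesis using l by blast
  qed
  then show ?thesis using C by blast
qed

lemma open_exp_ball:
  assumes "r' \<le> r"
  shows "open (exp_coord ` ball 0 r')"
proof -
  have "exp_coord ` ball 0 r' = \<Omega> \<inter> log_coord -` ball 0 r'"
  proof (rule subset_antisym; rule subsetI)
    fix g assume "g \<in> exp_coord ` ball 0 r'"
    then obtain x where x: "x \<in> ball 0 r'" "g = exp_coord x" by blast
    then have "x \<in> ball 0 r" using assms by auto
    then show "g \<in> \<Omega> \<inter> log_coord -` ball 0 r'" using x exp_in log_exp by simp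
  next
    fix g assume "g \<in> \<Omega> \<inter> log_coord -` ball 0 r'"
    then show "g \<in> exp_coord ` ball 0 r'" using exp_log(1)[of g] by (metis IntE image_eqI vimageE)
  qed
  then show ?thesis using continuous_open_preimage[OF continuous_log Omega(1) open_ball] by simp
qed

text \<open>The points joined to e form a set P that is closed under multiplication and contains a
  neighbourhood N of e. So P is open; its complement is open as well, because h in P and h^-1 g in N
  would put g = h(h^-1 g) into P. Connectedness finishes the proof.\<close>

lemma path_to_exists:
  assumes conn: "connected (UNIV :: 'g set)"
  shows "\<exists>l. path_to g l"
proof -
  let ?P = "{g. \<exists>l. path_to g l}"
  let ?N = "exp_coord ` ball 0 (r / 2)"
  have N: "?N \<subseteq> ?P" using path_to_exp[of "r / 2"] r_pos by force
  have oN: "open ?N" using r_pos by (intro open_exp_ball) auto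
  have eN: "\<one> \<in> ?N" using exp_coord_0 r_pos by (metis centre_in_ball half_gt_zero image_eqI)
  have mult: "g \<otimes> h \<in> ?P" if "g \<in> ?P" "h \<in> ?P" for g h using that path_to_mult by blast
  have "open ?P"
  proof (subst open_subopen, intro ballI)
    fix g assume g: "g \<in> ?P"
    let ?W = "(\<lambda>h. inv g \<otimes> h) -` ?N"
    have "open ?W" by (rule open_vimage[OF oN]) (intro continuous_intros)
    moreover have "g \<in> ?W" using eN by (simp add: carrier_UNIV)
    moreover have "?W \<subseteq> ?P"
    proof
      fix h assume "h \<in> ?W"
      then have "g \<otimes> (inv g \<otimes> h) \<in> ?P" using mult[OF g] N by blast
      then show "h \<in> ?P" by (simp add: carrier_UNIV m_assoc[symmetric])
    qed
    ultimately show "\<exists>T. open T \<and> g \<in> T \<and> T \<subseteq> ?P" by blast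
  qed
  moreover have "open (- ?P)"
  proof (subst open_subopen, intro ballI)
    fix g assume g: "g \<in> - ?P"
    let ?W = "(\<lambda>h. inv h \<otimes> g) -` ?N"
    have "open ?W" by (rule open_vimage[OF oN]) (intro continuous_intros)
    moreover have "g \<in> ?W" using eN by (simp add: carrier_UNIV)
    moreover have "?W \<subseteq> - ?P"
    proof
      fix h assume h: "h \<in> ?W"
      have "h \<notin> ?P"
      proof
        assume "h \<in> ?P"
        then have "h \<otimes> (inv h \<otimes> g) \<in> ?P" using mult h N by blast
        then show False using g by (simp add: carrier_UNIV m_assoc[symmetric])
      qed
      then show "h \<in> - ?P" by simp
    qed
    ultimately show "\<exists>T. open T \<and> g \<in> T \<and> T \<subseteq> - ?P" by blast
  qed
  moreover have "\<one> \<in> ?P" using eN N by blast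
  ultimately have "- ?P = {}"
    using connectedD[OF conn, of ?P "- ?P"] by auto
  then show ?thesis by blast
qed

text \<open>Near e the modulus is small by \<open>path_to_exp\<close>; the triangle inequality,
  applied with h = g(g^-1 h) and with g = h(h^-1 g), carries this to every point. It makes the
  weights Borel functions.\<close>

lemma modulus_continuous:
  assumes conn: "connected (UNIV :: 'g set)"
  shows "continuous_on UNIV modulus"
proof -
  obtain C where C: "C \<ge> 0" "\<And>x. norm x \<le> r / 2 \<Longrightarrow> \<exists>l. l \<le> C * norm x \<and> path_to (exp_coord x) l"
    using path_to_exp[of "r / 2"] r_pos by auto
  have tri: "modulus (g \<otimes> h) \<le> modulus g + modulus h" for g h
    using path_to_exists[OF conn] modulus_mult_le by metis
  have "(modulus \<longlongrightarrow> modulus g) (at g)" for g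
  proof (rule tendstoI)
    fix \<epsilon> :: real assume \<epsilon>: "\<epsilon> > 0"
    define \<delta> where "\<delta> = min (r / 2) (\<epsilon> / (C + 1))"
    have \<delta>: "\<delta> > 0" "\<delta> \<le> r / 2"
      using \<epsilon> r_pos C(1) min.cobounded1[of "r / 2"] by (auto simp: \<delta>_def simp del: min.bounded_iff)
    let ?N = "exp_coord ` ball 0 \<delta>"
    have small: "modulus h < \<epsilon>" if h: "h \<in> ?N" for h
    proof -
      obtain x where x: "norm x < \<delta>" "h = exp_coord x" using h by auto
      then obtain l where "l \<le> C * norm x" "path_to h l" using C(2)[of x] \<delta> by auto
      then have "modulus h \<le> C * norm x" using modulus_le by force
      also have "\<dots> \<le> C * \<delta>" using x C by (intro mult_left_mono) auto
      also have "\<dots> < (C + 1) * \<delta>" using \<delta> by simp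
      also have "\<dots> \<le> (C + 1) * (\<epsilon> / (C + 1))" using C by (intro mult_left_mono) (auto simp: \<delta>_def)
      finally show ?thesis using C by simp
    qed
    have oN: "open ?N" using \<delta> r_pos by (intro open_exp_ball) auto
    have eN: "\<one> \<in> ?N" using exp_coord_0 \<delta> by (metis centre_in_ball image_eqI)
    let ?W = "(\<lambda>h. inv g \<otimes> h) -` ?N \<inter> (\<lambda>h. inv h \<otimes> g) -` ?N"
    have "open ?W" by (intro open_Int open_vimage[OF oN] continuous_intros)
    moreover have "g \<in> ?W" using eN by (simp add: carrier_UNIV)
    moreover have "dist (modulus h) (modulus g) < \<epsilon>" if "h \<in> ?W" for h
    proof -
      have "modulus h \<le> modulus g + modulus (inv g \<otimes> h)"
        using tri[of g "inv g \<otimes> h"] by (simp add: carrier_UNIV m_assoc[symmetric])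
      moreover have "modulus g \<le> modulus h + modulus (inv h \<otimes> g)"
        using tri[of h "inv h \<otimes> g"] by (simp add: carrier_UNIV m_assoc[symmetric])
      moreover have "modulus (inv g \<otimes> h) < \<epsilon>" "modulus (inv h \<otimes> g) < \<epsilon>"
        using that small by blast+
      ultimately show ?thesis by (simp add: dist_real_def abs_less_iff)
    qed
    ultimately show "\<forall>\<^sub>F h in at g. dist (modulus h) (modulus g) < \<epsilon>"
      unfolding eventually_at_topological by blast
  qed
  then show ?thesis by (simp add: continuous_on_def)
qed

end

section \<open>Haar measure\<close>

context kernel_construction
begin

lemma sets_dg [measurable_cong]: "sets dg = sets borel"
  and space_dg [simp]: "space dg = UNIV"
proof -
  show s: "sets dg = sets borel" using haar by (simp add: left_haar_measure_def)
  show "space dg = UNIV" using sets_eq_imp_space_eq[OF s] by simp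
qed

lemma borel_dg: "borel_measurable dg = borel_measurable borel"
  by (rule measurable_cong_sets[OF sets_dg refl])

lemma measurable_mult_inv [measurable]:
  assumes [measurable]: "f \<in> borel_measurable N" "h \<in> borel_measurable N"
  shows "(\<lambda>x. f x \<otimes> h x) \<in> borel_measurable N" "(\<lambda>x. inv (f x)) \<in> borel_measurable N"
proof -
  have "(\<lambda>(g, h). g \<otimes> h) \<in> borel_measurable (borel \<Otimes>\<^sub>M borel)"
    unfolding borel_prod by (rule borel_measurable_continuous_onI[OF continuous_mult])
  from measurable_compose[OF measurable_Pair[OF assms] this]
  show "(\<lambda>x. f x \<otimes> h x) \<in> borel_measurable N" by simp
  have "(\<lambda>g. inv g) \<in> borel_measurable borel"
    by (rule borel_measurable_continuous_onI[OF continuous_inv])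
  from measurable_compose[OF assms(1) this] show "(\<lambda>x. inv (f x)) \<in> borel_measurable N" .
qed

lemma nn_integral_left_translate:
  assumes F: "F \<in> borel_measurable borel"
  shows "(\<integral>\<^sup>+h. F (g \<otimes> h) \<partial>dg) = (\<integral>\<^sup>+h. F h \<partial>dg)"
proof -
  have "distr dg dg (\<lambda>h. g \<otimes> h) = dg" using haar by (simp add: left_haar_measure_def)
  moreover have "(\<integral>\<^sup>+h. F h \<partial>distr dg dg (\<lambda>h. g \<otimes> h)) = (\<integral>\<^sup>+h. F (g \<otimes> h) \<partial>dg)"
    using F by (intro nn_integral_distr) measurable
  ultimately show ?thesis by simp
qed

lemma finite_Omega: "emeasure dg \<Omega> < \<infinity>"
proof -
  have "emeasure dg \<Omega> \<le> emeasure dg (closure \<Omega>)"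
    by (rule emeasure_mono) (auto simp: closure_subset sets_dg)
  also have "\<dots> < \<infinity>" using haar Omega(2) by (simp add: left_haar_measure_def)
  finally show ?thesis .
qed

text \<open>Second countability extracts countably many left translates of \<Omega>, all of the same
  measure. This yields sigma-finiteness, and positivity of the measure of \<Omega> since otherwise G
  would be a null set.\<close>

lemma translated_Omega_cover:
  "\<exists>A. countable A \<and> A \<subseteq> sets borel \<and> \<Union>A = UNIV \<and> (\<forall>W\<in>A. emeasure dg W = emeasure dg \<Omega>)"
proof -
  let ?W = "\<lambda>g. (\<lambda>h. inv g \<otimes> h) -` \<Omega>"
  have o: "open (?W g)" for g by (intro open_vimage Omega(1) continuous_intros)
  have e: "emeasure dg (?W g) = emeasure dg \<Omega>" for g
  proof -
    have "emeasure dg (?W g) = (\<integral>\<^sup>+h. indicator (?W g) h \<partial>dg)"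
      using o[of g] by (intro nn_integral_indicator[symmetric]) (simp add: sets_dg)
    also have "\<dots> = (\<integral>\<^sup>+h. indicator \<Omega> (inv g \<otimes> h) \<partial>dg)"
      by (intro nn_integral_cong) (simp add: indicator_def)
    also have "\<dots> = (\<integral>\<^sup>+h. indicator \<Omega> h \<partial>dg)"
      using Omega(1) by (intro nn_integral_left_translate) auto
    finally show ?thesis using Omega(1) by (simp add: sets_dg)
  qed
  obtain F' where F': "F' \<subseteq> range ?W" "countable F'" "\<Union>F' = \<Union>(range ?W)"
    using Lindelof[of "range ?W"] o by blast
  have "\<Union>(range ?W) = UNIV"
    using Omega(3) by (auto simp: carrier_UNIV intro!: exI[of _ "_ :: 'g"])
  then show ?thesis using F' o e by (intro exI[of _ F']) (auto simp: borel_open)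
qed

lemma sigma_finite_dg: "sigma_finite_measure dg"
proof
  obtain A where A: "countable A" "A \<subseteq> sets borel" "\<Union>A = UNIV" "\<forall>W\<in>A. emeasure dg W = emeasure dg \<Omega>"
    using translated_Omega_cover by blast
  have "\<forall>W\<in>A. emeasure dg W \<noteq> \<infinity>" using A(4) finite_Omega by force
  then show "\<exists>A. countable A \<and> A \<subseteq> sets dg \<and> \<Union> A = space dg \<and> (\<forall>a\<in>A. emeasure dg a \<noteq> \<infinity>)"
    unfolding sets_dg space_dg using A(1,2,3) by blast
qed

lemma positive_Omega: "emeasure dg \<Omega> > 0"
proof (rule ccontr)
  assume "\<not> 0 < emeasure dg \<Omega>"
  then have 0: "emeasure dg \<Omega> = 0" by (simp add: not_gr_zero)
  obtain A where A: "countable A" "A \<subseteq> sets borel" "\<Union>A = UNIV" "\<forall>W\<in>A. emeasure dg W = emeasure dg \<Omega>"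
    using translated_Omega_cover by blast
  then have "(\<Union>W\<in>A. W) \<in> null_sets dg"
    by (intro null_sets_UN') (auto simp: null_sets_def 0 sets_dg)
  then show False using A(3) haar by (auto simp: null_sets_def left_haar_measure_def)
qed

end

sublocale kernel_construction \<subseteq> dg: sigma_finite_measure dg
  by (rule sigma_finite_dg)

sublocale kernel_construction \<subseteq> dg_dg: pair_sigma_finite dg dg ..

context kernel_construction
begin

text \<open>A bound for the modular function on \<open>\<Omega>\<close> without the modular function: integrate
  \<open>F x\<close> over \<open>{(x, y). y x \<in> \<Omega>}\<close> in two ways.\<close>

lemma nn_integral_inverse_le:
  "\<exists>C\<ge>0. \<forall>F\<in>borel_measurable borel. (\<forall>g. g \<notin> \<Omega> \<longrightarrow> F g = 0) \<longrightarrow>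
     (\<integral>\<^sup>+k. F (inv k) \<partial>dg) \<le> ennreal C * (\<integral>\<^sup>+k. F k \<partial>dg)"
proof -
  let ?cl = "closure \<Omega>"
  \<comment> \<open>If x and yx both lie in \<Omega>, then y = (yx)x^-1 lies in this compact
    set.\<close>
  define Q where "Q = (\<lambda>(p, q). p \<otimes> inv q) ` (?cl \<times> ?cl)"
  have "compact Q"
    unfolding Q_def case_prod_beta'
    by (intro compact_continuous_image compact_Times Omega(2) continuous_intros)
  then have Q: "emeasure dg Q < \<infinity>" and Qm: "Q \<in> sets borel"
    using haar by (auto simp: left_haar_measure_def intro: borel_compact)
  have Om [measurable]: "\<Omega> \<in> sets borel" using Omega(1) by simp
  define C where "C = enn2real (emeasure dg Q) / enn2real (emeasure dg \<Omega>)"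
  have main: "(\<integral>\<^sup>+k. F (inv k) \<partial>dg) \<le> ennreal C * (\<integral>\<^sup>+k. F k \<partial>dg)"
    if F [measurable]: "F \<in> borel_measurable borel" and z: "\<And>g. g \<notin> \<Omega> \<Longrightarrow> F g = 0" for F
  proof -
    have "emeasure dg \<Omega> * (\<integral>\<^sup>+k. F (inv k) \<partial>dg) = (\<integral>\<^sup>+x. indicator \<Omega> x * (\<integral>\<^sup>+y. F (inv y) \<partial>dg) \<partial>dg)"
      by (simp add: nn_integral_multc sets_dg)
    also have "\<dots> = (\<integral>\<^sup>+x. \<integral>\<^sup>+y. F (inv y \<otimes> x) * indicator \<Omega> x \<partial>dg \<partial>dg)"
    proof (rule nn_integral_cong)
      fix x
      have "(\<integral>\<^sup>+y. F (inv (x \<otimes> y) \<otimes> x) \<partial>dg) = (\<integral>\<^sup>+y. F (inv y \<otimes> x) \<partial>dg)"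
        by (rule nn_integral_left_translate[of "\<lambda>y. F (inv y \<otimes> x)"]) measurable
      moreover have "inv (x \<otimes> y) \<otimes> x = inv y" for y
        by (simp add: carrier_UNIV inv_mult_group m_assoc)
      ultimately show "indicator \<Omega> x * (\<integral>\<^sup>+y. F (inv y) \<partial>dg) = (\<integral>\<^sup>+y. F (inv y \<otimes> x) * indicator \<Omega> x \<partial>dg)"
        by (subst nn_integral_multc) (measurable, simp add: mult.commute)
    qed
    also have "\<dots> = (\<integral>\<^sup>+y. \<integral>\<^sup>+x. F (inv y \<otimes> x) * indicator \<Omega> x \<partial>dg \<partial>dg)"
      by (rule dg_dg.Fubini') measurable
    also have "\<dots> = (\<integral>\<^sup>+y. \<integral>\<^sup>+x. F x * indicator \<Omega> (y \<otimes> x) \<partial>dg \<partial>dg)"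
    proof (rule nn_integral_cong)
      fix y
      have "(\<integral>\<^sup>+x. F (inv y \<otimes> (y \<otimes> x)) * indicator \<Omega> (y \<otimes> x) \<partial>dg) = (\<integral>\<^sup>+x. F (inv y \<otimes> x) * indicator \<Omega> x \<partial>dg)"
        by (rule nn_integral_left_translate[of "\<lambda>x. F (inv y \<otimes> x) * indicator \<Omega> x"]) measurable
      then show "(\<integral>\<^sup>+x. F (inv y \<otimes> x) * indicator \<Omega> x \<partial>dg) = (\<integral>\<^sup>+x. F x * indicator \<Omega> (y \<otimes> x) \<partial>dg)"
        by (simp add: carrier_UNIV m_assoc[symmetric])
    qed
    also have "\<dots> = (\<integral>\<^sup>+x. \<integral>\<^sup>+y. F x * indicator \<Omega> (y \<otimes> x) \<partial>dg \<partial>dg)"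
      by (rule dg_dg.Fubini') measurable
    also have "\<dots> \<le> (\<integral>\<^sup>+x. F x * emeasure dg Q \<partial>dg)"
    proof (rule nn_integral_mono)
      fix x
      show "(\<integral>\<^sup>+y. F x * indicator \<Omega> (y \<otimes> x) \<partial>dg) \<le> F x * emeasure dg Q"
      proof (cases "x \<in> \<Omega>")
        case True
        have "(\<integral>\<^sup>+y. F x * indicator \<Omega> (y \<otimes> x) \<partial>dg) \<le> (\<integral>\<^sup>+y. F x * indicator Q y \<partial>dg)"
        proof (intro nn_integral_mono mult_left_mono)
          fix y
          show "indicator \<Omega> (y \<otimes> x) \<le> (indicator Q y :: ennreal)"
          proof (cases "y \<otimes> x \<in> \<Omega>")
            case yx: True
            have "y = (y \<otimes> x) \<otimes> inv x" by (simp add: carrier_UNIV m_assoc)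
            then have "y \<in> Q" unfolding Q_def using yx True closure_subset[of \<Omega>]
              by (intro image_eqI[of _ _ "(y \<otimes> x, x)"]) auto
            then show ?thesis by (simp add: indicator_def)
          qed simp
        qed simp
        also have "\<dots> = F x * emeasure dg Q" using Qm by (simp add: nn_integral_cmult sets_dg)
        finally show ?thesis .
      qed (simp add: z)
    qed
    also have "\<dots> = emeasure dg Q * (\<integral>\<^sup>+x. F x \<partial>dg)" by (simp add: nn_integral_multc mult.commute)
    finally have le: "emeasure dg \<Omega> * (\<integral>\<^sup>+k. F (inv k) \<partial>dg) \<le> emeasure dg Q * (\<integral>\<^sup>+x. F x \<partial>dg)" .
    define w where "w = enn2real (emeasure dg \<Omega>)"
    have w: "emeasure dg \<Omega> = ennreal w" "w > 0"
      using finite_Omega positive_Omega by (auto simp: w_def less_top enn2real_positive_iff)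
    have q: "emeasure dg Q = ennreal (enn2real (emeasure dg Q))" using Q by (simp add: less_top)
    have "(\<integral>\<^sup>+k. F (inv k) \<partial>dg) = ennreal (1 / w) * (ennreal w * (\<integral>\<^sup>+k. F (inv k) \<partial>dg))"
      using w(2) by (simp add: mult.assoc[symmetric] ennreal_mult[symmetric])
    also have "\<dots> \<le> ennreal (1 / w) * (emeasure dg Q * (\<integral>\<^sup>+x. F x \<partial>dg))"
      using le w by (intro mult_left_mono) auto
    also have "\<dots> = ennreal C * (\<integral>\<^sup>+x. F x \<partial>dg)"
      using w(2) by (subst q) (simp add: C_def w_def mult.assoc[symmetric] ennreal_mult[symmetric])
    finally show ?thesis .
  qed
  have "C \<ge> 0" by (simp add: C_def)
  then show ?thesis using main by blast
qed

text \<open>The density is given for sets only, so the restriction of \<open>dg\<close> to \<Omega>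
  is identified with that of the image of \<sigma> dx under the exponential map, both extended off
  the ball to Borel functions \<open>s\<close> and \<open>e\<close>. On the closed ball that carries
  \<open>supp\<close>, \<sigma> is bounded.\<close>

lemma nn_integral_coord:
  "\<exists>C\<ge>0. \<forall>F\<in>borel_measurable borel. (\<forall>g. g \<notin> supp \<longrightarrow> F g = 0) \<longrightarrow>
     (\<integral>\<^sup>+g. F g \<partial>dg) \<le> ennreal C * (\<integral>\<^sup>+x. F (exp_coord x) * indicator (ball 0 r) x \<partial>lborel)"
proof -
  obtain \<sigma> where \<sigma>: "smooth_on \<sigma> (ball 0 r)" "\<forall>x\<in>ball 0 r. \<sigma> x > 0" and
    dens: "\<And>S. S \<in> sets borel \<Longrightarrow> S \<subseteq> \<Omega> \<Longrightarrow> emeasure dg S =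
        (\<integral>\<^sup>+ x\<in>ball 0 r. ennreal (\<sigma> x) * indicator S (exp_coord x) \<partial>lborel)"
    using haar_normalized by blast
  obtain r' where r': "0 < r'" "r' < r" "\<And>x. x \<in> ball 0 r \<Longrightarrow> exp_coord x \<in> supp \<Longrightarrow> norm x \<le> r'"
    using supp_radius by blast
  have "compact (\<sigma> ` cball 0 r')"
    by (intro compact_continuous_image continuous_on_subset[OF smooth_on_continuous[OF \<sigma>(1)]]) (use r' in auto)
  then obtain B where B: "\<And>x. x \<in> cball 0 r' \<Longrightarrow> norm (\<sigma> x) \<le> B"
    using compact_imp_bounded bounded_iff by (metis image_eqI)
  let ?B = "ball (0 :: real ^ 'd) r"
  define e where "e x = (if x \<in> ?B then exp_coord x else \<one>)" for x
  have e_meas [measurable]: "e \<in> borel_measurable borel"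
  proof (rule borel_measurableI)
    fix W :: "'g set" assume W: "open W"
    have "e -` W = (?B \<inter> exp_coord -` W) \<union> (if \<one> \<in> W then - ?B else {})"
      by (auto simp: e_def split: if_splits)
    moreover have "open (?B \<inter> exp_coord -` W)" using smooth_into_exp W by (rule smooth_into_preimage)
    ultimately show "e -` W \<inter> space borel \<in> sets borel" by auto
  qed
  define s where "s x = indicator ?B x *\<^sub>R \<sigma> x" for x
  have s_meas [measurable]: "s \<in> borel_measurable borel"
    unfolding s_def by (rule borel_measurable_continuous_on_indicator) (use smooth_on_continuous[OF \<sigma>(1)] in auto)
  define \<nu> where "\<nu> = distr (density lborel (\<lambda>x. ennreal (s x))) borel e"
  have Om [measurable]: "\<Omega> \<in> sets borel" using Omega(1) by simp
  have [measurable]: "?B \<in> sets borel" by simp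
  have eq: "density dg (indicator \<Omega>) = density \<nu> (indicator \<Omega>)"
  proof (rule measure_eqI)
    show "sets (density dg (indicator \<Omega>)) = sets (density \<nu> (indicator \<Omega>))" by (simp add: sets_dg \<nu>_def)
    fix S assume "S \<in> sets (density dg (indicator \<Omega>))"
    then have S [measurable]: "S \<in> sets borel" by (simp add: sets_dg)
    have "emeasure \<nu> (\<Omega> \<inter> S) = (\<integral>\<^sup>+x. ennreal (s x) * indicator (e -` (\<Omega> \<inter> S)) x \<partial>lborel)"
      using measurable_sets[OF e_meas, of "\<Omega> \<inter> S"]
      by (simp add: \<nu>_def emeasure_distr emeasure_density)
    also have "\<dots> = (\<integral>\<^sup>+ x\<in>ball 0 r. ennreal (\<sigma> x) * indicator (\<Omega> \<inter> S) (exp_coord x) \<partial>lborel)"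
      by (rule nn_integral_cong) (auto simp: s_def e_def indicator_def)
    also have "\<dots> = emeasure dg (\<Omega> \<inter> S)" by (rule dens[symmetric]) auto
    finally show "emeasure (density dg (indicator \<Omega>)) S = emeasure (density \<nu> (indicator \<Omega>)) S"
      using S Om by (simp add: emeasure_restricted sets_dg \<nu>_def)
  qed
  have main: "(\<integral>\<^sup>+g. F g \<partial>dg) \<le> ennreal \<bar>B\<bar> * (\<integral>\<^sup>+x. F (exp_coord x) * indicator ?B x \<partial>lborel)"
    if F [measurable]: "F \<in> borel_measurable borel" and z: "\<And>g. g \<notin> supp \<Longrightarrow> F g = 0" for F
  proof -
    have z': "indicator \<Omega> g * F g = F g" for g using z[of g] supp(3) by (cases "g \<in> \<Omega>") auto
    have "(\<integral>\<^sup>+g. F g \<partial>dg) = (\<integral>\<^sup>+g. F g \<partial>density dg (indicator \<Omega>))"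
      by (subst nn_integral_density) (auto simp: z')
    also have "\<dots> = (\<integral>\<^sup>+g. F g \<partial>\<nu>)"
      unfolding eq by (subst nn_integral_density) (auto simp: z' \<nu>_def)
    also have "\<dots> = (\<integral>\<^sup>+x. ennreal (s x) * F (e x) \<partial>lborel)"
      unfolding \<nu>_def by (simp add: nn_integral_distr nn_integral_density)
    also have "\<dots> \<le> (\<integral>\<^sup>+x. ennreal \<bar>B\<bar> * (F (e x) * indicator ?B x) \<partial>lborel)"
    proof (rule nn_integral_mono)
      fix x
      show "ennreal (s x) * F (e x) \<le> ennreal \<bar>B\<bar> * (F (e x) * indicator ?B x)"
      proof (cases "x \<in> ?B \<and> exp_coord x \<in> supp")
        case True
        then have "\<sigma> x \<le> \<bar>B\<bar>" using B[of x] r'(3)[of x] by auto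
        then show ?thesis using True by (auto simp: s_def intro!: mult_right_mono ennreal_leI)
      qed (auto simp: s_def e_def z)
    qed
    also have "\<dots> = ennreal \<bar>B\<bar> * (\<integral>\<^sup>+x. F (e x) * indicator ?B x \<partial>lborel)"
      by (rule nn_integral_cmult) measurable
    also have "(\<integral>\<^sup>+x. F (e x) * indicator ?B x \<partial>lborel) = (\<integral>\<^sup>+x. F (exp_coord x) * indicator ?B x \<partial>lborel)"
      by (rule nn_integral_cong) (auto simp: e_def indicator_def)
    finally show ?thesis .
  qed
  then show ?thesis by (intro exI[of _ "\<bar>B\<bar>"]) auto
qed

section \<open>Joint measurability of the parametrix\<close>

lemma measurable_lift:
  assumes q: "continuous_on (ball 0 r) q"
  shows "(\<lambda>(t, g). if t > 0 then lift (\<lambda>x. q x * heat_deriv \<beta> t x) g else 0) \<in> borel_measurable (borel \<Otimes>\<^sub>M borel)"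
proof -
  define l where "l g = (if g \<in> \<Omega> then log_coord g else 0)" for g
  have [measurable]: "l \<in> borel_measurable borel"
  proof (rule borel_measurableI)
    fix W :: "(real ^ 'd) set" assume W: "open W"
    have "l -` W = (\<Omega> \<inter> log_coord -` W) \<union> (if 0 \<in> W then - \<Omega> else {})" by (auto simp: l_def split: if_splits)
    moreover have "open (\<Omega> \<inter> log_coord -` W)" using continuous_log Omega(1) W by (rule continuous_open_preimage)
    ultimately show "l -` W \<inter> space borel \<in> sets borel" using Omega(1) by auto
  qed
  define q' where "q' x = indicator (ball 0 r) x *\<^sub>R q x" for x
  have [measurable]: "q' \<in> borel_measurable borel"
    unfolding q'_def by (rule borel_measurable_continuous_on_indicator) (use q in auto)
  have Om [measurable]: "\<Omega> \<in> sets borel" using Omega(1) by simp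
  have [measurable]: "(\<lambda>p. heat_deriv \<beta> (fst p) (l (snd p))) \<in> borel_measurable (borel \<Otimes>\<^sub>M borel)"
    using measurable_compose[OF _ measurable_heat_deriv, of "\<lambda>p. (fst p, l (snd p))" "borel \<Otimes>\<^sub>M borel" \<beta>] by simp
  have "(\<lambda>(t, g). if t > 0 then lift (\<lambda>x. q x * heat_deriv \<beta> t x) g else 0)
     = (\<lambda>p. if fst p > 0 \<and> snd p \<in> \<Omega> then q' (l (snd p)) * heat_deriv \<beta> (fst p) (l (snd p)) else 0)"
    using exp_log(2) by (auto simp: fun_eq_iff lift_def l_def q'_def)
  also have "\<dots> \<in> borel_measurable (borel \<Otimes>\<^sub>M borel)"
    by measurable
  finally show ?thesis .
qed

lemma K0_lift: "t > 0 \<Longrightarrow> K0 t = lift (\<lambda>x. of_real (\<theta> (exp_coord x)) * heat_deriv [] t x)"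
  using exp_log(1) by (auto simp: fun_eq_iff K0_def lift_def log_coord_def K_tilde_def heat_deriv_def integrand_def
      symbol_def complex_symbol_def inner_vec_def)

lemma measurable_K0: "(\<lambda>(t, g). K0 t g) \<in> borel_measurable (borel \<Otimes>\<^sub>M borel)"
proof -
  have "continuous_on (ball 0 r) (\<lambda>x. complex_of_real (\<theta> (exp_coord x)))"
    by (intro continuous_intros smooth_on_continuous smooth_function_compose[OF theta_smooth smooth_into_exp])
  moreover have "(\<lambda>(t, g). K0 t g) = (\<lambda>(t, g). if t > 0 then lift (\<lambda>x. of_real (\<theta> (exp_coord x)) * heat_deriv [] t x) g else 0)"
    using K0_lift by (auto simp: fun_eq_iff K0_def K_tilde_def)
  ultimately show ?thesis using measurable_lift by simp
qed

lemma measurable_M: "(\<lambda>(t, g). M t g) \<in> borel_measurable (borel \<Otimes>\<^sub>M borel)"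
proof -
  obtain q Q where q: "\<And>\<beta>. continuous_on (ball 0 r) (q \<beta>)"
    "\<And>t. t > 0 \<Longrightarrow> M t = lift (\<lambda>x. \<Sum>\<beta>\<in>multi_indices m. q \<beta> x * heat_deriv \<beta> t x)"
    using M_expansion by blast
  have "(\<lambda>(t, g). M t g) = (\<lambda>p. \<Sum>\<beta>\<in>multi_indices m. (\<lambda>(t, g). if t > 0 then lift (\<lambda>x. q \<beta> x * heat_deriv \<beta> t x) g else 0) p)"
    using q(2) by (auto simp: fun_eq_iff M_def lift_def)
  then show ?thesis using measurable_lift[OF q(1)] by simp
qed

end

section \<open>Weighted bounds for the parametrix\<close>

text \<open>Valid for every f, as the integral of a nonintegrable function is 0 by convention. Thus
  convolutions can be estimated before anything is known about their convergence.\<close>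

lemma ennreal_norm_integral_le:
  fixes f :: "'a \<Rightarrow> 'b::{banach, second_countable_topology}"
  shows "ennreal (norm (integral\<^sup>L M f)) \<le> (\<integral>\<^sup>+x. ennreal (norm (f x)) \<partial>M)"
  by (cases "integrable M f") (auto simp: integral_norm_bound_ennreal not_integrable_integral_eq)

lemma measurable_case_prod_compose:
  assumes "(\<lambda>(t, g). k t g) \<in> borel_measurable (borel \<Otimes>\<^sub>M borel)"
    and "f \<in> borel_measurable N" "u \<in> borel_measurable N"
  shows "(\<lambda>x. k (f x) (u x)) \<in> borel_measurable N"
  using measurable_compose[OF measurable_Pair[OF assms(2,3)] assms(1)] by simp

text \<open>By scaling, the integral is \<open>\<Gamma>(p) \<nu>\<^sup>-\<^sup>p\<close>.\<close>

lemma exists_small_Laplace_power: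
  fixes p \<epsilon> :: real
  assumes p: "p > 0" and \<epsilon>: "\<epsilon> > 0"
  shows "\<exists>\<nu>>0. (\<integral>\<^sup>+s. ennreal (indicator {0<..} s * (s powr (p - 1) * exp (- \<nu> * s))) \<partial>lborel) \<le> ennreal \<epsilon>"
proof -
  define G where "G = Gamma p"
  have G: "G > 0" using p by (simp add: G_def Gamma_real_pos)
  define \<nu> where "\<nu> = (G / \<epsilon>) powr (1 / p)"
  have \<nu>: "\<nu> > 0" using G \<epsilon> by (simp add: \<nu>_def)
  have \<nu>p: "\<nu> powr p = G / \<epsilon>" using p G \<epsilon> by (simp add: \<nu>_def powr_powr)
  let ?f = "\<lambda>s. ennreal (indicator {0..} s * s powr (p - 1) / exp s)"
  have "(\<integral>\<^sup>+s. ennreal (indicator {0<..} s * (s powr (p - 1) * exp (- \<nu> * s))) \<partial>lborel)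
      = (\<integral>\<^sup>+s. ennreal (\<nu> powr (1 - p)) * ?f (\<nu> *\<^sub>R s) \<partial>lborel)"
  proof (rule nn_integral_cong)
    fix s :: real
    show "ennreal (indicator {0<..} s * (s powr (p - 1) * exp (- \<nu> * s))) = ennreal (\<nu> powr (1 - p)) * ?f (\<nu> *\<^sub>R s)"
    proof (cases "s > 0")
      case True
      have "\<nu> powr (1 - p) * ((\<nu> * s) powr (p - 1) / exp (\<nu> * s)) = s powr (p - 1) * exp (- \<nu> * s)"
        using True \<nu> by (simp add: powr_mult exp_minus field_simps flip: powr_add)
      then show ?thesis using True \<nu> by (simp add: ennreal_mult[symmetric])
    next
      case False
      then show ?thesis using \<nu> by (cases "s = 0") (auto simp: indicator_def mult_le_0_iff zero_le_mult_iff)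
    qed
  qed
  also have "\<dots> = ennreal (\<nu> powr (1 - p)) * (ennreal (1 / \<nu>) * ennreal G)"
  proof -
    have "(\<integral>\<^sup>+s. ?f (\<nu> *\<^sub>R s) \<partial>lborel) = ennreal (1 / \<nu>) * ennreal G"
      using nn_integral_lborel_scale[of ?f \<nu>] \<nu> p by (simp add: Gamma_conv_nn_integral_real G_def)
    moreover have "(\<lambda>s. ?f (\<nu> *\<^sub>R s)) \<in> borel_measurable lborel"
      by (rule measurable_compose[of "\<lambda>s. \<nu> *\<^sub>R s" _ borel ?f]) simp_all
    ultimately show ?thesis by (simp only: nn_integral_cmult)
  qed
  also have "\<dots> = ennreal \<epsilon>"
  proof -
    have "\<nu> powr (1 - p) * (1 / \<nu> * G) = \<epsilon>"
      using \<nu> G \<epsilon> by (simp add: powr_diff \<nu>p field_simps)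
    then show ?thesis using \<nu> G by (simp add: ennreal_mult[symmetric])
  qed
  finally show ?thesis using \<nu> by (intro exI[of _ \<nu>]) simp
qed

context kernel_construction
begin

lemma heat_deriv_weighted:
  assumes r': "r' < r"
  shows "\<exists>A>0. \<exists>\<omega>\<ge>0. \<forall>\<beta>\<in>multi_indices m. \<forall>\<rho>\<ge>0. \<forall>t>0. \<forall>x. norm x \<le> r' \<longrightarrow>
     exp (\<rho> * modulus (exp_coord x)) * norm (heat_deriv \<beta> t x) \<le>
       A / (t powr (1 / m)) ^ (CARD('d) + length \<beta>) * exp (\<omega> * (1 + \<rho> ^ m) * t) * exp (- 2 * (norm x / t powr (1 / m)))"
proof -
  obtain C where C: "C \<ge> 0" "\<And>x. norm x \<le> r' \<Longrightarrow> \<exists>l. l \<le> C * norm x \<and> path_to (exp_coord x) l"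
    using path_to_exp[OF r'] by blast
  have mod: "modulus (exp_coord x) \<le> C * norm x" if "norm x \<le> r'" for x
    using C(2)[OF that] modulus_le by force
  obtain A \<omega> where A: "A > 0" "\<omega> \<ge> 0" and bd: "\<And>\<beta> t x \<tau>. \<beta> \<in> multi_indices m \<Longrightarrow> t > 0 \<Longrightarrow> \<tau> \<ge> 0 \<Longrightarrow>
     norm (heat_deriv \<beta> t x) \<le> A / (t powr (1 / m)) ^ (CARD('d) + length \<beta>) * exp (\<omega> * (1 + \<tau> ^ m) * t) * exp (- \<tau> * norm x)"
    using heat_deriv_bound by blast
  define \<omega>' where "\<omega>' = \<omega> * (1 + 3 ^ m * C ^ m)"
  define A' where "A' = A * exp (\<omega> * (3 ^ m * 2 ^ m))"
  have main: "exp (\<rho> * modulus (exp_coord x)) * norm (heat_deriv \<beta> t x) \<le>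
       A' / (t powr (1 / m)) ^ (CARD('d) + length \<beta>) * exp (\<omega>' * (1 + \<rho> ^ m) * t) * exp (- 2 * (norm x / t powr (1 / m)))"
    if \<beta>: "\<beta> \<in> multi_indices m" and \<rho>: "\<rho> \<ge> 0" and t: "t > 0" and x: "norm x \<le> r'" for \<beta> \<rho> t x
  proof -
    define T where "T = t powr (1 / m)"
    have T: "T > 0" using t by (simp add: T_def)
    have Tm: "T ^ m = t" using t order_ge_2 by (simp add: T_def powr_power)
    \<comment> \<open>The part C\<rho> outweighs e^(\<rho>|g|). The part 2/T leaves e^(-2|x|/T) and
      costs only a bounded factor, because (2/T)^m t = 2^m.\<close>
    define \<tau> where "\<tau> = C * \<rho> + 2 / T"
    have \<tau>: "\<tau> \<ge> 0" using C \<rho> T by (simp add: \<tau>_def)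
    have "\<tau> ^ m \<le> 3 ^ m * ((C * \<rho>) ^ m + (2 / T) ^ m)"
      using power_sum3_le[of "C * \<rho>" "2 / T" 0 m] C \<rho> T order_ge_2 by (simp add: \<tau>_def power_0_left)
    then have "\<tau> ^ m * t \<le> 3 ^ m * ((C * \<rho>) ^ m + (2 / T) ^ m) * t"
      using t by (intro mult_right_mono) auto
    also have "\<dots> = 3 ^ m * C ^ m * \<rho> ^ m * t + 3 ^ m * 2 ^ m"
      using T t by (simp add: power_mult_distrib power_divide Tm algebra_simps)
    finally have "\<omega> * (t + \<tau> ^ m * t) \<le> \<omega> * (t + (3 ^ m * C ^ m * \<rho> ^ m * t + 3 ^ m * 2 ^ m))"
      using A by (intro mult_left_mono) auto
    also have "\<dots> \<le> \<omega>' * (1 + \<rho> ^ m) * t + \<omega> * (3 ^ m * 2 ^ m)"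
    proof -
      have "0 \<le> \<omega> * (3 ^ m * C ^ m) * t + \<omega> * \<rho> ^ m * t" using A C \<rho> t by simp
      then show ?thesis by (simp add: \<omega>'_def algebra_simps)
    qed
    finally have e: "exp (\<omega> * (1 + \<tau> ^ m) * t) \<le> exp (\<omega>' * (1 + \<rho> ^ m) * t) * exp (\<omega> * (3 ^ m * 2 ^ m))"
      by (simp add: algebra_simps flip: exp_add)
    have "\<rho> * modulus (exp_coord x) \<le> \<rho> * (C * norm x)" using mod[OF x] \<rho> by (intro mult_left_mono)
    then have w: "exp (\<rho> * modulus (exp_coord x)) * exp (- \<tau> * norm x) \<le> exp (- 2 * (norm x / T))"
      by (simp add: \<tau>_def algebra_simps flip: exp_add)
    have "exp (\<rho> * modulus (exp_coord x)) * norm (heat_deriv \<beta> t x)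
      \<le> exp (\<rho> * modulus (exp_coord x)) * (A / T ^ (CARD('d) + length \<beta>) * exp (\<omega> * (1 + \<tau> ^ m) * t) * exp (- \<tau> * norm x))"
      using bd[OF \<beta> t \<tau>, of x] by (intro mult_left_mono) (auto simp: T_def)
    also have "\<dots> = A / T ^ (CARD('d) + length \<beta>) * exp (\<omega> * (1 + \<tau> ^ m) * t) * (exp (\<rho> * modulus (exp_coord x)) * exp (- \<tau> * norm x))"
      by (simp only: mult_ac)
    also have "\<dots> \<le> A / T ^ (CARD('d) + length \<beta>) * (exp (\<omega>' * (1 + \<rho> ^ m) * t) * exp (\<omega> * (3 ^ m * 2 ^ m))) * exp (- 2 * (norm x / T))"
      using A T by (intro mult_mono e w mult_left_mono) auto
    finally show ?thesis by (simp add: A'_def T_def mult_ac)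
  qed
  have "A' > 0" "\<omega>' \<ge> 0" using A C by (auto simp: A'_def \<omega>'_def)
  then show ?thesis using main by blast
qed

text \<open>Every term of M is brought to the common power T^-(d + m - 1), T = t^(1/m). At order m
  the coefficient O(|x|) supplies the missing T through y e^(-2y) \<le> e^(-y) with y = |x|/T; at
  lower order the excess power of T is bounded by e^t, which accounts for
  \<open>\<omega> + 1\<close>.\<close>

lemma K0_M_pointwise:
  "\<exists>A>0. \<exists>\<omega>\<ge>0. \<forall>\<rho>\<ge>0. \<forall>t>0. \<forall>g.
     (g \<notin> supp \<longrightarrow> K0 t g = 0 \<and> M t g = 0) \<and>
     (g \<in> supp \<longrightarrow>
       exp (\<rho> * modulus g) * norm (K0 t g) \<le> A * exp (\<omega> * (1 + \<rho> ^ m) * t) * t powr (- real CARD('d) / real m) * exp (- (norm (log_coord g) / t powr (1 / m))) \<and>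
       exp (\<rho> * modulus g) * norm (M t g) \<le> A * t powr (1 / m - 1) * exp (\<omega> * (1 + \<rho> ^ m) * t) * t powr (- real CARD('d) / real m) * exp (- (norm (log_coord g) / t powr (1 / m))))"
proof -
  obtain r' where r': "0 < r'" "r' < r" "\<And>x. x \<in> ball 0 r \<Longrightarrow> exp_coord x \<in> supp \<Longrightarrow> norm x \<le> r'"
    using supp_radius by blast
  obtain A \<omega> where A: "A > 0" "\<omega> \<ge> 0" and bd: "\<And>\<beta> \<rho> t x. \<beta> \<in> multi_indices m \<Longrightarrow> \<rho> \<ge> 0 \<Longrightarrow> t > 0 \<Longrightarrow> norm x \<le> r' \<Longrightarrow>
     exp (\<rho> * modulus (exp_coord x)) * norm (heat_deriv \<beta> t x) \<le>
       A / (t powr (1 / m)) ^ (CARD('d) + length \<beta>) * exp (\<omega> * (1 + \<rho> ^ m) * t) * exp (- 2 * (norm x / t powr (1 / m)))"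
    using heat_deriv_weighted[OF r'(2)] by blast
  obtain q Q where Q: "Q \<ge> 0" and q0: "\<And>\<beta> x. x \<in> ball 0 r \<Longrightarrow> exp_coord x \<notin> supp \<Longrightarrow> q \<beta> x = 0"
    and q: "\<And>\<beta> x. \<beta> \<in> multi_indices m \<Longrightarrow> x \<in> ball 0 r \<Longrightarrow> norm (q \<beta> x) \<le> Q \<and> (length \<beta> = m \<longrightarrow> norm (q \<beta> x) \<le> Q * norm x)"
    and Meq: "\<And>t. t > 0 \<Longrightarrow> M t = lift (\<lambda>x. \<Sum>\<beta>\<in>multi_indices m. q \<beta> x * heat_deriv \<beta> t x)"
    using M_expansion by blast
  let ?N = "real (card (multi_indices m :: 'd list set))"
  \<comment> \<open>The summand 1 serves \<open>K0\<close>; ?N Q, the number of multi-indices times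
    the bound of the coefficients, serves \<open>M\<close>.\<close>
  define A' where "A' = A * (1 + ?N * Q)"
  have A': "A \<le> A'" "A * (?N * Q) \<le> A'" "A' > 0"
    using A Q by (auto simp: A'_def algebra_simps add_pos_nonneg)
  have out: "K0 t g = 0 \<and> M t g = 0" if t: "t > 0" and g: "g \<notin> supp" for t g
    using exp_log[of g] q0[of "log_coord g"] g supp(4)[OF g] by (auto simp: K0_def Meq[OF t] lift_def)
  have ins: "exp (\<rho> * modulus g) * norm (K0 t g) \<le> A' * exp ((\<omega> + 1) * (1 + \<rho> ^ m) * t) * t powr (- real CARD('d) / real m) * exp (- (norm (log_coord g) / t powr (1 / m)))"
    "exp (\<rho> * modulus g) * norm (M t g) \<le> A' * t powr (1 / m - 1) * exp ((\<omega> + 1) * (1 + \<rho> ^ m) * t) * t powr (- real CARD('d) / real m) * exp (- (norm (log_coord g) / t powr (1 / m)))"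
    if \<rho>: "\<rho> \<ge> 0" and t: "t > 0" and g: "g \<in> supp" for \<rho> t g
  proof -
    define x where "x = log_coord g"
    have x: "x \<in> ball 0 r" and gx: "g = exp_coord x" and gO: "g \<in> \<Omega>"
      using g supp(3) exp_log[of g] by (auto simp: x_def)
    have xr: "norm x \<le> r'" using r'(3)[OF x] g gx by simp
    define T where "T = t powr (1 / m)"
    define w where "w = exp (\<rho> * modulus g)"
    define E where "E = exp (\<omega> * (1 + \<rho> ^ m) * t)"
    define E' where "E' = exp ((\<omega> + 1) * (1 + \<rho> ^ m) * t)"
    define y where "y = norm x / T"
    have T: "T > 0" using t by (simp add: T_def)
    have y: "y \<ge> 0" using T by (simp add: y_def)
    have Tm: "T ^ m = t" using t order_ge_2 by (simp add: T_def powr_power)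
    have Td: "1 / T ^ CARD('d) = t powr (- real CARD('d) / real m)"
      using t by (simp add: T_def powr_power powr_minus_divide)
    have T1: "1 / T ^ (m - 1) = t powr (1 / m - 1)"
    proof -
      have "T ^ (m - 1) = t powr (real (m - 1) * (1 / m))" using t by (simp add: T_def powr_power mult.commute)
      also have "real (m - 1) * (1 / m) = - (1 / m - 1)" using order_ge_2 by (simp add: of_nat_diff field_simps)
      finally show ?thesis by (simp only: powr_minus) (simp add: field_simps)
    qed
    have eE: "exp t * E \<le> E'"
    proof -
      have "t \<le> (1 + \<rho> ^ m) * t" using \<rho> t by simp
      then show ?thesis by (simp add: E_def E'_def algebra_simps flip: exp_add)
    qed
    have E: "0 < E" "E \<le> E'"
    proof -
      show "0 < E" by (simp add: E_def)
      have "1 * E \<le> exp t * E" using t by (intro mult_right_mono) (auto simp: E_def)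
      then show "E \<le> E'" using eE by simp
    qed
    have hd: "w * norm (heat_deriv \<beta> t x) \<le> A / T ^ (CARD('d) + length \<beta>) * E * exp (- 2 * y)"
      if "\<beta> \<in> multi_indices m" for \<beta>
      using bd[OF that \<rho> t xr] by (simp add: w_def E_def y_def T_def gx)
    have e2: "exp (- 2 * y) \<le> exp (- y)" using y by simp
    have "w * norm (K0 t g) \<le> w * norm (heat_deriv [] t x)"
    proof -
      have "norm (K0 t g) = \<theta> g * norm (heat_deriv [] t x)"
        using gO theta_range[of g] by (simp add: K0_lift[OF t] lift_def norm_mult x_def exp_log(1)[OF gO])
      also have "\<dots> \<le> 1 * norm (heat_deriv [] t x)"
        using theta_range[of g] by (intro mult_right_mono) auto
      finally show ?thesis by (simp add: w_def)
    qed
    also have "\<dots> \<le> A / T ^ CARD('d) * E * exp (- 2 * y)"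
      using hd[of "[]"] by (simp add: multi_indices_def)
    also have "\<dots> \<le> A' / T ^ CARD('d) * E' * exp (- y)"
      using A A' E T e2 by (intro mult_mono divide_right_mono) auto
    also have "\<dots> = A' * E' * (1 / T ^ CARD('d)) * exp (- y)" by simp
    finally show "exp (\<rho> * modulus g) * norm (K0 t g) \<le> A' * exp ((\<omega> + 1) * (1 + \<rho> ^ m) * t) * t powr (- real CARD('d) / real m) * exp (- (norm (log_coord g) / t powr (1 / m)))"
      unfolding Td by (simp add: w_def E'_def y_def T_def x_def)
    have summand: "w * norm (q \<beta> x * heat_deriv \<beta> t x) \<le> Q * (A / T ^ (CARD('d) + (m - 1)) * E' * exp (- y))"
      if \<beta>: "\<beta> \<in> multi_indices m" for \<beta>
    proof (cases "length \<beta> = m")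
      case True
      have m1: "T ^ m = T * T ^ (m - 1)" using order_ge_2 by (metis Suc_diff_1 less_le_trans pos2 power_Suc)
      have "y * exp (- 2 * y) \<le> exp (- y)"
      proof -
        have "y \<le> exp y" using exp_ge_add_one_self[of y] by linarith
        then have "y * exp (- 2 * y) \<le> exp y * exp (- 2 * y)" by (intro mult_right_mono) auto
        then show ?thesis by (simp flip: exp_add)
      qed
      then have 1: "A / T ^ (CARD('d) + (m - 1)) * E * (y * exp (- 2 * y)) \<le> A / T ^ (CARD('d) + (m - 1)) * E' * exp (- y)"
        using A E T y by (intro mult_mono) auto
      have "w * norm (q \<beta> x * heat_deriv \<beta> t x) = norm (q \<beta> x) * (w * norm (heat_deriv \<beta> t x))"
        by (simp add: norm_mult)
      also have "\<dots> \<le> (Q * norm x) * (A / T ^ (CARD('d) + length \<beta>) * E * exp (- 2 * y))"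
        using q[OF \<beta> x] True Q by (intro mult_mono hd \<beta>) (auto simp: w_def)
      also have "\<dots> = Q * (A / T ^ (CARD('d) + (m - 1)) * E * (y * exp (- 2 * y)))"
        using T by (simp add: True y_def power_add m1 field_simps)
      also have "\<dots> \<le> Q * (A / T ^ (CARD('d) + (m - 1)) * E' * exp (- y))"
        using 1 Q by (intro mult_left_mono)
      finally show ?thesis .
    next
      case False
      then have l: "length \<beta> \<le> m - 1" using \<beta> by (simp add: multi_indices_def)
      \<comment> \<open>The exponent lies between 0 and m, so the power is at most 1 or at most T^m
        = t, according to whether T \<le> 1.\<close>
      have Tk: "T ^ (m - 1 - length \<beta>) \<le> exp t"
      proof (cases "T \<le> 1")
        case True
        then have "T ^ (m - 1 - length \<beta>) \<le> 1" using T by (intro power_le_one) auto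
        then show ?thesis using t one_le_exp_iff[of t] by linarith
      next
        case False
        then have "T ^ (m - 1 - length \<beta>) \<le> T ^ m" by (intro power_increasing) auto
        then show ?thesis using Tm exp_ge_add_one_self[of t] by linarith
      qed
      have 1: "A / T ^ (CARD('d) + length \<beta>) * E \<le> A / T ^ (CARD('d) + (m - 1)) * E'"
      proof -
        have "T ^ (CARD('d) + (m - 1)) = T ^ (CARD('d) + length \<beta>) * T ^ (m - 1 - length \<beta>)"
          unfolding power_add[symmetric] using l by (intro arg_cong[where f = "power T"]) simp
        then have "A / T ^ (CARD('d) + length \<beta>) * E = A / T ^ (CARD('d) + (m - 1)) * (T ^ (m - 1 - length \<beta>) * E)"
          using T by simp
        also have "\<dots> \<le> A / T ^ (CARD('d) + (m - 1)) * E'"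
          using A T by (intro mult_left_mono order_trans[OF mult_right_mono[OF Tk] eE]) (auto simp: E_def)
        finally show ?thesis .
      qed
      have "w * norm (q \<beta> x * heat_deriv \<beta> t x) = norm (q \<beta> x) * (w * norm (heat_deriv \<beta> t x))"
        by (simp add: norm_mult)
      also have "\<dots> \<le> Q * (A / T ^ (CARD('d) + length \<beta>) * E * exp (- 2 * y))"
        using q[OF \<beta> x] Q by (intro mult_mono hd \<beta>) (auto simp: w_def)
      also have "\<dots> \<le> Q * (A / T ^ (CARD('d) + (m - 1)) * E' * exp (- y))"
        using Q A T E by (intro mult_left_mono mult_mono 1 e2) auto
      finally show ?thesis .
    qed
    have "w * norm (M t g) \<le> (\<Sum>\<beta>\<in>multi_indices m. w * norm (q \<beta> x * heat_deriv \<beta> t x))"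
      using gO by (simp add: Meq[OF t] lift_def x_def sum_distrib_left[symmetric] norm_sum w_def)
    also have "\<dots> \<le> (\<Sum>\<beta>\<in>(multi_indices m :: 'd list set). Q * (A / T ^ (CARD('d) + (m - 1)) * E' * exp (- y)))"
      by (intro sum_mono summand)
    also have "\<dots> = (A * (?N * Q)) * ((1 / T ^ (m - 1)) * (E' * (1 / T ^ CARD('d)) * exp (- y)))"
      by (simp add: power_add mult_ac)
    also have "\<dots> \<le> A' * ((1 / T ^ (m - 1)) * (E' * (1 / T ^ CARD('d)) * exp (- y)))"
      using T E A' by (intro mult_right_mono) auto
    finally show "exp (\<rho> * modulus g) * norm (M t g) \<le> A' * t powr (1 / m - 1) * exp ((\<omega> + 1) * (1 + \<rho> ^ m) * t) * t powr (- real CARD('d) / real m) * exp (- (norm (log_coord g) / t powr (1 / m)))"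
      unfolding Td T1 by (simp add: w_def E'_def y_def T_def x_def mult_ac)
  qed
  show ?thesis
    using A A' out ins by (intro exI[of _ A'] exI[of _ "\<omega> + 1"] conjI allI impI) auto
qed

text \<open>After the change to exponential coordinates, scaling by T = t^(1/m) produces T^d, which
  cancels t^(-d/m); the constant depends on neither t nor b.\<close>

lemma nn_integral_supp_le:
  "\<exists>C\<ge>0. \<forall>F\<in>borel_measurable borel. \<forall>t>0. \<forall>b\<ge>0. (\<forall>g. g \<notin> supp \<longrightarrow> F g = 0) \<longrightarrow>
     (\<forall>g\<in>supp. F g \<le> ennreal (b * t powr (- real CARD('d) / real m) * exp (- (norm (log_coord g) / t powr (1 / m))))) \<longrightarrow>
     (\<integral>\<^sup>+g. F g \<partial>dg) \<le> ennreal (C * b)"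
proof -
  obtain C where C: "C \<ge> 0" "\<And>F. F \<in> borel_measurable borel \<Longrightarrow> (\<And>g. g \<notin> supp \<Longrightarrow> F g = 0) \<Longrightarrow>
     (\<integral>\<^sup>+g. F g \<partial>dg) \<le> ennreal C * (\<integral>\<^sup>+x. F (exp_coord x) * indicator (ball 0 r) x \<partial>lborel)"
    using nn_integral_coord by blast
  let ?e = "\<lambda>x :: real ^ 'd. exp (- norm x)"
  have int: "integrable lborel ?e"
    by (rule integrable_power_exp_bound[where s = 1 and m = 1 and N = 0 and C = 1]) auto
  define I where "I = (\<integral>x. ?e x \<partial>lborel)"
  have I: "I \<ge> 0" "(\<integral>\<^sup>+x. ennreal (?e x) \<partial>lborel) = ennreal I"
    using nn_integral_eq_integral[OF int] by (auto simp: I_def)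
  have main: "(\<integral>\<^sup>+g. F g \<partial>dg) \<le> ennreal ((C * I) * b)"
    if F: "F \<in> borel_measurable borel" and t: "t > 0" and b: "b \<ge> 0" and z: "\<And>g. g \<notin> supp \<Longrightarrow> F g = 0"
      and le: "\<And>g. g \<in> supp \<Longrightarrow> F g \<le> ennreal (b * t powr (- real CARD('d) / real m) * exp (- (norm (log_coord g) / t powr (1 / m))))"
    for F t b
  proof -
    define T where "T = t powr (1 / m)"
    have T: "T > 0" using t by (simp add: T_def)
    let ?b = "b * t powr (- real CARD('d) / real m)"
    have Td: "T ^ CARD('d) = t powr (real CARD('d) / real m)" using t by (simp add: T_def powr_power)
    have bT: "?b * T ^ CARD('d) = b" using t by (simp add: Td mult.assoc flip: powr_add)
    have "(\<integral>\<^sup>+x. F (exp_coord x) * indicator (ball 0 r) x \<partial>lborel) \<le> (\<integral>\<^sup>+x. ennreal ?b * ennreal (?e ((1 / T) *\<^sub>R x)) \<partial>lborel)"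
    proof (rule nn_integral_mono)
      fix x :: "real ^ 'd"
      show "F (exp_coord x) * indicator (ball 0 r) x \<le> ennreal ?b * ennreal (?e ((1 / T) *\<^sub>R x))"
      proof (cases "x \<in> ball 0 r \<and> exp_coord x \<in> supp")
        case True
        then have "F (exp_coord x) \<le> ennreal (?b * exp (- (norm x / T)))"
          using le[of "exp_coord x"] by (simp add: T_def)
        then show ?thesis using True b T by (simp add: ennreal_mult[symmetric])
      next
        case False
        then show ?thesis using z[of "exp_coord x"] by (auto simp: indicator_def)
      qed
    qed
    also have "\<dots> = ennreal ?b * (\<integral>\<^sup>+x. ennreal (?e ((1 / T) *\<^sub>R x)) \<partial>lborel)"
      by (rule nn_integral_cmult) measurable
    also have "(\<integral>\<^sup>+x. ennreal (?e ((1 / T) *\<^sub>R x)) \<partial>lborel) = ennreal (1 / (1 / T) ^ DIM(real ^ 'd)) * ennreal I"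
      using T I(2) by (subst nn_integral_lborel_scale[of "\<lambda>x. ennreal (?e x)"]) auto
    also have "ennreal ?b * (ennreal (1 / (1 / T) ^ DIM(real ^ 'd)) * ennreal I) = ennreal (?b * T ^ CARD('d) * I)"
      using T I b by (simp add: ennreal_mult[symmetric] power_divide mult.assoc)
    also have "\<dots> = ennreal (b * I)" by (simp only: bT)
    finally have "ennreal C * (\<integral>\<^sup>+x. F (exp_coord x) * indicator (ball 0 r) x \<partial>lborel) \<le> ennreal C * ennreal (b * I)"
      by (intro mult_left_mono) auto
    then have "(\<integral>\<^sup>+g. F g \<partial>dg) \<le> ennreal C * ennreal (b * I)"
      using C(2)[OF F z] by (rule order_trans[rotated])
    also have "\<dots> = ennreal ((C * I) * b)" using C b I by (simp add: ennreal_mult[symmetric] mult_ac)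
    finally show ?thesis .
  qed
  show ?thesis using C I main by (intro exI[of _ "C * I"]) auto
qed

end

section \<open>Iterated convolutions\<close>

lemma powr_neg_half_le:
  fixes t x D :: real
  assumes "t > 0" "x \<ge> t / 2" "D \<ge> 0"
  shows "x powr (- D) \<le> 2 powr D * t powr (- D)"
proof -
  have "x powr (- D) \<le> (t / 2) powr (- D)" using assms by (intro powr_mono2') auto
  also have "\<dots> = 2 powr D * t powr (- D)" using assms by (simp add: powr_divide powr_minus field_simps)
  finally show ?thesis .
qed

context kernel_construction
begin

text \<open>The majorant of \<open>conv\<close> with values in the extended nonnegative reals. The
  open time interval keeps both t - s and s positive, where the kernel bounds hold; it omits only a
  null set.\<close>

definition nn_conv :: "(real \<Rightarrow> 'g \<Rightarrow> ennreal) \<Rightarrow> (real \<Rightarrow> 'g \<Rightarrow> ennreal) \<Rightarrow> real \<Rightarrow> 'g \<Rightarrow> ennreal"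
  where "nn_conv k \<mu> t g = (\<integral>\<^sup>+s. indicator {0<..<t} s * (\<integral>\<^sup>+h. k (t - s) h * \<mu> s (inv h \<otimes> g) \<partial>dg) \<partial>lborel)"

lemma norm_conv_le:
  "ennreal (norm (conv \<phi> \<psi> t g)) \<le> nn_conv (\<lambda>t h. ennreal (norm (\<phi> t h))) (\<lambda>t h. ennreal (norm (\<psi> t h))) t g"
proof -
  let ?F = "\<lambda>s. LINT h|dg. \<phi> (t - s) h * \<psi> s (inv h \<otimes> g)"
  have "ennreal (norm (conv \<phi> \<psi> t g)) \<le> (\<integral>\<^sup>+s. ennreal (norm (indicator {0..t} s *\<^sub>R ?F s)) \<partial>lborel)"
    unfolding conv_def set_lebesgue_integral_def by (rule ennreal_norm_integral_le)
  also have "\<dots> \<le> nn_conv (\<lambda>t h. ennreal (norm (\<phi> t h))) (\<lambda>t h. ennreal (norm (\<psi> t h))) t g"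
    unfolding nn_conv_def
  proof (rule nn_integral_mono_AE)
    have "AE s in lborel. s \<noteq> (0::real)" "AE s in lborel. s \<noteq> t" by (rule AE_lborel_singleton)+
    then show "AE s in lborel. ennreal (norm (indicator {0..t} s *\<^sub>R ?F s)) \<le>
       indicator {0<..<t} s * (\<integral>\<^sup>+h. ennreal (norm (\<phi> (t - s) h)) * ennreal (norm (\<psi> s (inv h \<otimes> g))) \<partial>dg)"
    proof eventually_elim
      case (elim s)
      have "ennreal (norm (?F s)) \<le> (\<integral>\<^sup>+h. ennreal (norm (\<phi> (t - s) h)) * ennreal (norm (\<psi> s (inv h \<otimes> g))) \<partial>dg)"
        using ennreal_norm_integral_le[of dg "\<lambda>h. \<phi> (t - s) h * \<psi> s (inv h \<otimes> g)"]
        by (simp add: norm_mult ennreal_mult)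
      then show ?case using elim by (auto simp: indicator_def)
    qed
  qed
  finally show ?thesis .
qed

text \<open>Fubini and left invariance factor the space integral into the L1 norms of
  \<open>k\<close> and \<mu>. As \<open>k\<close> is measured against e^((W+\<nu>)t) and \<mu> only
  against e^(Wt), a surplus e^(-\<nu>s) falls on the singularity s^(p-1), and their integral is the
  gain \<epsilon>.\<close>

lemma nn_conv_L1:
  assumes k: "(\<lambda>(t, g). k t g) \<in> borel_measurable (borel \<Otimes>\<^sub>M borel)"
    and \<mu>: "(\<lambda>(t, g). \<mu> t g) \<in> borel_measurable (borel \<Otimes>\<^sub>M borel)"
    and nonneg: "B \<ge> 0" "A \<ge> 0" "\<epsilon> \<ge> 0"
    and k_bound: "\<And>t. t > 0 \<Longrightarrow> (\<integral>\<^sup>+g. k t g \<partial>dg) \<le> ennreal (B * exp ((W + \<nu>) * t))"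
    and \<mu>_bound: "\<And>t. t > 0 \<Longrightarrow> (\<integral>\<^sup>+g. \<mu> t g \<partial>dg) \<le> ennreal (A * t powr (p - 1) * exp (W * t))"
    and \<epsilon>: "(\<integral>\<^sup>+s. ennreal (indicator {0<..} s * (s powr (p - 1) * exp (- \<nu> * s))) \<partial>lborel) \<le> ennreal \<epsilon>"
    and t: "t > 0"
  shows "(\<integral>\<^sup>+g. nn_conv k \<mu> t g \<partial>dg) \<le> ennreal (B * (A * \<epsilon>) * exp ((W + \<nu>) * t))"
proof -
  note [measurable] = measurable_case_prod_compose[OF k] measurable_case_prod_compose[OF \<mu>]
  interpret P: pair_sigma_finite lborel dg ..
  have k': "(\<lambda>q. k (t - fst (fst q)) (snd q)) \<in> borel_measurable ((lborel \<Otimes>\<^sub>M dg) \<Otimes>\<^sub>M dg)"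
    by measurable
  have \<mu>': "(\<lambda>q. \<mu> (fst (fst q)) (inv (snd q) \<otimes> snd (fst q))) \<in> borel_measurable ((lborel \<Otimes>\<^sub>M dg) \<Otimes>\<^sub>M dg)"
    by measurable
  have [measurable]: "(\<lambda>q. \<integral>\<^sup>+h. k (t - fst q) h * \<mu> (fst q) (inv h \<otimes> snd q) \<partial>dg) \<in> borel_measurable (lborel \<Otimes>\<^sub>M dg)"
    using borel_measurable_times_ennreal[OF k' \<mu>'] by (intro dg.borel_measurable_nn_integral) (simp add: case_prod_beta')
  have F: "(\<lambda>(s, g). indicator {0<..<t} s * (\<integral>\<^sup>+h. k (t - s) h * \<mu> s (inv h \<otimes> g) \<partial>dg)) \<in> borel_measurable (lborel \<Otimes>\<^sub>M dg)"
    unfolding case_prod_beta' by measurable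
  have "(\<integral>\<^sup>+g. nn_conv k \<mu> t g \<partial>dg)
      = (\<integral>\<^sup>+s. \<integral>\<^sup>+g. indicator {0<..<t} s * (\<integral>\<^sup>+h. k (t - s) h * \<mu> s (inv h \<otimes> g) \<partial>dg) \<partial>dg \<partial>lborel)"
    unfolding nn_conv_def by (rule P.Fubini'[OF F])
  also have "\<dots> = (\<integral>\<^sup>+s. indicator {0<..<t} s * ((\<integral>\<^sup>+h. k (t - s) h \<partial>dg) * (\<integral>\<^sup>+g. \<mu> s g \<partial>dg)) \<partial>lborel)"
  proof (rule nn_integral_cong)
    fix s :: real
    have "(\<integral>\<^sup>+g. indicator {0<..<t} s * (\<integral>\<^sup>+h. k (t - s) h * \<mu> s (inv h \<otimes> g) \<partial>dg) \<partial>dg)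
       = indicator {0<..<t} s * (\<integral>\<^sup>+g. \<integral>\<^sup>+h. k (t - s) h * \<mu> s (inv h \<otimes> g) \<partial>dg \<partial>dg)"
      by (rule nn_integral_cmult) measurable
    also have "(\<integral>\<^sup>+g. \<integral>\<^sup>+h. k (t - s) h * \<mu> s (inv h \<otimes> g) \<partial>dg \<partial>dg) = (\<integral>\<^sup>+h. \<integral>\<^sup>+g. k (t - s) h * \<mu> s (inv h \<otimes> g) \<partial>dg \<partial>dg)"
      by (rule dg_dg.Fubini') measurable
    also have "\<dots> = (\<integral>\<^sup>+h. k (t - s) h * (\<integral>\<^sup>+g. \<mu> s g \<partial>dg) \<partial>dg)"
    proof (rule nn_integral_cong)
      fix h
      have "(\<integral>\<^sup>+g. k (t - s) h * \<mu> s (inv h \<otimes> g) \<partial>dg) = k (t - s) h * (\<integral>\<^sup>+g. \<mu> s (inv h \<otimes> g) \<partial>dg)"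
        by (rule nn_integral_cmult) measurable
      also have "(\<integral>\<^sup>+g. \<mu> s (inv h \<otimes> g) \<partial>dg) = (\<integral>\<^sup>+g. \<mu> s g \<partial>dg)"
        by (rule nn_integral_left_translate) measurable
      finally show "(\<integral>\<^sup>+g. k (t - s) h * \<mu> s (inv h \<otimes> g) \<partial>dg) = k (t - s) h * (\<integral>\<^sup>+g. \<mu> s g \<partial>dg)" .
    qed
    also have "\<dots> = (\<integral>\<^sup>+h. k (t - s) h \<partial>dg) * (\<integral>\<^sup>+g. \<mu> s g \<partial>dg)"
      by (rule nn_integral_multc) measurable
    finally show "(\<integral>\<^sup>+g. indicator {0<..<t} s * (\<integral>\<^sup>+h. k (t - s) h * \<mu> s (inv h \<otimes> g) \<partial>dg) \<partial>dg)
       = indicator {0<..<t} s * ((\<integral>\<^sup>+h. k (t - s) h \<partial>dg) * (\<integral>\<^sup>+g. \<mu> s g \<partial>dg))" .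
  qed
  also have "\<dots> \<le> (\<integral>\<^sup>+s. ennreal (B * A * exp ((W + \<nu>) * t)) * ennreal (indicator {0<..} s * (s powr (p - 1) * exp (- \<nu> * s))) \<partial>lborel)"
  proof (rule nn_integral_mono)
    fix s :: real
    show "indicator {0<..<t} s * ((\<integral>\<^sup>+h. k (t - s) h \<partial>dg) * (\<integral>\<^sup>+g. \<mu> s g \<partial>dg))
      \<le> ennreal (B * A * exp ((W + \<nu>) * t)) * ennreal (indicator {0<..} s * (s powr (p - 1) * exp (- \<nu> * s)))"
    proof (cases "s \<in> {0<..<t}")
      case True
      have "(\<integral>\<^sup>+h. k (t - s) h \<partial>dg) * (\<integral>\<^sup>+g. \<mu> s g \<partial>dg)
         \<le> ennreal (B * exp ((W + \<nu>) * (t - s))) * ennreal (A * s powr (p - 1) * exp (W * s))"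
        using True by (intro mult_mono k_bound \<mu>_bound) auto
      also have "\<dots> = ennreal (B * A * exp ((W + \<nu>) * t) * (s powr (p - 1) * exp (- \<nu> * s)))"
      proof -
        have "exp ((W + \<nu>) * (t - s)) * exp (W * s) = exp ((W + \<nu>) * t) * exp (- \<nu> * s)"
          by (simp add: mult_exp_exp algebra_simps)
        then have "(B * exp ((W + \<nu>) * (t - s))) * (A * s powr (p - 1) * exp (W * s))
            = B * A * exp ((W + \<nu>) * t) * (s powr (p - 1) * exp (- \<nu> * s))"
          by (metis (no_types, opaque_lifting) mult.assoc mult.left_commute)
        then show ?thesis using nonneg by (simp only: ennreal_mult[symmetric] mult_nonneg_nonneg exp_ge_zero powr_ge_zero)
      qed
      finally show ?thesis using True nonneg by (simp add: ennreal_mult[symmetric])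
    qed simp
  qed
  also have "\<dots> = ennreal (B * A * exp ((W + \<nu>) * t)) * (\<integral>\<^sup>+s. ennreal (indicator {0<..} s * (s powr (p - 1) * exp (- \<nu> * s))) \<partial>lborel)"
    by (rule nn_integral_cmult) measurable
  also have "\<dots> \<le> ennreal (B * A * exp ((W + \<nu>) * t)) * ennreal \<epsilon>"
    by (intro mult_left_mono \<epsilon>) simp
  also have "\<dots> = ennreal (B * (A * \<epsilon>) * exp ((W + \<nu>) * t))"
    using nonneg by (simp add: ennreal_mult[symmetric] mult_ac)
  finally show ?thesis .
qed

text \<open>Near \<open>s = t\<close> the supremum is taken of \<open>\<mu>\<close>, near \<open>s = 0\<close> of \<open>k\<close>; in either case the
  singular factor \<open>x\<^sup>-\<^sup>D\<close> is evaluated at some \<open>x \<ge> t / 2\<close>.\<close>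

lemma nn_conv_sup:
  assumes k: "(\<lambda>(t, g). k t g) \<in> borel_measurable (borel \<Otimes>\<^sub>M borel)"
    and \<mu>: "(\<lambda>(t, g). \<mu> t g) \<in> borel_measurable (borel \<Otimes>\<^sub>M borel)"
    and nonneg: "B \<ge> 0" "A \<ge> 0" "\<epsilon> \<ge> 0" "D \<ge> 0"
    and k_bound: "\<And>t. t > 0 \<Longrightarrow> (\<integral>\<^sup>+g. k t g \<partial>dg) \<le> ennreal (B * exp ((W + \<nu>) * t))"
    and k_sup: "\<And>t g. t > 0 \<Longrightarrow> k t g \<le> ennreal (B * t powr (- D) * exp ((W + \<nu>) * t))"
    and \<mu>_bound: "\<And>t. t > 0 \<Longrightarrow> (\<integral>\<^sup>+g. \<mu> t (inv g) \<partial>dg) \<le> ennreal (A * t powr (p - 1) * exp (W * t))"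
    and \<mu>_sup: "\<And>t g. t > 0 \<Longrightarrow> \<mu> t g \<le> ennreal (A * t powr (- D) * t powr (p - 1) * exp (W * t))"
    and \<epsilon>: "(\<integral>\<^sup>+s. ennreal (indicator {0<..} s * (s powr (p - 1) * exp (- \<nu> * s))) \<partial>lborel) \<le> ennreal \<epsilon>"
    and t: "t > 0"
  shows "nn_conv k \<mu> t g \<le> ennreal (B * (A * \<epsilon> * 2 powr D) * t powr (- D) * exp ((W + \<nu>) * t))"
proof -
  note [measurable] = measurable_case_prod_compose[OF k] measurable_case_prod_compose[OF \<mu>]
  let ?c = "B * A * (2 powr D * t powr (- D)) * exp ((W + \<nu>) * t)"
  have E: "exp ((W + \<nu>) * (t - s)) * exp (W * s) = exp ((W + \<nu>) * t) * exp (- \<nu> * s)" for s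
    by (simp add: mult_exp_exp algebra_simps)
  have "nn_conv k \<mu> t g \<le> (\<integral>\<^sup>+s. ennreal ?c * ennreal (indicator {0<..} s * (s powr (p - 1) * exp (- \<nu> * s))) \<partial>lborel)"
    unfolding nn_conv_def
  proof (rule nn_integral_mono)
    fix s :: real
    show "indicator {0<..<t} s * (\<integral>\<^sup>+h. k (t - s) h * \<mu> s (inv h \<otimes> g) \<partial>dg)
      \<le> ennreal ?c * ennreal (indicator {0<..} s * (s powr (p - 1) * exp (- \<nu> * s)))"
    proof (cases "s \<in> {0<..<t}")
      case True
      have "(\<integral>\<^sup>+h. k (t - s) h * \<mu> s (inv h \<otimes> g) \<partial>dg) \<le> ennreal (?c * (s powr (p - 1) * exp (- \<nu> * s)))"
      proof (cases "s \<le> t / 2")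
        case le: True
        \<comment> \<open>Substituting gh for h removes g from the integral of \<mu>(h^-1 g) and
          leaves that of \<mu>(h^-1), which is what \<open>\<mu>_bound\<close> controls.\<close>
        have "(\<integral>\<^sup>+h. \<mu> s (inv (g \<otimes> h) \<otimes> g) \<partial>dg) = (\<integral>\<^sup>+h. \<mu> s (inv h \<otimes> g) \<partial>dg)"
          by (rule nn_integral_left_translate[of "\<lambda>h. \<mu> s (inv h \<otimes> g)"]) measurable
        moreover have "inv (g \<otimes> h) \<otimes> g = inv h" for h by (simp add: carrier_UNIV inv_mult_group m_assoc)
        ultimately have inv: "(\<integral>\<^sup>+h. \<mu> s (inv h \<otimes> g) \<partial>dg) = (\<integral>\<^sup>+h. \<mu> s (inv h) \<partial>dg)" by simp
        have "(\<integral>\<^sup>+h. k (t - s) h * \<mu> s (inv h \<otimes> g) \<partial>dg)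
           \<le> (\<integral>\<^sup>+h. ennreal (B * (t - s) powr (- D) * exp ((W + \<nu>) * (t - s))) * \<mu> s (inv h \<otimes> g) \<partial>dg)"
          using True by (intro nn_integral_mono mult_right_mono k_sup) auto
        also have "\<dots> = ennreal (B * (t - s) powr (- D) * exp ((W + \<nu>) * (t - s))) * (\<integral>\<^sup>+h. \<mu> s (inv h) \<partial>dg)"
          by (subst nn_integral_cmult) (measurable, simp add: inv)
        also have "\<dots> \<le> ennreal (B * (2 powr D * t powr (- D)) * exp ((W + \<nu>) * (t - s))) * ennreal (A * s powr (p - 1) * exp (W * s))"
          using True nonneg le t by (intro mult_mono ennreal_leI \<mu>_bound mult_right_mono mult_left_mono powr_neg_half_le) auto
        also have "\<dots> = ennreal (B * A * (2 powr D * t powr (- D)) * s powr (p - 1) * (exp ((W + \<nu>) * (t - s)) * exp (W * s)))"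
          using nonneg by (simp add: ennreal_mult[symmetric] mult_ac)
        finally show ?thesis unfolding E by (simp only: mult_ac)
      next
        case False
        have "(\<integral>\<^sup>+h. k (t - s) h * \<mu> s (inv h \<otimes> g) \<partial>dg)
           \<le> (\<integral>\<^sup>+h. k (t - s) h * ennreal (A * s powr (- D) * s powr (p - 1) * exp (W * s)) \<partial>dg)"
          using True by (intro nn_integral_mono mult_left_mono \<mu>_sup) auto
        also have "\<dots> = (\<integral>\<^sup>+h. k (t - s) h \<partial>dg) * ennreal (A * s powr (- D) * s powr (p - 1) * exp (W * s))"
          by (rule nn_integral_multc) measurable
        also have "\<dots> \<le> ennreal (B * exp ((W + \<nu>) * (t - s))) * ennreal (A * (2 powr D * t powr (- D)) * s powr (p - 1) * exp (W * s))"
          using True nonneg False t by (intro mult_mono ennreal_leI k_bound mult_right_mono mult_left_mono powr_neg_half_le) auto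
        also have "\<dots> = ennreal (B * A * (2 powr D * t powr (- D)) * s powr (p - 1) * (exp ((W + \<nu>) * (t - s)) * exp (W * s)))"
          using nonneg by (simp add: ennreal_mult[symmetric] mult_ac)
        finally show ?thesis unfolding E by (simp only: mult_ac)
      qed
      then show ?thesis using True nonneg by (simp add: ennreal_mult[symmetric])
    qed simp
  qed
  also have "\<dots> = ennreal ?c * (\<integral>\<^sup>+s. ennreal (indicator {0<..} s * (s powr (p - 1) * exp (- \<nu> * s))) \<partial>lborel)"
    by (rule nn_integral_cmult) measurable
  also have "\<dots> \<le> ennreal ?c * ennreal \<epsilon>"
    by (intro mult_left_mono \<epsilon>) simp
  also have "\<dots> = ennreal (B * (A * \<epsilon> * 2 powr D) * t powr (- D) * exp ((W + \<nu>) * t))"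
    using nonneg by (simp add: ennreal_mult[symmetric] mult_ac)
  finally show ?thesis .
qed

section \<open>Geometric bounds for the iterates and their sum\<close>

lemma measurable_conv:
  assumes "(\<lambda>(t, g). \<phi> t g) \<in> borel_measurable (borel \<Otimes>\<^sub>M borel)"
    and "(\<lambda>(t, g). \<psi> t g) \<in> borel_measurable (borel \<Otimes>\<^sub>M borel)"
  shows "(\<lambda>(t, g). conv \<phi> \<psi> t g) \<in> borel_measurable (borel \<Otimes>\<^sub>M borel)"
proof -
  note [measurable] = measurable_case_prod_compose[OF assms(1)] measurable_case_prod_compose[OF assms(2)]
  have "conv \<phi> \<psi> t g = (\<integral>s. (if 0 \<le> s \<and> s \<le> t then (\<integral>h. \<phi> (t - s) h * \<psi> s (inv h \<otimes> g) \<partial>dg) else 0) \<partial>lborel)" for t g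
    unfolding conv_def set_lebesgue_integral_def by (intro Bochner_Integration.integral_cong) (auto simp: indicator_def)
  then show ?thesis unfolding case_prod_beta' by simp measurable
qed

lemma measurable_K_iter: "(\<lambda>(t, g). K_iter n t g) \<in> borel_measurable (borel \<Otimes>\<^sub>M borel)"
proof (induction n)
  case 0
  then show ?case using measurable_K0 by simp
next
  case (Suc n)
  have "(\<lambda>x. - (case x of (t, g) \<Rightarrow> conv (K_iter n) M t g)) \<in> borel_measurable (borel \<Otimes>\<^sub>M borel)"
    by (intro borel_measurable_uminus measurable_conv Suc measurable_M)
  then show ?case by (simp add: case_prod_beta')
qed


text \<open>The two bounds form one induction: the supremum bound of the next iterate uses both
  bounds of the present one, its supremum for s \<le> t/2 and its L1 norm for s > t/2.\<close>

lemma K_iter_bounds: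
  assumes conn: "connected (UNIV :: 'g set)"
  shows "\<exists>A>0. \<exists>\<omega>\<ge>0. \<forall>\<rho>\<ge>0. \<forall>t>0. \<forall>n.
    (\<integral>\<^sup>+g. ennreal (exp (\<rho> * modulus g) * norm (K_iter n t g)) \<partial>dg) \<le> ennreal (A * (1 / 2) ^ n * exp (\<omega> * (1 + \<rho> ^ m) * t)) \<and>
    (\<forall>g. exp (\<rho> * modulus g) * norm (K_iter n t g) \<le> A * (1 / 2) ^ n * t powr (- real CARD('d) / real m) * exp (\<omega> * (1 + \<rho> ^ m) * t))"
proof -
  obtain A0 \<omega> where A0: "A0 > 0" "\<omega> \<ge> 0" and pointwise: "\<forall>\<rho>\<ge>0. \<forall>t>0. \<forall>g.
     (g \<notin> supp \<longrightarrow> K0 t g = 0 \<and> M t g = 0) \<and>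
     (g \<in> supp \<longrightarrow>
       exp (\<rho> * modulus g) * norm (K0 t g) \<le> A0 * exp (\<omega> * (1 + \<rho> ^ m) * t) * t powr (- real CARD('d) / real m) * exp (- (norm (log_coord g) / t powr (1 / m))) \<and>
       exp (\<rho> * modulus g) * norm (M t g) \<le> A0 * t powr (1 / m - 1) * exp (\<omega> * (1 + \<rho> ^ m) * t) * t powr (- real CARD('d) / real m) * exp (- (norm (log_coord g) / t powr (1 / m))))"
    using K0_M_pointwise by (elim exE conjE)
  have out: "K0 t g = 0 \<and> M t g = 0" if "t > 0" "g \<notin> supp" for t g
    using pointwise[rule_format, of 0 t g] that by simp
  have K0: "exp (\<rho> * modulus g) * norm (K0 t g)
      \<le> A0 * exp (\<omega> * (1 + \<rho> ^ m) * t) * t powr (- real CARD('d) / real m) * exp (- (norm (log_coord g) / t powr (1 / m)))"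
    and M: "exp (\<rho> * modulus g) * norm (M t g)
      \<le> A0 * t powr (1 / m - 1) * exp (\<omega> * (1 + \<rho> ^ m) * t) * t powr (- real CARD('d) / real m) * exp (- (norm (log_coord g) / t powr (1 / m)))"
    if "\<rho> \<ge> 0" "t > 0" "g \<in> supp" for \<rho> t g
    using pointwise[rule_format, OF that(1,2), of g] that(3) by simp_all
  obtain C where C_nonneg: "C \<ge> 0" and C_bound: "\<forall>F\<in>borel_measurable borel. \<forall>t>0. \<forall>b\<ge>0. (\<forall>g. g \<notin> supp \<longrightarrow> F g = 0) \<longrightarrow>
     (\<forall>g\<in>supp. F g \<le> ennreal (b * t powr (- real CARD('d) / real m) * exp (- (norm (log_coord g) / t powr (1 / m))))) \<longrightarrow>
     (\<integral>\<^sup>+g. F g \<partial>dg) \<le> ennreal (C * b)"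
    using nn_integral_supp_le by (elim exE conjE)
  note C = C_nonneg C_bound[rule_format]
  obtain C' where C': "C' \<ge> 0" "\<And>F. F \<in> borel_measurable borel \<Longrightarrow> (\<And>g. g \<notin> \<Omega> \<Longrightarrow> F g = 0) \<Longrightarrow>
     (\<integral>\<^sup>+k. F (inv k) \<partial>dg) \<le> ennreal C' * (\<integral>\<^sup>+k. F k \<partial>dg)"
    using nn_integral_inverse_le by blast
  \<comment> \<open>One constant above those of the pointwise bounds, of the L1 bounds (factor C)
    and of the L1 bound of M after inversion (factor C').\<close>
  define A where "A = A0 * (1 + C) * (1 + C')"
  define D where "D = real CARD('d) / m"
  define p where "p = 1 / real m"
  have p: "p > 0" using order_ge_2 by (simp add: p_def)
  have D: "D \<ge> 0" by (simp add: D_def)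
  have A: "A > 0" "A0 \<le> A" "C * A0 \<le> A" "C' * (C * A0) \<le> A"
    using A0 C(1) C'(1) by (auto simp: A_def algebra_simps add_pos_nonneg intro!: add_nonneg_nonneg mult_nonneg_nonneg)
  \<comment> \<open>Makes A \<epsilon> 2^D equal to 1/2, with 2^D the loss in
    \<open>nn_conv_sup\<close>; the L1 step then gains at least as much.\<close>
  define \<epsilon> where "\<epsilon> = 1 / (2 * A * 2 powr D)"
  have \<epsilon>: "\<epsilon> > 0" using A by (simp add: \<epsilon>_def)
  obtain \<nu> where \<nu>: "\<nu> > 0" and J: "(\<integral>\<^sup>+s. ennreal (indicator {0<..} s * (s powr (p - 1) * exp (- \<nu> * s))) \<partial>lborel) \<le> ennreal \<epsilon>"
    using exists_small_Laplace_power[OF p \<epsilon>] by blast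
  have half: "A * \<epsilon> * 2 powr D = 1 / 2" using A by (simp add: \<epsilon>_def)
  have half': "A * \<epsilon> \<le> 1 / 2"
  proof -
    have "1 \<le> 2 powr D" using D by (simp add: ge_one_powr_ge_zero)
    then have "A * \<epsilon> * 1 \<le> A * \<epsilon> * 2 powr D" using A \<epsilon> by (intro mult_left_mono) auto
    then show ?thesis using half by simp
  qed
  have main: "(\<forall>t>0. (\<integral>\<^sup>+g. ennreal (exp (\<rho> * modulus g) * norm (K_iter n t g)) \<partial>dg) \<le> ennreal (A * (1 / 2) ^ n * exp ((\<omega> * (1 + \<rho> ^ m) + \<nu>) * t))) \<and>
    (\<forall>t>0. \<forall>g. ennreal (exp (\<rho> * modulus g) * norm (K_iter n t g)) \<le> ennreal (A * (1 / 2) ^ n * t powr (- D) * exp ((\<omega> * (1 + \<rho> ^ m) + \<nu>) * t)))"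
    if \<rho>: "\<rho> \<ge> 0" for \<rho> n
  proof -
    define W where "W = \<omega> * (1 + \<rho> ^ m)"
    define w where "w g = exp (\<rho> * modulus g)" for g
    have w_pos: "w g > 0" for g by (simp add: w_def)
    have w_mult: "w (g \<otimes> h) \<le> w g * w h" for g h
    proof -
      have "modulus (g \<otimes> h) \<le> modulus g + modulus h"
        using path_to_exists[OF conn] modulus_mult_le by blast
      then have "\<rho> * modulus (g \<otimes> h) \<le> \<rho> * (modulus g + modulus h)" using \<rho> by (intro mult_left_mono)
      then show ?thesis by (simp add: w_def mult_exp_exp distrib_left)
    qed
    have w_meas [measurable]: "w \<in> borel_measurable borel"
      unfolding w_def[abs_def]
      by (intro borel_measurable_continuous_onI continuous_intros modulus_continuous[OF conn])
    have meas: "(\<lambda>(t, g). ennreal (w g * norm (k t g))) \<in> borel_measurable (borel \<Otimes>\<^sub>M borel)"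
      if "(\<lambda>(t, g). k t g) \<in> borel_measurable (borel \<Otimes>\<^sub>M borel)" for k :: "real \<Rightarrow> 'g \<Rightarrow> complex"
    proof -
      note [measurable] = measurable_case_prod_compose[OF that]
      show ?thesis unfolding case_prod_beta' by measurable
    qed
    let ?k = "\<lambda>n t g. ennreal (w g * norm (K_iter n t g))"
    let ?\<mu> = "\<lambda>t g. ennreal (w g * norm (M t g))"
    have mt: "(\<lambda>g. ennreal (w g * norm (k t g))) \<in> borel_measurable borel"
      if "(\<lambda>(t, g). k t g) \<in> borel_measurable (borel \<Otimes>\<^sub>M borel)" for k :: "real \<Rightarrow> 'g \<Rightarrow> complex" and t
    proof -
      note [measurable] = measurable_case_prod_compose[OF that]
      show ?thesis by measurable
    qed
    have eW: "exp (W * t) \<le> exp ((W + \<nu>) * t)" if "t > 0" for t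
      using that \<nu> by (simp add: algebra_simps)
    have drop: "c * exp (- (norm (log_coord g) / t powr (1 / m))) \<le> c" if "c \<ge> 0" for c t g
      using that by (intro mult_left_le) auto
    have \<mu>0: "?\<mu> t g \<le> ennreal (A0 * t powr (p - 1) * exp (W * t) * t powr (- real CARD('d) / real m) * exp (- (norm (log_coord g) / t powr (1 / m))))"
      if "t > 0" "g \<in> supp" for t g
      using M[OF \<rho> that] by (intro ennreal_leI) (simp add: w_def W_def p_def)
    have \<mu>1: "(\<integral>\<^sup>+g. ?\<mu> t g \<partial>dg) \<le> ennreal (C * A0 * t powr (p - 1) * exp (W * t))" if t: "t > 0" for t
    proof -
      have "(\<integral>\<^sup>+g. ?\<mu> t g \<partial>dg) \<le> ennreal (C * (A0 * t powr (p - 1) * exp (W * t)))"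
        by (rule C(2)[OF mt[OF measurable_M] t]) (use \<mu>0[OF t] out[OF t] A0 in auto)
      then show ?thesis by (simp add: mult.assoc)
    qed
    have \<mu>_L1: "(\<integral>\<^sup>+g. ?\<mu> t g \<partial>dg) \<le> ennreal (A * t powr (p - 1) * exp (W * t))" if t: "t > 0" for t
      using \<mu>1[OF t] by (rule order_trans) (intro ennreal_leI mult_right_mono A; simp)
    have \<mu>_inv: "(\<integral>\<^sup>+g. ?\<mu> t (inv g) \<partial>dg) \<le> ennreal (A * t powr (p - 1) * exp (W * t))" if t: "t > 0" for t
    proof -
      have z: "M t g = 0" if "g \<notin> \<Omega>" for g using out[OF t] supp(3) that by blast
      have "(\<integral>\<^sup>+g. ?\<mu> t (inv g) \<partial>dg) \<le> ennreal C' * (\<integral>\<^sup>+g. ?\<mu> t g \<partial>dg)"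
        by (rule C'(2)[OF mt[OF measurable_M]]) (simp add: z)
      also have "\<dots> \<le> ennreal C' * ennreal (C * A0 * t powr (p - 1) * exp (W * t))"
        by (intro mult_left_mono \<mu>1 t) simp
      also have "\<dots> = ennreal (C' * (C * A0) * t powr (p - 1) * exp (W * t))"
        using C C' A0 by (simp add: ennreal_mult[symmetric] mult.assoc)
      also have "\<dots> \<le> ennreal (A * t powr (p - 1) * exp (W * t))"
        by (intro ennreal_leI mult_right_mono A) auto
      finally show ?thesis .
    qed
    have \<mu>_sup: "?\<mu> t g \<le> ennreal (A * t powr (- D) * t powr (p - 1) * exp (W * t))" if t: "t > 0" for t g
    proof (cases "g \<in> supp")
      case True
      have "?\<mu> t g \<le> ennreal (A0 * t powr (p - 1) * exp (W * t) * t powr (- real CARD('d) / real m))"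
        by (rule order_trans[OF \<mu>0[OF t True]]) (intro ennreal_leI drop, use A0 in auto)
      also have "\<dots> \<le> ennreal (A * t powr (p - 1) * exp (W * t) * t powr (- real CARD('d) / real m))"
        by (intro ennreal_leI mult_right_mono A) auto
      finally show ?thesis by (simp add: D_def mult_ac)
    qed (use out[OF t] in simp)
    have k0: "?k 0 t g \<le> ennreal (A0 * exp ((W + \<nu>) * t) * t powr (- real CARD('d) / real m) * exp (- (norm (log_coord g) / t powr (1 / m))))"
      if "t > 0" "g \<in> supp" for t g
    proof (rule ennreal_leI)
      have "w g * norm (K_iter 0 t g) \<le> A0 * exp (W * t) * t powr (- real CARD('d) / real m) * exp (- (norm (log_coord g) / t powr (1 / m)))"
        using K0[OF \<rho> that] by (simp add: w_def W_def)
      also have "\<dots> \<le> A0 * exp ((W + \<nu>) * t) * t powr (- real CARD('d) / real m) * exp (- (norm (log_coord g) / t powr (1 / m)))"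
        using A0 by (intro mult_right_mono mult_left_mono eW that) auto
      finally show "w g * norm (K_iter 0 t g) \<le> \<dots>" .
    qed
    have "(\<forall>t>0. (\<integral>\<^sup>+g. ?k n t g \<partial>dg) \<le> ennreal (A * (1 / 2) ^ n * exp ((W + \<nu>) * t))) \<and>
      (\<forall>t>0. \<forall>g. ?k n t g \<le> ennreal (A * (1 / 2) ^ n * t powr (- D) * exp ((W + \<nu>) * t)))"
    proof (induction n)
      case 0
      have "(\<integral>\<^sup>+g. ?k 0 t g \<partial>dg) \<le> ennreal (A * exp ((W + \<nu>) * t))" if t: "t > 0" for t
      proof -
        have "(\<integral>\<^sup>+g. ?k 0 t g \<partial>dg) \<le> ennreal (C * (A0 * exp ((W + \<nu>) * t)))"
          by (rule C(2)[OF mt[OF measurable_K_iter] t]) (use k0[OF t] out[OF t] A0 in auto)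
        also have "\<dots> \<le> ennreal (A * exp ((W + \<nu>) * t))"
          unfolding mult.assoc[symmetric] by (intro ennreal_leI mult_right_mono A) auto
        finally show ?thesis .
      qed
      moreover have "?k 0 t g \<le> ennreal (A * t powr (- D) * exp ((W + \<nu>) * t))" if t: "t > 0" for t g
      proof (cases "g \<in> supp")
        case True
        have "?k 0 t g \<le> ennreal (A0 * exp ((W + \<nu>) * t) * t powr (- real CARD('d) / real m))"
          by (rule order_trans[OF k0[OF t True]]) (intro ennreal_leI drop, use A0 in auto)
        also have "\<dots> \<le> ennreal (A * exp ((W + \<nu>) * t) * t powr (- real CARD('d) / real m))"
          by (intro ennreal_leI mult_right_mono A) auto
        finally show ?thesis by (simp add: D_def mult_ac)
      qed (use out[OF t] in simp)
      ultimately show ?case by simp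
    next
      case (Suc n)
      have step: "?k (Suc n) t g \<le> nn_conv (?k n) ?\<mu> t g" for t g
      proof -
        have "?k (Suc n) t g = ennreal (w g) * ennreal (norm (conv (K_iter n) M t g))"
          using w_pos[of g] by (simp add: ennreal_mult)
        also have "\<dots> \<le> ennreal (w g) * nn_conv (\<lambda>t h. ennreal (norm (K_iter n t h))) (\<lambda>t h. ennreal (norm (M t h))) t g"
          by (intro mult_left_mono norm_conv_le) simp
        also have "\<dots> = (\<integral>\<^sup>+s. ennreal (w g) * (indicator {0<..<t} s * (\<integral>\<^sup>+h. ennreal (norm (K_iter n (t - s) h)) * ennreal (norm (M s (inv h \<otimes> g))) \<partial>dg)) \<partial>lborel)"
        proof -
          note [measurable] = measurable_case_prod_compose[OF measurable_K_iter] measurable_case_prod_compose[OF measurable_M]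
          show ?thesis unfolding nn_conv_def by (rule nn_integral_cmult[symmetric]) measurable
        qed
        also have "\<dots> \<le> nn_conv (?k n) ?\<mu> t g"
          unfolding nn_conv_def
        proof (rule nn_integral_mono)
          fix s :: real
          note [measurable] = measurable_case_prod_compose[OF measurable_K_iter] measurable_case_prod_compose[OF measurable_M]
          have "ennreal (w g) * (\<integral>\<^sup>+h. ennreal (norm (K_iter n (t - s) h)) * ennreal (norm (M s (inv h \<otimes> g))) \<partial>dg)
             = (\<integral>\<^sup>+h. ennreal (w g) * (ennreal (norm (K_iter n (t - s) h)) * ennreal (norm (M s (inv h \<otimes> g)))) \<partial>dg)"
            by (rule nn_integral_cmult[symmetric]) measurable
          also have "\<dots> \<le> (\<integral>\<^sup>+h. ?k n (t - s) h * ?\<mu> s (inv h \<otimes> g) \<partial>dg)"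
          proof (rule nn_integral_mono)
            fix h
            have "w g \<le> w h * w (inv h \<otimes> g)"
              using w_mult[of h "inv h \<otimes> g"] by (simp add: carrier_UNIV m_assoc[symmetric])
            then have "w g * (norm (K_iter n (t - s) h) * norm (M s (inv h \<otimes> g)))
               \<le> (w h * w (inv h \<otimes> g)) * (norm (K_iter n (t - s) h) * norm (M s (inv h \<otimes> g)))"
              by (intro mult_right_mono) auto
            then show "ennreal (w g) * (ennreal (norm (K_iter n (t - s) h)) * ennreal (norm (M s (inv h \<otimes> g))))
               \<le> ?k n (t - s) h * ?\<mu> s (inv h \<otimes> g)"
              using w_pos[THEN less_imp_le] by (simp add: ennreal_mult[symmetric] mult_ac ennreal_leI)
          qed
          finally have "ennreal (w g) * (\<integral>\<^sup>+h. ennreal (norm (K_iter n (t - s) h)) * ennreal (norm (M s (inv h \<otimes> g))) \<partial>dg)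
             \<le> (\<integral>\<^sup>+h. ?k n (t - s) h * ?\<mu> s (inv h \<otimes> g) \<partial>dg)" .
          then show "ennreal (w g) * (indicator {0<..<t} s * (\<integral>\<^sup>+h. ennreal (norm (K_iter n (t - s) h)) * ennreal (norm (M s (inv h \<otimes> g))) \<partial>dg))
             \<le> indicator {0<..<t} s * (\<integral>\<^sup>+h. ?k n (t - s) h * ?\<mu> s (inv h \<otimes> g) \<partial>dg)"
            by (simp add: indicator_def)
        qed
        finally show ?thesis .
      qed
      let ?a = "A * (1 / 2) ^ n"
      have a: "?a \<ge> 0" using A by simp
      note IH = Suc.IH[THEN conjunct1, rule_format] Suc.IH[THEN conjunct2, rule_format]
      have "(\<integral>\<^sup>+g. ?k (Suc n) t g \<partial>dg) \<le> ennreal (A * (1 / 2) ^ Suc n * exp ((W + \<nu>) * t))" if t: "t > 0" for t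
      proof -
        have "(\<integral>\<^sup>+g. ?k (Suc n) t g \<partial>dg) \<le> (\<integral>\<^sup>+g. nn_conv (?k n) ?\<mu> t g \<partial>dg)"
          by (intro nn_integral_mono step)
        also have "\<dots> \<le> ennreal (?a * (A * \<epsilon>) * exp ((W + \<nu>) * t))"
          by (rule nn_conv_L1[OF meas[OF measurable_K_iter] meas[OF measurable_M] a _ _ IH(1) \<mu>_L1 J t]) (use A \<epsilon> in auto)
        also have "\<dots> \<le> ennreal (?a * (1 / 2) * exp ((W + \<nu>) * t))"
          by (intro ennreal_leI mult_right_mono mult_left_mono half' a) auto
        finally show ?thesis by simp
      qed
      moreover have "?k (Suc n) t g \<le> ennreal (A * (1 / 2) ^ Suc n * t powr (- D) * exp ((W + \<nu>) * t))" if t: "t > 0" for t g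
      proof -
        have "nn_conv (?k n) ?\<mu> t g \<le> ennreal (?a * (A * \<epsilon> * 2 powr D) * t powr (- D) * exp ((W + \<nu>) * t))"
          by (rule nn_conv_sup[OF meas[OF measurable_K_iter] meas[OF measurable_M] a _ _ D IH(1) IH(2) \<mu>_inv \<mu>_sup J t]) (use A \<epsilon> in auto)
        from order_trans[OF step this] show ?thesis unfolding half by simp
      qed
      ultimately show ?case by blast
    qed
    then show ?thesis by (simp only: w_def W_def)
  qed
  have "(\<integral>\<^sup>+g. ennreal (exp (\<rho> * modulus g) * norm (K_iter n t g)) \<partial>dg) \<le> ennreal (A * (1 / 2) ^ n * exp ((\<omega> + \<nu>) * (1 + \<rho> ^ m) * t))"
    "exp (\<rho> * modulus g) * norm (K_iter n t g) \<le> A * (1 / 2) ^ n * t powr (- real CARD('d) / real m) * exp ((\<omega> + \<nu>) * (1 + \<rho> ^ m) * t)"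
    if \<rho>: "\<rho> \<ge> 0" and t: "t > 0" for \<rho> t n g
  proof -
    \<comment> \<open>As \<nu> was chosen without reference to \<rho>, it can be absorbed into the
      coefficient of 1 + \<rho>^m.\<close>
    have "(\<omega> * (1 + \<rho> ^ m) + \<nu>) * t \<le> (\<omega> + \<nu>) * (1 + \<rho> ^ m) * t"
      using \<rho> t \<nu> by (intro mult_right_mono) (auto simp: algebra_simps)
    then have e: "exp ((\<omega> * (1 + \<rho> ^ m) + \<nu>) * t) \<le> exp ((\<omega> + \<nu>) * (1 + \<rho> ^ m) * t)" by simp
    have "(\<integral>\<^sup>+g. ennreal (exp (\<rho> * modulus g) * norm (K_iter n t g)) \<partial>dg) \<le> ennreal (A * (1 / 2) ^ n * exp ((\<omega> * (1 + \<rho> ^ m) + \<nu>) * t))"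
      using main[OF \<rho>, of n] t by blast
    also have "\<dots> \<le> ennreal (A * (1 / 2) ^ n * exp ((\<omega> + \<nu>) * (1 + \<rho> ^ m) * t))"
      using A by (intro ennreal_leI mult_left_mono e) auto
    finally show "(\<integral>\<^sup>+g. ennreal (exp (\<rho> * modulus g) * norm (K_iter n t g)) \<partial>dg) \<le> \<dots>" .
    have "ennreal (exp (\<rho> * modulus g) * norm (K_iter n t g)) \<le> ennreal (A * (1 / 2) ^ n * t powr (- D) * exp ((\<omega> * (1 + \<rho> ^ m) + \<nu>) * t))"
      using main[OF \<rho>, of n] t by blast
    then have "exp (\<rho> * modulus g) * norm (K_iter n t g) \<le> A * (1 / 2) ^ n * t powr (- D) * exp ((\<omega> * (1 + \<rho> ^ m) + \<nu>) * t)"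
      using A by (subst (asm) ennreal_le_iff) auto
    also have "\<dots> \<le> A * (1 / 2) ^ n * t powr (- D) * exp ((\<omega> + \<nu>) * (1 + \<rho> ^ m) * t)"
      using A by (intro mult_left_mono e) auto
    finally show "exp (\<rho> * modulus g) * norm (K_iter n t g) \<le> A * (1 / 2) ^ n * t powr (- real CARD('d) / real m) * exp ((\<omega> + \<nu>) * (1 + \<rho> ^ m) * t)"
      by (simp add: D_def)
  qed
  moreover have "0 \<le> \<omega> + \<nu>" using A0 \<nu> by simp
  ultimately show ?thesis using A(1) by blast
qed

text \<open>A geometric majorant gives absolute convergence at every point, the positive weight
  being divided out; integrating the majorizing series termwise gives the L1 bound. Both constants
  double, since the powers of 1/2 sum to 2.\<close>

lemma K_bounds:
  assumes conn: "connected (UNIV :: 'g set)"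
  shows "\<exists>A>0. \<exists>\<omega>\<ge>0. \<forall>\<rho>\<ge>0. \<forall>t>0.
    K t \<in> borel_measurable borel \<and>
    (\<integral>\<^sup>+g. ennreal (exp (\<rho> * modulus g) * norm (K t g)) \<partial>dg) \<le> ennreal (A * exp (\<omega> * (1 + \<rho> ^ m) * t)) \<and>
    (\<forall>g. exp (\<rho> * modulus g) * norm (K t g) \<le> A * t powr (- real CARD('d) / real m) * exp (\<omega> * (1 + \<rho> ^ m) * t))"
proof -
  obtain A \<omega> where A: "A > 0" "\<omega> \<ge> 0" and bounds: "\<forall>\<rho>\<ge>0. \<forall>t>0. \<forall>n.
    (\<integral>\<^sup>+g. ennreal (exp (\<rho> * modulus g) * norm (K_iter n t g)) \<partial>dg) \<le> ennreal (A * (1 / 2) ^ n * exp (\<omega> * (1 + \<rho> ^ m) * t)) \<and>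
    (\<forall>g. exp (\<rho> * modulus g) * norm (K_iter n t g) \<le> A * (1 / 2) ^ n * t powr (- real CARD('d) / real m) * exp (\<omega> * (1 + \<rho> ^ m) * t))"
    using K_iter_bounds[OF conn] by (elim exE conjE)
  have L1: "(\<integral>\<^sup>+g. ennreal (exp (\<rho> * modulus g) * norm (K_iter n t g)) \<partial>dg) \<le> ennreal (A * (1 / 2) ^ n * exp (\<omega> * (1 + \<rho> ^ m) * t))"
    and sup: "exp (\<rho> * modulus g) * norm (K_iter n t g) \<le> A * (1 / 2) ^ n * t powr (- real CARD('d) / real m) * exp (\<omega> * (1 + \<rho> ^ m) * t)"
    if "\<rho> \<ge> 0" "t > 0" for \<rho> t n g
    using bounds[rule_format, OF that, of n] by simp_all
  have geo: "(\<lambda>n. b * (1 / 2) ^ n) sums (2 * b)" for b :: real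
    using sums_mult[OF geometric_sums[of "1 / 2 :: real"], of b] by (simp add: mult.commute)
  have it [measurable]: "(\<lambda>g. K_iter n t g) \<in> borel_measurable borel" for n t
    by (rule measurable_case_prod_compose[OF measurable_K_iter]) simp_all
  have m: "K t \<in> borel_measurable borel" for t
    unfolding K_def[abs_def] by measurable
  have md [measurable]: "modulus \<in> borel_measurable borel"
    by (rule borel_measurable_continuous_onI[OF modulus_continuous[OF conn]])
  have main: "(\<integral>\<^sup>+g. ennreal (exp (\<rho> * modulus g) * norm (K t g)) \<partial>dg) \<le> ennreal (2 * A * exp (\<omega> * (1 + \<rho> ^ m) * t))"
    "exp (\<rho> * modulus g) * norm (K t g) \<le> 2 * A * t powr (- real CARD('d) / real m) * exp (\<omega> * (1 + \<rho> ^ m) * t)"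
    if \<rho>: "\<rho> \<ge> 0" and t: "t > 0" for \<rho> t g
  proof -
    define w where "w g = exp (\<rho> * modulus g)" for g
    have w: "w g > 0" for g by (simp add: w_def)
    have [measurable]: "w \<in> borel_measurable borel" unfolding w_def[abs_def] by measurable
    let ?b = "A * t powr (- real CARD('d) / real m) * exp (\<omega> * (1 + \<rho> ^ m) * t)"
    have le: "w g * norm (K_iter n t g) \<le> ?b * (1 / 2) ^ n" for n g
      using sup[OF \<rho> t, of g n] by (simp add: w_def mult_ac)
    have s: "summable (\<lambda>n. w g * norm (K_iter n t g))" for g
      by (rule summable_comparison_test[OF _ sums_summable[OF geo[of ?b]]])
        (use le w[of g] in \<open>auto intro!: exI[of _ 0] simp: abs_mult\<close>)
    have s': "summable (\<lambda>n. norm (K_iter n t g))" for g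
      using w[of g] by (intro summable_mult_D[OF s]) auto
    have K_le: "w g * norm (K t g) \<le> (\<Sum>n. w g * norm (K_iter n t g))" for g
      unfolding K_def suminf_mult[OF s'] using w[of g] by (intro mult_left_mono summable_norm s') auto
    have "w g * norm (K t g) \<le> (\<Sum>n. ?b * (1 / 2) ^ n)"
      using K_le[of g] suminf_le[OF le s sums_summable[OF geo]] by (rule order_trans)
    also have "\<dots> = 2 * ?b" using sums_unique[OF geo[of ?b]] by simp
    finally show "exp (\<rho> * modulus g) * norm (K t g) \<le> 2 * A * t powr (- real CARD('d) / real m) * exp (\<omega> * (1 + \<rho> ^ m) * t)"
      by (simp add: w_def mult_ac)
    have "(\<integral>\<^sup>+g. ennreal (w g * norm (K t g)) \<partial>dg) \<le> (\<integral>\<^sup>+g. (\<Sum>n. ennreal (w g * norm (K_iter n t g))) \<partial>dg)"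
    proof (rule nn_integral_mono)
      fix g
      show "ennreal (w g * norm (K t g)) \<le> (\<Sum>n. ennreal (w g * norm (K_iter n t g)))"
        using K_le[of g] w[of g] by (subst suminf_ennreal2[OF _ s]) (auto intro!: ennreal_leI)
    qed
    also have "\<dots> = (\<Sum>n. (\<integral>\<^sup>+g. ennreal (w g * norm (K_iter n t g)) \<partial>dg))"
      by (rule nn_integral_suminf) measurable
    also have "\<dots> \<le> (\<Sum>n. ennreal (A * exp (\<omega> * (1 + \<rho> ^ m) * t) * (1 / 2) ^ n))"
      using L1[OF \<rho> t] by (intro suminf_le) (auto simp: w_def mult_ac)
    also have "\<dots> = ennreal (2 * (A * exp (\<omega> * (1 + \<rho> ^ m) * t)))"
      using A sums_unique[OF geo[of "A * exp (\<omega> * (1 + \<rho> ^ m) * t)"]]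
      by (subst suminf_ennreal2[OF _ sums_summable[OF geo]]) auto
    finally show "(\<integral>\<^sup>+g. ennreal (exp (\<rho> * modulus g) * norm (K t g)) \<partial>dg) \<le> ennreal (2 * A * exp (\<omega> * (1 + \<rho> ^ m) * t))"
      by (simp add: w_def mult_ac)
  qed
  show ?thesis using A m main by (intro exI[of _ "2 * A"] exI[of _ \<omega>]) auto
qed

end

section \<open>Optimization over the weight and conclusion\<close>

text \<open>The Gaussian bound comes from the choice \<open>\<rho> = \<epsilon> (y / t)\<^bsup>1 / (m - 1)\<^esup>\<close>.\<close>

lemma exp_optimize:
  fixes \<omega> y t :: real
  assumes "\<omega> \<ge> 0" "y \<ge> 0" "t > 0" "m \<ge> 2"
  defines "\<epsilon> \<equiv> 1 / (1 + 2 * \<omega>)"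
  shows "\<exists>\<rho>\<ge>0. \<omega> * \<rho> ^ m * t - \<rho> * y \<le> - (\<epsilon> / 2) * (y ^ m / t) powr (1 / (real m - 1))"
proof -
  define u where "u = (y / t) powr (1 / (real m - 1))"
  obtain k where m: "m = Suc k" "k \<ge> 1" using assms(4) by (cases m) auto
  have rm: "real m - 1 = real k" using m by simp
  have u: "u \<ge> 0" by (simp add: u_def)
  have root: "(z ^ k) powr (1 / real k) = z" if "z \<ge> 0" for z :: real
    using that m by (cases "z = 0") (auto simp: powr_realpow[symmetric] powr_powr)
  have uk: "u ^ k = y / t"
  proof (cases "y = 0")
    case True
    then show ?thesis using m by (simp add: u_def power_0_left)
  next
    case False
    then show ?thesis using assms m by (simp add: u_def powr_power)
  qed
  have "(y * u) ^ k = y ^ m / t" by (simp add: power_mult_distrib uk m)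
  then have z: "(y ^ m / t) powr (1 / (real m - 1)) = y * u"
    using root[of "y * u"] u assms by (simp add: rm)
  have um: "u ^ m * t = u * y" using assms by (simp add: m uk)
  have \<epsilon>: "0 < \<epsilon>" "\<epsilon> \<le> 1" using assms by (auto simp: \<epsilon>_def)
  \<comment> \<open>With \<rho> = \<epsilon>u the loss is \<omega>\<epsilon>^k times the gain
    \<rho>y. As \<epsilon> \<le> 1 and k \<ge> 1, this ratio is at most \<omega>\<epsilon> \<le>
    1/2, so half of the gain survives.\<close>
  have "\<epsilon> ^ k \<le> \<epsilon> ^ 1" using \<epsilon> m by (intro power_decreasing) auto
  then have "\<omega> * \<epsilon> ^ k \<le> \<omega> * \<epsilon>" using assms by (intro mult_left_mono) auto
  also have "\<dots> \<le> 1 / 2" using assms by (simp add: \<epsilon>_def field_simps)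
  finally have "(\<omega> * \<epsilon> ^ k) * (\<epsilon> * (u * y)) \<le> 1 / 2 * (\<epsilon> * (u * y))"
    using \<epsilon> u assms by (intro mult_right_mono) auto
  moreover have "\<omega> * (\<epsilon> * u) ^ m * t = (\<omega> * \<epsilon> ^ k) * (\<epsilon> * (u * y))"
  proof -
    have "\<omega> * (\<epsilon> * u) ^ m * t = \<omega> * \<epsilon> ^ m * (u ^ m * t)" by (simp add: power_mult_distrib mult_ac)
    then show ?thesis unfolding um by (simp add: m mult_ac)
  qed
  moreover have "(\<epsilon> * u) * y = \<epsilon> * (u * y)" "(\<epsilon> / 2) * (y * u) = 1 / 2 * (\<epsilon> * (u * y))"
    by simp_all
  ultimately have "\<omega> * (\<epsilon> * u) ^ m * t - (\<epsilon> * u) * y \<le> - (\<epsilon> / 2) * (y * u)"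
    by linarith
  then show ?thesis using \<epsilon> u unfolding z by (intro exI[of _ "\<epsilon> * u"]) auto
qed

theorem corollary3p2:
  fixes G :: "'g::{t2_space, second_countable_topology} monoid"
    and atlas :: "('g, real ^ 'd::finite) chart set"
    and a :: "'d \<Rightarrow> 'g tangent_vector"
    and m :: nat and c :: "'d list \<Rightarrow> complex"
    and r :: real and \<Omega> :: "'g set" and dg :: "'g measure" and \<theta> :: "'g \<Rightarrow> real"
  assumes "connected (UNIV :: 'g set)"
    and "kernel_construction G atlas a m c r \<Omega> dg \<theta>"
  shows "let K = kernel_construction.K G atlas a m c r \<Omega> dg \<theta>;
             U = lie_group_with_basis.U G atlas a;
             modulus = lie_group_with_basis.modulus G atlas a;
             d = real CARD('d)
         in
           (\<exists>A>0. \<exists>\<omega>\<ge>0. \<forall>\<rho>>0. \<forall>t>0.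
              L1_norm dg (U \<rho> (K t)) \<le> ennreal (A * exp (\<omega> * (1 + \<rho> ^ m) * t)) \<and>
              Linf_norm dg (U \<rho> (K t))
                \<le> ennreal (A * t powr (- d / real m) * exp (\<omega> * (1 + \<rho> ^ m) * t))) \<and>
           (\<exists>A>0. \<exists>b>0. \<exists>\<omega>\<ge>0. \<forall>g. \<forall>t>0.
              cmod (K t g)
                \<le> A * t powr (- d / real m) * exp (\<omega> * t)
                    * exp (- b * (modulus g ^ m / t) powr (1 / (real m - 1))))"
proof -
  interpret kernel_construction G atlas a m c r \<Omega> dg \<theta> by (rule assms(2))
  obtain A \<omega> where A: "A > 0" "\<omega> \<ge> 0"
    and m: "\<And>(\<rho> :: real) t. \<rho> \<ge> 0 \<Longrightarrow> t > 0 \<Longrightarrow> K t \<in> borel_measurable borel"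
    and L1: "\<And>\<rho> t. \<rho> \<ge> 0 \<Longrightarrow> t > 0 \<Longrightarrow> (\<integral>\<^sup>+g. ennreal (exp (\<rho> * modulus g) * norm (K t g)) \<partial>dg) \<le> ennreal (A * exp (\<omega> * (1 + \<rho> ^ m) * t))"
    and sup: "\<And>\<rho> t g. \<rho> \<ge> 0 \<Longrightarrow> t > 0 \<Longrightarrow> exp (\<rho> * modulus g) * norm (K t g) \<le> A * t powr (- real CARD('d) / real m) * exp (\<omega> * (1 + \<rho> ^ m) * t)"
    using K_bounds[OF assms(1)] by blast
  \<comment> \<open>Measurability was stated together with the weighted bounds; the weight \<rho> =
    1 discharges that premise.\<close>
  note m = m[OF zero_le_one]
  have md [measurable]: "modulus \<in> borel_measurable borel"
    by (rule borel_measurable_continuous_onI[OF modulus_continuous[OF assms(1)]])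
  have "L1_norm dg (U \<rho> (K t)) \<le> ennreal (A * exp (\<omega> * (1 + \<rho> ^ m) * t)) \<and>
      Linf_norm dg (U \<rho> (K t)) \<le> ennreal (A * t powr (- real CARD('d) / real m) * exp (\<omega> * (1 + \<rho> ^ m) * t))"
    if \<rho>: "\<rho> > 0" and t: "t > 0" for \<rho> t
  proof -
    note [measurable] = m[OF t]
    have meas: "U \<rho> (K t) \<in> borel_measurable dg"
      unfolding U_def[abs_def] borel_dg by measurable
    have n: "norm (U \<rho> (K t) g) = exp (\<rho> * modulus g) * norm (K t g)" for g
      by (simp add: U_def norm_mult)
    have "esssup dg (\<lambda>g. ennreal (norm (U \<rho> (K t) g))) \<le> ennreal (A * t powr (- real CARD('d) / real m) * exp (\<omega> * (1 + \<rho> ^ m) * t))"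
      using meas sup[of \<rho> t] \<rho> t by (intro esssup_I) (auto simp: n intro!: ennreal_leI)
    then show ?thesis
      using L1[of \<rho> t] \<rho> t by (simp add: L1_norm_def Linf_norm_def meas n)
  qed
  moreover have "cmod (K t g) \<le> A * t powr (- real CARD('d) / real m) * exp (\<omega> * t)
      * exp (- (1 / (1 + 2 * \<omega>) / 2) * (modulus g ^ m / t) powr (1 / (real m - 1)))"
    if t: "t > 0" for g t
  proof -
    obtain l where "path_to g l" using path_to_exists[OF assms(1)] by blast
    then have "0 \<le> modulus g" by (rule modulus_nonneg)
    \<comment> \<open>\<rho> may depend on g and t because the constants of the weighted bound do
      not depend on it. It can be 0, for instance when |g| = 0, which is why \<open>K_bounds\<close>
      includes that value.\<close>
    then obtain \<rho> where \<rho>: "\<rho> \<ge> 0"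
      "\<omega> * \<rho> ^ m * t - \<rho> * modulus g \<le> - (1 / (1 + 2 * \<omega>) / 2) * (modulus g ^ m / t) powr (1 / (real m - 1))"
      using exp_optimize[of \<omega> "modulus g" t m] A t m_ge_2 by blast
    have "cmod (K t g) = exp (- (\<rho> * modulus g)) * (exp (\<rho> * modulus g) * cmod (K t g))"
      by (simp add: exp_minus)
    also have "\<dots> \<le> exp (- (\<rho> * modulus g)) * (A * t powr (- real CARD('d) / real m) * exp (\<omega> * (1 + \<rho> ^ m) * t))"
      by (intro mult_left_mono sup \<rho> t) simp
    also have "\<dots> = A * t powr (- real CARD('d) / real m) * exp (\<omega> * t) * exp (\<omega> * \<rho> ^ m * t - \<rho> * modulus g)"
      by (simp add: algebra_simps mult_exp_exp)
    also have "\<dots> \<le> A * t powr (- real CARD('d) / real m) * exp (\<omega> * t)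
        * exp (- (1 / (1 + 2 * \<omega>) / 2) * (modulus g ^ m / t) powr (1 / (real m - 1)))"
      using A \<rho>(2) by (intro mult_left_mono) auto
    finally show ?thesis .
  qed
  moreover have "0 < 1 / (1 + 2 * \<omega>) / 2" using A by simp
  ultimately show ?thesis
    unfolding Let_def using A by blast
qed

end
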